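(* Let $\Lambda$ be a $d$-dimensional lattice, let $\bm x \in\mathbb{R}^d$, let $\bm y \in (\mathbb{R}^d\setminus\Lambda^* )\cup\{\bm 0\}$, let $\nu \in \mathbb{C}$ and let $\bm\alpha\in\mathbb{N}^d$. Then for $\lambda > 0$, $$ Z^{\rm reg}_{\Lambda,\nu,\bm\alpha}(\bm x,\bm y) = \frac{(\pi/\lambda^2)^{\nu/2}}{\Gamma(\nu/2)} \Bigg[ \sum_{\bm{z}\in\Lambda-\bm x} \bm z^{\bm\alpha}G_{\nu}(\bm z/\lambda)e^{-2\pi i\bm y\cdot \bm z} + (-2\pi i)^{-|\bm\alpha|} \frac{\lambda^{d}}{V_{\Lambda}} \Big[ G_{d-\nu,\lambda}^{\mathrm{reg},(\bm\alpha)}(\bm y)+ \lambda^{|\bm\alpha|} \sum_{\substack{\bm p\in\Lambda^{*} \\ \bm p \neq \bm 0}}G_{d-\nu}^{(\bm\alpha)} (\lambda (\bm p+\bm y))e^{-2\pi i \bm{x}\cdot \bm p} \Big]\Bigg], $$ where the regularized upper Crandall function is defined for $\nu\in\mathbb{C}$ as $$ G_{\nu,\lambda}^{\rm reg}(\bm y) = G_{\nu}(\lambda\bm y)- \lambda^{-\nu}\pi^{-(d-\nu)/2}\Gamma((d-\nu)/2)\,\hat{s}_{d-\nu}(\bm y) $$ (for $\bm y\ne\bm 0$, extended smoothly to $\bm y=\bm 0$), and $G_{\nu,\lambda}^{\mathrm{reg},(\bm\alpha)}=\nabla^{\bm\alpha}G_{\nu,\lambda}^{\rm reg}$. If $\nu\notin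 -2\mathbb{N}$, or $\nu=-2\ell$ with $\ell\in\mathbb{N}$ and $\ell <|\lceil \bm\alpha/2\rceil|$, we have $$ G_{\nu,\lambda}^{\mathrm{reg},(\bm\alpha)}(\bm y)= -\lambda^{|\bm\alpha|}g_{\nu}^{(\bm\alpha)}(\lambda\bm y), $$ and for any $\ell\in\mathbb{N}$ it holds that $$ G^{\rm reg,(\bm\alpha)}_{-2\ell,\lambda}(\bm y) =(-\pi \lambda^2)^{\ell}(H_\ell-\gamma -2\log\lambda)\,Y_\ell^{(\bm\alpha)}(\bm y) -\sum_{\substack{j=0 \\ j\neq \ell}}^{\infty}\frac{(-\pi \lambda^2)^j}{j-\ell}\,Y_j^{(\bm\alpha)}(\bm y). $$
   Context: $\mathbb{N}=\{0,1,2,\dots\}$, $d\ge 1$ is an integer, $0^0=1$. For $\bm\alpha\in\mathbb{N}^d$: $|\bm\alpha|=\sum_j\alpha^{(j)}$, $\bm z^{\bm\alpha}=\prod_j (z^{(j)})^{\alpha^{(j)}}$, a superscript $(\bm\alpha)$ or $\nabla^{\bm\alpha}$ denotes the iterated partial derivative; inequalities and the ceiling $\lceil\cdot\rceil$ are componentwise; for vectors $|\cdot|$ is the Euclidean norm and $\bm y^2=|\bm y|^2$ on $\mathbb{R}^d$. A $d$-dimensional lattice is $\Lambda=A\mathbb{Z}^d$, $A\in\mathbb{R}^{d\times d}$ regular; $V_\Lambda=|\det A|$, $\Lambda^*=A^{-T}\mathbb{Z}^d$. Anisotropic Epstein zeta function: $Z_{\Lambda,\nu,\bm\alpha}(\bm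 x,\bm y)$ is the meromorphic continuation in $\nu$ to $\mathbb{C}$ of $\sum_{\bm z\in\Lambda,\,\bm z\ne\bm x} e^{-2\pi i\bm y\cdot\bm z}(\bm z-\bm x)^{\bm\alpha}|\bm z-\bm x|^{-\nu}$, $\mathrm{Re}(\nu)>d+|\bm\alpha|$. Regularized version: $$Z_{\Lambda, \nu,\bm\alpha}^{\mathrm{reg}}(\bm x,\bm y) =e^{2\pi i\bm x\cdot\bm y} Z_{\Lambda,\nu,\bm\alpha}(\bm x,\bm y) -\frac{\hat s^{(\bm\alpha)}_{\nu}(\bm y)}{(-2\pi i)^{|\bm\alpha|}V_{\Lambda}},\qquad \bm y\neq \bm 0,$$ continuously extended to $\bm y=\bm 0$, where $\hat{s}_\nu(\bm y) = \frac{\pi^{\nu/2}}{\Gamma(\nu/2)}\Gamma((d-\nu)/2)(\pi \bm y^2)^{(\nu - d)/2}$ for $\nu\notin d+2\mathbb{N}$, and $\hat s_{d+2\ell}(\bm y)= \frac{\pi^{\ell+d/2}}{\Gamma(\ell+d/2)}\frac{(-1)^{\ell+1}}{\ell!} ( \pi \bm y^2 )^{\ell} \log (\pi \bm y^{2})$ for $\ell\in\mathbb{N}$. Upper Crandall function: $G_\nu(\bm z)=\Gamma(\nu/2,\pi\bm z^2)/(\pi\bm z^2)^{\nu/2}$ for $\bm z\in\mathbb{R}^d\setminus\{\bm 0\}$, $\nu\in\mathbb{C}$, with $\Gamma(s,x)$ the upper incomplete Gamma function, and $G_\nu(\bm 0)=-2/\nu$; $G^{(\bm\alpha)}_\nu$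 is its $\bm\alpha$-th partial derivative on $\mathbb{R}^d\setminus\{\bm 0\}$. Lower Crandall function: for $\nu\in\mathbb{C}\setminus(-2\mathbb{N})$, $g_\nu(\bm z)=\gamma(\nu/2,\pi\bm z^2)/(\pi\bm z^2)^{\nu/2}$ for $\bm z\ne\bm 0$ and $g_\nu(\bm 0)=2/\nu$, with $\gamma(s,x)$ the lower incomplete Gamma function ($\int_0^xt^{s-1}e^{-t}dt$ for $\mathrm{Re}(s)>0$, continued to $s\in\mathbb{C}\setminus(-\mathbb{N})$). Its derivatives are $g_\nu^{(\bm\alpha)}(\bm u)=\sum_{2\bm\beta\le\bm\alpha}p_{\bm\alpha,\bm\beta}(\bm u)\,g_{\nu+2|\bm\alpha|-2|\bm\beta|}(\bm u)$, where for $\nu=-2\ell$, $\ell\in\mathbb{N}$, $\ell<|\lceil\bm\alpha/2\rceil|$, $g_\nu^{(\bm\alpha)}$ is defined by this right-hand side; here $p_{\bm\alpha,\bm \beta}(\bm y)=(-\pi)^{|\bm\alpha|-|\bm \beta|}(\bm\alpha-\bm\beta)_{\bm\beta}\binom{\bm\alpha}{\bm \beta}(2\bm y)^{\bm\alpha-2 \bm \beta}$ with $(\bm\alpha)_{\bm\beta}=\prod_j\alpha^{(j)}(\alpha^{(j)}-1)\cdots(\alpha^{(j)}-\beta^{(j)}+1)$ and $\binom{\bm\alpha}{\bm\beta}=\prod_j\binom{\alpha^{(j)}}{\beta^{(j)}}$. $Y_\ell(\bm y)=(\bm y^2)^\ell/\ell!$; $H_\ell$ is the $\ell$-th harmonic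 number; $\gamma$ (without arguments) is the Euler–Mascheroni constant. Conventions: $1/\Gamma$ is the entire reciprocal Gamma function; in the definition of $G^{\rm reg}_{\nu,\lambda}$ for $\nu\in d+2\mathbb{N}$ the product $\Gamma((d-\nu)/2)\hat s_{d-\nu}(\bm y)$ is read as its limit $\pi^{(d-\nu)/2}\Gamma(\nu/2)(\pi\bm y^2)^{-\nu/2}$; if $\nu=0$ and $\bm x\in\Lambda$, the term $\frac{(\pi/\lambda^2)^{\nu/2}}{\Gamma(\nu/2)}\bm 0^{\bm\alpha}G_\nu(\bm 0)$ is read as its limit as $\nu\to 0$. *)

theory Defs
  imports "HOL-Complex_Analysis.Complex_Analysis"
begin

section \<open>Lattices and multi-indices\<close>

text \<open>
  The dimension is \<open>CARD('n)\<close>. A lattice is represented by an invertible generator matrix;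
  multi-indices have type \<open>nat ^ 'n\<close>.
\<close>

definition lattice :: "real ^ 'n ^ 'n \<Rightarrow> (real ^ 'n) set" where
  "lattice A = range (\<lambda>k :: int ^ 'n. A *v (\<chi> i. of_int (k $ i)))"

definition dual_lattice :: "real ^ 'n ^ 'n \<Rightarrow> (real ^ 'n) set" where
  "dual_lattice A = lattice (transpose (matrix_inv A))"

definition covolume :: "real ^ 'n ^ 'n \<Rightarrow> real" where
  "covolume A = \<bar>det A\<bar>"

definition mi_size :: "nat ^ 'n \<Rightarrow> nat" where
  "mi_size \<alpha> = (\<Sum>j\<in>UNIV. \<alpha> $ j)"

definition mi_power :: "real ^ 'n \<Rightarrow> nat ^ 'n \<Rightarrow> real" where
  "mi_power z \<alpha> = (\<Prod>j\<in>UNIV. (z $ j) ^ (\<alpha> $ j))"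

section \<open>Iterated partial derivatives\<close>

definition partial_deriv :: "'n \<Rightarrow> (real ^ 'n \<Rightarrow> complex) \<Rightarrow> real ^ 'n \<Rightarrow> complex" where
  "partial_deriv j f x = vector_derivative (\<lambda>t. f (x + t *\<^sub>R axis j 1)) (at 0)"

text \<open>
  The index type carries no order, so the order of differentiation is an arbitrary
  list containing each \<open>j\<close> exactly \<open>\<alpha> $ j\<close> times. The derivative is only used
  at points near which the function is smooth, where the order is irrelevant.
\<close>

definition nabla :: "nat ^ 'n \<Rightarrow> (real ^ 'n \<Rightarrow> complex) \<Rightarrow> real ^ 'n \<Rightarrow> complex" where
  "nabla \<alpha> f = foldr partial_deriv (SOME js. \<forall>j. count_list js j = \<alpha> $ j) f"

definition smooth :: "(real ^ 'n \<Rightarrow> complex) \<Rightarrow> bool" where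
  "smooth f \<longleftrightarrow> (\<forall>js x. foldr partial_deriv js f differentiable (at x))"

section \<open>Meromorphic continuation and incomplete Gamma functions\<close>

text \<open>
  \<open>nicely_meromorphic_on\<close> removes removable singularities and fixes the value 0 at poles,
  which makes the continuation from a half-plane unique as a total function.
\<close>

definition meromorphic_continuation :: "real \<Rightarrow> (complex \<Rightarrow> complex) \<Rightarrow> complex \<Rightarrow> complex" where
  "meromorphic_continuation c f =
     (THE F. F nicely_meromorphic_on UNIV \<and> (\<forall>s. Re s > c \<longrightarrow> F s = f s))"

text \<open>Both functions are used for \<open>x > 0\<close> only.\<close>

definition upper_Gamma :: "complex \<Rightarrow> real \<Rightarrow> complex" where
  "upper_Gamma s x = integral {x..} (\<lambda>t. of_real t powr (s - 1) * of_real (exp (- t)))"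

definition lower_Gamma :: "complex \<Rightarrow> real \<Rightarrow> complex" where
  "lower_Gamma s x = meromorphic_continuation 0
     (\<lambda>s. integral {0..x} (\<lambda>t. of_real t powr (s - 1) * of_real (exp (- t)))) s"

section \<open>Epstein zeta function\<close>

definition epstein_zeta ::
  "real ^ 'n ^ 'n \<Rightarrow> complex \<Rightarrow> nat ^ 'n \<Rightarrow> real ^ 'n \<Rightarrow> real ^ 'n \<Rightarrow> complex" where
  "epstein_zeta A \<nu> \<alpha> x y =
     meromorphic_continuation (real (CARD('n)) + real (mi_size \<alpha>))
       (\<lambda>\<nu>. \<Sum>\<^sub>\<infinity>z\<in>lattice A - {x}.
          exp (- 2 * of_real pi * \<i> * of_real (y \<bullet> z)) * of_real (mi_power (z - x) \<alpha>)
            * of_real (norm (z - x)) powr (- \<nu>)) \<nu>"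

definition s_hat :: "complex \<Rightarrow> real ^ 'n \<Rightarrow> complex" where
  "s_hat \<nu> y =
     (let d = of_nat (CARD('n)) :: complex in
      if \<exists>l::nat. \<nu> = d + 2 * of_nat l then
        let l = (THE l::nat. \<nu> = d + 2 * of_nat l) in
        of_real pi powr (of_nat l + d / 2) / Gamma (of_nat l + d / 2)
          * ((-1) ^ (l + 1) / fact l)
          * of_real ((pi * (norm y)\<^sup>2) ^ l * ln (pi * (norm y)\<^sup>2))
      else
        of_real pi powr (\<nu> / 2) * rGamma (\<nu> / 2) * Gamma ((d - \<nu>) / 2)
          * of_real (pi * (norm y)\<^sup>2) powr ((\<nu> - d) / 2))"

definition epstein_zeta_reg_punctured ::
  "real ^ 'n ^ 'n \<Rightarrow> complex \<Rightarrow> nat ^ 'n \<Rightarrow> real ^ 'n \<Rightarrow> real ^ 'n \<Rightarrow> complex" where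
  "epstein_zeta_reg_punctured A \<nu> \<alpha> x y =
     exp (2 * of_real pi * \<i> * of_real (x \<bullet> y)) * epstein_zeta A \<nu> \<alpha> x y
     - nabla \<alpha> (s_hat \<nu>) y
         / ((- 2 * of_real pi * \<i>) ^ mi_size \<alpha> * of_real (covolume A))"

definition epstein_zeta_reg ::
  "real ^ 'n ^ 'n \<Rightarrow> complex \<Rightarrow> nat ^ 'n \<Rightarrow> real ^ 'n \<Rightarrow> real ^ 'n \<Rightarrow> complex" where
  "epstein_zeta_reg A \<nu> \<alpha> x y =
     (if y = 0 then Lim (at 0) (epstein_zeta_reg_punctured A \<nu> \<alpha> x)
      else epstein_zeta_reg_punctured A \<nu> \<alpha> x y)"

section \<open>Crandall functions\<close>

definition crandall_G :: "complex \<Rightarrow> real ^ 'n \<Rightarrow> complex" where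
  "crandall_G \<nu> z =
     (if z = 0 then - 2 / \<nu>
      else upper_Gamma (\<nu> / 2) (pi * (norm z)\<^sup>2) / of_real (pi * (norm z)\<^sup>2) powr (\<nu> / 2))"

definition crandall_g :: "complex \<Rightarrow> real ^ 'n \<Rightarrow> complex" where
  "crandall_g \<nu> z =
     (if z = 0 then 2 / \<nu>
      else lower_Gamma (\<nu> / 2) (pi * (norm z)\<^sup>2) / of_real (pi * (norm z)\<^sup>2) powr (\<nu> / 2))"

text \<open>The natural-number subtractions are exact whenever \<open>2 * \<beta> \<le> \<alpha>\<close> componentwise.\<close>

definition crandall_poly :: "nat ^ 'n \<Rightarrow> nat ^ 'n \<Rightarrow> real ^ 'n \<Rightarrow> real" where
  "crandall_poly \<alpha> \<beta> y =
     (- pi) ^ (mi_size \<alpha> - mi_size \<beta>)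
     * (\<Prod>j\<in>UNIV. \<Prod>i<\<beta> $ j. real (\<alpha> $ j - \<beta> $ j) - real i)
     * (\<Prod>j\<in>UNIV. real ((\<alpha> $ j) choose (\<beta> $ j)))
     * mi_power (2 *\<^sub>R y) (\<chi> j. \<alpha> $ j - 2 * \<beta> $ j)"

text \<open>
  For \<open>\<nu> = -2 * l\<close> the function \<open>crandall_g \<nu>\<close> is undefined; its derivatives of order \<open>\<alpha>\<close>
  with \<open>l < \<bar>\<lceil>\<alpha>/2\<rceil>\<bar>\<close> are defined by the formula that holds for all other \<open>\<nu>\<close>.
\<close>

definition crandall_g_deriv :: "complex \<Rightarrow> nat ^ 'n \<Rightarrow> real ^ 'n \<Rightarrow> complex" where
  "crandall_g_deriv \<nu> \<alpha> u =
     (if \<exists>l::nat. \<nu> = - 2 * of_nat l then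
        (\<Sum>\<beta> | \<forall>j. 2 * \<beta> $ j \<le> \<alpha> $ j.
           of_real (crandall_poly \<alpha> \<beta> u)
           * crandall_g (\<nu> + 2 * of_nat (mi_size \<alpha>) - 2 * of_nat (mi_size \<beta>)) u)
      else nabla \<alpha> (crandall_g \<nu>) u)"

text \<open>
  The product \<open>\<Gamma>((d - \<nu>)/2) * s_hat (d - \<nu>) y\<close>; for \<open>\<nu> \<in> d + 2\<nat>\<close> the first factor has a
  pole and the second one vanishes, and the product is read as its limit.
\<close>

definition Gamma_s_hat :: "complex \<Rightarrow> real ^ 'n \<Rightarrow> complex" where
  "Gamma_s_hat \<nu> y =
     (let d = of_nat (CARD('n)) :: complex in
      if \<exists>l::nat. \<nu> = d + 2 * of_nat l then
        of_real pi powr ((d - \<nu>) / 2) * Gamma (\<nu> / 2)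
          * of_real (pi * (norm y)\<^sup>2) powr (- \<nu> / 2)
      else Gamma ((d - \<nu>) / 2) * s_hat (d - \<nu>) y)"

definition crandall_G_reg :: "complex \<Rightarrow> real \<Rightarrow> real ^ 'n \<Rightarrow> complex" where
  "crandall_G_reg \<nu> r =
     (THE h. smooth h \<and>
        (\<forall>y. y \<noteq> 0 \<longrightarrow> h y =
           crandall_G \<nu> (r *\<^sub>R y)
           - of_real r powr (- \<nu>) * of_real pi powr (- (of_nat (CARD('n)) - \<nu>) / 2)
               * Gamma_s_hat \<nu> y))"

definition Y_poly :: "nat \<Rightarrow> real ^ 'n \<Rightarrow> complex" where
  "Y_poly l y = of_real (((norm y)\<^sup>2) ^ l / fact l)"

text \<open>The entire function \<open>(\<pi>/r\<^sup>2)\<^bsup>\<nu>/2\<^esup> / \<Gamma>(\<nu>/2)\<close> of \<open>\<nu>\<close>.\<close>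

definition crandall_factor :: "real \<Rightarrow> complex \<Rightarrow> complex" where
  "crandall_factor r \<nu> = of_real (pi / r\<^sup>2) powr (\<nu> / 2) * rGamma (\<nu> / 2)"

text \<open>
  For \<open>\<nu> = 0\<close> and \<open>x\<close> in the lattice, the summand \<open>z = 0\<close> of the real-space sum, multiplied by
  \<open>crandall_factor r \<nu>\<close>, is read as its limit for \<open>\<nu> \<rightarrow> 0\<close>. Since \<open>crandall_factor r 0 = 0\<close>, that
  summand contributes nothing to the product as written, and the limit is added separately.
\<close>

definition zero_term_limit :: "real \<Rightarrow> complex \<Rightarrow> nat ^ 'n \<Rightarrow> real ^ 'n ^ 'n \<Rightarrow> real ^ 'n \<Rightarrow> complex" where
  "zero_term_limit r \<nu> \<alpha> A x =
     (if \<nu> = 0 \<and> x \<in> lattice A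
      then Lim (at 0) (\<lambda>\<mu>. crandall_factor r \<mu> * of_real (mi_power (0 :: real ^ 'n) \<alpha>)
                             * crandall_G \<mu> (0 :: real ^ 'n))
      else 0)"

end

theory Submission
  imports Defs "HOL-Library.Multiset" "HOL-Real_Asymp.Real_Asymp" "HOL-Probability.Probability"
begin

text \<open>
  By Euler's integral, \<open>\<Gamma>(\<nu>/2)\<close> times the zeta sum is the Mellin transform at \<open>\<nu>/2\<close> of a theta
  series with polynomial weight \<open>z\<^sup>\<alpha>\<close>. On \<open>{1..}\<close> one integrates termwise and obtains Crandall
  functions of the lattice points. On \<open>{0<..1}\<close> Poisson summation first turns the theta series into
  one over the dual lattice, in which the derivatives of order \<open>\<alpha>\<close> of Gaussians appear. Both
  resulting sums are entire in \<open>\<nu>\<close>, so the identity gives the meromorphic continuation. The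
  only dual term that is singular at \<open>y = 0\<close> is the one for \<open>p = 0\<close>; subtracting \<open>s_hat\<close> cancels
  exactly its singular part, because an upper incomplete Gamma function minus its singular
  part is a power series in \<open>y\<^sup>2\<close>. All derivatives are computed in one way:
  a sequence of radial functions with \<open>\<nabla>\<Phi>\<^sub>m = -2\<pi>q \<Phi>\<^sub>m\<^sub>+\<^sub>1\<close> has the same Hermite-type derivative formula
  whether it consists of Gaussians, Crandall functions or power series.
\<close>

section \<open>Iterated derivatives of radial functions\<close>

text \<open>The continuation identity is proved for \<open>y\<close> outside the dual lattice, where
  every dual term is entire in \<open>\<nu>\<close>; the value at \<open>y = 0\<close>, defined as a
  limit, then follows from continuity of the regularized right-hand side, so a pole of the zeta
  function at \<open>y = 0\<close> never has to be handled. The length \<open>r\<close> enters by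
  evaluating the theta series at t / r^2, so that the cut of the Mellin integral at 1 stands for an
  arbitrary cut of the original variable. The exceptional \<open>\<nu>\<close>, where Gamma factors
  have poles or \<open>s_hat\<close> is logarithmic, are settled for functions of one variable:
  \<open>expint_eq_Gamma_pser\<close> and \<open>expint_neg\<close> expand the incomplete Gamma
  function, after which the single coefficient sequence \<open>regG_coeff\<close> covers all
  \<open>\<nu>\<close>. \<open>nabla\<close> differentiates along an unspecified list, so
  derivatives are computed for arbitrary lists and found to depend on the counts only.
  \<open>meromorphic_continuation\<close> and \<open>crandall_G_reg\<close> are definite
  descriptions, so each value also needs a uniqueness argument.\<close>

lemma partial_deriv_eqI:
  assumes "(f has_derivative D) (at x)"
  shows "partial_deriv j f x = D (axis j 1)"
proof -
  have "((\<lambda>t. f (x + t *\<^sub>R axis j 1)) has_derivative (\<lambda>t. D (0 + t *\<^sub>R axis j 1))) (at (0::real))"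
    by (rule has_derivative_compose[of "\<lambda>t. x + t *\<^sub>R axis j 1" _ 0 UNIV f D])
      (auto intro!: derivative_eq_intros simp: assms)
  moreover have "linear D"
    using assms has_derivative_linear by blast
  ultimately have "((\<lambda>t. f (x + t *\<^sub>R axis j 1)) has_vector_derivative D (axis j 1)) (at (0::real))"
    by (simp add: has_vector_derivative_def linear_scale)
  thus ?thesis
    unfolding partial_deriv_def by (rule vector_derivative_at)
qed

lemma partial_deriv_cong_open:
  assumes "open S" "x \<in> S" "\<And>y. y \<in> S \<Longrightarrow> f y = g y"
  shows "partial_deriv j f x = partial_deriv j g x"
proof -
  have "open ((\<lambda>t::real. x + t *\<^sub>R axis j 1) -` S)"
    by (intro open_vimage assms continuous_intros)
  hence "\<forall>\<^sub>F t in nhds (0::real). x + t *\<^sub>R axis j 1 \<in> S"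
    using eventually_nhds_in_open[of "(\<lambda>t::real. x + t *\<^sub>R axis j 1) -` S" 0] assms(2) by simp
  hence "\<forall>\<^sub>F t in nhds (0::real). f (x + t *\<^sub>R axis j 1) = g (x + t *\<^sub>R axis j 1)"
    by eventually_elim (use assms in auto)
  thus ?thesis
    unfolding partial_deriv_def
    by (intro vector_derivative_cong_eq) (auto elim: eventually_mono)
qed

lemma foldr_partial_deriv_cong_open:
  assumes "open S" "x \<in> S" "\<And>y. y \<in> S \<Longrightarrow> f y = g y"
  shows "foldr partial_deriv js f x = foldr partial_deriv js g x"
  using assms(2)
proof (induction js arbitrary: x)
  case (Cons j js)
  show ?case
    using partial_deriv_cong_open[OF assms(1) Cons.prems Cons.IH] by simp
qed (use assms in auto)

lemma nabla_cong_open: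
  assumes "open S" "x \<in> S" "\<And>y. y \<in> S \<Longrightarrow> f y = g y"
  shows "nabla \<alpha> f x = nabla \<alpha> g x"
  unfolding nabla_def using foldr_partial_deriv_cong_open[OF assms] .

definition mi_count :: "'n list \<Rightarrow> nat ^ 'n" where
  "mi_count js = (\<chi> j. count_list js j)"

text \<open>The index type is finite, so a multi-index is the count function of a multiset, hence of
  a list; this makes the choice in \<open>nabla\<close> meaningful. One list serves all functions,
  so facts proved by induction over arbitrary lists carry over to \<open>nabla\<close>.\<close>

lemma nabla_eq_foldr:
  obtains js where "mi_count js = \<alpha>" "\<And>f. nabla \<alpha> f = foldr partial_deriv js f"
proof -
  obtain js where "mset js = Abs_multiset (\<lambda>j. \<alpha> $ j)"
    using ex_mset by blast
  hence "\<forall>j. count_list js j = \<alpha> $ j"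
    by (metis (mono_tags) count_Abs_multiset count_mset finite)
  hence ex: "\<exists>js. \<forall>j. count_list js j = \<alpha> $ j" by blast
  show thesis
    by (rule that[of "SOME js. \<forall>j. count_list js j = \<alpha> $ j"])
      (use someI_ex[OF ex] in \<open>auto simp: mi_count_def nabla_def vec_eq_iff\<close>)
qed

lemma mi_count_Nil: "mi_count [] = 0"
  by (simp add: mi_count_def vec_eq_iff)

lemma mi_count_Cons: "mi_count (j # js) = mi_count js + axis j 1"
  by (simp add: mi_count_def vec_eq_iff axis_def)

lemma mi_size_add: "mi_size (\<alpha> + \<beta>) = mi_size \<alpha> + mi_size \<beta>"
  by (simp add: mi_size_def sum.distrib)

lemma mi_size_0: "mi_size 0 = 0"
  by (simp add: mi_size_def)

lemma mi_size_axis: "mi_size (axis j (Suc 0)) = Suc 0"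
  by (simp add: mi_size_def axis_def)

text \<open>The one-coordinate factor of \<open>crandall_poly\<close> without the power of the
  variable. For \<open>2 * b \<le> a\<close> it is
  \<open>(- pi) ^ (a - b) * fact a / (fact b * fact (a - 2 * b))\<close>, a coefficient of the
  Hermite polynomial in the derivative of order \<open>a\<close> of exp(-pi t^2).\<close>

definition hermite_coeff :: "nat \<Rightarrow> nat \<Rightarrow> real" where
  "hermite_coeff a b = (- pi) ^ (a - b) * (\<Prod>i<b. real (a - b) - real i) * real (a choose b)"

lemma falling_prod_eq_fact: "b \<le> n \<Longrightarrow> (\<Prod>i<b. real n - real i) = fact n / fact (n - b)"
proof (induction b)
  case (Suc b)
  then obtain m where n: "n = Suc (b + m)"
    by (metis add_Suc less_eq_Suc_le less_imp_Suc_add)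
  hence "n - b = Suc m" "n - Suc b = m" by auto
  moreover have "(\<Prod>i<b. real n - real i) = fact n / fact (n - b)"
    using Suc by simp
  moreover have "real n - real b = real (Suc m)"
    using n by simp
  ultimately have "(\<Prod>i<Suc b. real n - real i) = fact n / (real (Suc m) * fact m) * real (Suc m)"
    by simp
  thus ?case using \<open>n - Suc b = m\<close>
    by (simp del: of_nat_Suc)
qed auto

lemma hermite_coeff_eq:
  assumes "2 * b \<le> a"
  shows "hermite_coeff a b = (- pi) ^ (a - b) * (fact a / (fact b * fact (a - 2 * b)))"
proof -
  have "a - b - b = a - 2 * b" by simp
  thus ?thesis
    using assms falling_prod_eq_fact[of b "a - b"]
    by (simp add: hermite_coeff_def binomial_fact)
qed

text \<open>Either the falling product contains a zero factor or the binomial coefficient vanishes.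
  This lets sums over \<open>half_indices\<close> be enlarged by one layer when an order of
  differentiation is raised.\<close>

lemma hermite_coeff_eq_0: "a < 2 * b \<Longrightarrow> hermite_coeff a b = 0"
proof -
  assume *: "a < 2 * b"
  show ?thesis
  proof (cases "a < b")
    case False
    with * have "a - b \<in> {..<b}" by auto
    hence "(\<Prod>i<b. real (a - b) - real i) = 0"
      by (intro prod_zero) auto
    thus ?thesis by (simp add: hermite_coeff_def)
  qed (auto simp: hermite_coeff_def)
qed

definition hermite_term :: "nat \<Rightarrow> nat \<Rightarrow> real \<Rightarrow> real" where
  "hermite_term a b t = hermite_coeff a b * (2 * t) ^ (a - 2 * b)"

definition hermite_term' :: "nat \<Rightarrow> nat \<Rightarrow> real \<Rightarrow> real" where
  "hermite_term' a b t = hermite_coeff a b * (2 * real (a - 2 * b) * (2 * t) ^ (a - 2 * b - 1))"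

lemma has_derivative_hermite_term:
  "(hermite_term a b has_real_derivative hermite_term' a b t) (at t)"
proof -
  have "((\<lambda>t. (2 * t) ^ (a - 2 * b)) has_real_derivative 2 * real (a - 2 * b) * (2 * t) ^ (a - 2 * b - 1)) (at t)"
    by (rule derivative_eq_intros refl)+ (simp only: mult_ac, simp)
  thus ?thesis
    unfolding hermite_term_def[abs_def] hermite_term'_def by (rule DERIV_cmult)
qed

text \<open>This is the product rule for \<open>hermite_term a b * \<Phi> (a - b)\<close> in one
  coordinate: the first term comes from the radial factor, whose index rises while \<open>b\<close>
  stays, the second from differentiating the polynomial for \<open>b - 1\<close>. Both meet at
  radial index \<open>a + 1 - b\<close>.\<close>

lemma hermite_term_Suc:
  assumes "2 * b \<le> Suc a"
  shows "hermite_term (Suc a) b t =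
           - 2 * pi * t * hermite_term a b t + (if b = 0 then 0 else hermite_term' a (b - 1) t)"
proof (cases "2 * b \<le> a")
  case True
  show ?thesis
  proof (cases b)
    case 0
    thus ?thesis
      by (simp add: hermite_term_def hermite_coeff_def)
  next
    case (Suc c)
    obtain n where n: "a = 2 * b + n" using True le_Suc_ex by blast
    have 1: "hermite_coeff (Suc a) b = (-pi)^(b+n+1) * (fact a / (fact b * fact n)) * (real (2*b+n+1) / real (n+1))"
    proof -
      have "Suc a - b = b + n + 1" "Suc a - 2 * b = n + 1" using n by auto
      moreover have "fact (Suc a) = real (2*b+n+1) * fact a" "fact (n+1) = real (n+1) * fact n"
        using n by simp_all
      ultimately show ?thesis
        using hermite_coeff_eq[of b "Suc a"] True by (simp add: mult_ac del: of_nat_Suc of_nat_add fact_Suc)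
    qed
    have 2: "hermite_coeff a b = (-pi)^(b+n) * (fact a / (fact b * fact n))"
      by (subst hermite_coeff_eq) (auto simp: n)
    have "hermite_coeff a c = (-pi)^(b+n+1) * (fact a / (fact c * fact (n+2)))"
      by (subst hermite_coeff_eq) (auto simp: n Suc)
    also have "fact c = (fact b / real b :: real)" using Suc by simp
    also have "(fact (n+2) :: real) = real (n+2) * real (n+1) * fact n" by (simp add: field_simps)
    finally have h: "hermite_coeff a c = (-pi)^(b+n+1) * (fact a / (fact b / real b * (real (n+2) * real (n+1) * fact n)))" .
    have *: "C * (A / (B / z * (x * y * F))) * (2 * x) = C * (A / (B * F)) * (2 * z / y)"
      if "x > 0" for A B C F x y z :: real
      using that by (simp add: divide_simps)
    have 3: "hermite_coeff a c * (2 * real (n + 2)) = (-pi)^(b+n+1) * (fact a / (fact b * fact n)) * (2 * real b / real (n+1))"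
      unfolding h by (rule *) simp
    have "Suc a - 2 * b = n + 1" "a - 2 * b = n" "a - 2 * c = n + 2" "a - 2 * c - 1 = n + 1" using n Suc by auto
    hence "hermite_term (Suc a) b t = (-pi)^(b+n+1) * (fact a / (fact b * fact n)) * (real (2*b+n+1) / real (n+1)) * (2*t)^(n+1)"
      and "hermite_term a b t = (-pi)^(b+n) * (fact a / (fact b * fact n)) * (2*t)^n"
      and "hermite_term' a c t = (hermite_coeff a c * (2 * real (n + 2))) * (2*t)^(n+1)"
      by (simp_all only: hermite_term_def hermite_term'_def 1 2 mult.assoc)
    \<comment> \<open>Apart from the common factor this is (2b + n + 1)/(n + 1) = 1 + 2b/(n +
      1).\<close>
    moreover have "(-pi)^(b+n+1) * M * (real (2*b+n+1) / real (n+1)) * (2*t)^(n+1)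
        = - 2 * pi * t * ((-pi)^(b+n) * M * (2*t)^n) + (-pi)^(b+n+1) * M * (2 * real b / real (n+1)) * (2*t)^(n+1)" for M
    proof -
      have "(- pi * Q) * M * ((y + 2 * z) / y) * (2 * t * T) = - 2 * pi * t * (Q * M * T) + (- pi * Q) * M * (2 * z / y) * (2 * t * T)"
        if "y > 0" for Q y z T :: real
        using that by (simp add: divide_simps) (simp add: algebra_simps)
      from this[of "real (n+1)" "(-pi)^(b+n)" "real b" "(2*t)^n"] show ?thesis
        by (simp add: add_ac)
    qed
    ultimately show ?thesis using Suc by (simp only: 3) simp
  qed
next
  case False
  \<comment> \<open>At this boundary the index \<open>b\<close> is new:
    \<open>hermite_term a b\<close> vanishes and only the derivative of the linear polynomial for
    \<open>b - 1\<close> contributes.\<close>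
  with assms have a: "Suc a = 2 * b" by simp
  then obtain c where b: "b = Suc c" by (cases b) auto
  have "hermite_term a b t = 0" using a by (simp add: hermite_term_def hermite_coeff_eq_0)
  moreover have "hermite_coeff (Suc a) b = hermite_coeff a c * 2"
  proof -
    have e: "Suc a - b = b" "Suc a - 2 * b = 0" "a - c = b" "a - 2 * c = 1" using a b by auto
    have "hermite_coeff (Suc a) b = (-pi)^b * (fact (Suc a) / fact b)"
      using hermite_coeff_eq[of b "Suc a"] a unfolding e by simp
    also have "fact (Suc a) = real (2 * b) * fact a" by (metis a fact_Suc)
    also have "fact b = real b * fact c" using b by simp
    also have "(-pi)^b * (real (2 * b) * fact a / (real b * fact c)) = (-pi)^b * (fact a / fact c) * 2"
    proof -
      have "real b \<noteq> 0" using b by simp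
      thus ?thesis by simp
    qed
    also have "\<dots> = hermite_coeff a c * 2"
      using hermite_coeff_eq[of c a] a b unfolding e by simp
    finally show ?thesis .
  qed
  moreover have "a - 2 * c = 1" "Suc a - 2 * b = 0" "a - 2 * c - 1 = 0" "b \<noteq> 0" "b - 1 = c" using a b by auto
  ultimately show ?thesis
    by (simp add: hermite_term_def hermite_term'_def)
qed

lemma crandall_poly_eq_prod:
  fixes \<alpha> \<beta> :: "nat ^ 'n"
  assumes "\<And>j. \<beta> $ j \<le> \<alpha> $ j"
  shows "crandall_poly \<alpha> \<beta> y = (\<Prod>j\<in>UNIV. hermite_term (\<alpha> $ j) (\<beta> $ j) (y $ j))"
proof -
  have "mi_size \<alpha> - mi_size \<beta> = (\<Sum>j\<in>UNIV. \<alpha> $ j - \<beta> $ j)"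
    unfolding mi_size_def using assms by (subst sum_subtractf_nat) auto
  thus ?thesis
    by (simp add: crandall_poly_def hermite_term_def hermite_coeff_def mi_power_def power_sum prod.distrib)
qed

definition half_indices :: "nat ^ 'n \<Rightarrow> (nat ^ 'n) set" where
  "half_indices \<alpha> = {\<beta>. \<forall>j. 2 * \<beta> $ j \<le> \<alpha> $ j}"

lemma finite_bounded_indices: "finite {\<beta> :: nat ^ 'n. \<forall>j. \<beta> $ j \<le> N j}"
proof (rule finite_subset)
  show "{\<beta> :: nat ^ 'n. \<forall>j. \<beta> $ j \<le> N j} \<subseteq> vec_lambda ` (PiE UNIV (\<lambda>j. {..N j}))"
  proof
    fix \<beta> :: "nat ^ 'n" assume "\<beta> \<in> {\<beta>. \<forall>j. \<beta> $ j \<le> N j}"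
    thus "\<beta> \<in> vec_lambda ` (PiE UNIV (\<lambda>j. {..N j}))"
      by (intro image_eqI[of _ _ "\<lambda>j. \<beta> $ j"]) (auto simp: vec_eq_iff)
  qed
qed (intro finite_imageI finite_PiE; simp)

lemma finite_half_indices: "finite (half_indices \<alpha>)"
  by (rule finite_subset[OF _ finite_bounded_indices[of "\<lambda>j. \<alpha> $ j"]])
    (auto simp: half_indices_def; metis add_leD1 mult_2)

text \<open>Each of the \<open>mi_size \<alpha>\<close> differentiations hits either the radial
  factor, raising the index of \<open>\<Phi>\<close>, or a power of a coordinate;
  \<open>\<beta>\<close> counts the latter, which explains the index
  \<open>mi_size \<alpha> - mi_size \<beta>\<close>.\<close>

definition hermite_sum :: "nat ^ 'n \<Rightarrow> (nat \<Rightarrow> real ^ 'n \<Rightarrow> complex) \<Rightarrow> real ^ 'n \<Rightarrow> complex" where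
  "hermite_sum \<alpha> \<Phi> q = (\<Sum>\<beta>\<in>half_indices \<alpha>.
      of_real (crandall_poly \<alpha> \<beta> q) * \<Phi> (mi_size \<alpha> - mi_size \<beta>) q)"

lemma hermite_sum_eq_prod:
  "hermite_sum \<alpha> \<Phi> q = (\<Sum>\<beta>\<in>half_indices \<alpha>.
      of_real (\<Prod>j\<in>UNIV. hermite_term (\<alpha> $ j) (\<beta> $ j) (q $ j)) * \<Phi> (mi_size \<alpha> - mi_size \<beta>) q)"
  unfolding hermite_sum_def
proof (rule sum.cong)
  fix \<beta> assume "\<beta> \<in> half_indices \<alpha>"
  hence "\<And>j. \<beta> $ j \<le> \<alpha> $ j" by (metis (mono_tags) add_leD1 half_indices_def mem_Collect_eq mult_2)
  thus "of_real (crandall_poly \<alpha> \<beta> q) * \<Phi> (mi_size \<alpha> - mi_size \<beta>) q =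
        of_real (\<Prod>j\<in>UNIV. hermite_term (\<alpha> $ j) (\<beta> $ j) (q $ j)) * \<Phi> (mi_size \<alpha> - mi_size \<beta>) q"
    by (simp add: crandall_poly_eq_prod)
qed auto

lemma mi_size_mono:
  fixes \<alpha> \<beta> :: "nat ^ 'n"
  shows "(\<And>j. \<beta> $ j \<le> \<alpha> $ j) \<Longrightarrow> mi_size \<beta> \<le> mi_size \<alpha>"
  by (simp add: mi_size_def sum_mono)

lemma has_derivative_prod_hermite:
  fixes \<alpha> \<beta> :: "nat ^ 'n" and q :: "real ^ 'n"
  shows "((\<lambda>q. (\<Prod>i\<in>UNIV. hermite_term (\<alpha> $ i) (\<beta> $ i) (q $ i))) has_derivative
     (\<lambda>v. \<Sum>i\<in>UNIV. v $ i * hermite_term' (\<alpha> $ i) (\<beta> $ i) (q $ i) *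
          (\<Prod>k\<in>UNIV - {i}. hermite_term (\<alpha> $ k) (\<beta> $ k) (q $ k)))) (at q)"
proof (rule has_derivative_eq_rhs[OF has_derivative_prod])
  fix i :: 'n
  have "(hermite_term (\<alpha> $ i) (\<beta> $ i) has_derivative (\<lambda>h. hermite_term' (\<alpha> $ i) (\<beta> $ i) (q $ i) * h)) (at (q $ i))"
    using has_derivative_hermite_term by (simp add: has_field_derivative_def)
  thus "((\<lambda>q. hermite_term (\<alpha> $ i) (\<beta> $ i) (q $ i)) has_derivative
      (\<lambda>v. hermite_term' (\<alpha> $ i) (\<beta> $ i) (q $ i) * v $ i)) (at q)"
    by (rule has_derivative_compose[rotated])
       (rule bounded_linear_imp_has_derivative[OF bounded_linear_vec_nth])
qed (simp add: mult_ac)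

text \<open>The product rule yields two sums over \<open>\<beta>\<close>, which
  \<open>hermite_term_Suc\<close> matches with the sum for \<open>\<alpha> + axis j 1\<close>. A
  full derivative is supplied, not merely the partial ones, since smoothness and continuity are read
  off from it later.\<close>

lemma hermite_sum_has_derivative:
  fixes \<Phi> :: "nat \<Rightarrow> real ^ 'n \<Rightarrow> complex"
  assumes \<Phi>: "\<And>m. (\<Phi> m has_derivative (\<lambda>v. - 2 * of_real pi * of_real (q \<bullet> v) * \<Phi> (Suc m) q)) (at q)"
  obtains D where "(hermite_sum \<alpha> \<Phi> has_derivative D) (at q)"
    "\<And>j. D (axis j 1) = hermite_sum (\<alpha> + axis j 1) \<Phi> q"
proof -
  define P where "P \<beta> q = (\<Prod>i\<in>UNIV. hermite_term (\<alpha> $ i) (\<beta> $ i) (q $ i))" for \<beta> and q :: "real ^ 'n"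
  define P' where "P' \<beta> v = (\<Sum>i\<in>UNIV. v $ i * hermite_term' (\<alpha> $ i) (\<beta> $ i) (q $ i) *
          (\<Prod>k\<in>UNIV - {i}. hermite_term (\<alpha> $ k) (\<beta> $ k) (q $ k)))" for \<beta> and v :: "real ^ 'n"
  define D where "D v = (\<Sum>\<beta>\<in>half_indices \<alpha>. of_real (P \<beta> q) * (- 2 * of_real pi * of_real (q \<bullet> v) * \<Phi> (Suc (mi_size \<alpha> - mi_size \<beta>)) q)
           + of_real (P' \<beta> v) * \<Phi> (mi_size \<alpha> - mi_size \<beta>) q)" for v
  have "(hermite_sum \<alpha> \<Phi> has_derivative D) (at q)"
    unfolding hermite_sum_eq_prod[abs_def] D_def P_def P'_def
    by (intro has_derivative_sum has_derivative_mult has_derivative_of_real has_derivative_prod_hermite \<Phi>)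
  moreover have "D (axis j 1) = hermite_sum (\<alpha> + axis j 1) \<Phi> q" for j
  proof -
    define \<alpha>' where "\<alpha>' = \<alpha> + axis j 1"
    have \<alpha>'j: "\<alpha>' $ j = Suc (\<alpha> $ j)" and \<alpha>'k: "k \<noteq> j \<Longrightarrow> \<alpha>' $ k = \<alpha> $ k" for k
      by (auto simp: \<alpha>'_def axis_def)
    define R where "R \<beta> = (\<Prod>k\<in>UNIV - {j}. hermite_term (\<alpha> $ k) (\<beta> $ k) (q $ k))" for \<beta> :: "nat ^ 'n"
    define \<Psi> where "\<Psi> \<beta> = \<Phi> (Suc (mi_size \<alpha>) - mi_size \<beta>) q" for \<beta> :: "nat ^ 'n"
    have le: "mi_size \<beta> \<le> mi_size \<alpha>" if "\<beta> \<in> half_indices \<alpha>" for \<beta>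
      using that by (intro mi_size_mono) (metis (mono_tags) add_leD1 half_indices_def mem_Collect_eq mult_2)
    have P_eq: "P \<beta> q = hermite_term (\<alpha> $ j) (\<beta> $ j) (q $ j) * R \<beta>" for \<beta>
      by (simp add: P_def R_def prod.remove[of UNIV j])
    have P'_eq: "P' \<beta> (axis j 1) = hermite_term' (\<alpha> $ j) (\<beta> $ j) (q $ j) * R \<beta>" for \<beta>
    proof -
      have "P' \<beta> (axis j 1) = (\<Sum>i\<in>{j}. (axis j 1 :: real^'n) $ i * hermite_term' (\<alpha> $ i) (\<beta> $ i) (q $ i) *
          (\<Prod>k\<in>UNIV - {i}. hermite_term (\<alpha> $ k) (\<beta> $ k) (q $ k)))"
        unfolding P'_def by (rule sum.mono_neutral_right) (auto simp: axis_def)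
      thus ?thesis by (simp add: R_def)
    qed
    have "hermite_sum \<alpha>' \<Phi> q = (\<Sum>\<beta>\<in>half_indices \<alpha>'. of_real (hermite_term (\<alpha>' $ j) (\<beta> $ j) (q $ j) * R \<beta>) * \<Psi> \<beta>)"
      unfolding hermite_sum_eq_prod
    proof (intro sum.cong refl)
      fix \<beta>
      have "(\<Prod>i\<in>UNIV. hermite_term (\<alpha>' $ i) (\<beta> $ i) (q $ i)) = hermite_term (\<alpha>' $ j) (\<beta> $ j) (q $ j) * R \<beta>"
        unfolding R_def by (subst prod.remove[of UNIV j]) (auto intro!: prod.cong simp: \<alpha>'k)
      moreover have "mi_size \<alpha>' = Suc (mi_size \<alpha>)"
        by (simp add: \<alpha>'_def mi_size_add mi_size_axis)
      ultimately show "of_real (\<Prod>i\<in>UNIV. hermite_term (\<alpha>' $ i) (\<beta> $ i) (q $ i)) * \<Phi> (mi_size \<alpha>' - mi_size \<beta>) q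
        = of_real (hermite_term (\<alpha>' $ j) (\<beta> $ j) (q $ j) * R \<beta>) * \<Psi> \<beta>"
        by (simp add: \<Psi>_def)
    qed
    also have "\<dots> = (\<Sum>\<beta>\<in>half_indices \<alpha>'. of_real (- 2 * pi * q $ j * hermite_term (\<alpha> $ j) (\<beta> $ j) (q $ j) * R \<beta>) * \<Psi> \<beta>
        + (if \<beta> $ j = 0 then 0 else of_real (hermite_term' (\<alpha> $ j) (\<beta> $ j - 1) (q $ j) * R \<beta>) * \<Psi> \<beta>))"
    proof (intro sum.cong refl)
      fix \<beta> assume "\<beta> \<in> half_indices \<alpha>'"
      hence "2 * \<beta> $ j \<le> Suc (\<alpha> $ j)" by (auto simp: half_indices_def simp flip: \<alpha>'j)
      from hermite_term_Suc[OF this, of "q $ j"]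
      show "of_real (hermite_term (\<alpha>' $ j) (\<beta> $ j) (q $ j) * R \<beta>) * \<Psi> \<beta> = of_real (- 2 * pi * q $ j * hermite_term (\<alpha> $ j) (\<beta> $ j) (q $ j) * R \<beta>) * \<Psi> \<beta>
        + (if \<beta> $ j = 0 then 0 else of_real (hermite_term' (\<alpha> $ j) (\<beta> $ j - 1) (q $ j) * R \<beta>) * \<Psi> \<beta>)"
        unfolding \<alpha>'j by (simp only:) (simp add: algebra_simps)
    qed
    also have "\<dots> = (\<Sum>\<beta>\<in>half_indices \<alpha>'. of_real (- 2 * pi * q $ j * hermite_term (\<alpha> $ j) (\<beta> $ j) (q $ j) * R \<beta>) * \<Psi> \<beta>)
        + (\<Sum>\<beta>\<in>half_indices \<alpha>'. (if \<beta> $ j = 0 then 0 else of_real (hermite_term' (\<alpha> $ j) (\<beta> $ j - 1) (q $ j) * R \<beta>) * \<Psi> \<beta>))"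
      by (rule sum.distrib)
    also have "(\<Sum>\<beta>\<in>half_indices \<alpha>'. of_real (- 2 * pi * q $ j * hermite_term (\<alpha> $ j) (\<beta> $ j) (q $ j) * R \<beta>) * \<Psi> \<beta>)
       = (\<Sum>\<beta>\<in>half_indices \<alpha>. of_real (- 2 * pi * q $ j * hermite_term (\<alpha> $ j) (\<beta> $ j) (q $ j) * R \<beta>) * \<Psi> \<beta>)"
    \<comment> \<open>The indices gained by passing to \<open>\<alpha>'\<close> satisfy
      \<open>2 * \<beta> $ j > \<alpha> $ j\<close>, where the coefficient for
      \<open>\<alpha> $ j\<close> is zero.\<close>
    proof (rule sum.mono_neutral_right[OF finite_half_indices])
      show "half_indices \<alpha> \<subseteq> half_indices \<alpha>'"
        by (auto simp: half_indices_def \<alpha>'_def intro: trans_le_add1)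
      show "\<forall>\<beta>\<in>half_indices \<alpha>' - half_indices \<alpha>. of_real (- 2 * pi * q $ j * hermite_term (\<alpha> $ j) (\<beta> $ j) (q $ j) * R \<beta>) * \<Psi> \<beta> = 0"
      proof
        fix \<beta> assume *: "\<beta> \<in> half_indices \<alpha>' - half_indices \<alpha>"
        then obtain k where k: "\<not> 2 * \<beta> $ k \<le> \<alpha> $ k" by (auto simp: half_indices_def)
        moreover have "2 * \<beta> $ k \<le> \<alpha>' $ k" using * by (simp add: half_indices_def)
        ultimately have "k = j" using \<alpha>'k[of k] by (cases "k = j") auto
        thus "of_real (- 2 * pi * q $ j * hermite_term (\<alpha> $ j) (\<beta> $ j) (q $ j) * R \<beta>) * \<Psi> \<beta> = 0"
          using k by (simp add: hermite_term_def hermite_coeff_eq_0)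
      qed
    qed
    also have "(\<Sum>\<beta>\<in>half_indices \<alpha>'. (if \<beta> $ j = 0 then 0 else of_real (hermite_term' (\<alpha> $ j) (\<beta> $ j - 1) (q $ j) * R \<beta>) * \<Psi> \<beta>))
       = (\<Sum>\<beta>\<in>{\<beta>\<in>half_indices \<alpha>'. \<beta> $ j \<noteq> 0}. of_real (hermite_term' (\<alpha> $ j) (\<beta> $ j - 1) (q $ j) * R \<beta>) * \<Psi> \<beta>)"
      by (rule sum.mono_neutral_cong_right[OF finite_half_indices]) auto
    also have "\<dots> = (\<Sum>\<beta>\<in>{\<beta>\<in>half_indices \<alpha>. 2 * \<beta> $ j < \<alpha> $ j}. of_real (hermite_term' (\<alpha> $ j) (\<beta> $ j) (q $ j) * R \<beta>) * \<Phi> (mi_size \<alpha> - mi_size \<beta>) q)"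
    \<comment> \<open>Lowering the \<open>j\<close>-th entry makes \<open>\<beta> $ j - 1\<close>
      the running index and reduces \<open>mi_size \<beta>\<close> by one, which restores the radial
      index \<open>mi_size \<alpha> - mi_size \<beta>\<close>.\<close>
    proof (rule sum.reindex_bij_witness[of _ "\<lambda>\<beta>. \<beta> + axis j 1" "\<lambda>\<beta>. \<chi> k. if k = j then \<beta> $ j - 1 else \<beta> $ k"])
      fix \<beta> assume "\<beta> \<in> {\<beta>\<in>half_indices \<alpha>'. \<beta> $ j \<noteq> 0}"
      hence h: "\<And>k. 2 * \<beta> $ k \<le> \<alpha>' $ k" and nz: "\<beta> $ j \<noteq> 0" by (auto simp: half_indices_def)
      define b where "b = (\<chi> k. if k = j then \<beta> $ j - 1 else \<beta> $ k)"
      show eq: "b + axis j 1 = \<beta>" using nz by (auto simp: b_def vec_eq_iff axis_def)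
      show "b \<in> {\<beta>\<in>half_indices \<alpha>. 2 * \<beta> $ j < \<alpha> $ j}"
        using h[of j] nz h by (auto simp: b_def half_indices_def \<alpha>'j) (metis \<alpha>'k)
      have "R b = R \<beta>" unfolding R_def by (rule prod.cong) (auto simp: b_def)
      moreover have "mi_size \<beta> = Suc (mi_size b)"
        by (simp add: mi_size_add mi_size_axis flip: eq)
      moreover have "b $ j = \<beta> $ j - 1" by (simp add: b_def)
      ultimately show "of_real (hermite_term' (\<alpha> $ j) (b $ j) (q $ j) * R b) * \<Phi> (mi_size \<alpha> - mi_size b) q
        = of_real (hermite_term' (\<alpha> $ j) (\<beta> $ j - 1) (q $ j) * R \<beta>) * \<Psi> \<beta>"
        by (simp add: \<Psi>_def)
    next
      fix \<beta> assume *: "\<beta> \<in> {\<beta>\<in>half_indices \<alpha>. 2 * \<beta> $ j < \<alpha> $ j}"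
      show "(\<chi> k. if k = j then (\<beta> + axis j 1) $ j - 1 else (\<beta> + axis j 1) $ k) = \<beta>"
        by (auto simp: vec_eq_iff axis_def)
      show "\<beta> + axis j 1 \<in> {\<beta>\<in>half_indices \<alpha>'. \<beta> $ j \<noteq> 0}"
        using * by (auto simp: half_indices_def \<alpha>'_def axis_def)
    qed
    also have "\<dots> = (\<Sum>\<beta>\<in>half_indices \<alpha>. of_real (hermite_term' (\<alpha> $ j) (\<beta> $ j) (q $ j) * R \<beta>) * \<Phi> (mi_size \<alpha> - mi_size \<beta>) q)"
    \<comment> \<open>For \<open>2 * \<beta> $ j = \<alpha> $ j\<close> the polynomial is constant
      in coordinate \<open>j\<close>, so its derivative factor is zero.\<close>
    proof (rule sum.mono_neutral_left[OF finite_half_indices])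
      show "\<forall>\<beta>\<in>half_indices \<alpha> - {\<beta> \<in> half_indices \<alpha>. 2 * \<beta> $ j < \<alpha> $ j}.
          of_real (hermite_term' (\<alpha> $ j) (\<beta> $ j) (q $ j) * R \<beta>) * \<Phi> (mi_size \<alpha> - mi_size \<beta>) q = 0"
      proof
        fix \<beta> assume *: "\<beta> \<in> half_indices \<alpha> - {\<beta> \<in> half_indices \<alpha>. 2 * \<beta> $ j < \<alpha> $ j}"
        hence "\<alpha> $ j - 2 * \<beta> $ j = 0" by auto
        thus "of_real (hermite_term' (\<alpha> $ j) (\<beta> $ j) (q $ j) * R \<beta>) * \<Phi> (mi_size \<alpha> - mi_size \<beta>) q = 0"
          unfolding hermite_term'_def by simp
      qed
    qed auto
    also have "(\<Sum>\<beta>\<in>half_indices \<alpha>. of_real (- 2 * pi * q $ j * hermite_term (\<alpha> $ j) (\<beta> $ j) (q $ j) * R \<beta>) * \<Psi> \<beta>) + \<dots> = D (axis j 1)"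
      unfolding D_def P_eq P'_eq sum.distrib[symmetric]
      by (intro sum.cong refl) (simp add: \<Psi>_def Suc_diff_le le inner_axis)
    finally show ?thesis unfolding \<alpha>'_def by simp
  qed
  ultimately show thesis by (rule that)
qed

lemma hermite_sum_0: "hermite_sum 0 \<Phi> = \<Phi> 0"
proof
  fix q
  have "half_indices (0 :: nat ^ 'a) = {0}"
    by (auto simp: half_indices_def vec_eq_iff)
  thus "hermite_sum 0 \<Phi> q = \<Phi> 0 q"
    by (simp add: hermite_sum_eq_prod hermite_term_def hermite_coeff_def mi_size_0)
qed

text \<open>Induction over the list, peeling off the outermost derivative. The family relation is
  assumed on an open set because the next partial derivative needs the formula in a neighbourhood of
  the point, not only at it.\<close>

lemma foldr_partial_deriv_family:
  fixes \<Phi> :: "nat \<Rightarrow> real ^ 'n \<Rightarrow> complex"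
  assumes "open S"
    and \<Phi>: "\<And>m q. q \<in> S \<Longrightarrow> (\<Phi> m has_derivative (\<lambda>v. - 2 * of_real pi * of_real (q \<bullet> v) * \<Phi> (Suc m) q)) (at q)"
    and "q \<in> S"
  shows "foldr partial_deriv js (\<Phi> 0) q = hermite_sum (mi_count js) \<Phi> q"
  using \<open>q \<in> S\<close>
proof (induction js arbitrary: q)
  case Nil
  show ?case by (simp add: hermite_sum_0 mi_count_Nil)
next
  case (Cons j js)
  obtain D where D: "(hermite_sum (mi_count js) \<Phi> has_derivative D) (at q)"
    "\<And>j. D (axis j 1) = hermite_sum (mi_count js + axis j 1) \<Phi> q"
    using hermite_sum_has_derivative \<Phi>[OF Cons.prems] by blast
  have "foldr partial_deriv (j # js) (\<Phi> 0) q = partial_deriv j (hermite_sum (mi_count js) \<Phi>) q"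
    using partial_deriv_cong_open[OF assms(1) Cons.prems Cons.IH] by simp
  also have "\<dots> = hermite_sum (mi_count (j # js)) \<Phi> q"
    using partial_deriv_eqI[OF D(1)] D(2) by (simp add: mi_count_Cons)
  finally show ?case .
qed

lemma nabla_family:
  fixes \<Phi> :: "nat \<Rightarrow> real ^ 'n \<Rightarrow> complex"
  assumes "open S"
    and "\<And>m q. q \<in> S \<Longrightarrow> (\<Phi> m has_derivative (\<lambda>v. - 2 * of_real pi * of_real (q \<bullet> v) * \<Phi> (Suc m) q)) (at q)"
    and "q \<in> S"
  shows "nabla \<alpha> (\<Phi> 0) q = hermite_sum \<alpha> \<Phi> q"
proof -
  obtain js where "mi_count js = \<alpha>" "\<And>f. nabla \<alpha> f = foldr partial_deriv js f"
    using nabla_eq_foldr by blast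
  thus ?thesis
    using foldr_partial_deriv_family[where \<Phi> = \<Phi> and S = S and q = q and js = js] assms by simp
qed

lemma smooth_family:
  fixes \<Phi> :: "nat \<Rightarrow> real ^ 'n \<Rightarrow> complex"
  assumes "\<And>m q. (\<Phi> m has_derivative (\<lambda>v. - 2 * of_real pi * of_real (q \<bullet> v) * \<Phi> (Suc m) q)) (at q)"
  shows "smooth (\<Phi> 0)"
proof -
  have "foldr partial_deriv js (\<Phi> 0) = hermite_sum (mi_count js) \<Phi>" for js
    using foldr_partial_deriv_family[where \<Phi> = \<Phi> and S = UNIV and js = js] assms by auto
  moreover have "hermite_sum \<alpha> \<Phi> differentiable (at q)" for \<alpha> q
    using hermite_sum_has_derivative[of \<Phi> q \<alpha>] assms by (metis differentiableI)
  ultimately show ?thesis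
    unfolding smooth_def by metis
qed

section \<open>Incomplete Gamma functions\<close>

text \<open>Fubini with a counting measure. An infinite index set is enumerated so that the theorem
  on integrals of series applies; the series of integrals is then absolutely convergent, which is
  what unordered summation requires.\<close>

lemma has_sum_integral_swap:
  fixes f :: "'i \<Rightarrow> 'a::euclidean_space \<Rightarrow> complex"
  assumes S: "countable S"
    and int: "\<And>i. i \<in> S \<Longrightarrow> f i absolutely_integrable_on T"
    and sum: "(\<lambda>i. integral T (\<lambda>x. norm (f i x))) summable_on S"
    and pw: "\<And>x. x \<in> T \<Longrightarrow> (\<lambda>i. f i x) summable_on S"
  shows "(\<lambda>x. \<Sum>\<^sub>\<infinity>i\<in>S. f i x) absolutely_integrable_on T"
    and "((\<lambda>i. integral T (f i)) has_sum integral T (\<lambda>x. \<Sum>\<^sub>\<infinity>i\<in>S. f i x)) S"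
proof -
  have "(\<lambda>x. \<Sum>\<^sub>\<infinity>i\<in>S. f i x) absolutely_integrable_on T \<and>
    ((\<lambda>i. integral T (f i)) has_sum integral T (\<lambda>x. \<Sum>\<^sub>\<infinity>i\<in>S. f i x)) S"
  proof (cases "finite S")
    case True
    have "f i integrable_on T" if "i \<in> S" for i
      using int[OF that] by (simp add: absolutely_integrable_on_def)
    thus ?thesis using True
      by (auto intro!: absolutely_integrable_sum int has_sum_finiteI simp: integral_sum)
  next
    case False
    define e where "e = from_nat_into S"
    have e: "bij_betw e UNIV S"
      unfolding e_def using S False by (rule bij_betw_from_nat_into)
    hence eS: "e n \<in> S" for n by (auto simp: bij_betw_def)
    define F where "F n x = indicat_real T x *\<^sub>R f (e n) x" for n x
    have Fint: "integrable lebesgue (F n)" for n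
      using int[OF eS] unfolding F_def set_integrable_def .
    have LF: "integral\<^sup>L lebesgue (F n) = integral T (f (e n))" for n
      using set_lebesgue_integral_eq_integral(2)[OF int[OF eS]]
      unfolding F_def set_lebesgue_integral_def .
    have "(\<lambda>x. norm (f (e n) x)) absolutely_integrable_on T" for n
      using int[OF eS] by (rule absolutely_integrable_norm[unfolded o_def])
    from set_lebesgue_integral_eq_integral(2)[OF this]
    have LN: "(\<integral>x. norm (F n x) \<partial>lebesgue) = integral T (\<lambda>x. norm (f (e n) x))" for n
      by (simp add: F_def set_lebesgue_integral_def)
    have s1: "summable (\<lambda>n. (\<integral>x. norm (F n x) \<partial>lebesgue))"
      unfolding LN
      by (rule summable_on_imp_summable)
         (use summable_on_reindex_bij_betw[OF e, of "\<lambda>i. integral T (\<lambda>x. norm (f i x))"] sum in simp)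
    \<comment> \<open>For complex numbers unordered summability is absolute, so the pointwise
      hypothesis already provides the norms.\<close>
    have abs: "(\<lambda>n. norm (F n x)) summable_on UNIV" for x
    proof (cases "x \<in> T")
      case True
      have "(\<lambda>n. f (e n) x) summable_on UNIV"
        using summable_on_reindex_bij_betw[OF e, of "\<lambda>i. f i x"] pw[OF True] by simp
      thus ?thesis
        using True by (simp add: F_def summable_on_iff_abs_summable_on_complex)
    qed (simp add: F_def)
    hence s2: "summable (\<lambda>n. norm (F n x))" for x
      by (rule summable_on_imp_summable)
    have lim: "(\<Sum>n. F n x) = indicat_real T x *\<^sub>R (\<Sum>\<^sub>\<infinity>i\<in>S. f i x)" for x
    proof -
      have "(\<Sum>n. F n x) = (\<Sum>\<^sub>\<infinity>n. F n x)"
        using norm_summable_imp_has_sum[OF s2[of x] summable_sums[OF summable_norm_cancel[OF s2[of x]]]]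
        by (rule infsumI[symmetric])
      also have "\<dots> = (\<Sum>\<^sub>\<infinity>i\<in>S. indicat_real T x *\<^sub>R f i x)"
        unfolding F_def by (rule infsum_reindex_bij_betw[OF e, of "\<lambda>i. indicat_real T x *\<^sub>R f i x"])
      finally show ?thesis by (cases "x \<in> T") auto
    qed
    have "integrable lebesgue (\<lambda>x. \<Sum>n. F n x)"
      by (rule integrable_suminf[OF Fint _ s1]) (use s2 in auto)
    hence 1: "(\<lambda>x. \<Sum>\<^sub>\<infinity>i\<in>S. f i x) absolutely_integrable_on T"
      unfolding lim set_integrable_def .
    have "(\<lambda>n. integral\<^sup>L lebesgue (F n)) sums (\<integral>x. (\<Sum>n. F n x) \<partial>lebesgue)"
      by (rule sums_integral[OF Fint _ s1]) (use s2 in auto)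
    moreover have "(\<integral>x. (\<Sum>n. F n x) \<partial>lebesgue) = integral T (\<lambda>x. \<Sum>\<^sub>\<infinity>i\<in>S. f i x)"
      using set_lebesgue_integral_eq_integral(2)[OF 1] unfolding lim set_lebesgue_integral_def .
    moreover have "summable (\<lambda>n. norm (integral\<^sup>L lebesgue (F n)))"
      by (rule summable_comparison_test'[OF s1, of 0]) simp
    ultimately have "((\<lambda>n. integral T (f (e n))) has_sum integral T (\<lambda>x. \<Sum>\<^sub>\<infinity>i\<in>S. f i x)) UNIV"
      unfolding LF by (intro norm_summable_imp_has_sum) simp_all
    with 1 show ?thesis
      using has_sum_reindex_bij_betw[OF e, of "\<lambda>i. integral T (f i)"] by simp
  qed
  thus "(\<lambda>x. \<Sum>\<^sub>\<infinity>i\<in>S. f i x) absolutely_integrable_on T"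
    "((\<lambda>i. integral T (f i)) has_sum integral T (\<lambda>x. \<Sum>\<^sub>\<infinity>i\<in>S. f i x)) S" by auto
qed

section \<open>Mellin integrals and the upper incomplete Gamma function\<close>

definition mellin_exp :: "complex \<Rightarrow> real \<Rightarrow> real \<Rightarrow> complex" where
  "mellin_exp s a t = of_real t powr (s - 1) * of_real (exp (- (a * t)))"

lemma continuous_on_mellin_exp: "S \<subseteq> {0<..} \<Longrightarrow> continuous_on S (mellin_exp s a)"
  unfolding mellin_exp_def by (intro continuous_intros) auto

lemma norm_mellin_exp: "t > 0 \<Longrightarrow> norm (mellin_exp s a t) = t powr (Re s - 1) * exp (- (a * t))"
  by (simp add: mellin_exp_def norm_mult norm_powr_real_powr)

lemma mellin_exp_integrable_Ioi:
  assumes "Re s > 0" "a > 0"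
  shows "mellin_exp s a absolutely_integrable_on {0<..}"
  using absolutely_integrable_Gamma_integral[OF assms]
  by (simp add: mellin_exp_def[abs_def] exp_minus divide_inverse)

text \<open>Raising the exponent by \<open>n\<close> reaches the half-plane where Euler's integral
  converges; on \<open>{x..}\<close> the compensating factor t^(-n) is at most x^(-n), so every
  complex \<open>s\<close> is covered.\<close>

lemma mellin_exp_integrable_Ici:
  assumes "x > 0" "a > 0"
  shows "mellin_exp s a absolutely_integrable_on {x..}"
proof -
  obtain n :: nat where n: "real n > - Re s" using reals_Archimedean2 by blast
  have "mellin_exp (s + of_nat n) a absolutely_integrable_on {0<..}"
    by (rule mellin_exp_integrable_Ioi) (use n assms in auto)
  hence "mellin_exp (s + of_nat n) a absolutely_integrable_on {x..}"
    by (rule set_integrable_subset) (use assms in auto)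
  hence *: "(\<lambda>t. norm (mellin_exp (s + of_nat n) a t)) integrable_on {x..}"
    by (simp add: absolutely_integrable_on_def)
  show ?thesis
  proof (rule measurable_bounded_by_integrable_imp_absolutely_integrable)
    show "(\<lambda>t. x powr (- real n) * norm (mellin_exp (s + of_nat n) a t)) integrable_on {x..}"
      using * by (rule integrable_on_mult_right)
    show "mellin_exp s a \<in> borel_measurable (lebesgue_on {x..})"
      by (intro continuous_imp_measurable_on_sets_lebesgue continuous_on_mellin_exp) (use assms in auto)
    fix t assume "t \<in> {x..}"
    hence t: "t \<ge> x" "t > 0" using assms by auto
    have "t powr (Re s - 1) = t powr (Re s + n - 1) * t powr (- real n)"
      by (simp add: powr_add[symmetric])
    also have "\<dots> \<le> t powr (Re s + n - 1) * x powr (- real n)"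
      using t assms by (intro mult_left_mono powr_mono2') auto
    finally show "norm (mellin_exp s a t) \<le> x powr (- real n) * norm (mellin_exp (s + of_nat n) a t)"
      using t by (simp add: norm_mellin_exp algebra_simps)
  qed auto
qed

lemma mellin_exp_scale:
  assumes "S \<subseteq> {0<..}" "S \<in> sets lebesgue" "u > 0"
    and "mellin_exp s 1 absolutely_integrable_on ((*) u ` S)"
  shows "mellin_exp s u absolutely_integrable_on S"
    "integral S (mellin_exp s u) = integral ((*) u ` S) (mellin_exp s 1) / of_real u powr s"
proof -
  have eq: "\<bar>u\<bar> *\<^sub>R mellin_exp s 1 (u * t) = of_real u powr s * mellin_exp s u t" if "t \<in> S" for t
  proof -
    have t: "t > 0" using that assms by auto
    have "of_real (u * t) powr (s - 1) = of_real u powr (s - 1) * (of_real t powr (s - 1) :: complex)"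
      using t assms(3) by (simp add: powr_times_real)
    moreover have "of_real u * of_real u powr (s - 1) = (of_real u powr s :: complex)"
      using assms(3) by (simp add: powr_diff)
    ultimately show ?thesis
      using assms(3) by (simp add: mellin_exp_def scaleR_conv_of_real mult_ac)
  qed
  have "(\<lambda>t. \<bar>u\<bar> *\<^sub>R mellin_exp s 1 (u * t)) absolutely_integrable_on S \<and>
      integral S (\<lambda>t. \<bar>u\<bar> *\<^sub>R mellin_exp s 1 (u * t)) = integral ((*) u ` S) (mellin_exp s 1)"
    by (subst has_absolute_integral_change_of_variables_real[where g = "(*) u" and h = "\<lambda>_. u"])
      (use assms in \<open>auto intro!: derivative_eq_intros inj_onI\<close>)
  moreover have "(\<lambda>t. \<bar>u\<bar> *\<^sub>R mellin_exp s 1 (u * t)) absolutely_integrable_on S \<longleftrightarrow>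
      (\<lambda>t. of_real u powr s * mellin_exp s u t) absolutely_integrable_on S"
    by (rule set_integrable_cong) (use eq in auto)
  moreover have "integral S (\<lambda>t. \<bar>u\<bar> *\<^sub>R mellin_exp s 1 (u * t)) = integral S (\<lambda>t. of_real u powr s * mellin_exp s u t)"
    by (rule integral_cong) (use eq in auto)
  ultimately have *: "(\<lambda>t. of_real u powr s * mellin_exp s u t) absolutely_integrable_on S"
    "integral S (\<lambda>t. of_real u powr s * mellin_exp s u t) = integral ((*) u ` S) (mellin_exp s 1)"
    by auto
  have nz: "of_real u powr s \<noteq> (0::complex)" using assms(3) by simp
  show **: "mellin_exp s u absolutely_integrable_on S"
    using * nz by (subst (asm) set_integrable_mult_right_iff) auto
  show "integral S (mellin_exp s u) = integral ((*) u ` S) (mellin_exp s 1) / of_real u powr s"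
    using *(2) nz by (simp add: divide_simps mult.commute)
qed

lemma upper_Gamma_eq: "upper_Gamma s x = integral {x..} (mellin_exp s 1)"
  by (simp add: upper_Gamma_def mellin_exp_def[abs_def])

text \<open>The upper Crandall function is \<open>G\<^sub>\<nu>(z) = expint (\<nu>/2) (\<pi>z\<^sup>2)\<close>.\<close>

definition expint :: "complex \<Rightarrow> real \<Rightarrow> complex" where
  "expint s u = upper_Gamma s u / of_real u powr s"

lemma expint_eq_integral:
  assumes "u > 0"
  shows "expint s u = integral {1..} (mellin_exp s u)"
proof -
  have "(*) u ` {1..} = {u..}"
  proof safe
    fix t assume "t \<ge> u" thus "t \<in> (*) u ` {1..}"
      using assms by (intro image_eqI[of _ _ "t / u"]) auto
  qed (use assms in auto)
  thus ?thesis
    using mellin_exp_scale(2)[of "{1..}" u s] mellin_exp_integrable_Ici[of u 1 s] assms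
    by (simp add: expint_def upper_Gamma_eq subset_iff)
qed

lemma Gamma_eq_mellin_integral:
  assumes "u > 0" "Re s > 0"
  shows "integral {0<..} (mellin_exp s u) = Gamma s / of_real u powr s"
proof -
  have "(*) u ` {0<..} = {0<..}"
  proof safe
    fix t :: real assume "t > 0" thus "t \<in> (*) u ` {0<..}"
      using assms by (intro image_eqI[of _ _ "t / u"]) auto
  qed (use assms in auto)
  moreover have "integral {0<..} (mellin_exp s 1) = Gamma s"
    using Gamma_integral_complex'[OF assms(2)]
    by (auto simp: mellin_exp_def[abs_def] exp_minus divide_inverse intro!: integral_unique)
  ultimately show ?thesis
    using mellin_exp_scale(2)[of "{0<..}" u s] mellin_exp_integrable_Ioi[of s 1] assms by simp
qed

text \<open>Riemann's splitting in a single lattice term: the integral over \<open>{1..}\<close>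
  stays on the real side, the one over \<open>{0<..1}\<close> is later summed over the lattice and
  moved to the dual side.\<close>

lemma Gamma_split:
  assumes "u > 0" "Re s > 0"
  shows "Gamma s / of_real u powr s = integral {0<..1} (mellin_exp s u) + expint s u"
proof -
  have i: "mellin_exp s u absolutely_integrable_on {0<..}"
    using assms by (intro mellin_exp_integrable_Ioi)
  have "mellin_exp s u integrable_on {0<..1}" "mellin_exp s u integrable_on {1..}"
    using set_integrable_subset[OF i, of "{0<..1}"] set_integrable_subset[OF i, of "{1..}"]
    by (auto simp: absolutely_integrable_on_def subset_iff)
  hence "integral ({0<..1} \<union> {1..}) (mellin_exp s u) = integral {0<..1} (mellin_exp s u) + integral {1..} (mellin_exp s u)"
    by (intro integral_Un) (auto intro: negligible_subset[of "{1}"])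
  moreover have "{0<..1} \<union> {1..} = {0::real<..}" by auto
  ultimately show ?thesis
    using Gamma_eq_mellin_integral[OF assms] expint_eq_integral[OF assms(1)] by simp
qed

lemma upper_Gamma_split:
  assumes "0 < a" "a \<le> x"
  shows "upper_Gamma s a = integral {a..x} (mellin_exp s 1) + upper_Gamma s x"
proof -
  have "mellin_exp s 1 integrable_on {a..x}"
    using assms by (intro integrable_continuous_interval continuous_on_mellin_exp) auto
  moreover have "mellin_exp s 1 integrable_on {x..}"
    using mellin_exp_integrable_Ici[of x 1 s] assms by (simp add: absolutely_integrable_on_def)
  ultimately have "integral ({a..x} \<union> {x..}) (mellin_exp s 1) = integral {a..x} (mellin_exp s 1) + integral {x..} (mellin_exp s 1)"
    by (intro integral_Un) (auto intro: negligible_subset[of "{x}"])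
  moreover have "{a..x} \<union> {x..} = {a..}" using assms by auto
  ultimately show ?thesis by (simp add: upper_Gamma_eq)
qed

lemma upper_Gamma_has_vector_derivative:
  assumes "x > 0"
  shows "(upper_Gamma s has_vector_derivative - mellin_exp s 1 x) (at x)"
proof -
  define a b where "a = x / 2" and "b = x + 1"
  have ab: "0 < a" "a < x" "x < b" using assms by (auto simp: a_def b_def)
  have "((\<lambda>x. integral {a..x} (mellin_exp s 1)) has_vector_derivative mellin_exp s 1 x) (at x within {a..b})"
    by (rule integral_has_vector_derivative) (use ab in \<open>auto intro!: continuous_on_mellin_exp\<close>)
  hence "((\<lambda>x. integral {a..x} (mellin_exp s 1)) has_vector_derivative mellin_exp s 1 x) (at x)"
    using ab at_within_Icc_at[of a x b] by metis
  hence "((\<lambda>x. upper_Gamma s a - integral {a..x} (mellin_exp s 1)) has_vector_derivative 0 - mellin_exp s 1 x) (at x)"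
    by (intro has_vector_derivative_diff has_vector_derivative_const)
  thus ?thesis
    unfolding diff_0
    proof (rule has_vector_derivative_transform_within_open[of _ _ _ "{a<..}"])
    fix y assume "y \<in> {a<..}"
    thus "upper_Gamma s a - integral {a..y} (mellin_exp s 1) = upper_Gamma s y"
      using upper_Gamma_split[of a y s] ab by simp
  qed (use ab in auto)
qed

definition expint_bound :: "real \<Rightarrow> real \<Rightarrow> real" where
  "expint_bound \<sigma> \<delta> = integral {1..} (\<lambda>t. t powr (\<sigma> - 1) * exp (- (\<delta> / 2 * t)))"

lemma expint_bound_integrable:
  fixes \<delta> \<sigma> :: real
  assumes "\<delta> > 0"
  shows "(\<lambda>t. t powr (\<sigma> - 1) * exp (- (\<delta> / 2 * t))) integrable_on {1..}"
proof -
  have "mellin_exp (of_real \<sigma>) (\<delta> / 2) absolutely_integrable_on {1..}"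
    using assms by (intro mellin_exp_integrable_Ici) auto
  hence "(\<lambda>t. norm (mellin_exp (of_real \<sigma>) (\<delta> / 2) t)) integrable_on {1..}"
    by (simp add: absolutely_integrable_on_def)
  thus ?thesis
    by (rule integrable_eq) (simp add: norm_mellin_exp)
qed

text \<open>With \<open>t \<ge> 1\<close> one half of the exponent \<open>u * t\<close> is at least
  \<open>u / 2\<close> and yields decay in \<open>u\<close>; with \<open>u \<ge> \<delta>\<close>
  the other half keeps the integral over \<open>t\<close> finite. The bound is uniform in
  \<open>Re s \<le> \<sigma>\<close>, as the later majorants for entire series require.\<close>

lemma norm_expint_integrand_le:
  fixes t \<delta> u \<sigma> :: real
  assumes "\<delta> > 0" "u \<ge> \<delta>" "Re s \<le> \<sigma>" "t \<ge> 1"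
  shows "norm (mellin_exp s u t) \<le> exp (- (u / 2)) * (t powr (\<sigma> - 1) * exp (- (\<delta> / 2 * t)))"
proof -
  have "u * 1 + \<delta> * t \<le> u * t + u * t"
    using assms by (intro add_mono mult_left_mono mult_right_mono) auto
  hence "- (u * t) \<le> - (u / 2) + - (\<delta> / 2 * t)"
    by (simp add: algebra_simps)
  hence "exp (- (u * t)) \<le> exp (- (u / 2) + - (\<delta> / 2 * t))"
    by (rule exp_le_cancel_iff[THEN iffD2])
  moreover have "t powr (Re s - 1) \<le> t powr (\<sigma> - 1)"
    using assms by (intro powr_mono) auto
  ultimately have "t powr (Re s - 1) * exp (- (u * t)) \<le> t powr (\<sigma> - 1) * exp (- (u / 2) + - (\<delta> / 2 * t))"
    by (intro mult_mono) auto
  thus ?thesis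
    using assms unfolding exp_add by (simp add: norm_mellin_exp mult_ac)
qed

lemma norm_expint_le:
  assumes "\<delta> > 0" "u \<ge> \<delta>" "Re s \<le> \<sigma>"
  shows "norm (expint s u) \<le> exp (- (u / 2)) * expint_bound \<sigma> \<delta>"
proof -
  have "norm (integral {1..} (mellin_exp s u)) \<le> integral {1..} (\<lambda>t. exp (- (u / 2)) * (t powr (\<sigma> - 1) * exp (- (\<delta> / 2 * t))))"
  proof (rule integral_norm_bound_integral)
    show "mellin_exp s u integrable_on {1..}"
      using mellin_exp_integrable_Ici[of 1 u s] assms by (simp add: absolutely_integrable_on_def)
    show "(\<lambda>t. exp (- (u / 2)) * (t powr (\<sigma> - 1) * exp (- (\<delta> / 2 * t)))) integrable_on {1..}"
      using expint_bound_integrable[OF assms(1)] by (rule integrable_on_mult_right)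
  qed (use assms norm_expint_integrand_le in auto)
  thus ?thesis
    using assms by (simp add: expint_eq_integral expint_bound_def)
qed

lemma expint_bound_nonneg: "\<delta> > 0 \<Longrightarrow> expint_bound \<sigma> \<delta> \<ge> 0"
  unfolding expint_bound_def by (intro integral_nonneg expint_bound_integrable) auto

lemma upper_Gamma_tendsto_0: "(upper_Gamma s \<longlongrightarrow> 0) at_top"
proof (rule Lim_null_comparison)
  show "\<forall>\<^sub>F x in at_top. norm (upper_Gamma s x) \<le> x powr Re s * (exp (- (x / 2)) * expint_bound (Re s) 1)"
    using eventually_ge_at_top[of 1]
  proof eventually_elim
    case (elim x)
    have "norm (upper_Gamma s x) = norm (of_real x powr s :: complex) * norm (expint s x)"
      using elim by (simp add: expint_def norm_divide)
    also have "\<dots> \<le> x powr Re s * (exp (- (x / 2)) * expint_bound (Re s) 1)"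
      using elim norm_expint_le[of 1 x s "Re s"] by (intro mult_mono) (auto simp: norm_powr_real_powr)
    finally show ?case .
  qed
  have "((\<lambda>x::real. x powr Re s * exp (- (x / 2))) \<longlongrightarrow> 0) at_top"
    by real_asymp
  from tendsto_mult_right[OF this, of "expint_bound (Re s) 1"]
  show "((\<lambda>x. x powr Re s * (exp (- (x / 2)) * expint_bound (Re s) 1)) \<longlongrightarrow> 0) at_top"
    by (simp add: mult_ac)
qed

lemma of_real_powr_has_vector_derivative:
  fixes s :: complex
  assumes "x > 0"
  shows "((\<lambda>x. of_real x powr s) has_vector_derivative s * of_real x powr (s - 1)) (at x)"
proof -
  have "((\<lambda>z. z powr s) has_field_derivative s * of_real x powr (s - 1)) (at (of_real x :: complex))"
    using assms by (intro has_field_derivative_powr) auto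
  thus ?thesis
    by (rule has_vector_derivative_real_field)
qed

text \<open>The difference of the two sides has derivative zero and tends to zero at infinity, hence
  vanishes; this replaces an integration by parts over a half-line.\<close>

lemma upper_Gamma_plus1:
  assumes x: "x > 0"
  shows "upper_Gamma (s + 1) x = s * upper_Gamma s x + of_real x powr s * of_real (exp (- x))"
proof -
  define R where "R x = upper_Gamma (s + 1) x - (s * upper_Gamma s x + of_real x powr s * of_real (exp (- x)))" for x
  have e: "((\<lambda>x. of_real (exp (- x)) :: complex) has_vector_derivative of_real (- exp (- x))) (at x)" for x :: real
    by (rule has_vector_derivative_of_real)
       (auto intro!: derivative_eq_intros simp: has_real_derivative_iff_has_vector_derivative[symmetric])
  have R: "(R has_vector_derivative 0) (at x)" if "x > 0" for x
  proof -
    have "(R has_vector_derivative - mellin_exp (s + 1) 1 x - (s * (- mellin_exp s 1 x) +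
        (of_real x powr s * of_real (- exp (- x)) + s * of_real x powr (s - 1) * of_real (exp (- x))))) (at x)"
      unfolding R_def using that
      by (intro has_vector_derivative_diff has_vector_derivative_add has_vector_derivative_mult
            has_vector_derivative_mult_right upper_Gamma_has_vector_derivative e of_real_powr_has_vector_derivative)
    thus ?thesis by (simp add: mellin_exp_def)
  qed
  have const: "R y = R x" if "y \<ge> x" for y
  proof (cases "y = x")
    case False
    have "(R has_vector_derivative 0) (at t within {x..y})" if "t \<in> {x..y}" for t
      using R[of t] x that by (auto intro: has_vector_derivative_at_within)
    then obtain c where "\<And>t. t \<in> {x..y} \<Longrightarrow> R t = c"
      using has_vector_derivative_zero_constant[of "{x..y}" R] by auto
    thus ?thesis using that by auto
  qed auto
  have "((\<lambda>x::real. x powr Re s * exp (- x)) \<longlongrightarrow> 0) at_top"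
    by real_asymp
  hence "((\<lambda>x. of_real x powr s * of_real (exp (- x)) :: complex) \<longlongrightarrow> 0) at_top"
    by (rule Lim_null_comparison[rotated])
       (rule eventually_mono[OF eventually_gt_at_top[of 0]], simp add: norm_mult norm_powr_real_powr)
  hence "(R \<longlongrightarrow> 0 - (s * 0 + 0)) at_top"
    unfolding R_def by (intro tendsto_intros upper_Gamma_tendsto_0)
  moreover have "(R \<longlongrightarrow> R x) at_top"
    by (rule tendsto_eventually, rule eventually_mono[OF eventually_ge_at_top[of x]], rule const)
  ultimately have "0 - (s * 0 + 0) = R x"
    by (intro tendsto_unique[of at_top R]) auto
  hence "R x = 0" by simp
  thus ?thesis by (simp add: R_def)
qed

lemma expint_recurrence:
  assumes "u > 0"
  shows "of_real u * expint (s + 1) u = s * expint s u + of_real (exp (- u))"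
  using assms upper_Gamma_plus1[OF assms, of s]
  by (simp add: expint_def powr_add divide_simps)

text \<open>Formally this is differentiation of t^(s-1) exp(-ut) under the integral sign; the proof
  uses the product rule and \<open>upper_Gamma_plus1\<close>. It is the relation that makes the
  Crandall functions a radial family, with shifts of \<open>s\<close> as the index.\<close>

lemma expint_has_vector_derivative:
  assumes "u > 0"
  shows "(expint s has_vector_derivative - expint (s + 1) u) (at u)"
proof -
  have "((\<lambda>u. upper_Gamma s u * of_real u powr (- s)) has_vector_derivative
      (upper_Gamma s u * (- s * of_real u powr (- s - 1)) + - mellin_exp s 1 u * of_real u powr (- s))) (at u)"
    using assms by (intro has_vector_derivative_mult of_real_powr_has_vector_derivative upper_Gamma_has_vector_derivative)
  moreover have "upper_Gamma s u * (- s * of_real u powr (- s - 1)) + - mellin_exp s 1 u * of_real u powr (- s) = - expint (s + 1) u"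
  proof -
    have "of_real u powr (- s - 1) = 1 / (of_real u powr s * (of_real u :: complex))"
      using assms by (simp add: powr_diff powr_minus divide_simps)
    moreover have "of_real u powr (- s) = 1 / (of_real u powr s :: complex)"
      by (simp add: powr_minus divide_simps)
    moreover have "mellin_exp s 1 u = of_real u powr s / of_real u * of_real (exp (- u))"
      using assms by (simp add: mellin_exp_def powr_diff)
    moreover have "of_real u powr (s + 1) = of_real u powr s * (of_real u :: complex)"
      using assms by (simp add: powr_add)
    ultimately show ?thesis
      using assms upper_Gamma_plus1[OF assms, of s]
      by (simp add: expint_def divide_simps) (simp add: algebra_simps)
  qed
  moreover have "expint s = (\<lambda>u. upper_Gamma s u * of_real u powr (- s))"
    by (simp add: expint_def powr_minus divide_inverse fun_eq_iff)
  ultimately show ?thesis by simp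
qed

section \<open>Exponential power series and the expansion of the incomplete Gamma function\<close>

definition pser :: "(nat \<Rightarrow> complex) \<Rightarrow> real \<Rightarrow> complex" where
  "pser c u = (\<Sum>k. c k * ((- of_real u) ^ k / fact k))"

lemma pser_summable:
  fixes z :: complex
  assumes "bounded (range c)"
  shows "summable (\<lambda>k. norm (c k * (z ^ k / fact k)))"
proof -
  obtain M where M: "\<And>k. norm (c k) \<le> M" using assms by (auto simp: bounded_iff)
  show ?thesis
  proof (rule summable_comparison_test'[of "\<lambda>k. M * (norm z ^ k /\<^sub>R fact k)" 0])
    show "summable (\<lambda>k. M * (norm z ^ k /\<^sub>R fact k))"
      by (intro summable_mult summable_exp_generic)
    have "norm (c k * (z ^ k / fact k)) = norm (c k) * (norm z ^ k /\<^sub>R fact k)" for k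
      by (simp add: norm_mult norm_divide norm_power divide_inverse norm_inverse mult_ac)
    moreover have "norm (c k) * (norm z ^ k /\<^sub>R fact k) \<le> M * (norm z ^ k /\<^sub>R fact k)" for k
      using M[of k] by (intro mult_right_mono) auto
    ultimately show "norm (norm (c k * (z ^ k / fact k))) \<le> M * (norm z ^ k /\<^sub>R fact k)" for k
      by simp
  qed
qed

lemma pser_sums:
  assumes "bounded (range c)"
  shows "(\<lambda>k. c k * ((- of_real u) ^ k / fact k)) sums pser c u"
  unfolding pser_def using summable_norm_cancel[OF pser_summable[OF assms]] by (rule summable_sums)

lemma pser_add:
  assumes "bounded (range c)" "bounded (range d)"
  shows "pser (\<lambda>k. a * c k + b * d k) u = a * pser c u + b * pser d u"
proof -
  have "(\<lambda>k. a * (c k * ((- of_real u) ^ k / fact k)) + b * (d k * ((- of_real u) ^ k / fact k)))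
    sums (a * pser c u + b * pser d u)"
    by (intro sums_add sums_mult pser_sums assms)
  hence "(\<lambda>k. (a * c k + b * d k) * ((- of_real u) ^ k / fact k)) sums (a * pser c u + b * pser d u)"
    by (simp add: algebra_simps)
  thus ?thesis unfolding pser_def by (rule sums_unique[symmetric])
qed

text \<open>The normalisation (-u)^k / k! turns differentiation into a shift of the coefficients
  with a sign, the same relation as for \<open>expint\<close>; boundedness of the coefficients
  survives the shift.\<close>

lemma pser_has_field_derivative:
  assumes "bounded (range c)"
  shows "(pser c has_vector_derivative - pser (\<lambda>k. c (Suc k)) u) (at u)"
proof -
  define a where "a k = c k * (-1) ^ k / fact k" for k
  have eq: "c k * ((- z) ^ k / fact k) = a k * z ^ k" for k and z :: complex
    by (simp add: a_def power_minus[of z])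
  have "summable (\<lambda>k. a k * z ^ k)" for z
    using summable_norm_cancel[OF pser_summable[OF assms, of "- z"]] by (simp only: eq)
  hence "((\<lambda>z. \<Sum>k. a k * z ^ k) has_field_derivative (\<Sum>k. diffs a k * z ^ k)) (at z)" for z
    by (rule termdiffs_strong_converges_everywhere)
  hence "((\<lambda>u. \<Sum>k. a k * of_real u ^ k) has_vector_derivative (\<Sum>k. diffs a k * of_real u ^ k)) (at u)"
    by (rule has_vector_derivative_real_field)
  moreover have "diffs a k * of_real u ^ k = - (c (Suc k) * ((- of_real u) ^ k / fact k))" for k
  proof -
    have "of_nat (Suc k) * a (Suc k) = - c (Suc k) * (-1) ^ k / fact k"
      by (simp add: a_def del: of_nat_Suc)
    thus ?thesis by (simp add: diffs_def power_minus[of "of_real u"])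
  qed
  moreover have "summable (\<lambda>k. c (Suc k) * ((- of_real u) ^ k / fact k))"
    by (rule summable_norm_cancel, rule pser_summable, rule bounded_subset[OF assms]) auto
  ultimately show ?thesis
    unfolding pser_def[abs_def] eq by (simp add: suminf_minus)
qed

lemma pser_exp: "pser (\<lambda>_. 1) u = of_real (exp (- u))"
proof -
  have "(\<lambda>k. (- of_real u) ^ k /\<^sub>R fact k) sums exp (- of_real u :: complex)"
    by (rule exp_converges)
  hence "(\<lambda>k. 1 * ((- of_real u) ^ k / fact k)) sums exp (- of_real u :: complex)"
    by (simp add: scaleR_conv_of_real divide_inverse mult_ac)
  thus ?thesis unfolding pser_def by (simp add: sums_iff exp_of_real flip: of_real_minus)
qed

text \<open>At \<open>k = 0\<close> the truncated subtraction \<open>k - 1\<close> is harmless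
  because the factor \<open>of_nat k\<close> is zero.\<close>

lemma pser_mult_u:
  assumes "bounded (range c)"
  shows "of_real u * pser c u = pser (\<lambda>k. - of_nat k * c (k - 1)) u"
proof -
  have "(\<lambda>k. - of_real u * (c k * ((- of_real u) ^ k / fact k))) sums (- of_real u * pser c u)"
    by (intro sums_mult pser_sums assms)
  also have "(\<lambda>k. - of_real u * (c k * ((- of_real u) ^ k / fact k))) =
      (\<lambda>k. (of_nat (Suc k) * c (Suc k - 1)) * ((- of_real u) ^ Suc k / fact (Suc k)))"
    by (auto simp: fun_eq_iff simp del: of_nat_Suc)
  finally have "(\<lambda>k. (of_nat k * c (k - 1)) * ((- of_real u) ^ k / fact k)) sums (- of_real u * pser c u)"
    by (subst (asm) sums_Suc_iff) simp
  from sums_minus[OF this] show ?thesis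
    unfolding pser_def by (simp add: sums_iff)
qed

lemma bounded_range_tendsto_0:
  fixes c :: "nat \<Rightarrow> complex"
  shows "c \<longlonglongrightarrow> l \<Longrightarrow> bounded (range c)"
  by (metis convergent_def convergent_imp_bounded)

lemma inverse_shift_tendsto_0: "(\<lambda>k. 1 / (s + of_nat k) :: complex) \<longlonglongrightarrow> 0"
proof -
  have "filterlim (\<lambda>k. s + of_nat k :: complex) at_infinity sequentially"
    by (intro tendsto_add_filterlim_at_infinity[OF tendsto_const] tendsto_of_nat)
  thus ?thesis
    by (intro tendsto_divide_0[OF tendsto_const])
qed

lemma bounded_inverse_shift: "bounded (range (\<lambda>k. 1 / (s + of_nat k) :: complex))"
  by (rule bounded_range_tendsto_0[OF inverse_shift_tendsto_0])

lemma integral_powr_Ioc: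
  assumes "Re s > 0"
  shows "((\<lambda>t. of_real t powr (s - 1)) has_integral 1 / s) {0<..1}"
proof -
  have "((\<lambda>t. complex_of_real t powr (s - 1)) has_integral
          (of_real 1 powr s / s - of_real 0 powr s / s)) {0..1}" using assms
    by (intro fundamental_theorem_of_calculus_interior)
       (auto intro!: continuous_intros derivative_eq_intros has_vector_derivative_real_field)
  hence "((\<lambda>t. complex_of_real t powr (s - 1)) has_integral 1 / s) {0..1}" by simp
  moreover have "{0<..1} - {0..1} = ({} :: real set)" "{0..1} - {0<..1} = {0::real}" by auto
  ultimately show ?thesis
    by (subst (asm) has_integral_spike_set_eq[of _ "{0<..1}"]) (auto intro: negligible_subset[of "{0}"])
qed

lemma powr_integrable_Ioc:
  assumes "Re s > 0"
  shows "(\<lambda>t. of_real t powr (s - 1) :: complex) absolutely_integrable_on {0<..1}"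
    and "integral {0<..1} (\<lambda>t. norm (of_real t powr (s - 1) :: complex)) = 1 / Re s"
proof -
  have "((\<lambda>t. complex_of_real t powr (of_real (Re s) - 1)) has_integral 1 / of_real (Re s)) {0<..1}"
    using assms by (intro integral_powr_Ioc) auto
  from has_integral_linear[OF this bounded_linear_Re]
  have "((\<lambda>t. Re (complex_of_real t powr (of_real (Re s) - 1))) has_integral Re (1 / of_real (Re s))) {0<..1}"
    by (simp only: o_def)
  moreover have "Re (1 / of_real (Re s)) = 1 / Re s"
    by (simp only: Re_divide_of_real one_complex.sel)
  moreover have "Re (complex_of_real t powr (of_real (Re s) - 1)) = norm (complex_of_real t powr (s - 1))"
    if "t \<in> {0<..1}" for t
  proof -
    have e: "complex_of_real (Re s) - 1 = of_real (Re s - 1)" by simp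
    have "complex_of_real t powr of_real (Re s - 1) = of_real (t powr (Re s - 1))"
      using that by (intro powr_of_real) auto
    thus ?thesis using that unfolding e by (simp only: Re_complex_of_real) (simp add: norm_powr_real_powr)
  qed
  ultimately have *: "((\<lambda>t. norm (complex_of_real t powr (s - 1))) has_integral 1 / Re s) {0<..1}"
    by (metis (no_types, lifting) has_integral_eq)
  show "(\<lambda>t. of_real t powr (s - 1) :: complex) absolutely_integrable_on {0<..1}"
    using * integral_powr_Ioc[OF assms] by (auto simp: absolutely_integrable_on_def)
  show "integral {0<..1} (\<lambda>t. norm (of_real t powr (s - 1) :: complex)) = 1 / Re s"
    using * by (rule integral_unique)
qed

text \<open>Expanding exp(-ut) and integrating t^(s+k-1) over the unit interval gives 1/(s+k). For
  \<open>u > 0\<close> the value is the lower incomplete Gamma function divided by u^s.\<close>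

lemma mellin_integral_Ioc:
  assumes s: "Re s > 0" and u: "u \<ge> 0"
  shows "integral {0<..1} (mellin_exp s u) = pser (\<lambda>k. 1 / (s + of_nat k)) u"
proof -
  define f where "f k t = (- of_real u) ^ k / fact k * (of_real t powr (s + of_nat k - 1) :: complex)" for k and t :: real
  have sk: "Re (s + of_nat k) > 0" for k using s by (simp add: add_pos_nonneg)
  have int: "integral {0<..1} (f k) = 1 / (s + of_nat k) * ((- of_real u) ^ k / fact k)" for k
    unfolding f_def using integral_unique[OF integral_powr_Ioc[OF sk[of k]]] by (simp add: mult.commute)
  have ai: "f k absolutely_integrable_on {0<..1}" for k
    unfolding f_def by (intro set_integrable_mult_right powr_integrable_Ioc sk)
  have nint: "integral {0<..1} (\<lambda>t. norm (f k t)) = 1 / Re (s + of_nat k) * (u ^ k / fact k)" for k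
    unfolding f_def norm_mult using powr_integrable_Ioc(2)[OF sk[of k]] u
    by (simp add: norm_divide norm_power mult.commute)
  have pt: "f k t = of_real t powr (s - 1) * ((- of_real (u * t)) ^ k / fact k)" if "t > 0" for k t
  proof -
    have "of_real t powr (s + of_nat k - 1) = of_real t powr (s - 1) * (of_real t ^ k :: complex)"
    proof -
      have "of_real t powr (s + of_nat k - 1) = (of_real t powr ((s - 1) + of_nat k) :: complex)"
        by (simp add: algebra_simps)
      also have "\<dots> = of_real t powr (s - 1) * of_real t powr (of_nat k)"
        by (rule powr_add)
      also have "of_real t powr (of_nat k) = (of_real t ^ k :: complex)"
        using that by (simp add: powr_nat)
      finally show ?thesis .
    qed
    thus ?thesis by (simp add: f_def power_mult_distrib[symmetric])
  qed
  have hs: "((\<lambda>k. f k t) has_sum mellin_exp s u t) UNIV" if "t \<in> {0<..1}" for t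
  proof -
    have t: "t > 0" using that by auto
    have sums: "(\<lambda>k. of_real t powr (s - 1) * (1 * ((- of_real (u * t)) ^ k / fact k))) sums
        (of_real t powr (s - 1) * pser (\<lambda>_. 1) (u * t))"
      by (intro sums_mult pser_sums) auto
    have "summable (\<lambda>k. norm (1 * ((- of_real (u * t)) ^ k / fact k) :: complex))"
      by (rule pser_summable[of "\<lambda>_. 1"]) auto
    hence "summable (\<lambda>k. norm (f k t))"
      unfolding pt[OF t] by (subst norm_mult) (intro summable_mult, simp)
    moreover have "(\<lambda>k. f k t) sums mellin_exp s u t"
      using sums unfolding pt[OF t] pser_exp by (simp add: mellin_exp_def)
    ultimately show ?thesis by (rule norm_summable_imp_has_sum)
  qed
  have "(\<lambda>k. integral {0<..1} (\<lambda>t. norm (f k t))) summable_on UNIV"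
  proof (rule norm_summable_imp_summable_on)
    have "bounded (range (\<lambda>k. 1 / (of_real (Re s) + of_nat k) :: complex))" by (rule bounded_inverse_shift)
    from pser_summable[OF this, of "of_real u"]
    moreover have "norm (1 / (of_real (Re s) + of_nat k) * (of_real u ^ k / fact k) :: complex) =
        norm (integral {0<..1} (\<lambda>t. norm (f k t)))" for k
    proof -
      have "of_real (Re s) + of_nat k = (of_real (Re s + real k) :: complex)" by simp
      thus ?thesis unfolding nint by (simp only: norm_mult norm_divide norm_power norm_of_real norm_one norm_fact) simp
    qed
    ultimately show "summable (\<lambda>k. norm (integral {0<..1} (\<lambda>t. norm (f k t))))"
      by simp
  qed
  from has_sum_integral_swap(2)[OF _ ai this]
  have "((\<lambda>k. integral {0<..1} (f k)) has_sum integral {0<..1} (\<lambda>t. \<Sum>\<^sub>\<infinity>k. f k t)) UNIV"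
    using hs by (auto simp: summable_on_def)
  moreover have "integral {0<..1} (\<lambda>t. \<Sum>\<^sub>\<infinity>k. f k t) = integral {0<..1} (mellin_exp s u)"
    by (rule integral_cong) (use hs in \<open>auto simp: infsumI\<close>)
  ultimately have "(\<lambda>k. integral {0<..1} (f k)) sums integral {0<..1} (mellin_exp s u)"
    by (metis has_sum_imp_sums)
  thus ?thesis
    unfolding int pser_def by (simp add: sums_iff)
qed

lemma expint_pos:
  assumes "Re s > 0" "u > 0"
  shows "expint s u = Gamma s / of_real u powr s - pser (\<lambda>k. 1 / (s + of_nat k)) u"
  using Gamma_split[OF assms(2,1)] mellin_integral_Ioc[OF assms(1), of u] assms by (simp add: algebra_simps)

lemma pser_recurrence:
  assumes "s \<notin> \<int>\<^sub>\<le>\<^sub>0"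
  shows "of_real u * pser (\<lambda>k. 1 / (s + 1 + of_nat k)) u =
         s * pser (\<lambda>k. 1 / (s + of_nat k)) u - of_real (exp (- u))"
proof -
  have nz: "s + of_nat k \<noteq> 0" for k
    using assms by (metis add.commute add_eq_0_iff minus_of_nat_in_nonpos_Ints)
  have "- of_nat k * (1 / (s + 1 + of_nat (k - 1))) = s * (1 / (s + of_nat k)) + (-1) * 1" for k
    using nz[of k] by (cases k) (auto simp: divide_simps add_ac)
  thus ?thesis
    unfolding pser_mult_u[OF bounded_inverse_shift] pser_exp[symmetric]
    using pser_add[OF bounded_inverse_shift, of "\<lambda>_. 1" s s "-1" u] by simp
qed

text \<open>For \<open>Re s > 0\<close> this is \<open>expint_pos\<close>. Both sides obey the same
  recurrence between \<open>s\<close> and \<open>s + 1\<close>, and \<open>s \<noteq> 0\<close>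
  allows division, so validity spreads to the left one unit strip at a time.\<close>

lemma expint_eq_Gamma_pser:
  assumes "s \<notin> \<int>\<^sub>\<le>\<^sub>0" "u > 0"
  shows "expint s u = Gamma s / of_real u powr s - pser (\<lambda>k. 1 / (s + of_nat k)) u"
proof -
  have "\<forall>s. s \<notin> \<int>\<^sub>\<le>\<^sub>0 \<longrightarrow> Re s > - real n \<longrightarrow>
     expint s u = Gamma s / of_real u powr s - pser (\<lambda>k. 1 / (s + of_nat k)) u" for n
  proof (induction n)
    case 0
    thus ?case using expint_pos assms by auto
  next
    case (Suc n)
    show ?case
    proof (intro allI impI)
      fix s :: complex assume s: "s \<notin> \<int>\<^sub>\<le>\<^sub>0" "Re s > - real (Suc n)"
      have "s \<noteq> 0" using s by auto
      have "s + 1 \<notin> \<int>\<^sub>\<le>\<^sub>0 \<or> s = -1 + 1"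
        using s(1) plus_one_in_nonpos_Ints_imp by blast
      hence "s + 1 \<notin> \<int>\<^sub>\<le>\<^sub>0" using \<open>s \<noteq> 0\<close> by auto
      hence "expint (s + 1) u = Gamma (s + 1) / of_real u powr (s + 1) - pser (\<lambda>k. 1 / (s + 1 + of_nat k)) u"
        using Suc s by auto
      hence "of_real u * expint (s + 1) u = s * Gamma s / of_real u powr s - of_real u * pser (\<lambda>k. 1 / (s + 1 + of_nat k)) u"
        using assms(2) Gamma_plus1[OF s(1)] by (simp add: powr_add right_diff_distrib)
      moreover have "s * expint s u = of_real u * expint (s + 1) u - of_real (exp (- u))"
        by (simp only: expint_recurrence[OF assms(2), of s]) simp
      ultimately have "s * expint s u = s * (Gamma s / of_real u powr s - pser (\<lambda>k. 1 / (s + of_nat k)) u)"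
        by (simp only: pser_recurrence[OF s(1), of u]) (simp add: right_diff_distrib)
      thus "expint s u = Gamma s / of_real u powr s - pser (\<lambda>k. 1 / (s + of_nat k)) u"
        using \<open>s \<noteq> 0\<close> by simp
    qed
  qed
  moreover obtain n where "- Re s < real n" using reals_Archimedean2 by blast
  ultimately show ?thesis using assms by (metis minus_less_iff)
qed

section \<open>Uniqueness of continuations, the lower Gamma function and the logarithmic
  cases\<close>

lemma nicely_meromorphic_eq_if_eventually_eq:
  assumes "F nicely_meromorphic_on UNIV" "E nicely_meromorphic_on UNIV"
    and ev: "eventually (\<lambda>w. F w = E w) (at z)"
  shows "F z = E z"
proof -
  have eq: "remove_sings f z = f z" if "f nicely_meromorphic_on UNIV" for f
  proof -
    from that have "is_pole f z \<and> f z = 0 \<or> f \<midarrow>z\<rightarrow> f z"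
      by (auto simp: nicely_meromorphic_on_def)
    thus ?thesis by auto
  qed
  have "remove_sings F z = remove_sings E z"
    using ev by (intro remove_sings_cong refl)
  thus ?thesis using eq assms by metis
qed

text \<open>The identity theorem, applied to \<open>remove_sings\<close> of the difference: at a
  common pole both functions have value 0, so the difference may fail to be continuous there and has
  to be normalised first. Agreement near each point then gives agreement at it, by the convention
  for values at poles.\<close>

lemma meromorphic_continuation_eqI:
  assumes E: "E nicely_meromorphic_on UNIV" and eq: "\<And>s. Re s > c \<Longrightarrow> E s = f s"
  shows "meromorphic_continuation c f = E"
  unfolding meromorphic_continuation_def
proof (rule the_equality)
  fix F assume F: "F nicely_meromorphic_on UNIV \<and> (\<forall>s. Re s > c \<longrightarrow> F s = f s)"
  define D where "D s = F s - E s" for s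
  have mD: "D meromorphic_on UNIV"
    using E F unfolding D_def by (intro meromorphic_intros) (auto simp: nicely_meromorphic_on_def)
  define H where "H = {s. Re s > c}"
  have "open H" unfolding H_def by (rule open_halfspace_Re_gt)
  have D0: "remove_sings D z = 0" if "z \<in> H" for z
  proof (rule remove_sings_eqI)
    have "eventually (\<lambda>w. w \<in> H) (at z)"
      using \<open>open H\<close> that by (intro eventually_at_in_open') auto
    hence "eventually (\<lambda>w. D w = 0) (at z)"
      by eventually_elim (use F eq in \<open>auto simp: D_def H_def\<close>)
    thus "D \<midarrow>z\<rightarrow> 0" by (rule tendsto_eventually)
  qed
  have "remove_sings D constant_on UNIV"
  proof (rule constant_on_extend_nicely_meromorphic_on[of _ UNIV H])
    show "remove_sings D nicely_meromorphic_on UNIV" using mD by (rule remove_sings_nicely_meromorphic)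
    show "remove_sings D constant_on H" using D0 by (auto simp: constant_on_def)
    have "of_real (c + 1) \<in> H" by (simp add: H_def)
    thus "H \<noteq> {}" by blast
  qed (use \<open>open H\<close> in auto)
  moreover have "of_real (c + 1) \<in> H" by (simp add: H_def)
  ultimately have D0: "remove_sings D z = 0" for z
    using D0 by (metis UNIV_I constant_on_def)
  show "F = E"
  proof
    fix z
    have "eventually (\<lambda>z. remove_sings D z = D z) (cosparse UNIV)"
      using mD by (rule eventually_remove_sings_eq)
    hence "eventually (\<lambda>w. remove_sings D w = D w) (at z)"
      by (simp add: eventually_cosparse_open_eq)
    hence "eventually (\<lambda>w. F w = E w) (at z)"
      by eventually_elim (simp add: D0 D_def)
    thus "F z = E z"
      using nicely_meromorphic_eq_if_eventually_eq E F by blast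
  qed
qed (use E eq in auto)

text \<open>Integrals over bounded intervals are entire by the Leibniz rule, and they converge
  locally uniformly because the tail is again \<open>upper_Gamma s\<close> at the right end point,
  which \<open>norm_expint_le\<close> controls.\<close>

lemma upper_Gamma_holomorphic:
  assumes x: "x > 0"
  shows "(\<lambda>s. upper_Gamma s x) holomorphic_on UNIV"
proof (rule holomorphic_uniform_sequence)
  show "(\<lambda>s. integral (cbox x (x + real n)) (mellin_exp s 1)) holomorphic_on UNIV" for n
  proof (rule leibniz_rule_holomorphic)
    fix s :: complex and t assume t: "t \<in> cbox x (x + real n)"
    show "((\<lambda>s. mellin_exp s 1 t) has_field_derivative
       of_real t powr (s - 1) * Ln (of_real t) * of_real (exp (- t))) (at s within UNIV)"
    proof -
      have "((\<lambda>s. of_real t powr (s - 1)) has_field_derivative Ln (of_real t) * of_real t powr (s - 1) * 1) (at (s :: complex))"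
        using t x by (intro DERIV_chain2[OF has_field_derivative_powr_right]) (auto intro!: derivative_eq_intros)
      from DERIV_cmult_right[OF this, of "of_real (exp (- t))"] show ?thesis
        by (simp add: mellin_exp_def mult.commute)
    qed
  next
    show "mellin_exp s 1 integrable_on cbox x (x + real n)" for s
      using x by (intro integrable_continuous continuous_on_mellin_exp) auto
    show "continuous_on (UNIV \<times> cbox x (x + real n))
       (\<lambda>(s, t). of_real t powr (s - 1) * Ln (of_real t) * of_real (exp (- t)))"
      unfolding case_prod_unfold using x by (auto intro!: continuous_intros simp: complex_nonpos_Reals_iff)
  qed auto
next
  fix s0 :: complex
  define \<sigma> where "\<sigma> = Re s0 + 1"
  have "uniform_limit (cball s0 1) (\<lambda>n s. integral (cbox x (x + real n)) (mellin_exp s 1)) (\<lambda>s. upper_Gamma s x) sequentially"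
  proof (rule uniform_limitI)
    fix e :: real assume "e > 0"
    have "((\<lambda>y::real. y powr \<sigma> * exp (- (y / 2))) \<longlongrightarrow> 0) at_top"
      by real_asymp
    hence "((\<lambda>y::real. y powr \<sigma> * exp (- (y / 2)) * expint_bound \<sigma> 1) \<longlongrightarrow> 0) at_top"
      by (rule tendsto_mult_left_zero)
    moreover have "filterlim (\<lambda>n. x + real n) at_top sequentially"
      by real_asymp
    ultimately have "(\<lambda>n. (x + real n) powr \<sigma> * exp (- ((x + real n) / 2)) * expint_bound \<sigma> 1) \<longlonglongrightarrow> 0"
      by (rule filterlim_compose)
    hence "\<forall>\<^sub>F n in sequentially. (x + real n) powr \<sigma> * exp (- ((x + real n) / 2)) * expint_bound \<sigma> 1 < e"
      using \<open>e > 0\<close> by (rule order_tendstoD)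
    moreover have "\<forall>\<^sub>F n in sequentially. n \<ge> 1" by (rule eventually_ge_at_top)
    ultimately show "\<forall>\<^sub>F n in sequentially. \<forall>s\<in>cball s0 1. dist (integral (cbox x (x + real n)) (mellin_exp s 1)) (upper_Gamma s x) < e"
    proof eventually_elim
      case (elim n)
      define y where "y = x + real n"
      have y: "y \<ge> 1" "x \<le> y" using elim x by (auto simp: y_def)
      show ?case
      proof
        fix s assume "s \<in> cball s0 1"
        hence s: "Re s \<le> \<sigma>" using abs_Re_le_cmod[of "s0 - s"] by (auto simp: \<sigma>_def dist_norm)
        have "dist (integral (cbox x y) (mellin_exp s 1)) (upper_Gamma s x) = norm (upper_Gamma s y)"
          using upper_Gamma_split[OF x y(2), of s] by (simp add: dist_norm)
        also have "\<dots> = norm (of_real y powr s :: complex) * norm (expint s y)"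
          using y by (simp add: expint_def norm_divide)
        also have "\<dots> \<le> y powr \<sigma> * (exp (- (y / 2)) * expint_bound \<sigma> 1)"
          using y s by (intro mult_mono norm_expint_le) (auto simp: norm_powr_real_powr intro: powr_mono)
        also have "\<dots> < e" using elim by (simp add: y_def mult_ac)
        finally show "dist (integral (cbox x (x + real n)) (mellin_exp s 1)) (upper_Gamma s x) < e"
          by (simp add: y_def)
      qed
    qed
  qed
  thus "\<exists>d>0. cball s0 d \<subseteq> UNIV \<and> uniform_limit (cball s0 d) (\<lambda>n s. integral (cbox x (x + real n)) (mellin_exp s 1)) (\<lambda>s. upper_Gamma s x) sequentially"
    by (intro exI[of _ 1]) auto
qed auto

lemma expint_holomorphic:
  assumes "u > 0"
  shows "(\<lambda>s. expint s u) holomorphic_on UNIV"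
  unfolding expint_def
  by (intro holomorphic_intros upper_Gamma_holomorphic assms) (use assms in auto)

text \<open>The difference on the right is meromorphic in the plane and equals the defining integral
  for \<open>Re s > 0\<close>; \<open>remove_sings\<close> brings it into the normal form of
  \<open>meromorphic_continuation\<close> and changes nothing outside the nonpositive
  integers.\<close>

lemma lower_Gamma_eq:
  assumes "s \<notin> \<int>\<^sub>\<le>\<^sub>0" "x > 0"
  shows "lower_Gamma s x = Gamma s - upper_Gamma s x"
proof -
  have hol: "(\<lambda>s. Gamma s - upper_Gamma s x) holomorphic_on - \<int>\<^sub>\<le>\<^sub>0"
    by (intro holomorphic_intros holomorphic_on_subset[OF upper_Gamma_holomorphic] assms) auto
  have op: "open (- \<int>\<^sub>\<le>\<^sub>0 :: complex set)" by auto
  have an: "(\<lambda>s. Gamma s - upper_Gamma s x) analytic_on {s}" if "s \<notin> \<int>\<^sub>\<le>\<^sub>0" for s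
    using hol op that by (auto simp: analytic_at)
  have mer: "(\<lambda>s. Gamma s - upper_Gamma s x) meromorphic_on UNIV"
  proof (intro meromorphic_intros)
    have "rGamma meromorphic_on UNIV"
      by (intro analytic_on_imp_meromorphic_on analytic_rGamma)
    hence "(\<lambda>s. inverse (rGamma s)) meromorphic_on (UNIV :: complex set)"
      by (rule meromorphic_on_inverse)
    thus "Gamma meromorphic_on (UNIV :: complex set)"
      by (simp add: rGamma_inverse_Gamma)
    show "(\<lambda>s. upper_Gamma s x) meromorphic_on UNIV"
      using upper_Gamma_holomorphic[OF assms(2)]
      by (intro analytic_on_imp_meromorphic_on) (simp add: analytic_on_open)
  qed
  have "meromorphic_continuation 0 (\<lambda>s. integral {0..x} (\<lambda>t. of_real t powr (s - 1) * of_real (exp (- t)))) =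
      remove_sings (\<lambda>s. Gamma s - upper_Gamma s x)"
  proof (rule meromorphic_continuation_eqI)
    show "remove_sings (\<lambda>s. Gamma s - upper_Gamma s x) nicely_meromorphic_on UNIV"
      using mer by (rule remove_sings_nicely_meromorphic)
    fix s :: complex assume s: "Re s > 0"
    have "s \<notin> \<int>\<^sub>\<le>\<^sub>0" using s by (auto elim!: nonpos_Ints_cases)
    hence "remove_sings (\<lambda>s. Gamma s - upper_Gamma s x) s = Gamma s - upper_Gamma s x"
      using an by simp
    also have "\<dots> = integral {0..x} (mellin_exp s 1)"
    proof -
      have i: "mellin_exp s 1 absolutely_integrable_on {0<..}"
        using s by (intro mellin_exp_integrable_Ioi) auto
      have "mellin_exp s 1 integrable_on {0<..x}" "mellin_exp s 1 integrable_on {x..}"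
        using set_integrable_subset[OF i, of "{0<..x}"] set_integrable_subset[OF i, of "{x..}"] assms
        by (auto simp: absolutely_integrable_on_def subset_iff)
      hence "integral ({0<..x} \<union> {x..}) (mellin_exp s 1) = integral {0<..x} (mellin_exp s 1) + integral {x..} (mellin_exp s 1)"
        by (intro integral_Un) (auto intro: negligible_subset[of "{x}"])
      moreover have "{0<..x} \<union> {x..} = {0::real<..}" using assms by auto
      moreover have "integral {0<..x} (mellin_exp s 1) = integral {0..x} (mellin_exp s 1)"
        by (rule integral_spike_set) (auto intro: negligible_subset[of "{0}"])
      ultimately show ?thesis
        using Gamma_eq_mellin_integral[of 1 s] s by (simp add: upper_Gamma_eq)
    qed
    finally show "remove_sings (\<lambda>s. Gamma s - upper_Gamma s x) s =
        integral {0..x} (\<lambda>t. of_real t powr (s - 1) * of_real (exp (- t)))"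
      by (simp add: mellin_exp_def[abs_def])
  qed
  thus ?thesis
    using an[OF assms(1)] by (simp add: lower_Gamma_def)
qed

text \<open>The power series part of \<open>\<Gamma>(-l, u)/u\<^sup>-\<^sup>l\<close>; the remaining part is a multiple of \<open>u\<^sup>l log u\<close>.\<close>

definition expint_coeff :: "nat \<Rightarrow> nat \<Rightarrow> complex" where
  "expint_coeff l k = (if k = l then harm l - euler_mascheroni else - 1 / (of_nat k - of_nat l))"

lemma bounded_expint_coeff: "bounded (range (expint_coeff l))"
proof (rule bounded_range_tendsto_0)
  have "(\<lambda>k. - (1 / (- of_nat l + of_nat k :: complex))) \<longlonglongrightarrow> - 0"
    by (intro tendsto_minus inverse_shift_tendsto_0)
  moreover have "\<forall>\<^sub>F k in sequentially. - (1 / (- of_nat l + of_nat k :: complex)) = expint_coeff l k"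
    using eventually_gt_at_top[of l]
    by eventually_elim (auto simp: expint_coeff_def)
  ultimately show "expint_coeff l \<longlonglongrightarrow> 0"
    by (metis Lim_transform_eventually minus_zero)
qed

text \<open>Let \<open>s\<close> tend to 0 in \<open>expint_eq_Gamma_pser\<close>: the pole of
  Gamma(s) / u^s cancels against the term 1/s of the series, and what remains is the difference
  quotient at 0 of Gamma(s+1) u^(-s), with limit \<open>- euler_mascheroni - ln u\<close>.\<close>

lemma expint_0:
  assumes u: "u > 0"
  shows "expint 0 u = pser (expint_coeff 0) u - of_real (ln u)"
proof -
  \<comment> \<open>The series without its singular term \<open>k = 0\<close>. On the disc of radius
    1/2 the denominators \<open>s + of_nat k\<close> with \<open>k > 0\<close> have modulus at least
    1/2, so the Weierstrass test with factor 2 gives continuity at 0.\<close>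
  define T where "T s = pser (\<lambda>k. if k = 0 then 0 else 1 / (s + of_nat k)) u" for s
  have bd: "bounded (range (\<lambda>k. if k = 0 then 0 else 1 / (s + of_nat k) :: complex))" for s
    by (rule bounded_subset[OF bounded_insert[THEN iffD2, OF bounded_inverse_shift[of s], of 0]]) auto
  have "continuous_on (cball 0 (1/2)) T"
    unfolding T_def pser_def
  proof (rule uniform_limit_theorem[OF _ Weierstrass_m_test])
    fix k s assume "s \<in> cball (0::complex) (1/2)"
    hence s: "norm s \<le> 1/2" by simp
    have "norm (if k = 0 then 0 else 1 / (s + of_nat k)) \<le> 2"
    proof (cases k)
      case (Suc m)
      have "norm (of_nat k :: complex) \<le> norm (s + of_nat k) + norm s"
        by (metis add.commute add_diff_cancel_right' norm_triangle_ineq4)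
      hence "real k \<le> norm (s + of_nat k) + norm s" by (simp only: norm_of_nat)
      hence "norm (s + of_nat k) \<ge> 1/2" using s Suc by linarith
      thus ?thesis using Suc by (simp add: norm_divide divide_simps del: of_nat_Suc)
    qed auto
    hence "norm (if k = 0 then 0 else 1 / (s + of_nat k)) * norm ((- complex_of_real u) ^ k / fact k) \<le> 2 * norm ((- complex_of_real u) ^ k / fact k)"
      by (intro mult_right_mono) auto
    thus "norm ((if k = 0 then 0 else 1 / (s + of_nat k)) * ((- complex_of_real u) ^ k / fact k)) \<le> norm (2 * ((- complex_of_real u) ^ k / fact k))"
      by (simp only: norm_mult norm_numeral)
  next
    show "summable (\<lambda>k. norm (2 * ((- complex_of_real u) ^ k / fact k)))"
      by (rule pser_summable[of "\<lambda>_. 2"]) auto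
    show "\<forall>\<^sub>F n in sequentially. continuous_on (cball 0 (1/2)) (\<lambda>s. \<Sum>k<n. (if k = 0 then 0 else 1 / (s + of_nat k)) * ((- complex_of_real u) ^ k / fact k))"
    proof (intro always_eventually allI continuous_on_sum)
      fix n k
      show "continuous_on (cball 0 (1/2)) (\<lambda>s. (if k = 0 then 0 else 1 / (s + of_nat k)) * ((- complex_of_real u) ^ k / fact k))"
      proof (cases "k = 0")
        case False
        have "s + of_nat k \<noteq> 0" if "s \<in> cball (0::complex) (1/2)" for s
        proof
          assume "s + of_nat k = 0"
          hence "norm s = real k" by (metis add_eq_0_iff2 norm_minus_cancel norm_of_nat)
          thus False using that False by simp
        qed
        thus ?thesis using False by (auto intro!: continuous_intros)
      qed simp
    qed
  qed auto
  hence T: "(T \<longlongrightarrow> T 0) (at 0)"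
    using continuous_on_interior[of "cball 0 (1/2)" T 0] by (simp add: isCont_def)
  have d: "((\<lambda>s. of_real u powr (- s)) has_field_derivative (Ln (of_real u) * of_real u powr (- 0)) * (-1)) (at (0::complex))"
    using u by (intro DERIV_chain2[OF has_field_derivative_powr_right]) (auto intro!: derivative_eq_intros)
  have "((\<lambda>s. Gamma (s + 1) * of_real u powr (- s)) has_field_derivative
     Gamma 1 * Digamma 1 * of_real u powr (- 0) + Gamma (0 + 1) * (- Ln (of_real u) * of_real u powr (- 0))) (at (0::complex))"
    using u by (auto intro!: derivative_eq_intros d)
  hence "((\<lambda>s. (Gamma (s + 1) * of_real u powr (- s) - 1) / s) \<longlongrightarrow> - euler_mascheroni - of_real (ln u)) (at (0::complex))"
    using u by (simp add: has_field_derivative_iff Ln_of_real)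
  hence "((\<lambda>s. (Gamma (s + 1) * of_real u powr (- s) - 1) / s - T s) \<longlongrightarrow> - euler_mascheroni - of_real (ln u) - T 0) (at (0::complex))"
    by (intro tendsto_diff T)
  moreover have "\<forall>\<^sub>F s in at 0. (Gamma (s + 1) * of_real u powr (- s) - 1) / s - T s = expint s u"
  proof -
    have "\<forall>\<^sub>F s in at 0. s \<in> ball 0 1 - {0::complex}"
      by (intro eventually_at_in_open) auto
    thus ?thesis
    proof eventually_elim
      case (elim s)
      hence s: "s \<noteq> 0" "norm s < 1" by auto
      have si: "s \<notin> \<int>\<^sub>\<le>\<^sub>0"
      proof
        assume "s \<in> \<int>\<^sub>\<le>\<^sub>0"
        then obtain n where n: "s = - of_nat n" by (auto elim!: nonpos_Ints_cases')
        hence "norm s = real n" by (simp only: norm_minus_cancel norm_of_nat)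
        thus False using s n by simp
      qed
      have sg: "(\<lambda>k. (if k = 0 then 1 / s else 0) * ((- complex_of_real u) ^ k / fact k)) sums (1 / s)"
      proof -
        have "(\<lambda>k. (if k = 0 then 1 / s else 0) * ((- complex_of_real u) ^ k / fact k)) =
            (\<lambda>k. if k = 0 then 1 / s * ((- complex_of_real u) ^ k / fact k) else 0)" by auto
        thus ?thesis
          using sums_single[of 0 "\<lambda>k. 1 / s * ((- complex_of_real u) ^ k / fact k)"] by (simp only: power_0 fact_0) simp
      qed
      have "bounded (range (\<lambda>k::nat. if k = 0 then 1 / s else 0))"
        by (rule finite_imp_bounded, rule finite_subset[of _ "{1/s, 0}"]) auto
      note pser_add[OF this bd, of 1 1 s u]
      also have "(\<lambda>k. 1 * (if k = 0 then 1 / s else 0) + 1 * (if k = 0 then 0 else 1 / (s + of_nat k))) =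
          (\<lambda>k. 1 / (s + of_nat k))" by (auto simp: fun_eq_iff)
      also have "pser (\<lambda>k. if k = 0 then 1 / s else 0) u = 1 / s"
        unfolding pser_def using sg by (rule sums_unique[symmetric])
      finally have "pser (\<lambda>k. 1 / (s + of_nat k)) u = 1 / s + T s"
        by (simp add: T_def)
      moreover have "Gamma s = Gamma (s + 1) / s" using Gamma_plus1[OF si] s by simp
      ultimately show ?case
        unfolding expint_eq_Gamma_pser[OF si u] by (simp add: powr_minus divide_inverse algebra_simps)
    qed
  qed
  ultimately have "((\<lambda>s. expint s u) \<longlongrightarrow> - euler_mascheroni - of_real (ln u) - T 0) (at 0)"
    by (rule Lim_transform_eventually)
  moreover have "((\<lambda>s. expint s u) \<longlongrightarrow> expint 0 u) (at 0)"
    using holomorphic_on_imp_continuous_on[OF expint_holomorphic[OF u]]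
    by (simp add: continuous_on_eq_continuous_at isCont_def)
  ultimately have 1: "expint 0 u = - euler_mascheroni - of_real (ln u) - T 0"
    by (intro tendsto_unique[of "at (0::complex)"]) auto
  have "(\<lambda>k. (if k = 0 then - euler_mascheroni else 0) * ((- complex_of_real u) ^ k / fact k)) sums (- euler_mascheroni)"
  proof -
    have "(\<lambda>k. (if k = 0 then - euler_mascheroni else 0) * ((- complex_of_real u) ^ k / fact k)) =
        (\<lambda>k. if k = 0 then - euler_mascheroni * ((- complex_of_real u) ^ k / fact k) else 0)" by auto
    thus ?thesis
      using sums_single[of 0 "\<lambda>k. - euler_mascheroni * ((- complex_of_real u) ^ k / fact k)"] by (simp only: power_0 fact_0) simp
  qed
  moreover have "bounded (range (\<lambda>k::nat. if k = 0 then - euler_mascheroni else 0 :: complex))"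
    by (rule finite_imp_bounded, rule finite_subset[of _ "{- euler_mascheroni, 0}"]) auto
  note pser_add[OF this bd, of 1 "-1" 0 u]
  ultimately have "pser (\<lambda>k. 1 * (if k = 0 then - euler_mascheroni else 0) + (-1) * (if k = 0 then 0 else 1 / (0 + of_nat k))) u = - euler_mascheroni - T 0"
    unfolding T_def by (simp add: pser_def sums_iff)
  also have "(\<lambda>k. 1 * (if k = 0 then - euler_mascheroni else 0) + (-1) * (if k = 0 then 0 else 1 / (0 + of_nat k))) = expint_coeff 0"
    by (auto simp: expint_coeff_def harm_def fun_eq_iff)
  finally show ?thesis using 1 by simp
qed

text \<open>Induction through the recurrence at \<open>s = - of_nat (Suc l)\<close>. When
  coefficients are compared, only \<open>k = Suc l\<close> involves harmonic numbers: there 1/(l+1)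
  turns the one for \<open>l\<close> into the next.\<close>

lemma expint_neg:
  assumes u: "u > 0"
  shows "expint (- of_nat l) u = pser (expint_coeff l) u - of_real ((- u) ^ l / fact l * ln u)"
proof (induction l)
  case 0
  thus ?case using expint_0[OF u] by simp
next
  case (Suc l)
  define L where "L = (of_nat (Suc l) :: complex)"
  have L: "L \<noteq> 0" by (simp add: L_def del: of_nat_Suc)
  have e: "- L + 1 = - of_nat l" by (simp add: L_def)
  have "L * expint (- L) u = of_real (exp (- u)) - of_real u * expint (- of_nat l) u"
    using expint_recurrence[OF u, of "- L"] unfolding e by simp
  also have "\<dots> = (pser (\<lambda>_. 1) u - pser (\<lambda>k. - of_nat k * expint_coeff l (k - 1)) u) + of_real u * of_real ((- u) ^ l / fact l * ln u)"
    unfolding Suc.IH pser_exp pser_mult_u[OF bounded_expint_coeff, symmetric] by (simp add: algebra_simps)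
  also have "pser (\<lambda>_. 1) u - pser (\<lambda>k. - of_nat k * expint_coeff l (k - 1)) u = L * pser (expint_coeff (Suc l)) u"
  proof -
    have c: "- of_nat k * expint_coeff l (k - 1) = 1 * 1 + (- L) * expint_coeff (Suc l) k" for k
    proof (cases k)
      case 0
      thus ?thesis using L by (simp add: expint_coeff_def L_def[symmetric] del: of_nat_Suc)
    next
      case (Suc m)
      show ?thesis
      proof (cases "m = l")
        case True
        have "L * harm (Suc l) = L * harm l + 1"
          using L by (simp add: harm_Suc L_def distrib_left del: of_nat_Suc)
        thus ?thesis using Suc True by (simp add: expint_coeff_def L_def[symmetric] algebra_simps del: of_nat_Suc)
      next
        case False
        hence nz: "of_nat m - of_nat l \<noteq> (0::complex)" by simp
        have "of_nat k - L = of_nat m - of_nat l" using Suc by (simp add: L_def)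
        hence "(- L) * expint_coeff (Suc l) k = L / (of_nat m - of_nat l)"
          using False Suc by (simp add: expint_coeff_def L_def[symmetric] del: of_nat_Suc)
        moreover have "- of_nat k * expint_coeff l (k - 1) = of_nat k / (of_nat m - of_nat l)"
          using False Suc nz by (simp add: expint_coeff_def divide_simps)
        moreover have "of_nat k = of_nat m - of_nat l + L" using Suc by (simp add: L_def)
        ultimately show ?thesis using nz by (simp add: add_divide_distrib)
      qed
    qed
    have "pser (\<lambda>k. - of_nat k * expint_coeff l (k - 1)) u = 1 * pser (\<lambda>_. 1) u + (- L) * pser (expint_coeff (Suc l)) u"
      unfolding c by (rule pser_add) (auto intro: bounded_expint_coeff)
    thus ?thesis by simp
  qed
  also have "of_real u * of_real ((- u) ^ l / fact l * ln u) = - (L * of_real ((- u) ^ Suc l / fact (Suc l) * ln u))"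
    using L by (simp add: L_def del: of_nat_Suc)
  finally have "L * expint (- L) u = L * (pser (expint_coeff (Suc l)) u - of_real ((- u) ^ Suc l / fact (Suc l) * ln u))"
    by (simp only: right_diff_distrib add_uminus_conv_diff)
  thus ?case using L by (simp add: L_def del: of_nat_Suc)
qed

section \<open>Poisson summation\<close>

definition ivec :: "int ^ 'n \<Rightarrow> real ^ 'n" where
  "ivec k = (\<chi> i. of_int (k $ i))"

lemma ivec_nth: "ivec k $ i = of_int (k $ i)"
  by (simp add: ivec_def)

lemma ivec_add: "ivec (k + m) = ivec k + ivec m"
  by (simp add: ivec_def vec_eq_iff)

lemma ivec_uminus: "ivec (- k) = - ivec k"
  by (simp add: ivec_def vec_eq_iff)

lemma ivec_0: "ivec 0 = 0"
  by (simp add: ivec_def vec_eq_iff)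

lemma inj_ivec: "inj ivec"
  by (auto simp: inj_on_def ivec_def vec_eq_iff)

lemma countable_int_vec: "countable (UNIV :: (int ^ 'n) set)"
proof -
  have "countable (PiE (UNIV :: 'n set) (\<lambda>_. UNIV :: int set))"
    by (intro countable_PiE) auto
  hence "countable (vec_lambda ` (PiE (UNIV :: 'n set) (\<lambda>_. UNIV :: int set)))"
    by (rule countable_image)
  moreover have "k \<in> vec_lambda ` (PiE (UNIV :: 'n set) (\<lambda>_. UNIV :: int set))" for k :: "int ^ 'n"
    by (rule image_eqI[of _ _ "\<lambda>j. k $ j"]) (auto simp: vec_eq_iff)
  ultimately show ?thesis by (metis UNIV_eq_I)
qed

lemma summable_int_powr:
  assumes "a > 1"
  shows "(\<lambda>m::int. (1 + \<bar>real_of_int m\<bar>) powr (- a)) summable_on UNIV"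
proof -
  have "summable (\<lambda>n. real n powr (- a))"
    using assms by (simp add: summable_real_powr_iff)
  hence "summable (\<lambda>n. real (Suc n) powr (- a))"
    by (subst summable_Suc_iff)
  hence s: "(\<lambda>n. (1 + real n) powr (- a)) summable_on UNIV"
    by (intro norm_summable_imp_summable_on) (simp add: add_ac)
  have "(\<lambda>m. (1 + \<bar>real_of_int m\<bar>) powr (- a)) summable_on range int"
    using s by (subst summable_on_reindex) (auto simp: o_def)
  moreover have "(\<lambda>m. (1 + \<bar>real_of_int m\<bar>) powr (- a)) summable_on range (\<lambda>n. - int n)"
    using s by (subst summable_on_reindex) (auto simp: o_def inj_on_def)
  ultimately have "(\<lambda>m. (1 + \<bar>real_of_int m\<bar>) powr (- a)) summable_on (range int \<union> range (\<lambda>n. - int n))"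
    by (rule summable_on_union)
  moreover have "range int \<union> range (\<lambda>n. - int n) = UNIV"
  proof -
    have "m \<in> range int \<union> range (\<lambda>n. - int n)" for m
      by (cases m rule: int_cases2) auto
    thus ?thesis by blast
  qed
  ultimately show ?thesis by simp
qed

text \<open>The norm dominates every coordinate, so a summand is at most a product over the
  coordinates of one-dimensional terms with exponent \<open>s / d\<close>, which exceeds 1. Finite
  partial sums are thus bounded by a power of a convergent sum over the integers.\<close>

lemma summable_ivec_powr:
  assumes "s > real CARD('n)"
  shows "(\<lambda>k :: int ^ 'n. (1 + norm (ivec k)) powr (- s)) summable_on UNIV"
proof -
  define d where "d = real CARD('n)"
  have d: "d > 0" by (simp add: d_def)
  define \<phi> where "\<phi> m = (1 + \<bar>real_of_int m\<bar>) powr (- (s / d))" for m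
  have \<phi>: "\<phi> summable_on UNIV"
    unfolding \<phi>_def using assms d by (intro summable_int_powr) (simp add: d_def)
  have \<phi>0: "\<phi> m \<ge> 0" for m by (simp add: \<phi>_def)
  have le: "(1 + norm (ivec k)) powr (- s) \<le> (\<Prod>j\<in>UNIV. \<phi> (k $ j))" for k :: "int ^ 'n"
  proof -
    have "(1 + norm (ivec k)) powr (- s) = ((1 + norm (ivec k)) powr (- (s / d))) ^ CARD('n)"
      using d by (simp add: powr_power d_def add_nonneg_eq_0_iff)
    also have "\<dots> = (\<Prod>j\<in>(UNIV :: 'n set). (1 + norm (ivec k)) powr (- (s / d)))" by simp
    also have "\<dots> \<le> (\<Prod>j\<in>UNIV. \<phi> (k $ j))"
    proof (intro prod_mono conjI)
      fix j :: 'n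
      have "\<bar>real_of_int (k $ j)\<bar> \<le> norm (ivec k)"
        using component_le_norm_cart[of "ivec k" j] by (simp add: ivec_nth)
      thus "(1 + norm (ivec k)) powr (- (s / d)) \<le> \<phi> (k $ j)"
        unfolding \<phi>_def using assms d by (intro powr_mono2') (auto simp: d_def)
    qed auto
    finally show ?thesis .
  qed
  show ?thesis
  proof (rule nonneg_bdd_above_summable_on)
    show "bdd_above (sum (\<lambda>k :: int ^ 'n. (1 + norm (ivec k)) powr (- s)) ` {F. F \<subseteq> UNIV \<and> finite F})"
    proof (rule bdd_aboveI2)
      fix F :: "(int ^ 'n) set" assume "F \<in> {F. F \<subseteq> UNIV \<and> finite F}"
      hence F: "finite F" by simp
      define B where "B j = (\<lambda>k. k $ j) ` F" for j
      have "sum (\<lambda>k. (1 + norm (ivec k)) powr (- s)) F \<le> (\<Sum>k\<in>F. \<Prod>j\<in>UNIV. \<phi> (k $ j))"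
        by (intro sum_mono le)
      also have "\<dots> = (\<Sum>g\<in>vec_nth ` F. \<Prod>j\<in>UNIV. \<phi> (g j))"
        by (subst sum.reindex) (auto intro!: inj_onI simp: vec_eq_iff)
      \<comment> \<open>A finite set of vectors lies in the product of its coordinate projections
        \<open>B j\<close>, over which the sum factorises.\<close>
      also have "\<dots> \<le> (\<Sum>g\<in>PiE UNIV B. \<Prod>j\<in>UNIV. \<phi> (g j))"
        using F by (intro sum_mono2 finite_PiE prod_nonneg \<phi>0) (auto simp: B_def)
      also have "\<dots> = (\<Prod>j\<in>UNIV. \<Sum>m\<in>B j. \<phi> m)"
        using F by (subst prod_sum_PiE) (auto simp: B_def)
      also have "\<dots> \<le> (\<Prod>j\<in>(UNIV :: 'n set). infsum \<phi> UNIV)"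
        using F by (intro prod_mono conjI sum_nonneg \<phi>0 finite_sum_le_infsum[OF \<phi>]) (auto simp: B_def \<phi>0)
      finally show "sum (\<lambda>k. (1 + norm (ivec k)) powr (- s)) F \<le> (\<Prod>j\<in>(UNIV :: 'n set). infsum \<phi> UNIV)" .
    qed
  qed auto
qed

section \<open>Trigonometric polynomials and uniqueness of Fourier coefficients\<close>

definition chr :: "int ^ 'n \<Rightarrow> real ^ 'n \<Rightarrow> complex" where
  "chr k u = cis (2 * pi * (ivec k \<bullet> u))"

lemma norm_chr: "norm (chr k u) = 1"
  by (simp add: chr_def)

lemma chr_mult: "chr k u * chr m u = chr (k + m) u"
  by (simp add: chr_def cis_mult ivec_add inner_add_left distrib_left)

lemma continuous_on_chr: "continuous_on S (chr k)"
  unfolding chr_def by (intro continuous_intros)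

lemma cis_2pi_int: "cis (2 * pi * of_int n) = 1"
  by (rule cis_multiple_2pi) auto

lemma ivec_inner_ivec: "ivec k \<bullet> ivec m = of_int (\<Sum>i\<in>UNIV. k $ i * m $ i)"
  by (simp add: inner_vec_def ivec_nth)

lemma chr_periodic: "chr k (u + ivec m) = chr k u"
proof -
  have "chr k (u + ivec m) = chr k u * cis (2 * pi * of_int (\<Sum>i\<in>UNIV. k $ i * m $ i))"
    by (simp add: chr_def inner_add_right distrib_left cis_mult[symmetric] ivec_inner_ivec del: of_int_sum)
  thus ?thesis by (simp only: cis_2pi_int mult_1_right)
qed

text \<open>Generated inductively so that the vanishing of integrals against characters extends to
  all trigonometric polynomials by rule induction.\<close>

inductive trig :: "(real ^ 'n \<Rightarrow> complex) \<Rightarrow> bool" where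
  chr: "trig (chr k)"
| add: "trig f \<Longrightarrow> trig g \<Longrightarrow> trig (\<lambda>u. f u + g u)"
| scale: "trig f \<Longrightarrow> trig (\<lambda>u. c * f u)"

lemma trig_mult: "trig f \<Longrightarrow> trig g \<Longrightarrow> trig (\<lambda>u. f u * g u)"
proof (induction f rule: trig.induct)
  case (chr k)
  thus ?case
  proof (induction g rule: trig.induct)
    case (chr m)
    show ?case using trig.chr[of "k + m"] by (simp add: chr_mult)
  next
    case (add f g)
    thus ?case using trig.add[of "\<lambda>u. chr k u * f u" "\<lambda>u. chr k u * g u"] by (simp add: distrib_left)
  next
    case (scale f c)
    thus ?case using trig.scale[of "\<lambda>u. chr k u * f u" c] by (simp add: mult_ac)
  qed
next
  case (add f g)
  thus ?case using trig.add[of "\<lambda>u. f u * _ u"] by (simp add: distrib_right)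
next
  case (scale f c)
  thus ?case using trig.scale[of "\<lambda>u. f u * g u" c] by (simp add: mult_ac)
qed

lemma trig_const: "trig (\<lambda>_ :: real ^ 'n. c)"
proof -
  have "chr (0 :: int ^ 'n) u = 1" for u by (simp add: chr_def ivec_0)
  thus ?thesis using trig.scale[OF trig.chr[of "0 :: int ^ 'n"], of c] by simp
qed

lemma trig_sum: "finite I \<Longrightarrow> (\<And>i. i \<in> I \<Longrightarrow> trig (f i)) \<Longrightarrow> trig (\<lambda>u. \<Sum>i\<in>I. f i u)"
  by (induction I rule: finite_induct) (auto intro: trig_const trig.add)

lemma continuous_on_trig: "trig f \<Longrightarrow> continuous_on S f"
  by (induction f rule: trig.induct) (auto intro!: continuous_intros continuous_on_chr)

text \<open>Realises the quotient by integer vectors as a subset of complex space, where real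
  polynomials in the coordinates pull back to trigonometric polynomials.\<close>

definition torus :: "real ^ 'n \<Rightarrow> complex ^ 'n" where
  "torus u = (\<chi> j. cis (2 * pi * u $ j))"

lemma continuous_on_torus: "continuous_on S torus"
  unfolding torus_def by (intro continuous_on_vec_lambda continuous_intros)

lemma torus_eqD:
  assumes "torus u = torus v"
  obtains k where "v = u + ivec k"
proof -
  have "\<exists>n::int. v $ j = u $ j + of_int n" for j
  proof -
    have "cis (2 * pi * v $ j) = cis (2 * pi * u $ j)"
      using assms by (simp add: torus_def vec_eq_iff)
    then obtain n :: int where "\<i> * of_real (2 * pi * v $ j) = \<i> * of_real (2 * pi * u $ j) + of_real (real_of_int (2 * n) * pi) * \<i>"
      unfolding cis_conv_exp exp_eq by blast
    hence "\<i> * of_real (2 * pi * v $ j) = \<i> * of_real (2 * pi * (u $ j + of_int n))"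
      by (simp add: algebra_simps)
    hence "complex_of_real (2 * pi * v $ j) = of_real (2 * pi * (u $ j + of_int n))"
      by (metis complex_i_not_zero mult_left_cancel)
    hence "2 * pi * v $ j = 2 * pi * (u $ j + of_int n)"
      by (simp only: of_real_eq_iff)
    thus ?thesis by auto
  qed
  then obtain n where "\<And>j. v $ j = u $ j + of_int (n j)" by metis
  hence "v = u + ivec (\<chi> j. n j)" by (simp add: vec_eq_iff ivec_nth)
  thus thesis by (rule that)
qed

lemma trig_torus_coord:
  fixes j :: "'n::finite"
  shows "trig (\<lambda>u :: real ^ 'n. of_real (cos (2 * pi * u $ j)))"
    "trig (\<lambda>u :: real ^ 'n. of_real (sin (2 * pi * u $ j)))"
proof -
  have e: "chr (axis j m) u = cis (2 * pi * of_int m * u $ j)" for m and u :: "real ^ 'n"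
  proof -
    have "ivec (axis j m) = axis j (of_int m)" by (simp add: vec_eq_iff ivec_nth axis_def)
    thus ?thesis by (simp add: chr_def inner_axis' mult_ac)
  qed
  have "trig (\<lambda>u. (1/2) * chr (axis j 1) u + (1/2) * chr (axis j (- 1)) u)"
    by (intro trig.intros)
  moreover have "(1/2) * chr (axis j 1) u + (1/2) * chr (axis j (- 1)) u = of_real (cos (2 * pi * u $ j))" for u
    unfolding e by (simp add: complex_eq_iff)
  ultimately show "trig (\<lambda>u :: real ^ 'n. of_real (cos (2 * pi * u $ j)))" by simp
  have "trig (\<lambda>u. (-\<i>/2) * chr (axis j 1) u + (\<i>/2) * chr (axis j (- 1)) u)"
    by (intro trig.intros)
  moreover have "(-\<i>/2) * chr (axis j 1) u + (\<i>/2) * chr (axis j (- 1)) u = of_real (sin (2 * pi * u $ j))" for u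
    unfolding e by (simp add: complex_eq_iff)
  ultimately show "trig (\<lambda>u :: real ^ 'n. of_real (sin (2 * pi * u $ j)))" by simp
qed

lemma trig_real_polynomial:
  "real_polynomial_function p \<Longrightarrow> trig (\<lambda>u. of_real (p (torus u)))"
proof (induction p rule: real_polynomial_function.induct)
  case (linear f)
  have b: "trig (\<lambda>u. of_real (torus u \<bullet> b))" if b: "b \<in> Basis" for b
  proof -
    obtain j c where "b = axis j c" "c \<in> Basis"
      using b unfolding Basis_vec_def by blast
    moreover from this have "c = 1 \<or> c = \<i>" by (auto simp: Basis_complex_def)
    ultimately have "b = axis j c" "c = 1 \<or> c = \<i>" by auto
    thus ?thesis using trig_torus_coord[of j]
      by (auto simp: inner_axis torus_def inner_complex_def)
  qed
  have "f (torus u) = (\<Sum>b\<in>Basis. (torus u \<bullet> b) * f b)" for u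
    using linear linear_sum[OF bounded_linear.linear[OF linear], of "\<lambda>b. (torus u \<bullet> b) *\<^sub>R b" Basis]
    by (simp add: euclidean_representation bounded_linear.linear linear_scale)
  moreover have "trig (\<lambda>u. \<Sum>b\<in>Basis. of_real (f b) * of_real (torus u \<bullet> b))"
    by (intro trig_sum trig.scale b) auto
  ultimately show ?case by (simp add: mult.commute)
next
  case (const c)
  show ?case by (rule trig_const)
next
  case (add f g)
  thus ?case using trig.add by simp
next
  case (mult f g)
  thus ?case using trig_mult by simp
qed

text \<open>Stone--Weierstrass on the image of the torus in \<open>complex ^ 'n\<close> gives density of trigonometric polynomials.\<close>

lemma fourier_unique:
  fixes F :: "real ^ 'n \<Rightarrow> complex"
  assumes cont: "continuous_on UNIV F" and per: "\<And>u k. F (u + ivec k) = F u"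
    and coeff: "\<And>k. integral (cbox 0 1) (\<lambda>u. F u * chr k u) = 0"
  shows "F u = 0"
proof -
  have cont': "continuous_on S F" for S using cont continuous_on_subset by blast
  define T where "T = torus ` cbox 0 (1 :: real ^ 'n)"
  have "compact T" unfolding T_def by (intro compact_continuous_image continuous_on_torus) auto
  \<comment> \<open>\<open>lft\<close> picks an arbitrary preimage; by periodicity the value of
    \<open>F\<close> does not depend on the choice, so the conjugate of \<open>F\<close> descends to
    a function \<open>G\<close> on the image of the torus.\<close>
  define lft where "lft z = (SOME u. torus u = z)" for z :: "complex ^ 'n"
  define G where "G z = cnj (F (lft z))" for z
  have G: "G (torus u) = cnj (F u)" for u
  proof -
    have "torus (lft (torus u)) = torus u" unfolding lft_def by (rule someI) simp
    then obtain k where "u = lft (torus u) + ivec k" by (metis torus_eqD)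
    hence "F u = F (lft (torus u))" using per by metis
    thus ?thesis by (simp add: G_def)
  qed
  have contG: "continuous_on T G"
    unfolding continuous_on_eq_continuous_within
  proof
    fix z0 assume "z0 \<in> T"
    then obtain u0 where u0: "z0 = torus u0" by (auto simp: T_def)
    \<comment> \<open>A local section of \<open>torus\<close> near \<open>z0\<close>: the quotients
      of coordinates are near 1, away from the branch cut of \<open>Arg\<close>, so this lift is
      continuous at \<open>z0\<close> even though \<open>lft\<close> need not be.\<close>
    define \<phi> where "\<phi> z = u0 + (\<chi> j. Arg (z $ j / z0 $ j) / (2 * pi))" for z
    have nz: "z0 $ j \<noteq> 0" for j by (simp add: u0 torus_def)
    have "continuous (at z0 within T) \<phi>"
      unfolding \<phi>_def continuous_within
    proof (intro tendsto_add tendsto_const tendsto_vec_lambda tendsto_divide)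
      fix j
      have "isCont Arg (z0 $ j / z0 $ j)"
        using nz by (intro continuous_at_Arg) auto
      thus "((\<lambda>z. Arg (z $ j / z0 $ j)) \<longlongrightarrow> Arg (z0 $ j / z0 $ j)) (at z0 within T)"
        using nz by (intro isCont_tendsto_compose[of _ Arg] tendsto_intros) auto
    qed auto
    moreover have "isCont F (\<phi> z0)" using cont by (simp add: continuous_on_eq_continuous_at)
    ultimately have "((\<lambda>z. F (\<phi> z)) \<longlongrightarrow> F (\<phi> z0)) (at z0 within T)"
      by (intro isCont_tendsto_compose[of _ F]) (auto simp: continuous_within)
    hence "((\<lambda>z. cnj (F (\<phi> z))) \<longlongrightarrow> cnj (F (\<phi> z0))) (at z0 within T)"
      by (rule tendsto_cnj)
    moreover have "cnj (F (\<phi> z)) = G z" if "z \<in> T" for z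
    proof -
      have n: "norm (z $ j) = 1" for j using that by (auto simp: T_def torus_def)
      have "cis (2 * pi * \<phi> z $ j) = z $ j" for j
      proof -
        have "z $ j \<noteq> 0" using n[of j] by auto
        have "2 * pi * \<phi> z $ j = 2 * pi * u0 $ j + Arg (z $ j / z0 $ j)"
          by (simp add: \<phi>_def distrib_left)
        hence "cis (2 * pi * \<phi> z $ j) = z0 $ j * cis (Arg (z $ j / z0 $ j))"
          by (simp add: cis_mult[symmetric] u0 torus_def)
        also have "cis (Arg (z $ j / z0 $ j)) = sgn (z $ j / z0 $ j)"
          using nz[of j] \<open>z $ j \<noteq> 0\<close> by (intro cis_Arg) auto
        also have "\<dots> = z $ j / z0 $ j"
          using n[of j] by (simp add: sgn_eq norm_divide u0 torus_def)
        finally show ?thesis using nz[of j] by simp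
      qed
      hence "torus (\<phi> z) = z" by (simp add: torus_def vec_eq_iff)
      thus ?thesis using G by metis
    qed
    ultimately show "continuous (at z0 within T) G"
      using \<open>z0 \<in> T\<close> unfolding continuous_within
      by (auto elim!: Lim_transform_eventually simp: eventually_at_filter)
  qed
  have int0: "integral (cbox 0 1) (\<lambda>u. F u * q u) = 0" if "trig q" for q
    using that
  proof (induction q rule: trig.induct)
    case (add f g)
    have "(\<lambda>u. F u * f u) integrable_on cbox 0 1" "(\<lambda>u. F u * g u) integrable_on cbox 0 1"
      by (intro integrable_continuous continuous_intros cont' continuous_on_trig add)+
    thus ?case using add by (simp add: distrib_left integral_add)
  next
    case (scale f c)
    have "integral (cbox 0 1) (\<lambda>u. c * (F u * f u)) = 0" using scale by simp
    thus ?case by (simp add: mult_ac)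
  qed (rule coeff)
  define I where "I = integral (cbox 0 1) (\<lambda>u. F u * cnj (F u))"
  define N where "N = integral (cbox 0 1) (\<lambda>u. norm (F u))"
  have N: "N \<ge> 0" unfolding N_def by (intro integral_nonneg integrable_continuous continuous_intros cont') auto
  \<comment> \<open>\<open>I\<close> is the integral of the squared modulus of \<open>F\<close>.
    Replacing the conjugate of \<open>F\<close> by a trigonometric polynomial \<open>q\<close>
    changes it by at most \<open>e * N\<close>, while the integral of \<open>F * q\<close> is
    zero.\<close>
  have "norm I \<le> e * N" if "e > 0" for e
  proof -
    obtain g where g: "polynomial_function g" "\<And>z. z \<in> T \<Longrightarrow> norm (G z - g z) < e"
      using Stone_Weierstrass_polynomial_function[OF \<open>compact T\<close> contG \<open>e > 0\<close>] by auto
    define q where "q u = g (torus u)" for u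
    have "real_polynomial_function (Re \<circ> g)" "real_polynomial_function (Im \<circ> g)"
      using g(1) bounded_linear_Re bounded_linear_Im unfolding polynomial_function_def by auto
    hence "trig (\<lambda>u. of_real ((Re \<circ> g) (torus u)) + \<i> * of_real ((Im \<circ> g) (torus u)))"
      by (intro trig.add trig.scale trig_real_polynomial)
    hence q: "trig q" by (simp add: q_def[abs_def] complex_eq[symmetric])
    have eq: "I - 0 = integral (cbox 0 1) (\<lambda>u. F u * cnj (F u) - F u * q u)"
      unfolding I_def int0[OF q, symmetric]
      by (intro integral_diff[symmetric] integrable_continuous continuous_intros cont' continuous_on_trig q)
    have "norm (integral (cbox 0 1) (\<lambda>u. F u * cnj (F u) - F u * q u)) \<le> integral (cbox 0 1) (\<lambda>u. e * norm (F u))"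
    proof (rule integral_norm_bound_integral)
      fix u :: "real ^ 'n" assume u: "u \<in> cbox 0 1"
      have "F u * cnj (F u) - F u * q u = F u * (G (torus u) - g (torus u))"
        by (simp add: G q_def right_diff_distrib)
      moreover have "norm (G (torus u) - g (torus u)) \<le> e"
        using g(2)[of "torus u"] u by (auto simp: T_def intro: less_imp_le)
      ultimately show "norm (F u * cnj (F u) - F u * q u) \<le> e * norm (F u)"
        by (simp add: norm_mult mult.commute[of e] mult_left_mono)
    qed (intro integrable_continuous continuous_intros cont' continuous_on_trig q)+
    thus ?thesis using eq by (simp add: N_def)
  qed
  hence "norm I \<le> 0 + e" if "e > 0" for e
  proof -
    have "norm I \<le> (e / (N + 1)) * N" using \<open>\<And>e. e > 0 \<Longrightarrow> norm I \<le> e * N\<close>[of "e / (N + 1)"] that N by simp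
    also have "\<dots> \<le> e" using N that by (simp add: divide_simps)
    finally show ?thesis by simp
  qed
  hence "norm I \<le> 0" by (rule field_le_epsilon)
  hence "I = 0" by simp
  have "I = of_real (integral (cbox 0 1) (\<lambda>u. (norm (F u))\<^sup>2))"
    unfolding I_def complex_norm_square[symmetric] of_real_power[symmetric]
  proof -
    have "(\<lambda>u. (norm (F u))\<^sup>2) integrable_on cbox 0 1"
      by (intro integrable_continuous continuous_intros cont')
    from integral_linear[OF this bounded_linear_of_real[where 'a = complex]]
    show "integral (cbox 0 1) (\<lambda>u. complex_of_real ((norm (F u))\<^sup>2)) = of_real (integral (cbox 0 1) (\<lambda>u. (norm (F u))\<^sup>2))"
      by (simp only: o_def)
  qed
  with \<open>I = 0\<close> have I0: "integral (cbox 0 1) (\<lambda>u. (norm (F u))\<^sup>2) = 0" by simp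
  have zero: "F u = 0" if "u \<in> cbox 0 1" for u
  proof -
    have "(\<forall>u\<in>cbox 0 1. (norm (F u))\<^sup>2 = 0)"
      using I0 by (subst (asm) integral_cbox_eq_0_iff)
        (auto intro!: continuous_intros cont' simp: interval_ne_empty_cart)
    thus ?thesis using that by auto
  qed
  define k where "k = (\<chi> j. \<lfloor>u $ j\<rfloor>)"
  have "F (u + ivec (- k)) = 0"
  proof (rule zero)
    show "u + ivec (- k) \<in> cbox 0 1"
      unfolding mem_box_cart by (auto simp: ivec_nth k_def) linarith+
  qed
  thus ?thesis by (simp only: per)
qed

section \<open>Linear changes of variables and product integrals\<close>

lemma det_matrix_shear:
  assumes "m \<noteq> n"
  shows "det (matrix (\<lambda>v :: real ^ 'n. \<chi> i. if i = m then v $ m + v $ n else v $ i)) = 1"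
proof -
  have "matrix (\<lambda>v :: real ^ 'n. \<chi> i. if i = m then v $ m + v $ n else v $ i)
      = (\<chi> k. if k = m then row m (mat 1) + 1 *s row n (mat 1) else row k (mat 1))"
    by (auto simp: matrix_def vec_eq_iff row_def mat_def axis_def)
  thus ?thesis using det_row_operation[OF assms, of "mat 1 :: real ^ 'n ^ 'n" 1] by simp
qed

lemma measure_shear_cbox:
  assumes "m \<noteq> n"
  shows "measure lebesgue ((\<lambda>v :: real ^ 'n. \<chi> i. if i = m then v $ m + v $ n else v $ i) ` cbox a b) =
         measure lebesgue (cbox a b)"
proof (cases "cbox a b = {}")
  case False
  define h where "h = (\<lambda>v :: real ^ 'n. \<chi> i. if i = m then v $ m + v $ n else v $ i)"
  \<comment> \<open>Translating by \<open>- e\<close> makes the \<open>n\<close>-th lower bound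
    zero, the normalisation under which \<open>measure_shear_interval\<close> applies; additivity of
    the shear turns this into a translation of the image.\<close>
  define e where "e = (a $ n) *\<^sub>R (axis n 1 :: real ^ 'n)"
  have add: "h (v + w) = h v + h w" for v w
    by (simp add: h_def vec_eq_iff)
  have "h ` cbox a b = (+) (h e) ` (h ` ((+) (- e) ` cbox a b))"
    unfolding image_comp by (rule image_cong) (simp_all flip: add)
  also have "measure lebesgue \<dots> = measure lebesgue (h ` ((+) (- e) ` cbox a b))"
    by (rule measure_translation)
  also have "(+) (- e) ` cbox a b = cbox (- e + a) (- e + b)"
    by (rule cbox_translation[symmetric])
  also have "measure lebesgue (h ` cbox (- e + a) (- e + b)) = measure lebesgue (cbox (- e + a) (- e + b))"
    unfolding h_def
  proof (rule measure_shear_interval[OF assms])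
    show "cbox (- e + a) (- e + b) \<noteq> {}" using False unfolding cbox_translation by simp
    show "0 \<le> (- e + a) $ n" by (simp add: e_def)
  qed
  also have "\<dots> = measure lebesgue (cbox a b)"
    unfolding cbox_translation by (rule measure_translation)
  finally show ?thesis unfolding h_def .
qed auto

text \<open>The library proves \<open>measure_linear_image\<close> only for index types of class \<open>wellorder\<close>.\<close>

lemma measure_linear_image_finite:
  fixes f :: "real ^ 'n \<Rightarrow> real ^ 'n"
  assumes "linear f" "S \<in> lmeasurable"
  shows "f ` S \<in> lmeasurable \<and> measure lebesgue (f ` S) = \<bar>det (matrix f)\<bar> * measure lebesgue S"
proof -
  define P where "P f \<longleftrightarrow> (\<forall>S \<in> lmeasurable. f ` S \<in> lmeasurable \<and>
      measure lebesgue (f ` S) = \<bar>det (matrix f)\<bar> * measure lebesgue S)" for f :: "real ^ 'n \<Rightarrow> real ^ 'n"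
  have suff: "P f" if "linear f" "\<And>a b. measure lebesgue (f ` cbox a b) = \<bar>det (matrix f)\<bar> * measure lebesgue (cbox a b)" for f
    unfolding P_def using measure_linear_sufficient[OF that(1) _ that(2)] by auto
  have "P f"
  proof (rule induct_linear_elementary[OF assms(1)])
    fix f g :: "real ^ 'n \<Rightarrow> real ^ 'n"
    assume *: "linear f" "linear g" "P f" "P g"
    have "matrix (f \<circ> g) = matrix f ** matrix g" by (rule matrix_compose) fact+
    thus "P (f \<circ> g)"
      using * unfolding P_def image_comp[symmetric] by (simp add: det_mul abs_mult)
  next
    fix f :: "real ^ 'n \<Rightarrow> real ^ 'n" and i
    assume lin: "linear f" and 0: "\<And>x. f x $ i = 0"
    have "\<not> surj f"
    proof
      assume "surj f"
      then obtain x where "axis i 1 = f x" by (metis surjE)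
      thus False using 0[of x] by (metis axis_nth zero_neq_one)
    qed
    hence "\<not> inj f" using lin linear_injective_imp_surjective by blast
    hence "negligible (f ` S)" for S
      using negligible_linear_singular_image[OF lin] by blast
    moreover have "det (matrix f) = 0"
      using \<open>\<not> inj f\<close> det_nz_iff_inj[OF lin] by blast
    ultimately show "P f"
      by (simp add: P_def negligible_iff_measure)
  next
    fix c :: "'n \<Rightarrow> real"
    have "matrix (\<lambda>x :: real ^ 'n. \<chi> i. c i * x $ i) $ i $ j = 0" if "i \<noteq> j" for i j
      using that by (simp add: matrix_def axis_def)
    hence "det (matrix (\<lambda>x :: real ^ 'n. \<chi> i. c i * x $ i)) = (\<Prod>i\<in>UNIV. c i)"
      by (subst det_diagonal) (auto simp: matrix_def axis_def)
    thus "P (\<lambda>x. \<chi> i. c i * x $ i)"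
      by (simp add: P_def measurable_stretch measure_stretch)
  next
    fix m n :: 'n assume "m \<noteq> n"
    show "P (\<lambda>x. \<chi> i. if i = m then x $ m + x $ n else x $ i)"
    proof (rule suff)
      show "linear (\<lambda>x :: real ^ 'n. \<chi> i. if i = m then x $ m + x $ n else x $ i)"
        by (rule linearI) (auto simp: vec_eq_iff algebra_simps)
    qed (simp add: det_matrix_shear[OF \<open>m \<noteq> n\<close>] measure_shear_cbox[OF \<open>m \<noteq> n\<close>])
    \<comment> \<open>Coordinate swaps: the involution \<open>h\<close> maps boxes to boxes with
      permuted side lengths, and a row permutation of the identity matrix has determinant of modulus
      1.\<close>
    define \<tau> where "\<tau> = Transposition.transpose m n"
    have \<tau>: "\<tau> permutes UNIV" unfolding \<tau>_def by (rule permutes_swap_id) auto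
    have \<tau>\<tau>: "\<tau> (\<tau> i) = i" for i by (simp add: \<tau>_def)
    define h where "h v = (\<chi> i. v $ \<tau> i)" for v :: "real ^ 'n"
    have "P h"
    proof (rule suff)
      show "linear h" unfolding h_def by (rule linearI) (auto simp: vec_eq_iff)
      have "matrix h = (\<chi> i. (mat 1 :: real ^ 'n ^ 'n) $ \<tau> i)"
        by (auto simp: matrix_def h_def vec_eq_iff mat_def axis_def)
      hence det: "\<bar>det (matrix h)\<bar> = 1"
        using det_permute_rows[OF \<tau>, of "mat 1 :: real ^ 'n ^ 'n"] by (simp add: sign_def)
      have im: "h ` cbox a b = cbox (h a) (h b)" for a b
      proof (intro equalityI subsetI)
        fix v assume "v \<in> cbox (h a) (h b)"
        hence "h v \<in> cbox a b" by (auto simp: mem_box_cart h_def) (metis \<tau>\<tau>)+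
        moreover have "v = h (h v)" by (simp add: h_def vec_eq_iff \<tau>\<tau>)
        ultimately show "v \<in> h ` cbox a b" by blast
      qed (auto simp: mem_box_cart h_def)
      have "measure lebesgue (cbox (h a) (h b)) = measure lebesgue (cbox a b)" for a b
      proof (cases "cbox a b = {}")
        case True
        thus ?thesis by (metis im image_empty)
      next
        case False
        hence "cbox (h a) (h b) \<noteq> {}" by (metis im image_is_empty)
        thus ?thesis
          using False prod.permute[OF \<tau>, of "\<lambda>i. b $ i - a $ i"]
          by (simp add: content_cbox_cart h_def o_def)
      qed
      thus "measure lebesgue (h ` cbox a b) = \<bar>det (matrix h)\<bar> * measure lebesgue (cbox a b)" for a b
        by (simp add: det im)
    qed
    thus "P (\<lambda>x. \<chi> i. x $ Transposition.transpose m n i)"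
      by (simp add: h_def[abs_def] \<tau>_def)
  qed
  thus ?thesis using assms(2) by (simp add: P_def)
qed

lemma matrix_inv_invertible:
  assumes "invertible A"
  shows "A ** matrix_inv A = mat 1" "matrix_inv A ** A = mat 1"
  using assms someI_ex[of "\<lambda>B. A ** B = mat 1 \<and> B ** A = mat 1"]
  by (auto simp: invertible_def matrix_inv_def)

text \<open>Both measures are compared on boxes, where the preimage under \<open>A\<close> is the
  image under the inverse matrix and \<open>measure_linear_image_finite\<close> gives its volume.
  Stated for measures, it delivers integrability and the value of integrals at once.\<close>

lemma lborel_matrix_image:
  fixes A :: "real ^ 'n ^ 'n"
  assumes A: "invertible A"
  shows "lborel = density (distr lborel borel ((*v) A)) (\<lambda>_. ennreal \<bar>det A\<bar>)"
proof (rule lborel_eqI)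
  fix l u :: "real ^ 'n" assume le: "\<And>b. b \<in> Basis \<Longrightarrow> l \<bullet> b \<le> u \<bullet> b"
  have meas [measurable]: "(*v) A \<in> borel_measurable borel"
    by (intro borel_measurable_continuous_onI linear_continuous_on) (simp add: matrix_vector_mul_bounded_linear)
  have inv1: "matrix_inv A ** A = mat 1" and inv2: "A ** matrix_inv A = mat 1"
    using A by (auto simp: matrix_inv_invertible)
  have "(*v) A -` box l u = (*v) (matrix_inv A) ` box l u"
  proof (intro equalityI subsetI)
    fix v assume "v \<in> (*v) A -` box l u"
    thus "v \<in> (*v) (matrix_inv A) ` box l u"
      by (intro image_eqI[of _ _ "A *v v"]) (auto simp: matrix_vector_mul_assoc inv1)
  qed (auto simp: matrix_vector_mul_assoc inv2)
  hence "emeasure lborel ((*v) A -` box l u) = emeasure lebesgue ((*v) (matrix_inv A) ` box l u)"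
  proof -
    have "(*v) A -` box l u \<in> sets lborel"
      using measurable_sets[OF meas, of "box l u"] by simp
    thus ?thesis unfolding \<open>(*v) A -` box l u = _\<close>[symmetric] by simp
  qed
  also have "\<dots> = ennreal (\<bar>det (matrix_inv A)\<bar> * measure lebesgue (box l u))"
    using measure_linear_image_finite[of "(*v) (matrix_inv A)" "box l u"]
    by (simp add: emeasure_eq_measure2 fmeasurableD2)
  finally have em: "emeasure lborel ((*v) A -` box l u) = ennreal (\<bar>det (matrix_inv A)\<bar> * measure lebesgue (box l u))" .
  have "det A * det (matrix_inv A) = 1"
    by (metis det_I det_mul inv2)
  hence "\<bar>det A\<bar> * (\<bar>det (matrix_inv A)\<bar> * measure lebesgue (box l u)) = measure lebesgue (box l u)"
    by (metis abs_mult abs_one mult.assoc mult_1)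
  moreover have "emeasure (density (distr lborel borel ((*v) A)) (\<lambda>_. ennreal \<bar>det A\<bar>)) (box l u)
      = ennreal \<bar>det A\<bar> * emeasure lborel ((*v) A -` box l u)"
    by (simp add: emeasure_density nn_integral_cmult_indicator emeasure_distr)
  ultimately have "emeasure (density (distr lborel borel ((*v) A)) (\<lambda>_. ennreal \<bar>det A\<bar>)) (box l u) = ennreal (measure lebesgue (box l u))"
    unfolding em by (simp add: ennreal_mult'[symmetric])
  also have "ennreal (measure lebesgue (box l u)) = emeasure lborel (box l u)"
    by (simp add: emeasure_eq_measure2 measure_completion)
  also have "\<dots> = (\<Prod>b\<in>Basis. (u - l) \<bullet> b)"
    using le by (rule emeasure_lborel_box)
  finally show "emeasure (density (distr lborel borel ((*v) A)) (\<lambda>_. ennreal \<bar>det A\<bar>)) (box l u) = (\<Prod>b\<in>Basis. (u - l) \<bullet> b)" .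
qed simp

lemma integral_matrix_image:
  fixes A :: "real ^ 'n ^ 'n" and f :: "real ^ 'n \<Rightarrow> complex"
  assumes A: "invertible A" and f: "integrable lborel f"
  shows "integrable lborel (\<lambda>v. f (A *v v))"
    "(\<integral>v. f (A *v v) \<partial>lborel) = (\<integral>v. f v \<partial>lborel) / of_real \<bar>det A\<bar>"
proof -
  have [measurable]: "(*v) A \<in> borel_measurable borel"
    by (intro borel_measurable_continuous_onI linear_continuous_on) (simp add: matrix_vector_mul_bounded_linear)
  have [measurable]: "f \<in> borel_measurable borel" using f by auto
  have d: "\<bar>det A\<bar> > 0" using A invertible_det_nz by auto
  have "integrable (density (distr lborel borel ((*v) A)) (\<lambda>_. ennreal \<bar>det A\<bar>)) f"
    using f lborel_matrix_image[OF A] by metis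
  hence "integrable (distr lborel borel ((*v) A)) (\<lambda>v. \<bar>det A\<bar> *\<^sub>R f v)"
    by (subst (asm) integrable_density) auto
  hence "integrable (distr lborel borel ((*v) A)) f"
    using d integrable_scaleR_right[of "1 / \<bar>det A\<bar>" "distr lborel borel ((*v) A)" "\<lambda>v. \<bar>det A\<bar> *\<^sub>R f v"]
    by simp
  thus "integrable lborel (\<lambda>v. f (A *v v))"
    by (subst (asm) integrable_distr_eq) auto
  have "(\<integral>v. f v \<partial>lborel) = (\<integral>v. f v \<partial>(density (distr lborel borel ((*v) A)) (\<lambda>_. ennreal \<bar>det A\<bar>)))"
    using lborel_matrix_image[OF A] by metis
  also have "\<dots> = (\<integral>v. \<bar>det A\<bar> *\<^sub>R f v \<partial>(distr lborel borel ((*v) A)))"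
    by (rule integral_density) auto
  also have "\<dots> = (\<integral>v. \<bar>det A\<bar> *\<^sub>R f (A *v v) \<partial>lborel)"
    by (rule integral_distr) auto
  also have "\<dots> = of_real \<bar>det A\<bar> * (\<integral>v. f (A *v v) \<partial>lborel)"
    by (simp add: scaleR_conv_of_real)
  finally show "(\<integral>v. f (A *v v) \<partial>lborel) = (\<integral>v. f v \<partial>lborel) / of_real \<bar>det A\<bar>"
    using d by (simp add: field_simps)
qed

text \<open>Lebesgue measure on \<open>real ^ 'n\<close> is the image of a product measure indexed
  by \<open>Basis\<close>; \<open>ix\<close> recovers the coordinate from a basis vector, and Fubini
  for finite products applies.\<close>

lemma integral_prod_vec:
  fixes f :: "'n::finite \<Rightarrow> real \<Rightarrow> complex"
  assumes f: "\<And>i. integrable lborel (f i)"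
  shows "integrable lborel (\<lambda>w :: real ^ 'n. \<Prod>i\<in>UNIV. f i (w $ i))"
    "(\<integral>w. (\<Prod>i\<in>UNIV. f i ((w :: real ^ 'n) $ i)) \<partial>lborel) = (\<Prod>i\<in>UNIV. \<integral>t. f i t \<partial>lborel)"
proof -
  have [measurable]: "f i \<in> borel_measurable borel" for i using f by auto
  define B where "B = (Basis :: (real ^ 'n) set)"
  define ix where "ix b = (THE i :: 'n. b = axis i (1::real))" for b
  have ix: "ix (axis i 1) = i" for i by (auto simp: ix_def axis_eq_axis)
  have B: "B = range (\<lambda>i. axis i 1)" by (auto simp: B_def Basis_vec_def)
  have inj: "inj (\<lambda>i :: 'n. axis i (1::real))" by (auto simp: inj_on_def axis_eq_axis)
  have finB: "finite B" by (simp add: B_def)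
  interpret product_sigma_finite "\<lambda>_ :: real ^ 'n. lborel :: real measure" ..
  have prodB: "(\<Prod>b\<in>B. F b) = (\<Prod>i\<in>UNIV. F (axis i 1))" for F :: "real ^ 'n \<Rightarrow> complex"
    unfolding B by (subst prod.reindex[OF inj]) simp
  define \<Sigma> where "\<Sigma> g = (\<Sum>b\<in>B. g b *\<^sub>R b)" for g :: "real ^ 'n \<Rightarrow> real"
  have \<Sigma>: "\<Sigma> g $ i = g (axis i 1)" for g i
  proof -
    have "\<Sigma> g = (\<Sum>i\<in>UNIV. g (axis i 1) *\<^sub>R axis i 1)"
      unfolding \<Sigma>_def B by (subst sum.reindex[OF inj]) simp
    thus ?thesis by (simp add: axis_def if_distrib[of "\<lambda>x. _ * x"] sum.delta cong: if_cong)
  qed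
  have lb: "lborel = distr (\<Pi>\<^sub>M b\<in>B. lborel) borel \<Sigma>"
    unfolding \<Sigma>_def B_def by (rule lborel_eq)
  have [measurable]: "\<Sigma> \<in> measurable (\<Pi>\<^sub>M b\<in>B. lborel) borel"
    unfolding \<Sigma>_def B_def by measurable
  have "integrable (\<Pi>\<^sub>M b\<in>B. lborel) (\<lambda>g. \<Prod>b\<in>B. f (ix b) (g b))"
    by (intro product_integrable_prod finB f)
  hence 1: "integrable (\<Pi>\<^sub>M b\<in>B. lborel) (\<lambda>g. \<Prod>i\<in>UNIV. f i (\<Sigma> g $ i))"
    by (simp add: prodB ix \<Sigma>)
  have m [measurable]: "(\<lambda>w :: real ^ 'n. \<Prod>i\<in>UNIV. f i (w $ i)) \<in> borel_measurable borel"
    by measurable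
  show "integrable lborel (\<lambda>w :: real ^ 'n. \<Prod>i\<in>UNIV. f i (w $ i))"
    unfolding lb using 1 by (subst integrable_distr_eq) auto
  have "(\<integral>w. (\<Prod>i\<in>UNIV. f i ((w :: real ^ 'n) $ i)) \<partial>lborel) = (\<integral>g. (\<Prod>b\<in>B. f (ix b) (g b)) \<partial>(\<Pi>\<^sub>M b\<in>B. lborel))"
    unfolding lb by (subst integral_distr) (auto simp: prodB ix \<Sigma>)
  also have "\<dots> = (\<Prod>b\<in>B. \<integral>t. f (ix b) t \<partial>lborel)"
    by (intro product_integral_prod finB f)
  finally show "(\<integral>w. (\<Prod>i\<in>UNIV. f i ((w :: real ^ 'n) $ i)) \<partial>lborel) = (\<Prod>i\<in>UNIV. \<integral>t. f i t \<partial>lborel)"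
    by (simp add: prodB ix)
qed

section \<open>Periodization and the summation formula\<close>

lemma continuous_on_infsum:
  fixes f :: "'i \<Rightarrow> 'a::topological_space \<Rightarrow> 'b::banach"
  assumes "\<And>i. i \<in> I \<Longrightarrow> continuous_on S (f i)"
    and "\<And>i x. i \<in> I \<Longrightarrow> x \<in> S \<Longrightarrow> norm (f i x) \<le> M i" and "M summable_on I"
  shows "continuous_on S (\<lambda>x. \<Sum>\<^sub>\<infinity>i\<in>I. f i x)"
proof (rule uniform_limit_theorem)
  show "uniform_limit S (\<lambda>X x. \<Sum>i\<in>X. f i x) (\<lambda>x. \<Sum>\<^sub>\<infinity>i\<in>I. f i x) (finite_subsets_at_top I)"
    by (rule Weierstrass_m_test_general) (use assms in auto)
  show "\<forall>\<^sub>F X in finite_subsets_at_top I. continuous_on S (\<lambda>x. \<Sum>i\<in>X. f i x)"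
    by (rule eventually_finite_subsets_at_top_weakI) (use assms in \<open>auto intro!: continuous_on_sum\<close>)
qed auto

lemma integral_translation_lborel:
  fixes f :: "'a::euclidean_space \<Rightarrow> complex"
  assumes [measurable]: "f \<in> borel_measurable borel"
  shows "(\<integral>u. f (c + u) \<partial>lborel) = (\<integral>u. f u \<partial>lborel)"
  by (subst lborel_distr_plus[symmetric, of c]) (subst integral_distr; simp)

text \<open>Half-open, so that the integer translates partition the space: \<open>u\<close> lies in
  exactly the translate given by its componentwise floor.\<close>

definition half_cube :: "(real ^ 'n) set" where
  "half_cube = {u. \<forall>j. 0 \<le> u $ j \<and> u $ j < 1}"

lemma half_cube_borel: "half_cube \<in> sets borel"
  unfolding half_cube_def by measurable

lemma integral_half_cube:
  fixes g :: "real ^ 'n \<Rightarrow> complex"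
  shows "integral half_cube g = integral (cbox 0 1) g"
proof (rule integral_spike_set)
  have "box 0 1 \<subseteq> (half_cube :: (real ^ 'n) set)" "half_cube \<subseteq> cbox 0 (1 :: real ^ 'n)"
    by (auto simp: half_cube_def mem_box_cart less_imp_le)
  thus "negligible {x \<in> half_cube - cbox 0 1. g x \<noteq> 0}"
    "negligible {x \<in> cbox 0 1 - half_cube. g x \<noteq> 0}"
    using negligible_frontier_interval[of 0 "1 :: real ^ 'n"]
    by (auto intro: negligible_subset[of "{}"] negligible_subset[of "cbox 0 1 - box 0 1"])
qed

text \<open>At each point exactly one piece of \<open>h\<close>, cut off to an integer translate of
  the half-open cube, is the value of \<open>h\<close> and all others vanish. Hence finite sums of
  the integrals of the norms stay below the integral of the norm of \<open>h\<close>, which is the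
  summability needed for exchanging sum and integral.\<close>

lemma integral_tiling:
  fixes h :: "real ^ 'n \<Rightarrow> complex"
  assumes h: "integrable lborel h"
  shows "((\<lambda>k. integral (cbox 0 1) (\<lambda>u. h (u + ivec k))) has_sum integral UNIV h) UNIV"
proof -
  have [measurable]: "h \<in> borel_measurable borel" using h by auto
  note half_cube_borel [measurable]
  define f where "f k u = indicat_real half_cube (u - ivec k) *\<^sub>R h u" for k u
  have fm [measurable]: "f k \<in> borel_measurable borel" for k unfolding f_def by measurable
  have fint: "integrable lborel (f k)" for k
    by (rule Bochner_Integration.integrable_bound[OF h]) (auto simp: f_def indicator_def)
  have ai: "g absolutely_integrable_on UNIV" if "integrable lborel g" for g :: "real ^ 'n \<Rightarrow> complex"
    using that by (simp add: set_integrable_def integrable_completion)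
  have f1: "f k u = (if k = (\<chi> j. \<lfloor>u $ j\<rfloor>) then h u else 0)" for k u
  proof -
    have "u - ivec k \<in> half_cube \<longleftrightarrow> (\<forall>j. k $ j = \<lfloor>u $ j\<rfloor>)"
      unfolding half_cube_def by (auto simp: ivec_nth floor_eq_iff eq_commute[of _ "floor _"] algebra_simps)
    thus ?thesis by (simp add: f_def vec_eq_iff)
  qed
  have pw: "((\<lambda>k. f k u) has_sum h u) UNIV" for u
    by (rule has_sum_finite_neutralI[of "{\<chi> j. \<lfloor>u $ j\<rfloor>}"]) (auto simp: f1)
  have int: "integral UNIV (f k) = integral (cbox 0 1) (\<lambda>u. h (u + ivec k))" for k
  proof -
    define g where "g u = indicat_real half_cube u *\<^sub>R h (u + ivec k)" for u
    have "integral UNIV (f k) = (\<integral>u. f k u \<partial>lborel)"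
      by (rule integral_lborel[OF fint])
    also have "\<dots> = (\<integral>u. f k (ivec k + u) \<partial>lborel)"
      by (rule integral_translation_lborel[symmetric]) simp
    also have "\<dots> = (\<integral>u. g u \<partial>lborel)"
      by (simp add: f_def g_def add.commute)
    also have "\<dots> = integral half_cube (\<lambda>u. h (u + ivec k))"
    proof -
      have "integrable (distr lborel borel ((+) (ivec k))) (f k)"
        using fint by (simp add: lborel_distr_plus)
      hence "integrable lborel (\<lambda>u. f k (ivec k + u))"
        by (subst (asm) integrable_distr_eq) auto
      hence "set_integrable lborel half_cube (\<lambda>u. h (u + ivec k))"
        by (simp add: set_integrable_def f_def add.commute)
      from set_borel_integral_eq_integral(2)[OF this] show ?thesis
        by (simp add: set_lebesgue_integral_def g_def)
    qed
    finally show ?thesis by (simp add: integral_half_cube)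
  qed
  have "(\<lambda>k. integral UNIV (\<lambda>u. norm (f k u))) summable_on UNIV"
  proof (rule nonneg_bdd_above_summable_on)
    show "0 \<le> integral UNIV (\<lambda>u. norm (f k u))" for k
      by (intro integral_nonneg) (use ai[OF fint] in \<open>auto simp: absolutely_integrable_on_def\<close>)
    show "bdd_above (sum (\<lambda>k. integral UNIV (\<lambda>u. norm (f k u))) ` {F. F \<subseteq> UNIV \<and> finite F})"
    proof (rule bdd_aboveI2)
      fix F :: "(int ^ 'n) set" assume "F \<in> {F. F \<subseteq> UNIV \<and> finite F}"
      hence F: "finite F" by simp
      have "(\<Sum>k\<in>F. integral UNIV (\<lambda>u. norm (f k u))) = integral UNIV (\<lambda>u. \<Sum>k\<in>F. norm (f k u))"
        using ai[OF fint] by (intro integral_sum[symmetric] F) (auto simp: absolutely_integrable_on_def)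
      also have "\<dots> \<le> integral UNIV (\<lambda>u. norm (h u))"
      proof (rule integral_le)
        show "(\<lambda>u. \<Sum>k\<in>F. norm (f k u)) integrable_on UNIV"
          using ai[OF fint] by (intro integrable_sum F) (auto simp: absolutely_integrable_on_def)
        show "(\<lambda>u. norm (h u)) integrable_on UNIV"
          using ai[OF h] by (auto simp: absolutely_integrable_on_def)
        fix u
        have "(\<Sum>k\<in>F. norm (f k u)) = (\<Sum>k\<in>F. if k = (\<chi> j. \<lfloor>u $ j\<rfloor>) then norm (h u) else 0)"
          by (intro sum.cong) (auto simp: f1)
        also have "\<dots> \<le> norm (h u)" using F by (simp add: sum.delta)
        finally show "(\<Sum>k\<in>F. norm (f k u)) \<le> norm (h u)" .
      qed
      finally show "(\<Sum>k\<in>F. integral UNIV (\<lambda>u. norm (f k u))) \<le> integral UNIV (\<lambda>u. norm (h u))" .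
    qed
  qed
  from has_sum_integral_swap(2)[OF countable_int_vec ai[OF fint] this]
  have "((\<lambda>k. integral UNIV (f k)) has_sum integral UNIV (\<lambda>u. \<Sum>\<^sub>\<infinity>k. f k u)) UNIV"
    using pw by (auto simp: summable_on_def)
  thus ?thesis by (simp add: int infsumI[OF pw])
qed

lemma integral_cis_unit: "n \<noteq> 0 \<Longrightarrow> integral {0..1} (\<lambda>t. cis (2 * pi * of_int n * t)) = 0"
proof -
  assume n: "n \<noteq> 0"
  define c where "c = 2 * of_real pi * of_int n * \<i>"
  have c: "c \<noteq> 0" using n by (simp add: c_def)
  have cis: "cis (2 * pi * of_int n * t) = exp (c * of_real t)" for t
    by (simp add: cis_conv_exp c_def mult_ac)
  have "((\<lambda>t. exp (c * of_real t)) has_integral exp (c * of_real 1) / c - exp (c * of_real 0) / c) {0..1}"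
  proof (rule fundamental_theorem_of_calculus)
    fix t :: real
    have "((\<lambda>z. exp (c * z) / c) has_field_derivative exp (c * of_real t)) (at (of_real t))"
      using c by (auto intro!: derivative_eq_intros)
    thus "((\<lambda>t. exp (c * of_real t) / c) has_vector_derivative exp (c * of_real t)) (at t within {0..1})"
      by (rule has_vector_derivative_real_field)
  qed auto
  moreover have "exp (c * of_real 1) = 1"
    using cis[of 1] cis_2pi_int[of n] by simp
  ultimately show ?thesis
    unfolding cis by (simp add: integral_unique)
qed

text \<open>The character is a product of one-dimensional exponentials, so a nonzero coordinate of
  \<open>k\<close> makes one factor of the integral zero.\<close>

lemma integral_chr:
  "integral (cbox 0 1) (chr (k :: int ^ 'n)) = (if k = 0 then 1 else 0)"
proof (cases "k = 0")
  case True
  have "chr (0 :: int ^ 'n) = (\<lambda>_. 1)" by (simp add: chr_def ivec_0 fun_eq_iff)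
  moreover have "measure lborel (cbox 0 (1 :: real ^ 'n)) = 1"
    by (subst content_cbox_cart) (auto simp: interval_ne_empty_cart)
  ultimately show ?thesis using True by simp
next
  case False
  then obtain j where j: "k $ j \<noteq> 0" by (auto simp: vec_eq_iff)
  define f where "f i t = indicat_real {0..1} t *\<^sub>R cis (2 * pi * of_int (k $ i) * t)" for i t
  have f: "integrable lborel (f i)" "(\<integral>t. f i t \<partial>lborel) = integral {0..1} (\<lambda>t. cis (2 * pi * of_int (k $ i) * t))" for i
  proof -
    have *: "set_integrable lborel {0..1} (\<lambda>t. cis (2 * pi * of_int (k $ i) * t))"
      by (rule borel_integrable_atLeastAtMost') (intro continuous_intros)
    thus "integrable lborel (f i)" by (simp add: set_integrable_def f_def[abs_def])
    show "(\<integral>t. f i t \<partial>lborel) = integral {0..1} (\<lambda>t. cis (2 * pi * of_int (k $ i) * t))"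
      using set_borel_integral_eq_integral(2)[OF *] by (simp add: set_lebesgue_integral_def f_def)
  qed
  have cisprod: "cis (\<Sum>i\<in>I. g i) = (\<Prod>i\<in>I. cis (g i))" if "finite I" for g and I :: "'n set"
    using that by (induction I rule: finite_induct) (auto simp: cis_mult[symmetric])
  have eq: "indicat_real (cbox 0 1) u *\<^sub>R chr k u = (\<Prod>i\<in>UNIV. f i (u $ i))" for u
  proof (cases "u \<in> cbox 0 1")
    case True
    hence "f i (u $ i) = cis (2 * pi * (of_int (k $ i) * u $ i))" for i
      by (simp add: f_def mem_box_cart mult_ac)
    thus ?thesis using True
      by (simp add: chr_def inner_vec_def ivec_nth cisprod[symmetric] sum_distrib_left)
  next
    case False
    then obtain i where "\<not> (0 \<le> u $ i \<and> u $ i \<le> 1)" by (auto simp: mem_box_cart)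
    hence "f i (u $ i) = 0" by (simp add: f_def)
    hence "(\<Prod>i\<in>UNIV. f i (u $ i)) = 0" by (intro prod_zero) auto
    thus ?thesis using False by simp
  qed
  have "integrable lborel (\<lambda>u. indicat_real (cbox 0 1) u *\<^sub>R chr k u)"
    unfolding eq by (rule integral_prod_vec(1)[OF f(1)])
  hence "set_integrable lborel (cbox 0 1) (chr k)" by (simp add: set_integrable_def)
  from set_borel_integral_eq_integral(2)[OF this]
  have "integral (cbox 0 1) (chr k) = (\<integral>u. (\<Prod>i\<in>UNIV. f i (u $ i)) \<partial>lborel)"
    by (simp add: set_lebesgue_integral_def eq)
  also have "\<dots> = (\<Prod>i\<in>UNIV. \<integral>t. f i t \<partial>lborel)"
    by (rule integral_prod_vec(2)[OF f(1)])
  also have "\<dots> = 0"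
    using integral_cis_unit[OF j] by (intro prod_zero) (auto simp: f(2))
  finally show ?thesis using False by simp
qed

text \<open>Peetre's inequality \<open>1 + norm w \<le> (1 + B) * (1 + norm (u + w))\<close>. It
  makes the decay of translates uniform for bounded \<open>u\<close>.\<close>

lemma powr_decay_translate:
  fixes u w :: "'a::real_normed_vector"
  assumes "s \<ge> 0" "norm u \<le> B"
  shows "(1 + norm (u + w)) powr (- s) \<le> (1 + B) powr s * (1 + norm w) powr (- s)"
proof -
  have "norm w \<le> norm (u + w) + norm u"
    by (metis add_diff_cancel_left' add.commute norm_triangle_ineq4)
  moreover have B: "B \<ge> 0" using assms(2) norm_ge_zero[of u] by linarith
  hence "0 \<le> B * norm (u + w)" by simp
  ultimately have "1 + norm w \<le> (1 + B) * (1 + norm (u + w))"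
    using assms(2) by (simp add: algebra_simps)
  hence "(1 + norm w) powr s \<le> ((1 + B) * (1 + norm (u + w))) powr s"
    using assms by (intro powr_mono2) auto
  also have "\<dots> = (1 + B) powr s * (1 + norm (u + w)) powr s"
    by (rule powr_mult)
  finally have *: "(1 + norm w) powr s \<le> (1 + B) powr s * (1 + norm (u + w)) powr s" .
  have "(1 + norm v) powr s > 0" for v :: 'a
    using norm_ge_zero[of v] by (simp add: add_nonneg_eq_0_iff)
  hence p: "(1 + norm w) powr s > 0" "(1 + norm (u + w)) powr s > 0" by blast+
  have "inverse y \<le> b * inverse z" if "z \<le> b * y" "z > 0" "y > 0" for b y z :: real
    using that by (simp add: field_simps)
  from this[OF * p] show ?thesis by (simp only: powr_minus)
qed

text \<open>The periodization \<open>L\<close> and the Fourier series \<open>R\<close> are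
  continuous and periodic with the same Fourier coefficients, so \<open>fourier_unique\<close>
  applies to \<open>L - R\<close>. The decay exponent above the dimension gives locally uniform
  convergence of \<open>L\<close>, the summability of the norms of \<open>c\<close> uniform
  convergence of \<open>R\<close>; the coefficients of \<open>L\<close> are unfolded by
  \<open>integral_tiling\<close>.\<close>

theorem poisson_summation:
  fixes h :: "real ^ 'n \<Rightarrow> complex"
  assumes cont: "continuous_on UNIV h" and s: "s > real CARD('n)"
    and decay: "\<And>w. norm (h w) \<le> C * (1 + norm w) powr (- s)"
    and int: "integrable lborel h"
    and c: "\<And>k. c k = integral UNIV (\<lambda>u. h u * chr (- k) u)"
    and sum: "(\<lambda>k. norm (c k)) summable_on UNIV"
  shows "(\<Sum>\<^sub>\<infinity>k. h (u + ivec k)) = (\<Sum>\<^sub>\<infinity>k. c k * chr k u)"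
proof -
  have s0: "s > 0" using s by (smt (verit) of_nat_0_le_iff)
  have cont': "continuous_on S h" for S using cont continuous_on_subset by blast
  have C: "C \<ge> 0"
  proof -
    have "0 \<le> C * 1" using order_trans[OF norm_ge_zero decay[of 0]] by simp
    thus ?thesis by simp
  qed
  define M where "M B k = C * ((1 + B) powr s * (1 + norm (ivec k :: real ^ 'n)) powr (- s))" for B k
  have hM: "norm (h (u + ivec k)) \<le> M B k" if "norm u \<le> B" for u B k
    unfolding M_def using decay[of "u + ivec k"] powr_decay_translate[of s u B "ivec k"] that s0 C
    by (smt (verit) mult_left_mono)
  have M: "M B summable_on UNIV" for B
    unfolding M_def by (intro summable_on_cmult_right summable_ivec_powr s)
  define L where "L u = (\<Sum>\<^sub>\<infinity>k. h (u + ivec k))" for u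
  define R where "R u = (\<Sum>\<^sub>\<infinity>k. c k * chr k u)" for u
  \<comment> \<open>The majorant depends on the radius \<open>B\<close>, so continuity is proved on
    balls and then assembled.\<close>
  have contL: "continuous_on (ball 0 B) L" for B
    unfolding L_def
  proof (rule continuous_on_infsum[OF _ _ M])
    show "norm (h (u + ivec k)) \<le> M B k" if "u \<in> ball 0 B" for u k
      using that by (intro hM) auto
    show "continuous_on (ball 0 B) (\<lambda>u. h (u + ivec k))" for k
      by (intro continuous_on_compose2[OF cont] continuous_intros) auto
  qed
  have "continuous_on UNIV L"
  proof (subst continuous_on_eq_continuous_at[OF open_UNIV], rule ballI)
    fix u :: "real ^ 'n"
    show "isCont L u"
      using contL[of "norm u + 1"] continuous_on_eq_continuous_at[of "ball 0 (norm u + 1)" L]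
      by (metis add.commute add_increasing2 dist_0_norm less_add_one mem_ball open_ball)
  qed
  have contR: "continuous_on UNIV R"
    unfolding R_def
    by (rule continuous_on_infsum[OF _ _ sum]) (auto intro!: continuous_intros continuous_on_chr simp: norm_mult norm_chr)
  have perL: "L (u + ivec m) = L u" for u m
  proof -
    have "bij_betw (\<lambda>k. m + k) UNIV (UNIV :: (int ^ 'n) set)" by (rule bij_plus)
    from infsum_reindex_bij_betw[OF this, of "\<lambda>k. h (u + ivec k)"] show ?thesis
      by (simp add: L_def ivec_add add.assoc)
  qed
  have perR: "R (u + ivec m) = R u" for u m
    by (simp add: R_def chr_periodic)
  have coeffL: "integral (cbox 0 1) (\<lambda>u. L u * chr k u) = c (- k)" for k
  proof -
    define g where "g u = h u * chr k u" for u
    have g: "integrable lborel g"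
      by (rule Bochner_Integration.integrable_bound[OF int])
        (auto simp: g_def norm_mult norm_chr intro!: borel_measurable_continuous_onI continuous_intros cont continuous_on_chr)
    have gk: "g (u + ivec m) = h (u + ivec m) * chr k u" for u m
      by (simp add: g_def chr_periodic)
    have nu: "norm u \<le> real CARD('n)" if "u \<in> cbox 0 1" for u :: "real ^ 'n"
    proof -
      have "norm u \<le> (\<Sum>i\<in>UNIV. \<bar>u $ i\<bar>)" by (rule norm_le_l1_cart)
      also have "\<dots> \<le> (\<Sum>i\<in>(UNIV :: 'n set). 1)"
        using that by (intro sum_mono) (auto simp: mem_box_cart)
      finally show ?thesis by simp
    qed
    have ng: "norm (g (u + ivec m)) \<le> M (real CARD('n)) m" if "u \<in> cbox 0 1" for u m
      using hM[OF nu[OF that]] by (simp add: gk norm_mult norm_chr)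
    have cg: "continuous_on S g" for S
      unfolding g_def by (intro continuous_intros cont' continuous_on_chr)
    have cgm: "continuous_on S (\<lambda>u. g (u + ivec m))" for S m
      by (intro continuous_on_compose2[OF cg[of UNIV]] continuous_intros) auto
    have ai: "(\<lambda>u. g (u + ivec m)) absolutely_integrable_on cbox 0 1" for m
      by (intro absolutely_integrable_continuous cgm)
    have abs: "(\<lambda>m. g (u + ivec m)) summable_on UNIV" if "u \<in> cbox 0 1" for u
      by (rule abs_summable_summable, rule Infinite_Sum.abs_summable_on_comparison_test'[OF M[of "real CARD('n)"]])
        (use ng[OF that] in auto)
    have "(\<lambda>m. integral (cbox 0 1) (\<lambda>u. norm (g (u + ivec m)))) summable_on UNIV"
    proof (rule summable_on_comparison_test[OF M[of "real CARD('n)"]])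
      fix m
      have "integral (cbox 0 1) (\<lambda>u. norm (g (u + ivec m))) \<le> integral (cbox 0 (1 :: real ^ 'n)) (\<lambda>u. M (real CARD('n)) m)"
        by (intro integral_le ng integrable_continuous continuous_intros cgm)
      also have "measure lborel (cbox 0 (1 :: real ^ 'n)) = 1"
        by (subst content_cbox_cart) (auto simp: interval_ne_empty_cart)
      hence "integral (cbox 0 (1 :: real ^ 'n)) (\<lambda>u. M (real CARD('n)) m) = M (real CARD('n)) m" by simp
      finally show "integral (cbox 0 1) (\<lambda>u. norm (g (u + ivec m))) \<le> M (real CARD('n)) m" .
      show "0 \<le> integral (cbox 0 1) (\<lambda>u. norm (g (u + ivec m)))"
        by (intro integral_nonneg integrable_continuous continuous_intros cgm) auto
    qed
    from has_sum_integral_swap(2)[OF countable_int_vec ai this abs]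
    have "((\<lambda>m. integral (cbox 0 1) (\<lambda>u. g (u + ivec m))) has_sum
        integral (cbox 0 1) (\<lambda>u. \<Sum>\<^sub>\<infinity>m. g (u + ivec m))) UNIV" .
    moreover have "(\<Sum>\<^sub>\<infinity>m. g (u + ivec m)) = L u * chr k u" for u
      unfolding gk L_def by (rule infsum_cmult_left')
    ultimately have "integral (cbox 0 1) (\<lambda>u. L u * chr k u) = integral UNIV g"
      using has_sum_unique[OF integral_tiling[OF g]] by simp
    thus ?thesis by (simp add: c g_def[abs_def])
  qed
  have coeffR: "integral (cbox 0 1) (\<lambda>u. R u * chr k u) = c (- k)" for k
  proof -
    define f where "f m u = c m * chr m u * chr k u" for m u
    have cf: "continuous_on S (f m)" for S m
      unfolding f_def by (intro continuous_intros continuous_on_chr)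
    have nf: "norm (f m u) = norm (c m)" for m u by (simp add: f_def norm_mult norm_chr)
    have abs: "(\<lambda>m. f m u) summable_on UNIV" for u
      by (rule abs_summable_summable) (simp add: nf sum)
    have "measure lborel (cbox 0 (1 :: real ^ 'n)) = 1"
      by (subst content_cbox_cart) (auto simp: interval_ne_empty_cart)
    hence "(\<lambda>m. integral (cbox 0 1) (\<lambda>u. norm (f m u))) summable_on UNIV"
      using sum by (simp add: nf)
    from has_sum_integral_swap(2)[OF countable_int_vec absolutely_integrable_continuous[OF cf] this abs]
    have A: "((\<lambda>m. integral (cbox 0 1) (f m)) has_sum integral (cbox 0 1) (\<lambda>u. \<Sum>\<^sub>\<infinity>m. f m u)) UNIV" .
    have B: "(\<Sum>\<^sub>\<infinity>m. f m u) = R u * chr k u" for u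
      unfolding f_def R_def by (rule infsum_cmult_left')
    have E: "integral (cbox 0 1) (f m) = (if m = - k then c (- k) else 0)" for m
    proof -
      have "f m = (\<lambda>u. c m * chr (m + k) u)" by (simp add: f_def fun_eq_iff mult.assoc chr_mult)
      thus ?thesis by (auto simp: integral_chr add_eq_0_iff2)
    qed
    have "((\<lambda>m. if m = - k then c (- k) else 0) has_sum c (- k)) UNIV"
      by (rule has_sum_finite_neutralI[of "{- k}"]) auto
    from has_sum_unique[OF A[unfolded E B] this] show ?thesis .
  qed
  have "L u - R u = 0"
  proof (rule fourier_unique[of "\<lambda>u. L u - R u"])
    show "continuous_on UNIV (\<lambda>u. L u - R u)"
      by (intro continuous_intros \<open>continuous_on UNIV L\<close> contR)
    show "L (u + ivec k) - R (u + ivec k) = L u - R u" for u k by (simp add: perL perR)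
    fix k
    have "integral (cbox 0 1) (\<lambda>u. L u * chr k u - R u * chr k u) =
        integral (cbox 0 1) (\<lambda>u. L u * chr k u) - integral (cbox 0 1) (\<lambda>u. R u * chr k u)"
      by (intro integral_diff integrable_continuous continuous_intros continuous_on_chr
            continuous_on_subset[OF \<open>continuous_on UNIV L\<close>] continuous_on_subset[OF contR]) auto
    thus "integral (cbox 0 1) (\<lambda>u. (L u - R u) * chr k u) = 0"
      by (simp add: left_diff_distrib coeffL coeffR)
  qed
  thus ?thesis by (simp add: L_def R_def)
qed

section \<open>Gaussian derivatives and moments\<close>

fun gauss_deriv :: "real \<Rightarrow> nat \<Rightarrow> real \<Rightarrow> real" where
  "gauss_deriv c 0 q = exp (- (pi * c * q\<^sup>2))"
| "gauss_deriv c (Suc 0) q = - 2 * pi * c * q * exp (- (pi * c * q\<^sup>2))"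
| "gauss_deriv c (Suc (Suc a)) q =
     - 2 * pi * c * (q * gauss_deriv c (Suc a) q + real (Suc a) * gauss_deriv c a q)"

text \<open>The recursion is Leibniz' rule applied to f' = -2 pi c q f, so differentiating it
  reproduces it with \<open>a\<close> raised by one. Two predecessors enter, hence the strong
  induction.\<close>

lemma gauss_deriv_has_derivative:
  "(gauss_deriv c a has_real_derivative gauss_deriv c (Suc a) q) (at q)"
proof (induction a rule: less_induct)
  case (less a)
  consider "a = 0" | "a = 1" | b where "a = Suc (Suc b)"
    by (metis One_nat_def not0_implies_Suc)
  thus ?case
  proof cases
    case 1
    show ?thesis unfolding 1 gauss_deriv.simps
      by (auto intro!: derivative_eq_intros)
  next
    case 2
    show ?thesis unfolding 2 One_nat_def gauss_deriv.simps
      by (auto intro!: derivative_eq_intros simp: power2_eq_square algebra_simps)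
  next
    case (3 b)
    have "(gauss_deriv c (Suc b) has_real_derivative gauss_deriv c (Suc (Suc b)) q) (at q)"
      "(gauss_deriv c b has_real_derivative gauss_deriv c (Suc b) q) (at q)"
      by (rule less; simp add: 3)+
    hence "((\<lambda>q. - 2 * pi * c * (q * gauss_deriv c (Suc b) q + real (Suc b) * gauss_deriv c b q)) has_real_derivative
        - 2 * pi * c * ((1 * gauss_deriv c (Suc b) q + gauss_deriv c (Suc (Suc b)) q * q) + real (Suc b) * gauss_deriv c (Suc b) q)) (at q)"
      by (intro DERIV_cmult DERIV_add DERIV_mult DERIV_ident)
    thus ?thesis unfolding 3 gauss_deriv.simps
      by (simp add: algebra_simps)
  qed
qed

lemma foldr_partial_deriv_gauss:
  fixes q :: "real ^ 'n"
  shows "foldr partial_deriv js (\<lambda>q :: real ^ 'n. of_real (exp (- (pi * c * (norm q)\<^sup>2)))) q =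
     of_real (\<Prod>j\<in>UNIV. gauss_deriv c (count_list js j) (q $ j))"
proof (induction js arbitrary: q)
  case Nil
  have "(norm q)\<^sup>2 = (\<Sum>j\<in>UNIV. (q $ j)\<^sup>2)"
    by (simp add: norm_vec_def L2_set_def sum_nonneg)
  thus ?case
    by (simp add: exp_sum[symmetric] sum_distrib_left sum_negf)
next
  case (Cons i js)
  define P where "P q = (\<Prod>j\<in>UNIV. gauss_deriv c (count_list js j) (q $ j))" for q :: "real ^ 'n"
  have "((\<lambda>q :: real ^ 'n. gauss_deriv c (count_list js j) (q $ j)) has_derivative
      (\<lambda>v. gauss_deriv c (Suc (count_list js j)) (q $ j) * v $ j)) (at q)" for j
  proof -
    have "(gauss_deriv c (count_list js j) has_derivative (\<lambda>h. gauss_deriv c (Suc (count_list js j)) (q $ j) * h)) (at (q $ j))"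
      using gauss_deriv_has_derivative[of c "count_list js j" "q $ j"] by (simp add: has_field_derivative_def)
    thus ?thesis
      by (rule has_derivative_compose[rotated]) (rule bounded_linear_imp_has_derivative[OF bounded_linear_vec_nth])
  qed
  hence "(P has_derivative (\<lambda>v. \<Sum>j\<in>UNIV. (gauss_deriv c (Suc (count_list js j)) (q $ j) * v $ j) *
      (\<Prod>k\<in>UNIV - {j}. gauss_deriv c (count_list js k) (q $ k)))) (at q)"
    unfolding P_def by (intro has_derivative_prod)
  hence d: "((\<lambda>q. complex_of_real (P q)) has_derivative (\<lambda>v. of_real (\<Sum>j\<in>UNIV. (gauss_deriv c (Suc (count_list js j)) (q $ j) * v $ j) *
      (\<Prod>k\<in>UNIV - {j}. gauss_deriv c (count_list js k) (q $ k))))) (at q)"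
    by (rule has_derivative_of_real)
  have "foldr partial_deriv (i # js) (\<lambda>q :: real ^ 'n. of_real (exp (- (pi * c * (norm q)\<^sup>2)))) q
      = partial_deriv i (\<lambda>q. of_real (P q)) q"
    unfolding P_def by (simp add: Cons.IH[abs_def])
  also have "\<dots> = of_real (\<Sum>j\<in>UNIV. (gauss_deriv c (Suc (count_list js j)) (q $ j) * (axis i 1 :: real ^ 'n) $ j) *
      (\<Prod>k\<in>UNIV - {j}. gauss_deriv c (count_list js k) (q $ k)))"
    by (rule partial_deriv_eqI[OF d])
  also have "(\<Sum>j\<in>UNIV. (gauss_deriv c (Suc (count_list js j)) (q $ j) * (axis i 1 :: real ^ 'n) $ j) *
      (\<Prod>k\<in>UNIV - {j}. gauss_deriv c (count_list js k) (q $ k))) =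
      (\<Sum>j\<in>{i}. (gauss_deriv c (Suc (count_list js j)) (q $ j) * (axis i 1 :: real ^ 'n) $ j) *
      (\<Prod>k\<in>UNIV - {j}. gauss_deriv c (count_list js k) (q $ k)))"
    by (rule sum.mono_neutral_right) (auto simp: axis_def)
  also have "\<dots> = (\<Prod>j\<in>UNIV. gauss_deriv c (count_list (i # js) j) (q $ j))"
    by (subst prod.remove[of UNIV i "\<lambda>j. gauss_deriv c (count_list (i # js) j) (q $ j)"]) (auto intro!: prod.cong)
  finally show ?case .
qed

text \<open>Each radial differentiation of exp(-pi c |q|^2) yields -2 pi q times another factor
  \<open>c\<close>; the powers \<open>c ^ m\<close> record this, so that the derivative relation of
  families holds.\<close>

definition gauss_family :: "real \<Rightarrow> nat \<Rightarrow> real ^ 'n \<Rightarrow> complex" where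
  "gauss_family c m q = of_real (c ^ m * exp (- (pi * c * (norm q)\<^sup>2)))"

lemma has_derivative_norm_power2:
  "((\<lambda>q :: real ^ 'n. (norm q)\<^sup>2) has_derivative (\<lambda>v. 2 * (q \<bullet> v))) (at q)"
  unfolding power2_norm_eq_inner
  by (auto intro!: derivative_eq_intros simp: inner_commute)

lemma gauss_family_has_derivative:
  "(gauss_family c m has_derivative (\<lambda>v. - 2 * of_real pi * of_real (q \<bullet> v) * gauss_family c (Suc m) q)) (at q)"
proof -
  have "((\<lambda>s. c ^ m * exp (- (pi * c * s))) has_real_derivative c ^ m * (exp (- (pi * c * (norm q)\<^sup>2)) * (- (pi * c)))) (at ((norm q)\<^sup>2))"
    by (auto intro!: derivative_eq_intros)
  from has_derivative_compose[OF has_derivative_norm_power2 this[unfolded has_field_derivative_def]]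
  have "((\<lambda>q. c ^ m * exp (- (pi * c * (norm q)\<^sup>2))) has_derivative
      (\<lambda>v. c ^ m * (exp (- (pi * c * (norm q)\<^sup>2)) * (- (pi * c))) * (2 * (q \<bullet> v)))) (at q)" .
  from has_derivative_of_real[OF this] show ?thesis
    unfolding gauss_family_def[abs_def] by (rule has_derivative_eq_rhs) (simp add: fun_eq_iff)
qed

text \<open>The same iterated derivative of a Gaussian is computed in two ways: by the general
  formula for radial families, and coordinatewise as a product of one-dimensional
  derivatives.\<close>

lemma hermite_sum_gauss_family:
  "hermite_sum \<alpha> (gauss_family c) q = of_real (\<Prod>j\<in>UNIV. gauss_deriv c (\<alpha> $ j) (q $ j))"
proof -
  obtain js where js: "mi_count js = \<alpha>" using nabla_eq_foldr by blast
  have "hermite_sum \<alpha> (gauss_family c) q = foldr partial_deriv js (gauss_family c 0) q"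
    unfolding js[symmetric]
    by (rule foldr_partial_deriv_family[OF open_UNIV, where \<Phi> = "gauss_family c", symmetric])
      (rule gauss_family_has_derivative, simp)
  also have "gauss_family c 0 = (\<lambda>q. of_real (exp (- (pi * c * (norm q)\<^sup>2))))"
    by (simp add: gauss_family_def fun_eq_iff)
  finally show ?thesis
    using js by (simp add: foldr_partial_deriv_gauss mi_count_def[of js] flip: js)
qed

definition gauss_moment_fun :: "real \<Rightarrow> nat \<Rightarrow> real \<Rightarrow> real \<Rightarrow> complex" where
  "gauss_moment_fun t a q w = of_real (w ^ a * exp (- (pi * t * w\<^sup>2))) * cis (- 2 * pi * (q * w))"

lemma power_le_fact_exp:
  assumes "(x::real) \<ge> 0"
  shows "x ^ n \<le> fact n * exp x"
proof -
  have "(\<Sum>k\<in>{n}. x ^ k /\<^sub>R fact k) \<le> (\<Sum>k. x ^ k /\<^sub>R fact k)"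
    using assms by (intro sum_le_suminf summable_exp_generic) auto
  also have "\<dots> = exp x" by (simp add: exp_def)
  finally show ?thesis by (simp add: field_simps)
qed

lemma integrable_gauss: "c > 0 \<Longrightarrow> integrable lborel (\<lambda>w::real. exp (- (c * w\<^sup>2)))"
proof -
  assume c: "c > 0"
  define \<sigma> where "\<sigma> = sqrt (1 / (2 * c))"
  have \<sigma>: "\<sigma> > 0" "2 * \<sigma>\<^sup>2 = 1 / c" using c by (auto simp: \<sigma>_def)
  have "integrable lborel (\<lambda>w. sqrt (2 * pi * \<sigma>\<^sup>2) * normal_density 0 \<sigma> w)"
    using \<sigma> by (intro integrable_mult_right integrable_normal_density)
  moreover have "sqrt (2 * pi * \<sigma>\<^sup>2) * normal_density 0 \<sigma> w = exp (- (c * w\<^sup>2))" for w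
  proof -
    have "w\<^sup>2 / (2 * \<sigma>\<^sup>2) = c * w\<^sup>2" unfolding \<sigma>(2) using c by simp
    thus ?thesis using \<sigma> by (simp add: normal_density_def)
  qed
  ultimately show ?thesis by simp
qed

lemma integrable_gauss_moment:
  assumes t: "t > 0"
  shows "integrable lborel (gauss_moment_fun t a q)"
proof (rule Bochner_Integration.integrable_bound)
  \<comment> \<open>One half of the exponent pays for the polynomial: x^a exp(-x) is at most
    \<open>fact a\<close> with x = (pi t / 2) w^2, and |w|^a is at most 1 + w^(2a). The other half
    stays as the majorant.\<close>
  define K where "K = 1 + fact a / (pi * t / 2) ^ a"
  show "integrable lborel (\<lambda>w::real. K * exp (- ((pi * t / 2) * w\<^sup>2)))"
    using t by (intro integrable_mult_right integrable_gauss) auto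
  show "gauss_moment_fun t a q \<in> borel_measurable lborel"
    unfolding gauss_moment_fun_def[abs_def] by (auto intro!: borel_measurable_continuous_onI continuous_intros)
  show "AE w in lborel. norm (gauss_moment_fun t a q w) \<le> norm (K * exp (- ((pi * t / 2) * w\<^sup>2)))"
  proof (rule AE_I2)
    fix w :: real
    define e where "e = exp (- ((pi * t / 2) * w\<^sup>2))"
    have e: "e > 0" "e \<le> 1" using t by (auto simp: e_def)
    have "\<bar>w\<bar> ^ a \<le> 1 + (w\<^sup>2) ^ a"
    proof (cases "\<bar>w\<bar> \<le> 1")
      case True
      hence "\<bar>w\<bar> ^ a \<le> 1" by (intro power_le_one) auto
      moreover have "0 \<le> (w\<^sup>2) ^ a" by simp
      ultimately show ?thesis by linarith
    next
      case False
      hence "\<bar>w\<bar> \<le> w\<^sup>2" using self_le_power[of "\<bar>w\<bar>" 2] by simp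
      hence "\<bar>w\<bar> ^ a \<le> (w\<^sup>2) ^ a" by (intro power_mono) auto
      thus ?thesis by simp
    qed
    moreover have "(w\<^sup>2) ^ a * e \<le> fact a / (pi * t / 2) ^ a"
    proof -
      have "((pi * t / 2) * w\<^sup>2) ^ a \<le> fact a * exp ((pi * t / 2) * w\<^sup>2)"
        using t by (intro power_le_fact_exp) auto
      hence "((pi * t / 2) * w\<^sup>2) ^ a * e \<le> fact a"
        by (simp add: e_def exp_minus field_simps)
      thus ?thesis using t by (simp add: power_mult_distrib field_simps)
    qed
    ultimately have "\<bar>w\<bar> ^ a * e \<le> K"
      using e mult_right_mono[of "\<bar>w\<bar> ^ a" "1 + (w\<^sup>2) ^ a" e] by (simp add: K_def distrib_right)
    hence "(\<bar>w\<bar> ^ a * e) * e \<le> K * e" using e by (intro mult_right_mono) auto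
    moreover have "e * e = exp (- (pi * t * w\<^sup>2))" by (simp add: e_def mult_exp_exp)
    moreover have "norm (gauss_moment_fun t a q w) = \<bar>w\<bar> ^ a * exp (- (pi * t * w\<^sup>2))"
      by (simp add: gauss_moment_fun_def norm_mult norm_power power_abs abs_mult)
    moreover have "K * e \<le> norm (K * e)" by simp
    ultimately show "norm (gauss_moment_fun t a q w) \<le> norm (K * exp (- ((pi * t / 2) * w\<^sup>2)))"
      unfolding e_def[symmetric] by (metis mult.assoc order_trans)
  qed
qed

text \<open>The substitution by \<open>c = sqrt (2 * pi * t)\<close> turns the integral into the
  characteristic function of the standard normal distribution at \<open>\<tau>\<close>.\<close>

lemma gauss_moment_0:
  assumes t: "t > 0"
  shows "(\<integral>w. gauss_moment_fun t 0 q w \<partial>lborel) = of_real (t powr (-1/2) * gauss_deriv (1 / t) 0 q)"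
proof -
  define c where "c = sqrt (2 * pi * t)"
  have c: "c > 0" "c\<^sup>2 = 2 * pi * t" using t by (auto simp: c_def)
  define \<tau> where "\<tau> = - 2 * pi * q / c"
  have "char std_normal_distribution \<tau> = (\<integral>x. std_normal_density x *\<^sub>R iexp (\<tau> * x) \<partial>lborel)"
    unfolding char_def by (subst integral_density) (auto simp: less_imp_le)
  also have "\<dots> = \<bar>c\<bar> *\<^sub>R (\<integral>w. std_normal_density (0 + c * w) *\<^sub>R iexp (\<tau> * (0 + c * w)) \<partial>lborel)"
    using c by (intro lborel_integral_real_affine) auto
  also have "(\<lambda>w. std_normal_density (0 + c * w) *\<^sub>R iexp (\<tau> * (0 + c * w))) = (\<lambda>w. of_real (1 / sqrt (2 * pi)) * gauss_moment_fun t 0 q w)"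
  proof
    fix w :: real
    have "(c * w)\<^sup>2 / 2 = pi * t * w\<^sup>2" by (simp add: power_mult_distrib c)
    moreover have "\<tau> * (c * w) = - 2 * pi * (q * w)" using c by (simp add: \<tau>_def)
    ultimately show "std_normal_density (0 + c * w) *\<^sub>R iexp (\<tau> * (0 + c * w)) = of_real (1 / sqrt (2 * pi)) * gauss_moment_fun t 0 q w"
      by (simp add: normal_density_def gauss_moment_fun_def cis_conv_exp scaleR_conv_of_real mult_ac)
  qed
  finally have "of_real (c / sqrt (2 * pi)) * (\<integral>w. gauss_moment_fun t 0 q w \<partial>lborel) = char std_normal_distribution \<tau>"
    using c by (simp add: scaleR_conv_of_real)
  also have "\<dots> = of_real (exp (- (\<tau>\<^sup>2) / 2))"
    by (simp add: char_std_normal_distribution)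
  also have "- (\<tau>\<^sup>2) / 2 = - (pi * (1 / t) * q\<^sup>2)"
    using t by (simp add: \<tau>_def power_divide power_mult_distrib c) (simp add: field_simps power2_eq_square)
  also have "c / sqrt (2 * pi) = sqrt t" by (simp add: c_def real_sqrt_mult)
  finally have "of_real (sqrt t) * (\<integral>w. gauss_moment_fun t 0 q w \<partial>lborel) = of_real (exp (- (pi * (1 / t) * q\<^sup>2)))" .
  moreover have "complex_of_real (sqrt t) \<noteq> 0" using t by simp
  ultimately have "(\<integral>w. gauss_moment_fun t 0 q w \<partial>lborel) = of_real (exp (- (pi * (1 / t) * q\<^sup>2))) / of_real (sqrt t)"
    by (metis nonzero_mult_div_cancel_left)
  moreover have "t powr (-1/2) = 1 / sqrt t"
  proof -
    have "t powr (-1/2) = inverse (t powr (1/2))"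
      using powr_minus[of t "1/2"] by simp
    thus ?thesis using t by (simp only: powr_half_sqrt[OF less_imp_le] inverse_eq_divide)
  qed
  ultimately show ?thesis by (simp only: gauss_deriv.simps of_real_mult of_real_divide) simp
qed

text \<open>\<open>f\<close> is the derivative of \<open>gauss_moment_fun t a q\<close>, which
  vanishes at both ends of the line, so the integral of \<open>f\<close> is zero. For
  \<open>a = 0\<close> the term with \<open>a - 1\<close> is multiplied by zero.\<close>

lemma gauss_moment_recurrence:
  fixes a :: nat and q t :: real and M :: "nat \<Rightarrow> complex"
  assumes t: "t > 0"
  defines "M \<equiv> \<lambda>a. (\<integral>w. gauss_moment_fun t a q w \<partial>lborel)"
  shows "2 * complex_of_real pi * of_real t * M (Suc a) = of_nat a * M (a - 1) - 2 * pi * \<i> * q * M a"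
proof -
  define f where "f w = of_nat a * gauss_moment_fun t (a - 1) q w - 2 * pi * \<i> * q * gauss_moment_fun t a q w
     - 2 * pi * t * gauss_moment_fun t (Suc a) q w" for w
  have cont: "continuous_on UNIV (gauss_moment_fun t a q)" for a
    unfolding gauss_moment_fun_def[abs_def] by (intro continuous_intros)
  have int: "integrable lborel f"
    unfolding f_def using integrable_gauss_moment[OF t] by (intro Bochner_Integration.integrable_diff integrable_mult_right)
  have lim: "((\<lambda>w. norm (gauss_moment_fun t a q w)) \<longlongrightarrow> 0) F" if "F = at_top \<or> F = at_bot" for F
  proof -
    have "((\<lambda>w::real. w ^ a * exp (- w)) \<longlongrightarrow> 0) at_top" by real_asymp
    have "((\<lambda>w::real. \<bar>w\<bar> ^ a * exp (- (pi * t * w\<^sup>2))) \<longlongrightarrow> 0) F"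
    proof (rule Lim_null_comparison)
      \<comment> \<open>Completing the square bounds the Gaussian by a multiple of exp(-|w|), for
        which the limit is elementary.\<close>
      have "pi * t * w\<^sup>2 \<ge> \<bar>w\<bar> - 1 / (4 * pi * t)" for w
      proof -
        have "(2 * pi * t * \<bar>w\<bar> - 1)\<^sup>2 \<ge> 0" by simp
        thus ?thesis using t by (simp add: field_simps power2_eq_square)
      qed
      hence "exp (- (pi * t * w\<^sup>2)) \<le> exp (1 / (4 * pi * t)) * exp (- \<bar>w\<bar>)" for w
        by (simp add: mult_exp_exp algebra_simps)
      thus "\<forall>\<^sub>F w in F. norm (\<bar>w\<bar> ^ a * exp (- (pi * t * w\<^sup>2))) \<le> exp (1 / (4 * pi * t)) * (\<bar>w\<bar> ^ a * exp (- \<bar>w\<bar>))"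
        by (intro always_eventually) (auto simp: abs_mult power_abs mult.left_commute[of "exp _" "_ ^ _"] intro!: mult_left_mono)
      have "((\<lambda>w::real. \<bar>w\<bar> ^ a * exp (- \<bar>w\<bar>)) \<longlongrightarrow> 0) F"
        by (rule filterlim_compose[OF \<open>((\<lambda>w::real. w ^ a * exp (- w)) \<longlongrightarrow> 0) at_top\<close>])
          (use that filterlim_abs_real filterlim_at_top_mirror[of abs] in auto)
      thus "((\<lambda>w. exp (1 / (4 * pi * t)) * (\<bar>w\<bar> ^ a * exp (- \<bar>w\<bar>))) \<longlongrightarrow> 0) F"
        by (rule tendsto_mult_right_zero)
    qed
    thus ?thesis by (simp add: gauss_moment_fun_def norm_mult norm_power power_abs abs_mult)
  qed
  have "(LBINT w=-\<infinity>..\<infinity>. f w) = 0 - 0"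
  proof (rule interval_integral_FTC_integrable[where F = "gauss_moment_fun t a q"])
    fix w :: real
    have 1: "((\<lambda>w. w ^ a * exp (- (pi * t * w\<^sup>2))) has_real_derivative
         (real a * w ^ (a - 1) * exp (- (pi * t * w\<^sup>2)) + w ^ a * (exp (- (pi * t * w\<^sup>2)) * (- (pi * t * (2 * w)))))) (at w)"
      by (auto intro!: derivative_eq_intros simp: algebra_simps)
    have "((\<lambda>w. exp (\<i> * of_real (- 2 * pi * q) * of_real w)) has_vector_derivative
        exp (\<i> * of_real (- 2 * pi * q) * of_real w) * (\<i> * of_real (- 2 * pi * q))) (at w)"
      by (rule has_vector_derivative_real_field) (auto intro!: derivative_eq_intros)
    hence 2: "((\<lambda>w. cis (- 2 * pi * (q * w))) has_vector_derivative (- 2 * pi * q) *\<^sub>R (\<i> * cis (- 2 * pi * (q * w)))) (at w)"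
      by (simp add: cis_conv_exp scaleR_conv_of_real mult_ac)
    note has_vector_derivative_mult[OF has_vector_derivative_of_real[OF 1] 2]
    moreover have "of_real (w ^ a * exp (- (pi * t * w\<^sup>2))) * ((- 2 * pi * q) *\<^sub>R (\<i> * cis (- 2 * pi * (q * w)))) +
       of_real (real a * w ^ (a - 1) * exp (- (pi * t * w\<^sup>2)) + w ^ a * (exp (- (pi * t * w\<^sup>2)) * (- (pi * t * (2 * w))))) * cis (- 2 * pi * (q * w)) = f w"
      by (simp add: f_def gauss_moment_fun_def scaleR_conv_of_real algebra_simps)
    ultimately show "(gauss_moment_fun t a q has_vector_derivative f w) (at w)"
      by (simp add: gauss_moment_fun_def[abs_def])
    show "isCont f w"
      using cont unfolding f_def by (intro continuous_intros) (auto simp: continuous_on_eq_continuous_at)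
  next
    show "set_integrable lborel (einterval (- \<infinity>) \<infinity>) f"
      using int by (simp add: set_integrable_def)
    show "((gauss_moment_fun t a q \<circ> real_of_ereal) \<longlongrightarrow> 0) (at_right (- \<infinity>))"
      using lim[of at_bot] by (simp add: ereal_tendsto_simps1 tendsto_norm_zero_iff)
    show "((gauss_moment_fun t a q \<circ> real_of_ereal) \<longlongrightarrow> 0) (at_left \<infinity>)"
      using lim[of at_top] by (simp add: ereal_tendsto_simps1 tendsto_norm_zero_iff)
  qed auto
  moreover have "(LBINT w=-\<infinity>..\<infinity>. f w) = (\<integral>w. f w \<partial>lborel)"
    by (simp add: interval_lebesgue_integral_def set_lebesgue_integral_def)
  moreover have "(\<integral>w. f w \<partial>lborel) = of_nat a * M (a - 1) - 2 * pi * \<i> * q * M a - 2 * pi * t * M (Suc a)"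
    unfolding f_def M_def using integrable_gauss_moment[OF t]
    by simp
  ultimately show ?thesis by simp
qed

text \<open>Under the Fourier transform multiplication by \<open>w\<close> becomes
  \<open>\<i> / (2 * pi)\<close> times differentiation in \<open>q\<close>, and a Gaussian with
  parameter \<open>t\<close> becomes one with parameter \<open>1 / t\<close>. In the proof the
  recurrence for the moments is matched with the recursion of \<open>gauss_deriv\<close>, starting
  from \<open>gauss_moment_0\<close>.\<close>

lemma gauss_moment:
  assumes t: "t > 0"
  shows "(\<integral>w. gauss_moment_fun t a q w \<partial>lborel) =
     (\<i> / (2 * pi)) ^ a * of_real (t powr (-1/2) * gauss_deriv (1 / t) a q)"
proof (induction a rule: less_induct)
  case (less a)
  define M where "M a = (\<integral>w. gauss_moment_fun t a q w \<partial>lborel)" for a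
  define \<kappa> where "\<kappa> = t powr (-1/2)"
  define c where "c = \<i> / (2 * complex_of_real pi)"
  have IH: "M b = c ^ b * of_real (\<kappa> * gauss_deriv (1 / t) b q)" if "b < a" for b
    using less[OF that] by (simp add: M_def \<kappa>_def c_def)
  have nz: "2 * complex_of_real pi * of_real t \<noteq> 0" using t by simp
  have rec: "M (Suc b) = (of_nat b * M (b - 1) - 2 * pi * \<i> * q * M b) / (2 * of_real pi * of_real t)" for b
    using gauss_moment_recurrence[OF t, of b q] nz by (simp add: M_def field_simps)
  have "M a = c ^ a * of_real (\<kappa> * gauss_deriv (1 / t) a q)"
  proof (cases a)
    case 0
    thus ?thesis using gauss_moment_0[OF t] by (simp add: M_def \<kappa>_def)
  next
    case (Suc b)
    show ?thesis
    proof (cases b)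
      case 0
      have "M 1 = - 2 * pi * \<i> * q * M 0 / (2 * of_real pi * of_real t)" using rec[of 0] by simp
      also have "\<dots> = c * of_real (\<kappa> * gauss_deriv (1 / t) 1 q)"
        using t by (subst IH) (auto simp: Suc 0 c_def field_simps)
      finally show ?thesis by (simp add: Suc 0)
    next
      case (Suc b')
      define E where "E = (\<lambda>a. complex_of_real (gauss_deriv (1 / t) a q))"
      have c2: "c * c = - 1 / (4 * of_real pi * of_real pi)" by (simp add: c_def)
      have "M a = (of_nat b * (c ^ b' * (of_real \<kappa> * E b')) - 2 * pi * \<i> * q * (c ^ b * (of_real \<kappa> * E b))) / (2 * of_real pi * of_real t)"
        using rec[of b] IH[of b] IH[of b'] \<open>a = Suc b\<close> Suc by (simp add: E_def)
      also have "\<dots> = c ^ b' * (of_real \<kappa> * (of_nat b * E b' - 2 * pi * \<i> * q * c * E b)) / (2 * of_real pi * of_real t)"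
        using Suc by (simp add: algebra_simps)
      also have "\<dots> = c ^ b' * (c * c) * of_real \<kappa> * ((- 2 * of_real pi / of_real t) * (q * E b + of_nat b * E b'))"
        unfolding c2 using t by (simp add: c_def field_simps)
      also have "(- 2 * of_real pi / of_real t) * (q * E b + of_nat b * E b') = E a"
        using \<open>a = Suc b\<close> Suc by (simp add: E_def)
      finally show ?thesis using \<open>a = Suc b\<close> Suc by (simp add: E_def mult_ac)
    qed
  qed
  thus ?case by (simp add: M_def \<kappa>_def c_def)
qed

section \<open>The theta identity\<close>

lemma lattice_eq_range: "lattice A = range (\<lambda>k. A *v ivec k)"
  by (simp add: lattice_def ivec_def)

lemma inj_lattice:
  fixes A :: "real ^ 'n ^ 'n"
  assumes "invertible A"
  shows "inj (\<lambda>k. A *v ivec k)"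
proof (rule injI)
  fix k m :: "int ^ 'n" assume "A *v ivec k = A *v ivec m"
  hence "matrix_inv A *v (A *v ivec k) = matrix_inv A *v (A *v ivec m)" by simp
  hence "ivec k = ivec m"
    by (simp add: matrix_vector_mul_assoc matrix_inv_invertible[OF assms])
  thus "k = m" by (rule injD[OF inj_ivec])
qed

lemma invertible_dual:
  fixes A :: "real ^ 'n ^ 'n"
  assumes "invertible A"
  shows "invertible (transpose (matrix_inv A))"
  unfolding invertible_def
  by (rule exI[of _ "transpose A"]) (simp add: matrix_transpose_mul[symmetric] matrix_inv_invertible[OF assms])

section \<open>Polynomial decay estimates\<close>

lemma powr_exp_decay:
  fixes c s :: real
  assumes c: "c > 0"
  obtains C where "C \<ge> 0" "\<And>\<rho>. \<rho> \<ge> 0 \<Longrightarrow> (1 + \<rho>) ^ N * exp (- (c * \<rho>\<^sup>2)) \<le> C * (1 + \<rho>) powr (- s)"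
proof -
  define f where "f \<rho> = (1 + \<rho>) powr (real N + s) * exp (- \<rho>)" for \<rho> :: real
  have "(f \<longlongrightarrow> 0) at_top" unfolding f_def by real_asymp
  hence "\<forall>\<^sub>F \<rho> in at_top. f \<rho> < 1" by (rule order_tendstoD) simp
  then obtain R where R: "\<And>\<rho>. \<rho> \<ge> R \<Longrightarrow> f \<rho> < 1" by (auto simp: eventually_at_top_linorder)
  have "continuous_on {0..R} f" unfolding f_def by (intro continuous_intros) auto
  hence "bounded (f ` {0..R})" by (intro compact_imp_bounded compact_continuous_image) auto
  then obtain K where "\<forall>x\<in>f ` {0..R}. norm x \<le> K" unfolding bounded_iff by blast
  hence K: "\<And>\<rho>. \<rho> \<in> {0..R} \<Longrightarrow> norm (f \<rho>) \<le> K" by blast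
  \<comment> \<open>\<open>K\<close> bounds \<open>f\<close> on the compact part and 1 bounds it
    beyond \<open>R\<close>; the factor exp(1/(4c)) comes from completing the square, which gives c
    rho^2 >= rho - 1/(4c).\<close>
  define C where "C = exp (1 / (4 * c)) * max 1 K"
  show thesis
  proof (rule that[of C])
    show "C \<ge> 0" by (simp add: C_def)
    fix \<rho> :: real assume \<rho>: "\<rho> \<ge> 0"
    have "(2 * c * \<rho> - 1)\<^sup>2 \<ge> 0" by simp
    hence "c * \<rho>\<^sup>2 \<ge> \<rho> - 1 / (4 * c)" using c by (simp add: field_simps power2_eq_square)
    hence "exp (- (c * \<rho>\<^sup>2)) \<le> exp (1 / (4 * c)) * exp (- \<rho>)" by (simp add: mult_exp_exp)
    hence "(1 + \<rho>) ^ N * exp (- (c * \<rho>\<^sup>2)) \<le> (1 + \<rho>) ^ N * (exp (1 / (4 * c)) * exp (- \<rho>))"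
      using \<rho> by (intro mult_left_mono) auto
    also have "\<dots> = exp (1 / (4 * c)) * f \<rho> * (1 + \<rho>) powr (- s)"
    proof -
      have "(1 + \<rho>) ^ N = (1 + \<rho>) powr (real N + s) * (1 + \<rho>) powr (- s)"
        using \<rho> by (simp add: powr_add[symmetric] powr_realpow)
      thus ?thesis by (simp only: f_def mult_ac)
    qed
    also have "f \<rho> \<le> max 1 K"
    proof (cases "\<rho> \<le> R")
      case True
      thus ?thesis using K[of \<rho>] \<rho> by auto
    next
      case False
      thus ?thesis using R[of \<rho>] by auto
    qed
    finally show "(1 + \<rho>) ^ N * exp (- (c * \<rho>\<^sup>2)) \<le> C * (1 + \<rho>) powr (- s)"
      by (simp add: C_def mult_left_mono mult_right_mono)
  qed
qed

text \<open>Writing \<open>u\<close> through the inverse matrix bounds it by the image point and the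
  shift \<open>z\<close>; the constant absorbs both. It transfers decay in a lattice point to decay
  in its integer coordinates.\<close>

lemma affine_lower_bound:
  fixes B :: "real ^ 'n ^ 'n"
  assumes "invertible B"
  obtains L where "L > 0" "\<And>u. 1 + norm u \<le> L * (1 + norm (B *v u + z))"
proof -
  obtain K where K: "K > 0" "\<And>v. norm (matrix_inv B *v v) \<le> norm v * K"
    using bounded_linear.pos_bounded[OF matrix_vector_mul_bounded_linear[of "matrix_inv B"]] by blast
  define L where "L = 1 + K + K * norm z"
  show thesis
  proof (rule that[of L])
    show "L > 0" using K by (simp add: L_def add_pos_nonneg)
    fix u
    define q where "q = B *v u + z"
    have "u = matrix_inv B *v (q - z)"
      by (simp add: q_def matrix_vector_mul_assoc matrix_inv_invertible[OF assms])
    hence "norm u \<le> norm (q - z) * K" using K(2) by metis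
    also have "\<dots> \<le> (norm q + norm z) * K" using K by (intro mult_right_mono norm_triangle_ineq4) auto
    finally have "norm u \<le> (norm q + norm z) * K" .
    moreover have "0 \<le> norm q" "0 \<le> K * norm z * norm q" "0 \<le> K" using K by auto
    ultimately show "1 + norm u \<le> L * (1 + norm (B *v u + z))"
      unfolding q_def[symmetric] L_def distrib_left distrib_right mult_1 mult_1_right
      using mult.commute[of K "norm q"] mult.commute[of K "norm z"] by linarith
  qed
qed

lemma powr_neg_le_of_le_mult:
  assumes "1 + a \<le> L * (1 + b)" "L > 0" "a \<ge> 0" "b \<ge> 0" "s \<ge> 0"
  shows "(1 + b) powr (- s) \<le> L powr s * (1 + a) powr (- s :: real)"
proof -
  have "(1 + a) powr s \<le> (L * (1 + b)) powr s" using assms by (intro powr_mono2) auto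
  also have "\<dots> = L powr s * (1 + b) powr s" by (rule powr_mult)
  finally have *: "(1 + a) powr s \<le> L powr s * (1 + b) powr s" .
  have p: "(1 + a) powr s > 0" "(1 + b) powr s > 0" using assms by auto
  have "inverse y \<le> l * inverse z" if "z \<le> l * y" "z > 0" "y > 0" for l y z :: real
    using that by (simp add: field_simps)
  from this[OF * p] show ?thesis by (simp only: powr_minus)
qed

lemma summable_affine_lattice:
  fixes B :: "real ^ 'n ^ 'n"
  assumes B: "invertible B" and s: "s > real CARD('n)"
  shows "(\<lambda>k. (1 + norm (B *v ivec k + z)) powr (- s)) summable_on UNIV"
proof -
  obtain L where L: "L > 0" "\<And>u. 1 + norm u \<le> L * (1 + norm (B *v u + z))"
    using affine_lower_bound[OF B] by blast
  have s0: "s \<ge> 0" using s by (smt (verit) of_nat_0_le_iff)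
  show ?thesis
  proof (rule summable_on_comparison_test)
    show "(\<lambda>k :: int ^ 'n. L powr s * (1 + norm (ivec k)) powr (- s)) summable_on UNIV"
      by (intro summable_on_cmult_right summable_ivec_powr s)
    show "(1 + norm (B *v ivec k + z)) powr (- s) \<le> L powr s * (1 + norm (ivec k)) powr (- s)" for k
      using L s0 by (intro powr_neg_le_of_le_mult) auto
  qed auto
qed

lemma mi_power_le: "\<bar>mi_power z \<gamma>\<bar> \<le> (1 + norm z) ^ mi_size \<gamma>"
proof -
  have "\<bar>mi_power z \<gamma>\<bar> = (\<Prod>j\<in>UNIV. \<bar>z $ j\<bar> ^ (\<gamma> $ j))"
    by (simp add: mi_power_def abs_prod power_abs)
  also have "\<dots> \<le> (\<Prod>j\<in>UNIV. (1 + norm z) ^ (\<gamma> $ j))"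
    by (intro prod_mono conjI power_mono) (auto intro: order_trans[OF component_le_norm_cart])
  also have "\<dots> = (1 + norm z) ^ mi_size \<gamma>"
    by (simp add: mi_size_def power_sum)
  finally show ?thesis .
qed

text \<open>The polynomial factors have degree at most \<open>mi_size \<alpha>\<close>, so one
  constant serves every family \<open>\<Phi>\<close>. This uniformity lets the same estimate be used
  for Gaussians, for Crandall functions and under the integral sign.\<close>

lemma hermite_sum_bound:
  fixes \<alpha> :: "nat ^ 'n"
  obtains K where "K \<ge> 0"
    "\<And>\<Phi> q. norm (hermite_sum \<alpha> \<Phi> q) \<le> K * (1 + norm q) ^ mi_size \<alpha> * (\<Sum>m\<le>mi_size \<alpha>. norm (\<Phi> m q))"
proof -
  define N where "N = mi_size \<alpha>"
  define k where "k \<beta> = (- pi) ^ (mi_size \<alpha> - mi_size \<beta>)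
     * (\<Prod>j\<in>UNIV. \<Prod>i<\<beta> $ j. real (\<alpha> $ j - \<beta> $ j) - real i)
     * (\<Prod>j\<in>UNIV. real ((\<alpha> $ j) choose (\<beta> $ j)))" for \<beta> :: "nat ^ 'n"
  define K where "K = (\<Sum>\<beta>\<in>half_indices \<alpha>. \<bar>k \<beta>\<bar> * 2 ^ N)"
  have p: "\<bar>crandall_poly \<alpha> \<beta> q\<bar> \<le> \<bar>k \<beta>\<bar> * 2 ^ N * (1 + norm q) ^ N" for \<beta> q
  proof -
    define \<gamma> where "\<gamma> = (\<chi> j. \<alpha> $ j - 2 * \<beta> $ j)"
    have "mi_size \<gamma> \<le> N" unfolding N_def by (intro mi_size_mono) (simp add: \<gamma>_def)
    have "\<bar>mi_power (2 *\<^sub>R q) \<gamma>\<bar> \<le> (1 + norm (2 *\<^sub>R q)) ^ mi_size \<gamma>" by (rule mi_power_le)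
    also have "\<dots> \<le> (1 + norm (2 *\<^sub>R q)) ^ N" by (intro power_increasing \<open>mi_size \<gamma> \<le> N\<close>) auto
    also have "\<dots> \<le> (2 * (1 + norm q)) ^ N" by (intro power_mono) auto
    finally have "\<bar>mi_power (2 *\<^sub>R q) \<gamma>\<bar> \<le> 2 ^ N * (1 + norm q) ^ N" by (simp only: power_mult_distrib)
    hence "\<bar>k \<beta>\<bar> * \<bar>mi_power (2 *\<^sub>R q) \<gamma>\<bar> \<le> \<bar>k \<beta>\<bar> * (2 ^ N * (1 + norm q) ^ N)"
      by (intro mult_left_mono) auto
    thus ?thesis by (simp add: crandall_poly_def k_def \<gamma>_def abs_mult mult.assoc)
  qed
  show thesis
  proof (rule that[of K])
    show "K \<ge> 0" unfolding K_def by (intro sum_nonneg) auto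
    fix \<Phi> :: "nat \<Rightarrow> real ^ 'n \<Rightarrow> complex" and q
    define S where "S = (\<Sum>m\<le>N. norm (\<Phi> m q))"
    have "norm (hermite_sum \<alpha> \<Phi> q) \<le> (\<Sum>\<beta>\<in>half_indices \<alpha>. norm (of_real (crandall_poly \<alpha> \<beta> q) * \<Phi> (mi_size \<alpha> - mi_size \<beta>) q))"
      unfolding hermite_sum_def by (rule norm_sum)
    also have "\<dots> \<le> (\<Sum>\<beta>\<in>half_indices \<alpha>. (\<bar>k \<beta>\<bar> * 2 ^ N * (1 + norm q) ^ N) * S)"
    proof (rule sum_mono)
      fix \<beta> :: "nat ^ 'n"
      have "norm (\<Phi> (mi_size \<alpha> - mi_size \<beta>) q) \<le> S"
        unfolding S_def by (rule member_le_sum[of _ _ "\<lambda>m. norm (\<Phi> m q)"]) (auto simp: N_def)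
      thus "norm (of_real (crandall_poly \<alpha> \<beta> q) * \<Phi> (mi_size \<alpha> - mi_size \<beta>) q) \<le> (\<bar>k \<beta>\<bar> * 2 ^ N * (1 + norm q) ^ N) * S"
        using p[of \<beta> q] by (simp only: norm_mult norm_of_real) (intro mult_mono, auto)
    qed
    also have "\<dots> = K * (1 + norm q) ^ N * S"
      by (simp add: K_def sum_distrib_right)
    finally show "norm (hermite_sum \<alpha> \<Phi> q) \<le> K * (1 + norm q) ^ mi_size \<alpha> * (\<Sum>m\<le>mi_size \<alpha>. norm (\<Phi> m q))"
      by (simp add: S_def N_def)
  qed
qed

section \<open>Theta terms and their Fourier transform\<close>

abbreviation fourier_kernel :: "real \<Rightarrow> complex" where
  "fourier_kernel r \<equiv> exp (- 2 * of_real pi * \<i> * of_real r)"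

lemma fourier_kernel_eq_cis: "fourier_kernel r = cis (- 2 * pi * r)"
  by (simp add: cis_conv_exp mult_ac)

lemma norm_fourier_kernel: "norm (fourier_kernel r) = 1"
  unfolding fourier_kernel_eq_cis by simp

lemma fourier_kernel_add: "fourier_kernel (a + b) = fourier_kernel a * fourier_kernel b"
  by (simp add: exp_add[symmetric] algebra_simps)

definition theta_term :: "nat ^ 'n \<Rightarrow> real \<Rightarrow> real ^ 'n \<Rightarrow> real ^ 'n \<Rightarrow> complex" where
  "theta_term \<alpha> t y w = of_real (mi_power w \<alpha> * exp (- (pi * t * (norm w)\<^sup>2))) * fourier_kernel (y \<bullet> w)"

lemma theta_term_eq_prod:
  "theta_term \<alpha> t y w = (\<Prod>j\<in>UNIV. gauss_moment_fun t (\<alpha> $ j) (y $ j) (w $ j))"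
proof -
  have cisprod: "cis (\<Sum>i\<in>I. g i) = (\<Prod>i\<in>I. cis (g i))" if "finite I" for g and I :: "'a set"
    using that by (induction I rule: finite_induct) (auto simp: cis_mult[symmetric])
  have "(norm w)\<^sup>2 = (\<Sum>j\<in>UNIV. (w $ j)\<^sup>2)"
    by (simp add: norm_vec_def L2_set_def sum_nonneg)
  hence "exp (- (pi * t * (norm w)\<^sup>2)) = (\<Prod>j\<in>UNIV. exp (- (pi * t * (w $ j)\<^sup>2)))"
    by (simp add: exp_sum[symmetric] sum_distrib_left sum_negf)
  moreover have "fourier_kernel (y \<bullet> w) = (\<Prod>j\<in>UNIV. cis (- 2 * pi * (y $ j * w $ j)))"
    unfolding fourier_kernel_eq_cis by (subst cisprod[symmetric]) (auto simp: inner_vec_def sum_distrib_left)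
  ultimately show ?thesis
    by (simp add: theta_term_def gauss_moment_fun_def mi_power_def prod.distrib)
qed

lemma continuous_on_theta_term: "continuous_on S (theta_term \<alpha> t y)"
  unfolding theta_term_def[abs_def] mi_power_def by (intro continuous_intros)

lemma norm_theta_term: "norm (theta_term \<alpha> t y w) = \<bar>mi_power w \<alpha>\<bar> * exp (- (pi * t * (norm w)\<^sup>2))"
  by (simp only: theta_term_def norm_mult norm_fourier_kernel norm_of_real abs_mult abs_exp_cancel mult_1_right)

lemma integral_theta_term:
  fixes \<alpha> :: "nat ^ 'n"
  assumes t: "t > 0"
  shows "integrable lborel (theta_term \<alpha> t y)"
    "(\<integral>w. theta_term \<alpha> t y w \<partial>lborel) = (\<i> / (2 * of_real pi)) ^ mi_size \<alpha>
       * of_real (t powr (- (real CARD('n) / 2))) * hermite_sum \<alpha> (gauss_family (1 / t)) y"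
proof -
  show "integrable lborel (theta_term \<alpha> t y)"
    unfolding theta_term_eq_prod[abs_def] by (intro integral_prod_vec integrable_gauss_moment t)
  have "(\<integral>w. theta_term \<alpha> t y w \<partial>lborel) = (\<Prod>j\<in>UNIV. \<integral>w. gauss_moment_fun t (\<alpha> $ j) (y $ j) w \<partial>lborel)"
    unfolding theta_term_eq_prod by (intro integral_prod_vec integrable_gauss_moment t)
  also have "\<dots> = (\<Prod>j\<in>UNIV. (\<i> / (2 * of_real pi)) ^ (\<alpha> $ j) * (of_real (t powr (- 1 / 2)) * of_real (gauss_deriv (1 / t) (\<alpha> $ j) (y $ j))))"
    by (simp add: gauss_moment[OF t])
  also have "\<dots> = (\<i> / (2 * of_real pi)) ^ mi_size \<alpha> * (of_real (t powr (- 1 / 2)) ^ CARD('n) *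
      hermite_sum \<alpha> (gauss_family (1 / t)) y)"
    by (simp add: prod.distrib mi_size_def power_sum hermite_sum_gauss_family)
  also have "of_real (t powr (- 1 / 2)) ^ CARD('n) = (of_real (t powr (- (real CARD('n) / 2))) :: complex)"
    using t by (simp add: powr_power flip: of_real_power)
  finally show "(\<integral>w. theta_term \<alpha> t y w \<partial>lborel) = (\<i> / (2 * of_real pi)) ^ mi_size \<alpha>
       * of_real (t powr (- (real CARD('n) / 2))) * hermite_sum \<alpha> (gauss_family (1 / t)) y"
    by (simp add: mult.assoc)
qed

lemma theta_term_decay:
  assumes "t > 0"
  obtains C where "C \<ge> 0" "\<And>y w. norm (theta_term \<alpha> t y w) \<le> C * (1 + norm w) powr (- s)"
proof -
  obtain C where C: "C \<ge> 0" "\<And>\<rho>. \<rho> \<ge> 0 \<Longrightarrow> (1 + \<rho>) ^ mi_size \<alpha> * exp (- (pi * t * \<rho>\<^sup>2)) \<le> C * (1 + \<rho>) powr (- s)"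
    using powr_exp_decay[of "pi * t" "mi_size \<alpha>" s] assms by auto
  have "norm (theta_term \<alpha> t y w) \<le> C * (1 + norm w) powr (- s)" for y w
  proof -
    have "norm (theta_term \<alpha> t y w) \<le> (1 + norm w) ^ mi_size \<alpha> * exp (- (pi * t * (norm w)\<^sup>2))"
      unfolding norm_theta_term by (intro mult_right_mono mi_power_le) auto
    also have "\<dots> \<le> C * (1 + norm w) powr (- s)" by (rule C) auto
    finally show ?thesis .
  qed
  with C show thesis using that by blast
qed

lemma hermite_gauss_decay:
  fixes \<alpha> :: "nat ^ 'n"
  assumes "c > 0"
  obtains C where "C \<ge> 0" "\<And>q :: real ^ 'n. norm (hermite_sum \<alpha> (gauss_family c) q) \<le> C * (1 + norm q) powr (- s)"
proof -
  obtain K where K: "K \<ge> 0"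
    "\<And>\<Phi> q. norm (hermite_sum \<alpha> \<Phi> q) \<le> K * (1 + norm q) ^ mi_size \<alpha> * (\<Sum>m\<le>mi_size \<alpha>. norm (\<Phi> m q))"
    using hermite_sum_bound[of \<alpha>] by blast
  obtain C where C: "C \<ge> 0" "\<And>\<rho>. \<rho> \<ge> 0 \<Longrightarrow> (1 + \<rho>) ^ mi_size \<alpha> * exp (- (pi * c * \<rho>\<^sup>2)) \<le> C * (1 + \<rho>) powr (- s)"
    using powr_exp_decay[of "pi * c" "mi_size \<alpha>" s] assms by auto
  define S where "S = (\<Sum>m\<le>mi_size \<alpha>. c ^ m)"
  have S: "S \<ge> 0" unfolding S_def using assms by (intro sum_nonneg) auto
  show thesis
  proof (rule that[of "K * S * C"])
    show "K * S * C \<ge> 0" using K S C by auto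
    fix q :: "real ^ 'n"
    have "(\<Sum>m\<le>mi_size \<alpha>. norm (gauss_family c m q)) = S * exp (- (pi * c * (norm q)\<^sup>2))"
      using assms by (simp add: gauss_family_def S_def sum_distrib_right norm_mult norm_power)
    hence "norm (hermite_sum \<alpha> (gauss_family c) q) \<le> K * S * ((1 + norm q) ^ mi_size \<alpha> * exp (- (pi * c * (norm q)\<^sup>2)))"
      using K(2)[of "gauss_family c" q] by (simp add: mult_ac)
    also have "\<dots> \<le> K * S * (C * (1 + norm q) powr (- s))"
      using K S by (intro mult_left_mono C) auto
    finally show "norm (hermite_sum \<alpha> (gauss_family c) q) \<le> K * S * C * (1 + norm q) powr (- s)"
      by (simp add: mult.assoc)
  qed
qed

lemma inner_dual:
  fixes A :: "real ^ 'n ^ 'n"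
  assumes "invertible A"
  shows "(transpose (matrix_inv A) *v k) \<bullet> (A *v u) = k \<bullet> u"
  by (simp add: transpose_matrix_vector dot_lmul_matrix matrix_vector_mul_assoc matrix_inv_invertible[OF assms])

text \<open>Poisson summation for \<open>theta_term\<close> composed with the affine map
  \<open>A *v u - x\<close>. The matrix contributes \<open>1 / \<bar>det A\<bar>\<close> and the
  dual lattice, the shift by \<open>x\<close> becomes the phase, and \<open>y\<close> translates the
  dual points because its exponential merges with the character.\<close>

theorem theta_identity:
  fixes A :: "real ^ 'n ^ 'n" and \<alpha> :: "nat ^ 'n"
  assumes A: "invertible A" and t: "t > 0"
  defines "B \<equiv> transpose (matrix_inv A)"
  shows "(\<Sum>\<^sub>\<infinity>k. theta_term \<alpha> t y (A *v ivec k - x)) =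
    (\<i> / (2 * of_real pi)) ^ mi_size \<alpha> * of_real (t powr (- (real CARD('n) / 2))) / of_real \<bar>det A\<bar> *
    (\<Sum>\<^sub>\<infinity>k. hermite_sum \<alpha> (gauss_family (1 / t)) (B *v ivec k + y) * fourier_kernel (x \<bullet> (B *v ivec k)))"
proof -
  define s where "s = real CARD('n) + 1"
  define h where "h u = theta_term \<alpha> t y (A *v u - x)" for u
  define \<kappa> where "\<kappa> = (\<i> / (2 * of_real pi)) ^ mi_size \<alpha> * of_real (t powr (- (real CARD('n) / 2))) / of_real \<bar>det A\<bar>"
  define c where "c k = \<kappa> * (hermite_sum \<alpha> (gauss_family (1 / t)) (B *v ivec k + y) * fourier_kernel (x \<bullet> (B *v ivec k)))" for k
  have meas: "theta_term \<alpha> t y \<in> borel_measurable borel" for y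
    by (intro borel_measurable_continuous_onI continuous_on_theta_term)
  have transl: "integrable lborel (\<lambda>w. theta_term \<alpha> t q (w - x))"
    "(\<integral>w. theta_term \<alpha> t q (w - x) \<partial>lborel) = (\<integral>w. theta_term \<alpha> t q w \<partial>lborel)" for q
  proof -
    have "integrable (distr lborel borel ((+) (- x))) (theta_term \<alpha> t q)"
      using integral_theta_term(1)[OF t] by (simp only: lborel_distr_plus)
    thus "integrable lborel (\<lambda>w. theta_term \<alpha> t q (w - x))"
      using meas by (subst (asm) integrable_distr_eq) auto
    show "(\<integral>w. theta_term \<alpha> t q (w - x) \<partial>lborel) = (\<integral>w. theta_term \<alpha> t q w \<partial>lborel)"
      using integral_translation_lborel[OF meas, of q "- x"] by simp
  qed
  obtain C where C: "C \<ge> 0" "\<And>w. norm (theta_term \<alpha> t y w) \<le> C * (1 + norm w) powr (- s)"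
    using theta_term_decay[OF t] by metis
  obtain L where L: "L > 0" "\<And>u. 1 + norm u \<le> L * (1 + norm (A *v u + (- x)))"
    using affine_lower_bound[OF A] by blast
  obtain D where D: "D \<ge> 0" "\<And>q. norm (hermite_sum \<alpha> (gauss_family (1 / t)) q) \<le> D * (1 + norm q) powr (- s)"
    using hermite_gauss_decay[of "1 / t"] t by (metis divide_pos_pos zero_less_one)
  have "(\<Sum>\<^sub>\<infinity>k. h (0 + ivec k)) = (\<Sum>\<^sub>\<infinity>k. c k * chr k 0)"
  proof (rule poisson_summation)
    show "continuous_on UNIV h"
      unfolding h_def
      by (intro continuous_on_compose2[OF continuous_on_theta_term[of UNIV]] continuous_intros
            linear_continuous_on matrix_vector_mul_bounded_linear) auto
    show "s > real CARD('n)" by (simp add: s_def)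
    show "norm (h u) \<le> (C * L powr s) * (1 + norm u) powr (- s)" for u
    proof -
      have "(1 + norm (A *v u - x)) powr (- s) \<le> L powr s * (1 + norm u) powr (- s)"
        using L(2)[of u] L(1) by (intro powr_neg_le_of_le_mult) (auto simp: s_def)
      hence "C * (1 + norm (A *v u - x)) powr (- s) \<le> C * (L powr s * (1 + norm u) powr (- s))"
        using C(1) by (rule mult_left_mono)
      with C(2)[of "A *v u - x"] show ?thesis by (simp add: h_def mult.assoc)
    qed
    show "integrable lborel h"
      unfolding h_def by (rule integral_matrix_image(1)[OF A transl(1)])
    show "c k = integral UNIV (\<lambda>u. h u * chr (- k) u)" for k
    proof -
      define p where "p = B *v ivec k"
      \<comment> \<open>With \<open>p\<close> dual to \<open>k\<close>,
        \<open>ivec k \<bullet> u\<close> equals \<open>p \<bullet> (A *v u)\<close>, which is split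
        at \<open>x\<close> so that the remaining exponential depends only on the argument of
        \<open>theta_term\<close>.\<close>
      have eq: "h u * chr (- k) u = fourier_kernel (x \<bullet> p) * theta_term \<alpha> t (p + y) (A *v u - x)" for u
      proof -
        have "ivec k \<bullet> u = p \<bullet> (A *v u)" unfolding p_def B_def inner_dual[OF A] ..
        also have "\<dots> = x \<bullet> p + p \<bullet> (A *v u - x)" by (simp add: inner_diff_right inner_commute)
        finally have h: "ivec k \<bullet> u = x \<bullet> p + p \<bullet> (A *v u - x)" .
        have "chr (- k) u = fourier_kernel (ivec k \<bullet> u)"
          unfolding chr_def fourier_kernel_eq_cis ivec_uminus inner_minus_left by simp
        hence "chr (- k) u = fourier_kernel (x \<bullet> p) * fourier_kernel (p \<bullet> (A *v u - x))"
          unfolding h fourier_kernel_add .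
        thus ?thesis
          by (simp only: h_def theta_term_def inner_add_left fourier_kernel_add) (simp only: mult_ac)
      qed
      have i: "integrable lborel (\<lambda>u. theta_term \<alpha> t (p + y) (A *v u - x))"
        by (rule integral_matrix_image(1)[OF A transl(1)])
      have "integral UNIV (\<lambda>u. h u * chr (- k) u) = (\<integral>u. h u * chr (- k) u \<partial>lborel)"
        unfolding eq by (intro integral_lborel integrable_mult_right i)
      also have "\<dots> = fourier_kernel (x \<bullet> p) * ((\<integral>w. theta_term \<alpha> t (p + y) w \<partial>lborel) / of_real \<bar>det A\<bar>)"
        unfolding eq using integral_matrix_image(2)[OF A transl(1)] transl(2) by simp
      finally show ?thesis
        unfolding integral_theta_term(2)[OF t] by (simp add: c_def \<kappa>_def p_def mult_ac)
    qed
    show "(\<lambda>k. norm (c k)) summable_on UNIV"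
    proof (rule summable_on_comparison_test)
      show "(\<lambda>k. norm \<kappa> * (D * (1 + norm (B *v ivec k + y)) powr (- s))) summable_on UNIV"
        unfolding B_def by (intro summable_on_cmult_right summable_affine_lattice invertible_dual A) (simp add: s_def)
      show "norm (c k) \<le> norm \<kappa> * (D * (1 + norm (B *v ivec k + y)) powr (- s))" for k
        using D(2) by (simp only: c_def norm_mult norm_fourier_kernel mult_1_right) (intro mult_left_mono, auto)
    qed auto
  qed
  moreover have chr0: "chr k 0 = 1" for k :: "int ^ 'n" by (simp add: chr_def)
  ultimately show ?thesis
    unfolding h_def c_def \<kappa>_def[symmetric] by (simp only: chr0 mult_1_right infsum_cmult_right' add_0_left)
qed

text \<open>The majorant may depend on the radius \<open>R\<close>: uniform convergence gives
  holomorphy on each ball, and the balls exhaust the plane.\<close>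

lemma holomorphic_infsum:
  fixes f :: "'i \<Rightarrow> complex \<Rightarrow> complex"
  assumes hol: "\<And>i. i \<in> I \<Longrightarrow> f i holomorphic_on UNIV"
    and bound: "\<And>R. \<exists>M. M summable_on I \<and> (\<forall>i\<in>I. \<forall>z. norm z \<le> R \<longrightarrow> norm (f i z) \<le> M i)"
  shows "(\<lambda>z. \<Sum>\<^sub>\<infinity>i\<in>I. f i z) holomorphic_on UNIV"
proof -
  have "(\<lambda>z. \<Sum>\<^sub>\<infinity>i\<in>I. f i z) holomorphic_on ball 0 R" for R
  proof -
    obtain M where M: "M summable_on I" "\<And>i z. i \<in> I \<Longrightarrow> norm z \<le> R \<Longrightarrow> norm (f i z) \<le> M i"
      using bound by meson
    have "uniform_limit (cball 0 R) (\<lambda>X z. \<Sum>i\<in>X. f i z) (\<lambda>z. \<Sum>\<^sub>\<infinity>i\<in>I. f i z) (finite_subsets_at_top I)"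
      by (rule Weierstrass_m_test_general) (use M in auto)
    moreover have "\<forall>\<^sub>F X in finite_subsets_at_top I. continuous_on (cball 0 R) (\<lambda>z. \<Sum>i\<in>X. f i z) \<and>
       (\<lambda>z. \<Sum>i\<in>X. f i z) holomorphic_on ball 0 R"
    proof (rule eventually_finite_subsets_at_top_weakI)
      fix X assume X: "finite X" "X \<subseteq> I"
      have "(\<lambda>z. \<Sum>i\<in>X. f i z) holomorphic_on UNIV"
        using X hol by (intro holomorphic_on_sum) auto
      thus "continuous_on (cball 0 R) (\<lambda>z. \<Sum>i\<in>X. f i z) \<and> (\<lambda>z. \<Sum>i\<in>X. f i z) holomorphic_on ball 0 R"
        by (meson holomorphic_on_imp_continuous_on holomorphic_on_subset subset_UNIV)
    qed
    ultimately show ?thesis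
      using holomorphic_uniform_limit[of 0 R "\<lambda>X z. \<Sum>i\<in>X. f i z" "finite_subsets_at_top I"] by auto
  qed
  moreover have "UNIV = (\<Union>n::nat. ball (0::complex) (real n))"
    using reals_Archimedean2 by (auto simp: mem_ball)
  ultimately show ?thesis
    by (metis (no_types, lifting) holomorphic_on_UN_open open_ball)
qed

section \<open>Derivatives of the Crandall functions\<close>

definition deriv_family :: "(nat \<Rightarrow> real ^ 'n \<Rightarrow> complex) \<Rightarrow> real ^ 'n \<Rightarrow> bool" where
  "deriv_family \<Phi> q \<longleftrightarrow> (\<forall>m. (\<Phi> m has_derivative (\<lambda>v. - 2 * of_real pi * of_real (q \<bullet> v) * \<Phi> (Suc m) q)) (at q))"

text \<open>Scaling the argument contributes one \<open>r\<close> from the chain rule and another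
  from the vector \<open>r *\<^sub>R q\<close> in the family relation, hence
  \<open>r ^ (2 * m)\<close>.\<close>

definition scale_family :: "real \<Rightarrow> (nat \<Rightarrow> real ^ 'n \<Rightarrow> complex) \<Rightarrow> nat \<Rightarrow> real ^ 'n \<Rightarrow> complex" where
  "scale_family r \<Phi> m q = of_real (r ^ (2 * m)) * \<Phi> m (r *\<^sub>R q)"

lemma deriv_family_scale:
  assumes "deriv_family \<Phi> (r *\<^sub>R q)"
  shows "deriv_family (scale_family r \<Phi>) q"
  unfolding deriv_family_def
proof
  fix m
  have 1: "((\<lambda>q. r *\<^sub>R q) has_derivative (\<lambda>v. r *\<^sub>R v)) (at q)"
    by (intro has_derivative_scaleR_right has_derivative_ident)
  have 2: "(\<Phi> m has_derivative (\<lambda>v. - 2 * of_real pi * of_real ((r *\<^sub>R q) \<bullet> v) * \<Phi> (Suc m) (r *\<^sub>R q))) (at (r *\<^sub>R q))"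
    using assms unfolding deriv_family_def by blast
  note has_derivative_compose[OF 1 2]
  from has_derivative_mult_right[OF this, of "of_real (r ^ (2 * m))"]
  show "(scale_family r \<Phi> m has_derivative (\<lambda>v. - 2 * of_real pi * of_real (q \<bullet> v) * scale_family r \<Phi> (Suc m) q)) (at q)"
    unfolding scale_family_def[abs_def]
    by (rule has_derivative_eq_rhs) (simp add: fun_eq_iff power_add power2_eq_square mult_ac)
qed

text \<open>Homogeneity: for \<gamma> = \<alpha> - 2\<beta> one has 2(|\<alpha>| - |\<beta>|) =
  |\<alpha>| + |\<gamma>|, and |\<gamma>| is the degree of the polynomial. So a scaled family gets
  the factor \<open>r ^ mi_size \<alpha>\<close> expected of a derivative of order
  \<open>\<alpha>\<close>.\<close>

lemma crandall_poly_scale: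
  assumes "\<beta> \<in> half_indices \<alpha>"
  shows "crandall_poly \<alpha> \<beta> q * r ^ (2 * (mi_size \<alpha> - mi_size \<beta>)) = r ^ mi_size \<alpha> * crandall_poly \<alpha> \<beta> (r *\<^sub>R q)"
proof -
  define \<gamma> where "\<gamma> = (\<chi> j. \<alpha> $ j - 2 * \<beta> $ j)"
  have h: "2 * \<beta> $ j \<le> \<alpha> $ j" for j using assms by (simp add: half_indices_def)
  have "\<alpha> = \<gamma> + \<beta> + \<beta>"
    unfolding vec_eq_iff
  proof
    fix j
    show "\<alpha> $ j = (\<gamma> + \<beta> + \<beta>) $ j" using h[of j] by (simp add: \<gamma>_def)
  qed
  hence s: "mi_size \<alpha> = mi_size \<gamma> + 2 * mi_size \<beta>" by (metis mi_size_add add.assoc mult_2)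
  have "mi_power (2 *\<^sub>R (r *\<^sub>R q)) \<gamma> = r ^ mi_size \<gamma> * mi_power (2 *\<^sub>R q) \<gamma>"
    by (simp add: mi_power_def mi_size_def power_sum power_mult_distrib prod.distrib mult_ac)
  moreover have "r ^ (2 * (mi_size \<alpha> - mi_size \<beta>)) = r ^ mi_size \<alpha> * r ^ mi_size \<gamma>"
    unfolding s power_add[symmetric] by (rule arg_cong[of _ _ "power r"]) simp
  ultimately show ?thesis
    unfolding crandall_poly_def \<gamma>_def[symmetric] by simp
qed

lemma hermite_sum_scale:
  "hermite_sum \<alpha> (scale_family r \<Phi>) q = of_real (r ^ mi_size \<alpha>) * hermite_sum \<alpha> \<Phi> (r *\<^sub>R q)"
  unfolding hermite_sum_def sum_distrib_left
proof (rule sum.cong)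
  fix \<beta> assume "\<beta> \<in> half_indices \<alpha>"
  from arg_cong[OF crandall_poly_scale[OF this, of q r], of "of_real :: real \<Rightarrow> complex"]
  show "of_real (crandall_poly \<alpha> \<beta> q) * scale_family r \<Phi> (mi_size \<alpha> - mi_size \<beta>) q =
     of_real (r ^ mi_size \<alpha>) * (of_real (crandall_poly \<alpha> \<beta> (r *\<^sub>R q)) * \<Phi> (mi_size \<alpha> - mi_size \<beta>) (r *\<^sub>R q))"
    unfolding scale_family_def by (simp only: of_real_mult mult.assoc[symmetric])
qed auto

lemma nabla_deriv_family:
  assumes "open S" "\<And>q. q \<in> S \<Longrightarrow> deriv_family \<Phi> q" "\<And>q. q \<in> S \<Longrightarrow> f q = \<Phi> 0 q" "q \<in> S"
  shows "nabla \<alpha> f q = hermite_sum \<alpha> \<Phi> q"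
  using nabla_cong_open[OF assms(1,4), of f "\<Phi> 0"] nabla_family[where \<Phi> = \<Phi> and S = S and q = q and \<alpha> = \<alpha>] assms
  by (simp add: deriv_family_def)

lemma hermite_sum_linear:
  "hermite_sum \<alpha> (\<lambda>m q. a * \<Phi> m q + b * \<Psi> m q) q = a * hermite_sum \<alpha> \<Phi> q + b * hermite_sum \<alpha> \<Psi> q"
  by (simp add: hermite_sum_def sum_distrib_left sum.distrib[symmetric] algebra_simps)

lemma deriv_family_linear:
  assumes "deriv_family \<Phi> q" "deriv_family \<Psi> q"
  shows "deriv_family (\<lambda>m q. a * \<Phi> m q + b * \<Psi> m q) q"
  unfolding deriv_family_def
proof
  fix m
  have "((\<lambda>q. a * \<Phi> m q + b * \<Psi> m q) has_derivative (\<lambda>v. a * (- 2 * of_real pi * of_real (q \<bullet> v) * \<Phi> (Suc m) q)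
      + b * (- 2 * of_real pi * of_real (q \<bullet> v) * \<Psi> (Suc m) q))) (at q)"
    using assms unfolding deriv_family_def by (intro has_derivative_add has_derivative_mult_right) auto
  thus "((\<lambda>q. a * \<Phi> m q + b * \<Psi> m q) has_derivative (\<lambda>v. - 2 * of_real pi * of_real (q \<bullet> v) * (a * \<Phi> (Suc m) q + b * \<Psi> (Suc m) q))) (at q)"
    by (rule has_derivative_eq_rhs) (simp add: fun_eq_iff algebra_simps)
qed

text \<open>Chain rule through \<open>pi * (norm q)\<^sup>2\<close>, whose differential supplies the
  factor 2 pi q; thus a sequence of one-variable functions, each being minus the derivative of its
  predecessor, becomes a radial family.\<close>

lemma radial_has_derivative:
  fixes f :: "real \<Rightarrow> complex"
  assumes "(f has_vector_derivative - g) (at (pi * (norm q)\<^sup>2))"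
  shows "((\<lambda>q :: real ^ 'n. f (pi * (norm q)\<^sup>2)) has_derivative (\<lambda>v. - 2 * of_real pi * of_real (q \<bullet> v) * g)) (at q)"
proof -
  have "((\<lambda>q :: real ^ 'n. pi * (norm q)\<^sup>2) has_derivative (\<lambda>v. pi * (2 * (q \<bullet> v)))) (at q)"
    by (intro has_derivative_mult_right has_derivative_norm_power2)
  from has_derivative_compose[OF this assms[unfolded has_vector_derivative_def]]
  show ?thesis
    by (rule has_derivative_eq_rhs) (simp add: fun_eq_iff scaleR_conv_of_real)
qed

definition expint_family :: "complex \<Rightarrow> nat \<Rightarrow> real ^ 'n \<Rightarrow> complex" where
  "expint_family \<nu> m z = expint (\<nu> / 2 + of_nat m) (pi * (norm z)\<^sup>2)"

lemma deriv_family_expint: "q \<noteq> 0 \<Longrightarrow> deriv_family (expint_family \<nu>) q"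
  unfolding deriv_family_def expint_family_def[abs_def]
proof (intro allI radial_has_derivative)
  fix m assume "q \<noteq> 0"
  hence "pi * (norm q)\<^sup>2 > 0" by simp
  from expint_has_vector_derivative[OF this, of "\<nu> / 2 + of_nat m"]
  show "(expint (\<nu> / 2 + of_nat m) has_vector_derivative - expint (\<nu> / 2 + of_nat (Suc m)) (pi * (norm q)\<^sup>2)) (at (pi * (norm q)\<^sup>2))"
    by (simp add: add_ac)
qed

lemma crandall_G_eq: "z \<noteq> 0 \<Longrightarrow> crandall_G \<nu> z = expint_family \<nu> 0 z"
  by (simp add: crandall_G_def expint_family_def expint_def)

lemma nabla_crandall_G: "q \<noteq> 0 \<Longrightarrow> nabla \<alpha> (crandall_G \<nu>) q = hermite_sum \<alpha> (expint_family \<nu>) q"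
  by (rule nabla_deriv_family[of "- {0}"]) (auto simp: deriv_family_expint crandall_G_eq)

section \<open>Power series families and the regularized Crandall function\<close>

definition pser_family :: "(nat \<Rightarrow> complex) \<Rightarrow> nat \<Rightarrow> real ^ 'n \<Rightarrow> complex" where
  "pser_family c m z = pser (\<lambda>k. c (k + m)) (pi * (norm z)\<^sup>2)"

lemma bounded_shift: "bounded (range c) \<Longrightarrow> bounded (range (\<lambda>k. c (k + m)))"
  for c :: "nat \<Rightarrow> complex"
  by (erule bounded_subset) auto

lemma deriv_family_pser:
  assumes "bounded (range c)"
  shows "deriv_family (pser_family c) q"
  unfolding deriv_family_def pser_family_def[abs_def]
proof (intro allI radial_has_derivative)
  fix m
  show "(pser (\<lambda>k. c (k + m)) has_vector_derivative - pser (\<lambda>k. c (k + Suc m)) (pi * (norm q)\<^sup>2)) (at (pi * (norm q)\<^sup>2))"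
    using pser_has_field_derivative[OF bounded_shift[OF assms, of m]] by simp
qed

text \<open>
  For \<open>\<nu> = -2k\<close> the logarithms \<open>log (\<pi>r\<^sup>2y\<^sup>2)\<close> of the Crandall function and \<open>log (\<pi>y\<^sup>2)\<close> of \<open>s_hat\<close> leave the
  difference \<open>2 log r\<close>.
\<close>

definition regG_coeff :: "complex \<Rightarrow> real \<Rightarrow> nat \<Rightarrow> complex" where
  "regG_coeff \<nu> r k = (if \<nu> = - 2 * of_nat k then harm k - euler_mascheroni - 2 * of_real (ln r)
     else - 1 / (\<nu> / 2 + of_nat k))"

lemma bounded_regG_coeff: "bounded (range (regG_coeff \<nu> r))"
proof (rule bounded_range_tendsto_0)
  have "(\<lambda>k. - (1 / (\<nu> / 2 + of_nat k))) \<longlonglongrightarrow> - 0"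
    by (intro tendsto_minus inverse_shift_tendsto_0)
  moreover obtain N where N: "norm \<nu> < real N" using reals_Archimedean2 by blast
  have "\<forall>\<^sub>F k in sequentially. - (1 / (\<nu> / 2 + of_nat k)) = regG_coeff \<nu> r k"
    using eventually_ge_at_top[of N]
  proof eventually_elim
    case (elim k)
    have "\<nu> \<noteq> - 2 * of_nat k"
    proof
      assume "\<nu> = - 2 * of_nat k"
      hence "norm \<nu> = 2 * real k" by (simp add: norm_mult)
      thus False using N elim by linarith
    qed
    thus ?case by (simp add: regG_coeff_def)
  qed
  ultimately show "regG_coeff \<nu> r \<longlonglongrightarrow> 0"
    by (metis Lim_transform_eventually minus_zero)
qed

lemma not_nonpos_even_half:
  fixes \<nu> :: complex
  assumes "\<forall>l::nat. \<nu> \<noteq> - 2 * of_nat l"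
  shows "\<nu> / 2 \<notin> \<int>\<^sub>\<le>\<^sub>0"
proof
  assume "\<nu> / 2 \<in> \<int>\<^sub>\<le>\<^sub>0"
  then obtain n where "\<nu> / 2 = - of_nat n" by (auto elim!: nonpos_Ints_cases')
  hence "\<nu> = - 2 * of_nat n" by (simp add: field_simps)
  thus False using assms by blast
qed

text \<open>The generic product and the value prescribed on the exceptional set of
  \<open>Gamma_s_hat\<close> are the same expression: outside that set
  \<open>Gamma ((d - \<nu>) / 2)\<close> is free of poles and cancels against the reciprocal Gamma
  factor in \<open>s_hat\<close>.\<close>

lemma Gamma_s_hat_eq:
  fixes y :: "real ^ 'n"
  assumes \<nu>: "\<forall>l::nat. \<nu> \<noteq> - 2 * of_nat l"
  shows "Gamma_s_hat \<nu> y = of_real pi powr ((of_nat CARD('n) - \<nu>) / 2) * Gamma (\<nu> / 2) * of_real (pi * (norm y)\<^sup>2) powr (- \<nu> / 2)"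
proof (cases "\<exists>l::nat. \<nu> = of_nat CARD('n) + 2 * of_nat l")
  case True
  thus ?thesis by (simp add: Gamma_s_hat_def)
next
  case False
  define d where "d = (of_nat CARD('n) :: complex)"
  have n1: "\<not> (\<exists>l::nat. d - \<nu> = d + 2 * of_nat l)"
    using \<nu> by (metis add_diff_cancel_left' diff_eq_eq minus_diff_eq minus_mult_left uminus_add_conv_diff add.commute)
  have n2: "(d - \<nu>) / 2 \<notin> \<int>\<^sub>\<le>\<^sub>0"
  proof (rule not_nonpos_even_half, rule allI, rule notI)
    fix l :: nat assume "d - \<nu> = - 2 * of_nat l"
    hence "\<nu> = d + 2 * of_nat l" by (simp add: algebra_simps)
    thus False using False by (auto simp: d_def)
  qed
  hence one: "Gamma ((d - \<nu>) / 2) * rGamma ((d - \<nu>) / 2) = 1"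
    by (simp add: rGamma_inverse_Gamma Gamma_eq_zero_iff)
  have sh: "s_hat (d - \<nu>) y = of_real pi powr ((d - \<nu>) / 2) * rGamma ((d - \<nu>) / 2) * Gamma (\<nu> / 2) * of_real (pi * (norm y)\<^sup>2) powr (- \<nu> / 2)"
    using n1 by (simp add: s_hat_def Let_def d_def)
  have "Gamma ((d - \<nu>) / 2) * s_hat (d - \<nu>) y = (Gamma ((d - \<nu>) / 2) * rGamma ((d - \<nu>) / 2)) *
      (of_real pi powr ((d - \<nu>) / 2) * Gamma (\<nu> / 2) * of_real (pi * (norm y)\<^sup>2) powr (- \<nu> / 2))"
    unfolding sh by (simp only: mult_ac)
  hence "Gamma ((d - \<nu>) / 2) * s_hat (d - \<nu>) y =
      of_real pi powr ((d - \<nu>) / 2) * Gamma (\<nu> / 2) * of_real (pi * (norm y)\<^sup>2) powr (- \<nu> / 2)"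
    unfolding one mult_1 .
  thus ?thesis using False by (simp add: Gamma_s_hat_def Let_def d_def)
qed

text \<open>With \<open>u = pi * (norm (r *\<^sub>R y))\<^sup>2\<close>, the subtracted term is
  generically the singular part Gamma(\<nu>/2) / u^(\<nu>/2) of \<open>expint_eq_Gamma_pser\<close>.
  For \<open>\<nu> = - 2 * of_nat l\<close> it is the logarithmic part of \<open>expint_neg\<close>,
  up to the change of scale in the logarithm. What is left is a power series in
  \<open>u\<close>.\<close>

lemma crandall_G_sub_Gamma_s_hat:
  fixes y :: "real ^ 'n"
  assumes r: "r > 0" and y: "y \<noteq> 0"
  shows "crandall_G \<nu> (r *\<^sub>R y) - of_real r powr (- \<nu>) * of_real pi powr (- (of_nat (CARD('n)) - \<nu>) / 2) * Gamma_s_hat \<nu> y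
    = pser_family (regG_coeff \<nu> r) 0 (r *\<^sub>R y)"
proof -
  define d where "d = (of_nat CARD('n) :: complex)"
  define a where "a = pi * (norm y)\<^sup>2"
  define u where "u = pi * (norm (r *\<^sub>R y))\<^sup>2"
  have a: "a > 0" and u: "u > 0" using r y by (auto simp: a_def u_def)
  have ua: "u = r * r * a" using r by (simp add: u_def a_def power_mult_distrib power2_eq_square)
  have G: "crandall_G \<nu> (r *\<^sub>R y) = expint (\<nu> / 2) u"
    using r y by (simp add: crandall_G_eq expint_family_def u_def)
  have pi1: "complex_of_real pi powr (- (d - \<nu>) / 2) * of_real pi powr ((d - \<nu>) / 2) = 1"
  proof -
    have "complex_of_real pi powr (- (d - \<nu>) / 2) * of_real pi powr ((d - \<nu>) / 2) = of_real pi powr (- (d - \<nu>) / 2 + (d - \<nu>) / 2)"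
      by (rule powr_add[symmetric])
    thus ?thesis by (simp add: add_divide_distrib[symmetric])
  qed
  show ?thesis
  proof (cases "\<forall>l::nat. \<nu> \<noteq> - 2 * of_nat l")
    case True
    have "of_real r powr (- \<nu>) * of_real pi powr (- (d - \<nu>) / 2) * Gamma_s_hat \<nu> y
      = of_real r powr (- \<nu>) * (of_real pi powr (- (d - \<nu>) / 2) * of_real pi powr ((d - \<nu>) / 2)) * (Gamma (\<nu> / 2) * of_real a powr (- \<nu> / 2))"
      unfolding Gamma_s_hat_eq[OF True] d_def a_def by (simp only: mult_ac)
    also have "\<dots> = Gamma (\<nu> / 2) * (of_real r powr (- \<nu>) * of_real a powr (- \<nu> / 2))"
      unfolding pi1 by (simp add: mult_ac)
    also have "of_real r powr (- \<nu>) * of_real a powr (- \<nu> / 2) = 1 / (of_real u powr (\<nu> / 2) :: complex)"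
    proof -
      have "of_real u powr (\<nu> / 2) = of_real r powr (\<nu> / 2) * of_real r powr (\<nu> / 2) * (of_real a powr (\<nu> / 2) :: complex)"
        unfolding ua using r a by (simp add: powr_times_real)
      also have "of_real r powr (\<nu> / 2) * of_real r powr (\<nu> / 2) = (of_real r powr \<nu> :: complex)"
        by (simp add: powr_add[symmetric])
      finally have "of_real u powr (\<nu> / 2) = of_real r powr \<nu> * (of_real a powr (\<nu> / 2) :: complex)" .
      moreover have "- \<nu> / 2 = - (\<nu> / 2)" by simp
      moreover have "inverse X * inverse Y = 1 / (X * Y)" for X Y :: complex by (simp add: inverse_eq_divide)
      ultimately show ?thesis by (simp only: powr_minus)
    qed
    finally have "crandall_G \<nu> (r *\<^sub>R y) - of_real r powr (- \<nu>) * of_real pi powr (- (d - \<nu>) / 2) * Gamma_s_hat \<nu> y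
        = - pser (\<lambda>k. 1 / (\<nu> / 2 + of_nat k)) u"
      unfolding G expint_eq_Gamma_pser[OF not_nonpos_even_half[OF True] u] by simp
    also have "\<dots> = pser (regG_coeff \<nu> r) u"
    proof -
      have "regG_coeff \<nu> r = (\<lambda>k. (-1) * (1 / (\<nu> / 2 + of_nat k)) + 0 * 0)"
        using True by (auto simp: regG_coeff_def fun_eq_iff)
      thus ?thesis using pser_add[OF bounded_inverse_shift[of "\<nu> / 2"], of "\<lambda>_. 0" "-1" 0 u] by simp
    qed
    finally show ?thesis by (simp add: pser_family_def u_def d_def)
  next
    case False
    then obtain l :: nat where l: "\<nu> = - 2 * of_nat l" by blast
    \<comment> \<open>Since \<open>d\<close> is positive, \<open>\<nu>\<close> is not of the form
      \<open>d + 2 * of_nat k\<close>, and \<open>Gamma_s_hat\<close> uses the product, whose second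
      factor lies in the logarithmic branch of \<open>s_hat\<close>.\<close>
    have nd: "\<not> (\<exists>k::nat. \<nu> = d + 2 * of_nat k)"
    proof
      assume "\<exists>k::nat. \<nu> = d + 2 * of_nat k"
      then obtain k :: nat where "- 2 * of_nat l = d + 2 * of_nat k" using l by metis
      hence "d + 2 * of_nat k + 2 * of_nat l = 0" by (simp add: eq_neg_iff_add_eq_0[symmetric])
      hence "of_nat (CARD('n) + 2 * k + 2 * l) = (0 :: complex)" by (simp add: d_def)
      thus False by (simp only: of_nat_eq_0_iff) simp
    qed
    have "(THE k::nat. d - \<nu> = d + 2 * of_nat k) = l"
      by (rule the_equality) (auto simp: l)
    moreover have "\<exists>k::nat. d - \<nu> = d + 2 * of_nat k" by (auto simp: l)
    ultimately have sh: "s_hat (d - \<nu>) y = of_real pi powr (of_nat l + d / 2) / Gamma (of_nat l + d / 2) * ((-1) ^ (l + 1) / fact l) * of_real (a ^ l * ln a)"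
      unfolding s_hat_def Let_def d_def[symmetric] a_def[symmetric] by simp
    have dl: "(d - \<nu>) / 2 = of_nat l + d / 2" by (simp add: l field_simps)
    have "of_nat l + d / 2 = of_real (real l + real CARD('n) / 2)" by (simp add: d_def)
    moreover have "real l + real CARD('n) / 2 > 0" by (simp add: add_nonneg_pos)
    ultimately have "Gamma (of_nat l + d / 2) \<noteq> 0"
      by (metis Gamma_complex_of_real Gamma_real_pos less_irrefl of_real_eq_0_iff)
    hence "Gamma_s_hat \<nu> y = of_real pi powr ((d - \<nu>) / 2) * ((-1) ^ (l + 1) / fact l) * of_real (a ^ l * ln a)"
      using nd by (simp add: Gamma_s_hat_def Let_def d_def[symmetric] dl sh)
    hence "of_real r powr (- \<nu>) * of_real pi powr (- (d - \<nu>) / 2) * Gamma_s_hat \<nu> y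
      = of_real r powr (- \<nu>) * (of_real pi powr (- (d - \<nu>) / 2) * of_real pi powr ((d - \<nu>) / 2)) * (((-1) ^ (l + 1) / fact l) * of_real (a ^ l * ln a))"
      by (simp only: mult_ac)
    also have "\<dots> = of_real r powr (- \<nu>) * (((-1) ^ (l + 1) / fact l) * of_real (a ^ l * ln a))"
      unfolding pi1 by simp
    also have "of_real r powr (- \<nu>) * (((-1) ^ (l + 1) / fact l) * of_real (a ^ l * ln a)) =
        of_real ((r * r) ^ l) * (((-1) ^ (l + 1) / fact l) * (of_real (a ^ l * ln a) :: complex))"
    proof -
      have "of_real r powr (- \<nu>) = (of_real r powr (of_nat (2 * l)) :: complex)" by (simp add: l)
      also have "\<dots> = of_real r ^ (2 * l)" using r by (subst powr_nat) auto
      finally have "of_real r powr (- \<nu>) = (of_real ((r * r) ^ l) :: complex)"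
        by (simp add: power_mult power2_eq_square)
      thus ?thesis by (simp only:)
    qed
    also have "of_real ((r * r) ^ l) * (((-1) ^ (l + 1) / fact l) * of_real (a ^ l * ln a)) = - (of_real ((- u) ^ l / fact l * ln a) :: complex)"
    proof -
      have "(- u) ^ l = (- 1) ^ l * ((r * r) ^ l * a ^ l)" unfolding ua
        by (simp add: power_mult_distrib[symmetric])
      thus ?thesis by simp
    qed
    finally have 1: "of_real r powr (- \<nu>) * of_real pi powr (- (d - \<nu>) / 2) * Gamma_s_hat \<nu> y = - (of_real ((- u) ^ l / fact l * ln a) :: complex)" .
    have "\<nu> / 2 = - of_nat l" by (simp add: l)
    hence G': "crandall_G \<nu> (r *\<^sub>R y) = pser (expint_coeff l) u - of_real ((- u) ^ l / fact l * ln u)"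
      unfolding G by (simp add: expint_neg[OF u])
    have lnu: "ln u = 2 * ln r + ln a" unfolding ua using r a by (simp add: ln_mult)
    have "crandall_G \<nu> (r *\<^sub>R y) - of_real r powr (- \<nu>) * of_real pi powr (- (d - \<nu>) / 2) * Gamma_s_hat \<nu> y
       = pser (expint_coeff l) u - of_real (2 * ln r) * of_real ((- u) ^ l / fact l)"
      unfolding 1 G' lnu by (simp add: algebra_simps)
    also have "of_real ((- u) ^ l / fact l) = pser (\<lambda>k. if k = l then 1 else 0) u"
    proof -
      have "(\<lambda>k. (if k = l then 1 else 0) * ((- of_real u) ^ k / fact k)) = (\<lambda>k. if k = l then (- complex_of_real u) ^ k / fact k else 0)"
        by (simp add: fun_eq_iff)
      thus ?thesis using sums_single[of l "\<lambda>k. (- complex_of_real u) ^ k / fact k"]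
        by (simp add: pser_def sums_iff)
    qed
    also have "pser (expint_coeff l) u - of_real (2 * ln r) * pser (\<lambda>k. if k = l then 1 else 0) u = pser (regG_coeff \<nu> r) u"
    proof -
      have "bounded (range (\<lambda>k::nat. if k = l then 1 else 0 :: complex))"
        by (rule finite_imp_bounded, rule finite_subset[of _ "{1, 0}"]) auto
      from pser_add[OF bounded_expint_coeff this, of 1 l "- of_real (2 * ln r)" u]
      have "pser (expint_coeff l) u - of_real (2 * ln r) * pser (\<lambda>k. if k = l then 1 else 0) u =
          pser (\<lambda>k. 1 * expint_coeff l k + - of_real (2 * ln r) * (if k = l then 1 else 0)) u" by simp
      also have "(\<lambda>k. 1 * expint_coeff l k + - of_real (2 * ln r) * (if k = l then 1 else 0)) = regG_coeff \<nu> r"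
        by (auto simp: fun_eq_iff expint_coeff_def regG_coeff_def l)
      finally show ?thesis .
    qed
    finally show ?thesis by (simp add: pser_family_def u_def d_def)
  qed
qed

text \<open>The defining description needs existence, which the power series family provides
  together with smoothness, and uniqueness: two smooth candidates agree off 0, hence at 0 by
  continuity.\<close>

lemma crandall_G_reg_eq:
  assumes r: "r > 0"
  shows "(crandall_G_reg \<nu> r :: real ^ 'n \<Rightarrow> complex) = scale_family r (pser_family (regG_coeff \<nu> r)) 0"
proof -
  define h :: "real ^ 'n \<Rightarrow> complex" where "h = scale_family r (pser_family (regG_coeff \<nu> r)) 0"
  have df: "deriv_family (scale_family r (pser_family (regG_coeff \<nu> r))) q" for q :: "real ^ 'n"
    by (intro deriv_family_scale deriv_family_pser bounded_regG_coeff)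
  have sm: "smooth h"
    unfolding h_def by (rule smooth_family) (use df in \<open>simp add: deriv_family_def\<close>)
  have eq: "h y = crandall_G \<nu> (r *\<^sub>R (y :: real ^ 'n)) - of_real r powr (- \<nu>) * of_real pi powr (- (of_nat (CARD('n)) - \<nu>) / 2) * Gamma_s_hat \<nu> y"
    if "y \<noteq> 0" for y :: "real ^ 'n"
    using crandall_G_sub_Gamma_s_hat[OF r that] by (simp add: h_def scale_family_def)
  have cont: "continuous_on UNIV g" if "smooth g" for g :: "real ^ 'n \<Rightarrow> complex"
  proof -
    have "g differentiable (at x)" for x
      using that unfolding smooth_def by (metis foldr_Nil id_apply)
    thus ?thesis
      by (simp add: continuous_on_eq_continuous_at differentiable_imp_continuous_within)
  qed
  have "crandall_G_reg \<nu> r = h"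
    unfolding crandall_G_reg_def
  proof (rule the_equality)
    show "smooth h \<and> (\<forall>y. y \<noteq> 0 \<longrightarrow> h y = crandall_G \<nu> (r *\<^sub>R y) - of_real r powr (- \<nu>) * of_real pi powr (- (of_nat (CARD('n)) - \<nu>) / 2) * Gamma_s_hat \<nu> y)"
      using sm eq by blast
    fix g :: "real ^ 'n \<Rightarrow> complex"
    assume g: "smooth g \<and> (\<forall>y. y \<noteq> 0 \<longrightarrow> g y = crandall_G \<nu> (r *\<^sub>R y) - of_real r powr (- \<nu>) * of_real pi powr (- (of_nat (CARD('n)) - \<nu>) / 2) * Gamma_s_hat \<nu> y)"
    have gh: "g y = h y" if "y \<noteq> 0" for y :: "real ^ 'n" using g eq that by simp
    have lg: "(g \<longlongrightarrow> g 0) (at 0)" and lh: "(h \<longlongrightarrow> h 0) (at 0)"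
      using cont[of g] cont[of h] g sm by (auto simp: continuous_on_eq_continuous_at isCont_def)
    have "\<forall>\<^sub>F y in at 0. g y = h y"
      by (auto simp: eventually_at_filter gh)
    hence "(h \<longlongrightarrow> g 0) (at 0)" by (rule Lim_transform_eventually[OF lg])
    from tendsto_unique[OF _ this lh] have "g 0 = h 0" by simp
    show "g = h"
    proof
      fix y show "g y = h y" using gh[of y] \<open>g 0 = h 0\<close> by (cases "y = 0") auto
    qed
  qed
  thus ?thesis by (simp add: h_def)
qed

lemma nabla_crandall_G_reg:
  assumes r: "r > 0"
  shows "nabla \<alpha> (crandall_G_reg \<nu> r) y = of_real (r ^ mi_size \<alpha>) * hermite_sum \<alpha> (pser_family (regG_coeff \<nu> r)) (r *\<^sub>R y)"
proof -
  have "nabla \<alpha> (crandall_G_reg \<nu> r) y = hermite_sum \<alpha> (scale_family r (pser_family (regG_coeff \<nu> r))) y"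
    by (rule nabla_deriv_family[of UNIV])
      (auto intro: deriv_family_scale deriv_family_pser bounded_regG_coeff simp: crandall_G_reg_eq[OF r])
  thus ?thesis by (simp add: hermite_sum_scale)
qed

text \<open>The value \<open>2 / \<nu>\<close> prescribed at 0 is the constant term of the series;
  elsewhere the lower function is Gamma minus the upper one, and the Gamma term cancels in
  \<open>expint_eq_Gamma_pser\<close>.\<close>

lemma crandall_g_eq:
  assumes "\<forall>l::nat. \<nu> \<noteq> - 2 * of_nat l"
  shows "crandall_g \<nu> z = pser (\<lambda>k. 1 / (\<nu> / 2 + of_nat k)) (pi * (norm z)\<^sup>2)"
proof (cases "z = 0")
  case True
  have "(\<lambda>k. 1 / (\<nu> / 2 + of_nat k) * ((- complex_of_real 0) ^ k / fact k)) = (\<lambda>k. if k = 0 then 1 / (\<nu> / 2 + of_nat k) else 0)"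
    by (auto simp: fun_eq_iff)
  hence "pser (\<lambda>k. 1 / (\<nu> / 2 + of_nat k)) 0 = 1 / (\<nu> / 2)"
    using sums_single[of 0 "\<lambda>k. 1 / (\<nu> / 2 + of_nat k)"] by (simp add: pser_def sums_iff)
  thus ?thesis using True by (simp add: crandall_g_def)
next
  case False
  define u where "u = pi * (norm z)\<^sup>2"
  have u: "u > 0" using False by (simp add: u_def)
  have "crandall_g \<nu> z = Gamma (\<nu> / 2) / of_real u powr (\<nu> / 2) - expint (\<nu> / 2) u"
    using False lower_Gamma_eq[OF not_nonpos_even_half[OF assms] u]
    by (simp add: crandall_g_def u_def expint_def diff_divide_distrib)
  thus ?thesis
    unfolding expint_eq_Gamma_pser[OF not_nonpos_even_half[OF assms] u] by (simp add: u_def)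
qed

text \<open>Away from the even nonpositive integers the coefficients of the two power series differ
  only in sign. In the exceptional case every term uses coefficients shifted by
  \<open>mi_size \<alpha> - mi_size \<beta>\<close>, and the condition on \<open>l\<close> pushes
  this shift beyond the exceptional index \<open>l\<close>.\<close>

lemma nabla_crandall_G_reg_eq_g:
  fixes \<alpha> :: "nat ^ 'n"
  assumes r: "r > 0"
    and \<nu>: "(\<forall>l::nat. \<nu> \<noteq> - 2 * of_nat l) \<or>
      (\<exists>l::nat. \<nu> = - 2 * of_nat l \<and> l < (\<Sum>j\<in>UNIV. nat \<lceil>real (\<alpha> $ j) / 2\<rceil>))"
  shows "nabla \<alpha> (crandall_G_reg \<nu> r) y = - of_real (r ^ mi_size \<alpha>) * crandall_g_deriv \<nu> \<alpha> (r *\<^sub>R y)"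
proof -
  define u where "u = r *\<^sub>R y"
  have "hermite_sum \<alpha> (pser_family (regG_coeff \<nu> r)) u = - crandall_g_deriv \<nu> \<alpha> u"
  proof (cases "\<forall>l::nat. \<nu> \<noteq> - 2 * of_nat l")
    case True
    define c where "c k = 1 / (\<nu> / 2 + of_nat k)" for k
    have c: "bounded (range c)" unfolding c_def by (rule bounded_inverse_shift)
    have "regG_coeff \<nu> r = (\<lambda>k. (-1) * c k + 0 * 0)"
      using True by (auto simp: regG_coeff_def c_def fun_eq_iff)
    hence "pser_family (regG_coeff \<nu> r) m z = (-1) * pser_family c m z + 0 * 0" for m and z :: "real ^ 'n"
      using pser_add[OF bounded_shift[OF c, of m], of "\<lambda>_. 0" "-1" 0] by (simp add: pser_family_def)
    hence "hermite_sum \<alpha> (pser_family (regG_coeff \<nu> r)) u = - hermite_sum \<alpha> (pser_family c) u"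
      by (simp add: hermite_sum_def sum_negf)
    also have "hermite_sum \<alpha> (pser_family c) u = nabla \<alpha> (crandall_g \<nu>) u"
    proof (rule nabla_deriv_family[symmetric, of UNIV])
      show "crandall_g \<nu> q = pser_family c 0 q" for q :: "real ^ 'n"
        by (simp add: crandall_g_eq[OF True] pser_family_def c_def)
    qed (auto intro: deriv_family_pser[OF c])
    finally show ?thesis using True by (auto simp: crandall_g_deriv_def)
  next
    case False
    with \<nu> obtain l :: nat where l: "\<nu> = - 2 * of_nat l" "l < (\<Sum>j\<in>UNIV. nat \<lceil>real (\<alpha> $ j) / 2\<rceil>)" by auto
    have "of_real (crandall_poly \<alpha> \<beta> u) * pser_family (regG_coeff \<nu> r) (mi_size \<alpha> - mi_size \<beta>) u =
        - (of_real (crandall_poly \<alpha> \<beta> u) * crandall_g (\<nu> + 2 * of_nat (mi_size \<alpha>) - 2 * of_nat (mi_size \<beta>)) u)"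
      if \<beta>: "\<beta> \<in> half_indices \<alpha>" for \<beta>
    proof -
      have h: "2 * \<beta> $ j \<le> \<alpha> $ j" for j using \<beta> by (simp add: half_indices_def)
      \<comment> \<open>\<open>2 * \<beta> $ j \<le> \<alpha> $ j\<close> makes
        \<open>\<alpha> $ j - \<beta> $ j\<close> at least half of \<open>\<alpha> $ j\<close> and,
        being an integer, at least the ceiling of that half.\<close>
      have "(\<Sum>j\<in>UNIV. nat \<lceil>real (\<alpha> $ j) / 2\<rceil>) + mi_size \<beta> \<le> mi_size \<alpha>"
        unfolding mi_size_def sum.distrib[symmetric]
      proof (rule sum_mono)
        fix j
        have "real (\<alpha> $ j) / 2 \<le> real (\<alpha> $ j - \<beta> $ j)" using h[of j] by linarith
        hence "\<lceil>real (\<alpha> $ j) / 2\<rceil> \<le> int (\<alpha> $ j - \<beta> $ j)" by (simp add: ceiling_le_iff)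
        thus "nat \<lceil>real (\<alpha> $ j) / 2\<rceil> + \<beta> $ j \<le> \<alpha> $ j" using h[of j] by linarith
      qed
      hence "l + mi_size \<beta> < mi_size \<alpha>" using l(2) by linarith
      then obtain e where "mi_size \<alpha> = Suc (l + mi_size \<beta> + e)" by (metis less_iff_Suc_add)
      hence e: "mi_size \<alpha> = l + mi_size \<beta> + Suc e" by simp
      define M where "M = mi_size \<alpha> - mi_size \<beta>"
      have M: "M = l + Suc e" using e by (simp add: M_def)
      define \<mu> where "\<mu> = \<nu> + 2 * of_nat (mi_size \<alpha>) - 2 * of_nat (mi_size \<beta>)"
      have \<mu>: "\<mu> = 2 * of_nat (Suc e)" by (simp add: \<mu>_def l(1) e algebra_simps)
      have "\<forall>l::nat. \<mu> \<noteq> - 2 * of_nat l"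
      proof (intro allI notI)
        fix k :: nat assume "\<mu> = - 2 * of_nat k"
        hence "Re (2 * of_nat (Suc e)) = Re (- 2 * of_nat k)" unfolding \<mu> by (rule arg_cong)
        thus False by simp
      qed
      hence "crandall_g \<mu> u = pser (\<lambda>k. 1 / (\<mu> / 2 + of_nat k)) (pi * (norm u)\<^sup>2)"
        by (rule crandall_g_eq)
      also have "\<dots> = - pser (\<lambda>k. regG_coeff \<nu> r (k + M)) (pi * (norm u)\<^sup>2)"
      proof -
        have "regG_coeff \<nu> r (k + M) = (-1) * (1 / (\<mu> / 2 + of_nat k)) + 0 * 0" for k
          unfolding \<mu> by (simp add: regG_coeff_def l(1) M add_ac del: of_nat_Suc) (simp add: add_ac)
        thus ?thesis using pser_add[OF bounded_inverse_shift[of "\<mu> / 2"], of "\<lambda>_. 0" "-1" 0] by simp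
      qed
      finally show ?thesis by (simp add: pser_family_def M_def \<mu>_def)
    qed
    thus ?thesis
      using l by (auto simp: crandall_g_deriv_def hermite_sum_def half_indices_def sum_negf[symmetric] intro!: sum.cong)
  qed
  thus ?thesis by (simp add: nabla_crandall_G_reg[OF r] u_def)
qed

section \<open>Expansion in the polynomials \<open>Y_poly\<close>\<close>

lemma pser_single: "pser (\<lambda>k. if k = j then 1 else 0) u = (- of_real u) ^ j / fact j"
proof -
  have "(\<lambda>k. (if k = j then 1 else 0) * ((- of_real u) ^ k / fact k)) = (\<lambda>k. if k = j then (- complex_of_real u) ^ k / fact k else 0)"
    by (simp add: fun_eq_iff)
  thus ?thesis using sums_single[of j "\<lambda>k. (- complex_of_real u) ^ k / fact k"]
    by (simp add: pser_def sums_iff)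
qed

text \<open>Decomposes the coefficients into unit sequences: shifted by \<open>m\<close>, the unit
  sequence at \<open>j\<close> vanishes if \<open>j < m\<close> and otherwise sits at
  \<open>j - m\<close>.\<close>

lemma pser_shift_sums:
  assumes c: "bounded (range c)"
  shows "(\<lambda>j. c j * pser (\<lambda>k. if k + m = j then 1 else 0) u) sums pser (\<lambda>k. c (k + m)) u"
proof -
  define f where "f j = c j * pser (\<lambda>k. if k + m = j then 1 else 0) u" for j
  have "f j = 0" if "j < m" for j
    using that by (simp add: f_def pser_def)
  moreover have "f (j + m) = c (j + m) * ((- of_real u) ^ j / fact j)" for j
    by (simp add: f_def pser_single)
  hence "(\<lambda>j. f (j + m)) sums pser (\<lambda>k. c (k + m)) u"
    using pser_sums[OF bounded_shift[OF c], of m u] by simp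
  ultimately have "f sums pser (\<lambda>k. c (k + m)) u"
    by (subst (asm) sums_iff_shift) simp
  thus ?thesis by (simp add: f_def[abs_def])
qed

text \<open>Multiplied by \<open>(- pi * r\<^sup>2) ^ j\<close>, the polynomial is the power series
  with the single coefficient 1 at \<open>j\<close>, scaled by \<open>r\<close>; so its derivatives
  fall under the general formula.\<close>

lemma nabla_Y_poly:
  fixes y :: "real ^ 'n"
  assumes r: "r > 0"
  shows "of_real ((- pi * r\<^sup>2) ^ j) * nabla \<alpha> (Y_poly j) y =
    of_real (r ^ mi_size \<alpha>) * hermite_sum \<alpha> (pser_family (\<lambda>k. if k = j then 1 else 0)) (r *\<^sub>R y)"
proof -
  define \<delta> where "\<delta> = (\<lambda>k. if k = j then 1 else 0 :: complex)"
  have \<delta>: "bounded (range \<delta>)"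
    unfolding \<delta>_def by (rule finite_imp_bounded, rule finite_subset[of _ "{1, 0}"]) auto
  define a where "a = (of_real ((- pi * r\<^sup>2) ^ j) :: complex)"
  have a: "a \<noteq> 0" using r by (simp add: a_def)
  define \<Phi> where "\<Phi> = scale_family r (pser_family \<delta> :: nat \<Rightarrow> real ^ 'n \<Rightarrow> complex)"
  have df: "deriv_family \<Phi> q" for q
    unfolding \<Phi>_def by (intro deriv_family_scale deriv_family_pser \<delta>)
  have Y: "Y_poly j q = inverse a * \<Phi> 0 q + 0 * \<Phi> 0 q" for q
  proof -
    have "\<Phi> 0 q = (- of_real (pi * (norm (r *\<^sub>R q))\<^sup>2)) ^ j / fact j"
      by (simp only: \<Phi>_def scale_family_def pser_family_def \<delta>_def add_0_right pser_single mult_0_right power_0 of_real_1 mult_1)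
    also have "(- of_real (pi * (norm (r *\<^sub>R q))\<^sup>2)) ^ j = a * (of_real (((norm q)\<^sup>2) ^ j) :: complex)"
    proof -
      have "- (pi * (norm (r *\<^sub>R q))\<^sup>2) = (- pi * r\<^sup>2) * (norm q)\<^sup>2"
        by (simp add: power_mult_distrib)
      hence "(- (pi * (norm (r *\<^sub>R q))\<^sup>2)) ^ j = (- pi * r\<^sup>2) ^ j * ((norm q)\<^sup>2) ^ j"
        by (simp only: power_mult_distrib)
      from arg_cong[OF this, of complex_of_real] show ?thesis
        by (simp only: a_def of_real_mult of_real_minus of_real_power)
    qed
    finally show ?thesis using a by (simp add: Y_poly_def)
  qed
  have "nabla \<alpha> (Y_poly j) y = hermite_sum \<alpha> (\<lambda>m q. inverse a * \<Phi> m q + 0 * \<Phi> m q) y"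
  proof (rule nabla_deriv_family[of UNIV])
    show "deriv_family (\<lambda>m q. inverse a * \<Phi> m q + 0 * \<Phi> m q) q" for q
      by (rule deriv_family_linear[OF df df])
    show "Y_poly j q = inverse a * \<Phi> 0 q + 0 * \<Phi> 0 q" for q by (rule Y)
  qed auto
  also have "\<dots> = inverse a * (of_real (r ^ mi_size \<alpha>) * hermite_sum \<alpha> (pser_family \<delta>) (r *\<^sub>R y))"
    unfolding hermite_sum_linear by (simp add: \<Phi>_def hermite_sum_scale)
  finally show ?thesis using a by (simp add: a_def \<delta>_def)
qed

text \<open>Termwise differentiation amounts to exchanging the sum over \<open>j\<close> with the
  finite sum over \<open>half_indices \<alpha>\<close>, and so reduces to the convergence of
  finitely many scalar series.\<close>

lemma nabla_Y_poly_sums: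
  fixes y :: "real ^ 'n"
  assumes r: "r > 0" and c: "bounded (range c)"
  shows "(\<lambda>j. c j * (of_real ((- pi * r\<^sup>2) ^ j) * nabla \<alpha> (Y_poly j) y)) sums
    (of_real (r ^ mi_size \<alpha>) * hermite_sum \<alpha> (pser_family c) (r *\<^sub>R y))"
proof -
  define u where "u = r *\<^sub>R y"
  have "(\<lambda>j. \<Sum>\<beta>\<in>half_indices \<alpha>. of_real (crandall_poly \<alpha> \<beta> u) *
      (c j * pser (\<lambda>k. if k + (mi_size \<alpha> - mi_size \<beta>) = j then 1 else 0) (pi * (norm u)\<^sup>2))) sums
      hermite_sum \<alpha> (pser_family c) u"
    unfolding hermite_sum_def pser_family_def
    by (intro sums_sum sums_mult pser_shift_sums c)
  moreover have "(\<Sum>\<beta>\<in>half_indices \<alpha>. of_real (crandall_poly \<alpha> \<beta> u) *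
      (c j * pser (\<lambda>k. if k + (mi_size \<alpha> - mi_size \<beta>) = j then 1 else 0) (pi * (norm u)\<^sup>2))) =
      c j * hermite_sum \<alpha> (pser_family (\<lambda>k. if k = j then 1 else 0)) u" for j
    unfolding hermite_sum_def pser_family_def sum_distrib_left by (intro sum.cong) (auto simp: mult_ac)
  ultimately have "(\<lambda>j. c j * hermite_sum \<alpha> (pser_family (\<lambda>k. if k = j then 1 else 0)) u) sums hermite_sum \<alpha> (pser_family c) u"
    by simp
  from sums_mult[OF this, of "of_real (r ^ mi_size \<alpha>)"] show ?thesis
    unfolding nabla_Y_poly[OF r] u_def by (simp only: mult_ac)
qed

lemma nabla_crandall_G_reg_series:
  fixes y :: "real ^ 'n" and l :: nat
  assumes r: "r > 0"
  shows "summable (\<lambda>j. if j = l then 0 else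
            of_real ((- pi * r\<^sup>2) ^ j / (real j - real l)) * nabla \<alpha> (Y_poly j) y)"
    and "nabla \<alpha> (crandall_G_reg (- 2 * of_nat l) r) y =
              of_real ((- pi * r\<^sup>2) ^ l * (harm l - euler_mascheroni - 2 * ln r)) * nabla \<alpha> (Y_poly l) y
              - (\<Sum>j. if j = l then 0 else
                  of_real ((- pi * r\<^sup>2) ^ j / (real j - real l)) * nabla \<alpha> (Y_poly j) y)"
proof -
  define c where "c = regG_coeff (- 2 * of_nat l) r"
  define N where "N = nabla \<alpha> (crandall_G_reg (- 2 * of_nat l) r) y"
  define g where "g j = c j * (of_real ((- pi * r\<^sup>2) ^ j) * nabla \<alpha> (Y_poly j) y)" for j
  define f where "f j = (if j = l then 0 else
            of_real ((- pi * r\<^sup>2) ^ j / (real j - real l)) * nabla \<alpha> (Y_poly j) y)" for j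
  have g: "g sums N"
    unfolding g_def N_def nabla_crandall_G_reg[OF r] c_def[symmetric]
    by (rule nabla_Y_poly_sums[OF r]) (simp add: c_def bounded_regG_coeff)
  \<comment> \<open>Subtracting the full series from its isolated term at \<open>l\<close> leaves
    the other terms with reversed sign, which is the series of \<open>f\<close>.\<close>
  have "(\<lambda>j. (if j = l then g j else 0) - g j) sums (g l - N)"
    by (intro sums_diff sums_single g)
  moreover have "(if j = l then g j else 0) - g j = f j" for j
  proof (cases "j = l")
    case False
    have "c j = - 1 / (of_nat j - of_nat l)" using False by (simp add: c_def regG_coeff_def)
    moreover have "complex_of_real ((- pi * r\<^sup>2) ^ j / (real j - real l)) = of_real ((- pi * r\<^sup>2) ^ j) / (of_nat j - of_nat l)"
      by simp
    ultimately show ?thesis using False by (simp add: f_def g_def)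
  qed (simp add: f_def)
  ultimately have f: "f sums (g l - N)" by simp
  have "summable f" using f by (rule sums_summable)
  thus "summable (\<lambda>j. if j = l then 0 else
            of_real ((- pi * r\<^sup>2) ^ j / (real j - real l)) * nabla \<alpha> (Y_poly j) y)"
    unfolding f_def .
  have gl: "g l = of_real ((- pi * r\<^sup>2) ^ l * (harm l - euler_mascheroni - 2 * ln r)) * nabla \<alpha> (Y_poly l) y"
  proof -
    have "c l = of_real (harm l - euler_mascheroni - 2 * ln r)"
      by (simp add: c_def regG_coeff_def of_real_harm)
    thus ?thesis by (simp only: g_def of_real_mult mult_ac)
  qed
  have "suminf f = g l - N" by (rule sums_unique[OF f, symmetric])
  hence "N = g l - suminf f" by simp
  thus "nabla \<alpha> (crandall_G_reg (- 2 * of_nat l) r) y =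
              of_real ((- pi * r\<^sup>2) ^ l * (harm l - euler_mascheroni - 2 * ln r)) * nabla \<alpha> (Y_poly l) y
              - (\<Sum>j. if j = l then 0 else
                  of_real ((- pi * r\<^sup>2) ^ j / (real j - real l)) * nabla \<alpha> (Y_poly j) y)"
    unfolding gl N_def f_def .
qed

section \<open>Lattice sums and Riemann splitting\<close>

lemma finite_ivec_norm_le: "finite {k :: int ^ 'n. norm (ivec k) \<le> N}"
proof (rule finite_subset)
  show "{k :: int ^ 'n. norm (ivec k) \<le> N} \<subseteq> vec_lambda ` (PiE UNIV (\<lambda>_. {- \<lceil>N\<rceil>..\<lceil>N\<rceil>}))"
  proof
    fix k :: "int ^ 'n" assume k: "k \<in> {k. norm (ivec k) \<le> N}"
    have "k $ j \<in> {- \<lceil>N\<rceil>..\<lceil>N\<rceil>}" for j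
    proof -
      have "\<bar>real_of_int (k $ j)\<bar> \<le> N"
        using k component_le_norm_cart[of "ivec k" j] by (simp add: ivec_nth)
      hence "real_of_int \<bar>k $ j\<bar> \<le> real_of_int \<lceil>N\<rceil>" by linarith
      thus ?thesis by auto
    qed
    thus "k \<in> vec_lambda ` (PiE UNIV (\<lambda>_. {- \<lceil>N\<rceil>..\<lceil>N\<rceil>}))"
      by (intro image_eqI[of _ _ "\<lambda>j. k $ j"]) (auto simp: vec_eq_iff)
  qed
qed (intro finite_imageI finite_PiE; simp)

text \<open>Points of norm below 1 come from integer vectors with
  \<open>norm (ivec k) \<le> 2 * L\<close>, of which there are finitely many;
  \<open>\<delta>\<close> is the least among 1 and the nonzero norms that these vectors
  produce.\<close>

lemma lattice_gap:
  fixes B :: "real ^ 'n ^ 'n"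
  assumes "invertible B"
  obtains \<delta> where "\<delta> > 0" "\<And>k. B *v ivec k + z \<noteq> 0 \<Longrightarrow> \<delta> \<le> norm (B *v ivec k + z)"
proof -
  obtain L where L: "L > 0" "\<And>u. 1 + norm u \<le> L * (1 + norm (B *v u + z))"
    using affine_lower_bound[OF assms] by blast
  define S where "S = insert 1 ((\<lambda>k. norm (B *v ivec k + z)) ` {k. norm (ivec k) \<le> 2 * L \<and> B *v ivec k + z \<noteq> 0})"
  have fin: "finite S"
    unfolding S_def by (intro finite.insertI finite_imageI finite_subset[OF _ finite_ivec_norm_le[of "2 * L"]]) auto
  show thesis
  proof (rule that[of "Min S"])
    show "Min S > 0" using fin by (subst Min_gr_iff) (auto simp: S_def)
    fix k assume nz: "B *v ivec k + z \<noteq> 0"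
    show "Min S \<le> norm (B *v ivec k + z)"
    proof (cases "norm (B *v ivec k + z) < 1")
      case True
      have "norm (ivec k) \<le> L * (1 + norm (B *v ivec k + z))" using L(2)[of "ivec k"] by linarith
      also have "\<dots> \<le> L * 2" using True L by (intro mult_left_mono) auto
      finally have "norm (B *v ivec k + z) \<in> S" using nz by (auto simp: S_def mult.commute)
      thus ?thesis using fin by (rule Min_le[rotated])
    next
      case False
      have "Min S \<le> 1" using fin by (rule Min_le) (simp add: S_def)
      thus ?thesis using False by linarith
    qed
  qed
qed

text \<open>Two estimates with one constant: the first controls the integrals of norms when sum and
  integral are exchanged, the second the dual terms themselves. Both hold uniformly for
  \<open>Re \<nu> \<le> \<sigma>\<close>.\<close>

lemma expint_family_decay:
  fixes \<alpha> :: "nat ^ 'n"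
  assumes "\<delta> > 0"
  obtains C where "C \<ge> 0" "\<And>\<nu> (q :: real ^ 'n). Re \<nu> \<le> \<sigma> \<Longrightarrow> norm q \<ge> \<delta> \<Longrightarrow>
    (1 + norm q) ^ mi_size \<alpha> * (\<Sum>m\<le>mi_size \<alpha>. norm (expint_family \<nu> m q)) \<le> C * (1 + norm q) powr (- s)"
    "\<And>\<nu> (q :: real ^ 'n). Re \<nu> \<le> \<sigma> \<Longrightarrow> norm q \<ge> \<delta> \<Longrightarrow>
      norm (hermite_sum \<alpha> (expint_family \<nu>) q) \<le> C * (1 + norm q) powr (- s)"
proof -
  define N where "N = mi_size \<alpha>"
  obtain K where K: "K \<ge> 0"
    "\<And>\<Phi> q. norm (hermite_sum \<alpha> \<Phi> q) \<le> K * (1 + norm q) ^ N * (\<Sum>m\<le>N. norm (\<Phi> m q))"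
    using hermite_sum_bound[of \<alpha>] unfolding N_def by blast
  obtain C where C: "C \<ge> 0" "\<And>\<rho>. \<rho> \<ge> 0 \<Longrightarrow> (1 + \<rho>) ^ N * exp (- (pi / 2 * \<rho>\<^sup>2)) \<le> C * (1 + \<rho>) powr (- s)"
    using powr_exp_decay[of "pi / 2" N s] by auto
  define D where "D = pi * \<delta>\<^sup>2"
  have D: "D > 0" using assms by (simp add: D_def)
  define E where "E = (\<Sum>m\<le>N. expint_bound (\<sigma> / 2 + real m) D)"
  have E: "E \<ge> 0" unfolding E_def by (intro sum_nonneg expint_bound_nonneg D)
  have main: "(1 + norm q) ^ N * (\<Sum>m\<le>N. norm (expint_family \<nu> m q)) \<le> (E * C) * (1 + norm q) powr (- s)"
    if \<nu>: "Re \<nu> \<le> \<sigma>" and q: "norm q \<ge> \<delta>" for \<nu> and q :: "real ^ 'n"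
  proof -
    have "D \<le> pi * (norm q)\<^sup>2"
      unfolding D_def using q assms by (intro mult_left_mono power_mono) auto
    hence "norm (expint_family \<nu> m q) \<le> exp (- (pi * (norm q)\<^sup>2 / 2)) * expint_bound (\<sigma> / 2 + real m) D" for m
      unfolding expint_family_def using \<nu> by (intro norm_expint_le D) auto
    hence "(\<Sum>m\<le>N. norm (expint_family \<nu> m q)) \<le> (\<Sum>m\<le>N. exp (- (pi * (norm q)\<^sup>2 / 2)) * expint_bound (\<sigma> / 2 + real m) D)"
      by (intro sum_mono)
    also have "\<dots> = exp (- (pi / 2 * (norm q)\<^sup>2)) * E"
      by (simp add: E_def sum_distrib_left)
    finally have "(1 + norm q) ^ N * (\<Sum>m\<le>N. norm (expint_family \<nu> m q)) \<le> (1 + norm q) ^ N * (exp (- (pi / 2 * (norm q)\<^sup>2)) * E)"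
      by (intro mult_left_mono) auto
    also have "\<dots> = E * ((1 + norm q) ^ N * exp (- (pi / 2 * (norm q)\<^sup>2)))" by (simp only: mult_ac)
    also have "\<dots> \<le> E * (C * (1 + norm q) powr (- s))" using E by (intro mult_left_mono C) auto
    finally show ?thesis by (simp only: mult.assoc)
  qed
  show thesis
  proof (rule that[of "(1 + K) * (E * C)"])
    show "(1 + K) * (E * C) \<ge> 0" using K E C by auto
    fix \<nu> and q :: "real ^ 'n" assume *: "Re \<nu> \<le> \<sigma>" "norm q \<ge> \<delta>"
    have p: "0 \<le> (E * C) * (1 + norm q) powr (- s)" using E C by auto
    have "1 * ((E * C) * (1 + norm q) powr (- s)) \<le> (1 + K) * ((E * C) * (1 + norm q) powr (- s))"
      using K p by (intro mult_right_mono) auto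
    with main[OF *] show "(1 + norm q) ^ mi_size \<alpha> * (\<Sum>m\<le>mi_size \<alpha>. norm (expint_family \<nu> m q)) \<le> (1 + K) * (E * C) * (1 + norm q) powr (- s)"
      unfolding N_def by (simp only: mult.assoc mult_1)
    have "norm (hermite_sum \<alpha> (expint_family \<nu>) q) \<le> K * ((1 + norm q) ^ N * (\<Sum>m\<le>N. norm (expint_family \<nu> m q)))"
      using K(2) by (simp only: mult.assoc)
    also have "\<dots> \<le> K * ((E * C) * (1 + norm q) powr (- s))" using K by (intro mult_left_mono main *)
    also have "\<dots> \<le> (1 + K) * ((E * C) * (1 + norm q) powr (- s))" using p by (intro mult_right_mono) auto
    finally show "norm (hermite_sum \<alpha> (expint_family \<nu>) q) \<le> (1 + K) * (E * C) * (1 + norm q) powr (- s)"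
      by (simp only: mult.assoc)
  qed
qed

text \<open>The form taken by the dual side on \<open>{0<..1}\<close>: Poisson summation replaces
  the parameter \<open>t\<close> of the Gaussian by \<open>1 / t\<close>, and the substitution of
  1/t for t brings back \<open>mellin_exp\<close> on \<open>{1..}\<close>.\<close>

definition inv_mellin :: "complex \<Rightarrow> real \<Rightarrow> real \<Rightarrow> complex" where
  "inv_mellin a v t = of_real t powr (- a - 1) * of_real (exp (- (v / t)))"

lemma norm_inv_mellin: "t > 0 \<Longrightarrow> norm (inv_mellin a v t) = Re (inv_mellin (of_real (Re a)) v t)"
proof -
  assume t: "t > 0"
  have "of_real t powr (- of_real (Re a) - 1) = complex_of_real (t powr (- Re a - 1))"
    using t powr_of_real[of t "- Re a - 1"] by simp
  hence "inv_mellin (of_real (Re a)) v t = of_real (t powr (- Re a - 1) * exp (- (v / t)))"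
    by (simp add: inv_mellin_def)
  hence "Re (inv_mellin (of_real (Re a)) v t) = t powr (- Re a - 1) * exp (- (v / t))"
    by (simp only: Re_complex_of_real)
  thus ?thesis using t by (simp add: inv_mellin_def norm_mult norm_powr_real_powr)
qed

lemma inv_mellin_integral:
  assumes v: "v > 0"
  shows "inv_mellin a v absolutely_integrable_on {0<..1}" "integral {0<..1} (inv_mellin a v) = expint a v"
proof -
  have img: "(\<lambda>t::real. 1 / t) ` {1..} = {0<..1}"
  proof safe
    fix t :: real assume "t \<in> {0<..1}"
    thus "t \<in> (\<lambda>t. 1 / t) ` {1..}" by (intro image_eqI[of _ _ "1 / t"]) auto
  qed auto
  have eq: "\<bar>- (1 / t\<^sup>2)\<bar> *\<^sub>R inv_mellin a v (1 / t) = mellin_exp a v t" if "t \<in> {1..}" for t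
  proof -
    have t: "t > 0" using that by auto
    have "of_real (1 / t) powr (- a - 1) = exp ((- a - 1) * of_real (ln (1 / t)))"
      using t by (simp add: powr_def Ln_of_real del: of_real_divide)
    also have "ln (1 / t) = - ln t" using t by (simp add: ln_div)
    also have "exp ((- a - 1) * of_real (- ln t)) = of_real t powr ((a - 1) + of_nat 2)"
      using t by (simp add: powr_def Ln_of_real algebra_simps)
    also have "\<dots> = of_real t powr (a - 1) * of_real t powr (of_nat 2)" by (rule powr_add)
    also have "of_real t powr (of_nat 2) = (of_real (t\<^sup>2) :: complex)"
      using t by (subst powr_nat) auto
    finally have "of_real (1 / t) powr (- a - 1) = of_real t powr (a - 1) * (of_real (t\<^sup>2) :: complex)" .
    thus ?thesis using t by (simp add: inv_mellin_def mellin_exp_def scaleR_conv_of_real)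
  qed
  have "mellin_exp a v absolutely_integrable_on {1..}"
    using v by (intro mellin_exp_integrable_Ici) auto
  hence "(\<lambda>t. \<bar>- (1 / t\<^sup>2)\<bar> *\<^sub>R inv_mellin a v (1 / t)) absolutely_integrable_on {1..}"
    by (subst set_integrable_cong[OF refl refl eq]) auto
  moreover have "integral {1..} (\<lambda>t. \<bar>- (1 / t\<^sup>2)\<bar> *\<^sub>R inv_mellin a v (1 / t)) = expint a v"
    unfolding expint_eq_integral[OF v] by (rule integral_cong) (rule eq)
  ultimately have "inv_mellin a v absolutely_integrable_on (\<lambda>t. 1 / t) ` {1..} \<and> integral ((\<lambda>t. 1 / t) ` {1..}) (inv_mellin a v) = expint a v"
    by (subst has_absolute_integral_change_of_variables_real[symmetric, where h = "\<lambda>t. - (1 / t\<^sup>2)"])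
      (auto intro!: derivative_eq_intros inj_onI simp: power2_eq_square)
  thus "inv_mellin a v absolutely_integrable_on {0<..1}" "integral {0<..1} (inv_mellin a v) = expint a v"
    unfolding img by auto
qed

text \<open>The norm of the integrand is the same integrand at the real parameter
  \<open>Re a\<close>, so its integral is \<open>expint\<close> there, which the decay estimates
  already control.\<close>

lemma integral_norm_inv_mellin:
  assumes v: "v > 0"
  shows "(\<lambda>t. norm (inv_mellin a v t)) integrable_on {0<..1}"
    "integral {0<..1} (\<lambda>t. norm (inv_mellin a v t)) \<le> norm (expint (of_real (Re a)) v)"
proof -
  show "(\<lambda>t. norm (inv_mellin a v t)) integrable_on {0<..1}"
    using inv_mellin_integral(1)[OF v, of a] by (simp add: absolutely_integrable_on_def)
  have i: "inv_mellin (of_real (Re a)) v integrable_on {0<..1}"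
    using inv_mellin_integral(1)[OF v, of "of_real (Re a)"] by (simp add: absolutely_integrable_on_def)
  have "integral {0<..1} (\<lambda>t. norm (inv_mellin a v t)) = integral {0<..1} (\<lambda>t. Re (inv_mellin (of_real (Re a)) v t))"
    by (rule integral_cong) (simp add: norm_inv_mellin)
  also have "\<dots> = Re (expint (of_real (Re a)) v)"
    using integral_linear[OF i bounded_linear_Re] inv_mellin_integral(2)[OF v] by (simp add: o_def)
  also have "\<dots> \<le> norm (expint (of_real (Re a)) v)" by (rule complex_Re_le_cmod)
  finally show "integral {0<..1} (\<lambda>t. norm (inv_mellin a v t)) \<le> norm (expint (of_real (Re a)) v)" .
qed

lemma gauss_family_scale:
  "t > 0 \<Longrightarrow> gauss_family (1 / (t / r\<^sup>2)) = scale_family r (gauss_family (1 / t))"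
  by (simp add: fun_eq_iff gauss_family_def scale_family_def power_mult_distrib power_divide mult_ac flip: power_mult)

text \<open>Exponent bookkeeping: \<nu>/2 - 1 - d/2 - m = -((d - \<nu>)/2 + m) - 1. This is where
  the reflected parameter \<open>d - \<nu>\<close> enters.\<close>

lemma inv_mellin_gauss:
  assumes t: "t > 0"
  shows "of_real t powr (\<nu> / 2 - 1) * of_real (t powr (- (real d / 2))) * gauss_family (1 / t) m z =
    inv_mellin ((of_nat d - \<nu>) / 2 + of_nat m) (pi * (norm z)\<^sup>2) t"
proof -
  have 1: "complex_of_real (t powr (- (real d / 2))) = of_real t powr (- (of_nat d / 2))"
    using t powr_of_real[of t "- (real d / 2)"] by simp
  have 2: "complex_of_real ((1 / t) ^ m) = of_real t powr (- of_nat m)"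
    using t by (simp add: powr_minus powr_nat power_divide divide_inverse power_inverse)
  have "inv_mellin ((of_nat d - \<nu>) / 2 + of_nat m) (pi * (norm z)\<^sup>2) t =
      of_real t powr ((\<nu> / 2 - 1) + (- (of_nat d / 2)) + (- of_nat m)) * of_real (exp (- (pi * (norm z)\<^sup>2 / t)))"
  proof -
    have "- ((of_nat d - \<nu>) / 2 + of_nat m) - 1 = (\<nu> / 2 - 1) + (- (of_nat d / 2)) + (- of_nat m)"
      by (simp add: diff_divide_distrib)
    thus ?thesis by (simp only: inv_mellin_def)
  qed
  also have "\<dots> = of_real t powr (\<nu> / 2 - 1) * of_real (t powr (- (real d / 2))) * (of_real ((1 / t) ^ m) * of_real (exp (- (pi * (norm z)\<^sup>2 / t))))"
    unfolding powr_add 1 2 by (simp only: mult.assoc)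
  also have "of_real ((1 / t) ^ m) * of_real (exp (- (pi * (norm z)\<^sup>2 / t))) = gauss_family (1 / t) m z"
    by (simp add: gauss_family_def)
  finally show ?thesis ..
qed

text \<open>The sum over \<open>half_indices\<close> is finite, so integration passes through it.
  The third claim takes the constant \<open>K\<close> as a hypothesis because the same
  \<open>K\<close> has to serve all dual points when these integrals are summed.\<close>

lemma hermite_inv_mellin_integral:
  fixes \<alpha> :: "nat ^ 'n" and z :: "real ^ 'n" and \<mu> :: complex and K :: real
  assumes z: "z \<noteq> 0"
  defines "h \<equiv> \<lambda>t. hermite_sum \<alpha> (\<lambda>m z. inv_mellin (\<mu> / 2 + of_nat m) (pi * (norm z)\<^sup>2) t) z"
  shows "h absolutely_integrable_on {0<..1}"
    and "integral {0<..1} h = hermite_sum \<alpha> (expint_family \<mu>) z"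
    and "(\<And>\<Phi> q. norm (hermite_sum \<alpha> \<Phi> q) \<le> K * (1 + norm q) ^ mi_size \<alpha> * (\<Sum>m\<le>mi_size \<alpha>. norm (\<Phi> m q))) \<Longrightarrow> K \<ge> 0 \<Longrightarrow>
      integral {0<..1} (\<lambda>t. norm (h t)) \<le> K * ((1 + norm z) ^ mi_size \<alpha> * (\<Sum>m\<le>mi_size \<alpha>. norm (expint_family (of_real (Re \<mu>)) m z)))"
proof -
  define v where "v = pi * (norm z)\<^sup>2"
  have v: "v > 0" using z by (simp add: v_def)
  have ai: "inv_mellin a v absolutely_integrable_on {0<..1}" for a by (rule inv_mellin_integral(1)[OF v])
  have i: "inv_mellin a v integrable_on {0<..1}" for a using ai[of a] by (simp add: absolutely_integrable_on_def)
  show hai: "h absolutely_integrable_on {0<..1}"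
    unfolding h_def hermite_sum_def v_def[symmetric]
    by (intro absolutely_integrable_sum finite_half_indices set_integrable_mult_right ai)
  have "integral {0<..1} h = (\<Sum>\<beta>\<in>half_indices \<alpha>. integral {0<..1} (\<lambda>t. of_real (crandall_poly \<alpha> \<beta> z) * inv_mellin (\<mu> / 2 + of_nat (mi_size \<alpha> - mi_size \<beta>)) v t))"
    unfolding h_def hermite_sum_def v_def[symmetric]
    by (intro integral_sum finite_half_indices integrable_on_mult_right i)
  thus "integral {0<..1} h = hermite_sum \<alpha> (expint_family \<mu>) z"
    by (simp add: hermite_sum_def inv_mellin_integral(2)[OF v] expint_family_def flip: v_def)
  assume K: "\<And>\<Phi> q. norm (hermite_sum \<alpha> \<Phi> q) \<le> K * (1 + norm q) ^ mi_size \<alpha> * (\<Sum>m\<le>mi_size \<alpha>. norm (\<Phi> m q))" "K \<ge> 0"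
  have ni: "(\<lambda>t. norm (inv_mellin a v t)) integrable_on {0<..1}" for a by (rule integral_norm_inv_mellin(1)[OF v])
  have "integral {0<..1} (\<lambda>t. norm (h t)) \<le> integral {0<..1} (\<lambda>t. K * (1 + norm z) ^ mi_size \<alpha> * (\<Sum>m\<le>mi_size \<alpha>. norm (inv_mellin (\<mu> / 2 + of_nat m) v t)))"
  proof (rule integral_le)
    show "(\<lambda>t. norm (h t)) integrable_on {0<..1}" using hai by (simp add: absolutely_integrable_on_def)
    show "(\<lambda>t. K * (1 + norm z) ^ mi_size \<alpha> * (\<Sum>m\<le>mi_size \<alpha>. norm (inv_mellin (\<mu> / 2 + of_nat m) v t))) integrable_on {0<..1}"
      by (intro integrable_on_mult_right integrable_sum ni) auto
    show "norm (h t) \<le> K * (1 + norm z) ^ mi_size \<alpha> * (\<Sum>m\<le>mi_size \<alpha>. norm (inv_mellin (\<mu> / 2 + of_nat m) v t))" for t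
      unfolding h_def v_def by (rule K)
  qed
  also have "\<dots> = K * (1 + norm z) ^ mi_size \<alpha> * (\<Sum>m\<le>mi_size \<alpha>. integral {0<..1} (\<lambda>t. norm (inv_mellin (\<mu> / 2 + of_nat m) v t)))"
    by (simp add: integral_sum ni)
  also have "\<dots> \<le> K * (1 + norm z) ^ mi_size \<alpha> * (\<Sum>m\<le>mi_size \<alpha>. norm (expint_family (of_real (Re \<mu>)) m z))"
  proof (intro mult_left_mono sum_mono)
    fix m
    have "of_real (Re (\<mu> / 2 + of_nat m)) = (of_real (Re \<mu>) / 2 + of_nat m :: complex)" by simp
    thus "integral {0<..1} (\<lambda>t. norm (inv_mellin (\<mu> / 2 + of_nat m) v t)) \<le> norm (expint_family (of_real (Re \<mu>)) m z)"
      using integral_norm_inv_mellin(2)[OF v, of "\<mu> / 2 + of_nat m"] by (simp only: expint_family_def v_def)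
  qed (use K in auto)
  finally show "integral {0<..1} (\<lambda>t. norm (h t)) \<le> K * ((1 + norm z) ^ mi_size \<alpha> * (\<Sum>m\<le>mi_size \<alpha>. norm (expint_family (of_real (Re \<mu>)) m z)))"
    by (simp only: mult.assoc)
qed

text \<open>Enlarging the domain to the half-line gives Euler's integral at \<open>Re s\<close>. For
  \<open>u\<close> proportional to the squared norm of a lattice point this leaves a term of the
  Dirichlet series.\<close>

lemma integral_norm_mellin_Ioc_le:
  assumes "u > 0" "Re s > 0"
  shows "integral {0<..1} (\<lambda>t. norm (mellin_exp s u t)) \<le> norm (Gamma (of_real (Re s) :: complex)) * u powr (- Re s)"
proof -
  have i: "mellin_exp (of_real (Re s)) u absolutely_integrable_on {0<..}"
    using assms by (intro mellin_exp_integrable_Ioi) auto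
  have eq: "norm (mellin_exp s u t) = norm (mellin_exp (of_real (Re s)) u t)" if "t > 0" for t
    using that by (simp add: norm_mellin_exp)
  have ni: "(\<lambda>t. norm (mellin_exp (of_real (Re s)) u t)) integrable_on {0<..}"
    using i by (simp add: absolutely_integrable_on_def)
  have ni1: "(\<lambda>t. norm (mellin_exp (of_real (Re s)) u t)) integrable_on {0<..1}"
    using set_integrable_subset[OF i, of "{0<..1}"] by (auto simp: absolutely_integrable_on_def subset_iff)
  have re: "norm (mellin_exp (of_real (Re s)) u t) = Re (mellin_exp (of_real (Re s)) u t)" if "t > 0" for t
  proof -
    have "of_real t powr (of_real (Re s) - 1) = complex_of_real (t powr (Re s - 1))"
      using that powr_of_real[of t "Re s - 1"] by simp
    hence "mellin_exp (of_real (Re s)) u t = of_real (t powr (Re s - 1) * exp (- (u * t)))"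
      by (simp add: mellin_exp_def)
    thus ?thesis using that by (simp add: norm_mult)
  qed
  have "integral {0<..1} (\<lambda>t. norm (mellin_exp s u t)) = integral {0<..1} (\<lambda>t. norm (mellin_exp (of_real (Re s)) u t))"
    by (rule integral_cong) (simp add: eq)
  also have "\<dots> \<le> integral {0<..} (\<lambda>t. norm (mellin_exp (of_real (Re s)) u t))"
    by (intro integral_subset_le ni ni1) auto
  also have "\<dots> = integral {0<..} (\<lambda>t. Re (mellin_exp (of_real (Re s)) u t))"
    by (rule integral_cong) (simp add: re)
  also have "\<dots> = Re (integral {0<..} (mellin_exp (of_real (Re s)) u))"
    using integral_linear[OF _ bounded_linear_Re, of "mellin_exp (of_real (Re s)) u" "{0<..}"] i
    by (simp add: o_def absolutely_integrable_on_def)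
  also have "\<dots> = Re (Gamma (of_real (Re s)) / of_real u powr (of_real (Re s)))"
    using assms by (subst Gamma_eq_mellin_integral) auto
  also have "\<dots> \<le> norm (Gamma (of_real (Re s)) / of_real u powr (of_real (Re s) :: complex))"
    by (rule complex_Re_le_cmod)
  also have "\<dots> = norm (Gamma (of_real (Re s) :: complex)) * u powr (- Re s)"
    using assms powr_of_real[of u "Re s"] by (simp add: norm_divide powr_minus_divide)
  finally show ?thesis .
qed

section \<open>Termwise splitting for a fixed lattice and shift\<close>

locale epstein =
  fixes A :: "real ^ 'n ^ 'n" and x :: "real ^ 'n" and \<alpha> :: "nat ^ 'n" and r :: real
  assumes invA: "invertible A" and r: "r > 0"
begin

definition w :: "int ^ 'n \<Rightarrow> real ^ 'n" where
  "w k = A *v ivec k - x"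

definition p :: "int ^ 'n \<Rightarrow> real ^ 'n" where
  "p k = transpose (matrix_inv A) *v ivec k"

text \<open>Indices rather than points: the complement consists of the index of \<open>x\<close> if
  \<open>x\<close> is a lattice point, and is empty otherwise.\<close>

definition off_lattice :: "(int ^ 'n) set" where
  "off_lattice = {k. w k \<noteq> 0}"

definition phase :: "real ^ 'n \<Rightarrow> int ^ 'n \<Rightarrow> complex" where
  "phase y k = of_real (mi_power (w k) \<alpha>) * fourier_kernel (y \<bullet> w k)"

definition real_term :: "real ^ 'n \<Rightarrow> complex \<Rightarrow> int ^ 'n \<Rightarrow> complex" where
  "real_term y \<nu> k = phase y k * expint (\<nu> / 2) (pi * (norm (w k /\<^sub>R r))\<^sup>2)"

definition dual_term :: "real ^ 'n \<Rightarrow> complex \<Rightarrow> int ^ 'n \<Rightarrow> complex" where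
  "dual_term y \<nu> k = hermite_sum \<alpha> (expint_family (of_nat CARD('n) - \<nu>)) (r *\<^sub>R (p k + y)) * fourier_kernel (x \<bullet> p k)"

text \<open>\<open>\<i> / (2 * pi)\<close> is the inverse of -2 pi i. The powers of \<open>r\<close>
  come from evaluating the theta identity at t / r^2: \<open>r ^ CARD('n)\<close> from the factor in
  front, \<open>r ^ mi_size \<alpha>\<close> from rescaling the derivative of order
  \<open>\<alpha>\<close>.\<close>

definition dual_factor :: complex where
  "dual_factor = (\<i> / (2 * of_real pi)) ^ mi_size \<alpha> * of_real (r ^ CARD('n) * r ^ mi_size \<alpha>) / of_real \<bar>det A\<bar>"

lemma invB: "invertible (transpose (matrix_inv A))"
  by (rule invertible_dual[OF invA])

lemma norm_phase_le: "norm (phase y k) \<le> (1 + norm (w k)) ^ mi_size \<alpha>"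
  using mi_power_le[of "w k" \<alpha>] by (simp add: phase_def norm_mult norm_fourier_kernel)

lemma summable_w: "s > real CARD('n) \<Longrightarrow> (\<lambda>k. (1 + norm (w k)) powr (- s)) summable_on S"
  using summable_affine_lattice[OF invA, of s "- x"] summable_on_subset_banach by (force simp: w_def)

lemma w_gap:
  obtains \<delta> where "\<delta> > 0" "\<And>k. k \<in> off_lattice \<Longrightarrow> \<delta> \<le> norm (w k)"
  using lattice_gap[OF invA, of "- x"] unfolding off_lattice_def w_def by auto

lemma p_eq_0_iff: "p k = 0 \<longleftrightarrow> k = 0"
proof
  assume "p k = 0"
  hence "p k = p 0" by (simp add: p_def ivec_0)
  thus "k = 0" using inj_lattice[OF invB] by (auto simp: p_def inj_def)
qed (simp add: p_def ivec_0)

lemma p_gap: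
  obtains \<delta> where "\<delta> > 0" "\<And>k. k \<noteq> 0 \<Longrightarrow> \<delta> \<le> norm (p k)"
  using lattice_gap[OF invB, of 0] p_eq_0_iff unfolding p_def by auto

lemma range_p: "range p = dual_lattice A"
  by (simp add: dual_lattice_def lattice_eq_range p_def)

lemma inj_p: "inj p"
  using inj_lattice[OF invB] by (simp add: p_def[abs_def])

lemma p_add_nonzero: "y \<notin> dual_lattice A \<Longrightarrow> p k + y \<noteq> 0"
proof
  assume "y \<notin> dual_lattice A" "p k + y = 0"
  moreover have "y = p (- k)"
    using \<open>p k + y = 0\<close> matrix_vector_mult_diff_distrib[of "transpose (matrix_inv A)" 0 "ivec k"]
    by (simp add: p_def ivec_uminus add_eq_0_iff)
  ultimately show False using range_p by blast
qed

lemma finite_on_lattice: "finite (- off_lattice)"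
proof -
  have "- off_lattice = (\<lambda>k. A *v ivec k) -` {x}"
    by (auto simp: off_lattice_def w_def)
  thus ?thesis using finite_vimageI[OF _ inj_lattice[OF invA], of "{x}"] by simp
qed

lemma powr_power_le:
  "(1 + a) ^ n * (1 + a) powr (- (s + real n)) = (1 + a) powr (- s)" if "a \<ge> 0" for a :: real
proof -
  have "(1 + a) ^ n = (1 + a) powr real n" using that by (simp add: powr_realpow)
  thus ?thesis by (simp add: powr_add[symmetric])
qed

text \<open>\<open>expint_family_decay\<close> is used at order 0 with the exponent raised by
  \<open>mi_size \<alpha>\<close>, which pays for the polynomial factor in \<open>phase\<close>; the
  remaining exponent \<open>CARD('n) + 1\<close> is summable.\<close>

lemma real_term_bound:
  obtains M where "M summable_on off_lattice"
    "\<And>y \<nu> k. k \<in> off_lattice \<Longrightarrow> Re \<nu> \<le> \<sigma> \<Longrightarrow> norm (real_term y \<nu> k) \<le> M k"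
proof -
  obtain \<delta> where \<delta>: "\<delta> > 0" "\<And>k. k \<in> off_lattice \<Longrightarrow> \<delta> \<le> norm (w k)" by (rule w_gap) blast
  define s where "s = real CARD('n) + 1"
  define N where "N = mi_size \<alpha>"
  obtain C where C: "C \<ge> 0" "\<And>\<nu> (q :: real ^ 'n). Re \<nu> \<le> \<sigma> \<Longrightarrow> norm q \<ge> \<delta> / r \<Longrightarrow>
      norm (hermite_sum 0 (expint_family \<nu>) q) \<le> C * (1 + norm q) powr (- (s + real N))"
    using expint_family_decay[where \<delta> = "\<delta> / r" and \<alpha> = "0 :: nat ^ 'n" and s = "s + real N" and \<sigma> = \<sigma>] \<delta> r by (metis divide_pos_pos)
  define L where "L = max 1 r"
  define C' where "C' = C * L powr (s + real N)"
  have s: "s + real N \<ge> 0" by (simp add: s_def)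
  show thesis
  proof (rule that[of "\<lambda>k. C' * (1 + norm (w k)) powr (- s)"])
    show "(\<lambda>k. C' * (1 + norm (w k)) powr (- s)) summable_on off_lattice"
      by (intro summable_on_cmult_right summable_w) (simp add: s_def)
    fix y \<nu> k assume k: "k \<in> off_lattice" and \<nu>: "Re \<nu> \<le> \<sigma>"
    define q where "q = w k /\<^sub>R r"
    have nq: "norm q = norm (w k) / r" using r by (simp add: q_def divide_inverse)
    have "1 + norm (w k) \<le> L * (1 + norm q)"
    proof -
      have "norm (w k) = r * norm q" using r by (simp add: nq)
      also have "\<dots> \<le> L * norm q" by (intro mult_right_mono) (auto simp: L_def)
      finally show ?thesis by (simp add: L_def distrib_left)
    qed
    hence "(1 + norm q) powr (- (s + real N)) \<le> L powr (s + real N) * (1 + norm (w k)) powr (- (s + real N))"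
      using s by (intro powr_neg_le_of_le_mult) (auto simp: L_def)
    hence 1: "C * (1 + norm q) powr (- (s + real N)) \<le> C' * (1 + norm (w k)) powr (- (s + real N))"
      unfolding C'_def mult.assoc by (rule mult_left_mono) (rule C)
    have "norm q \<ge> \<delta> / r" using \<delta>(2)[OF k] r by (simp add: nq divide_right_mono)
    hence "norm (expint_family \<nu> 0 q) \<le> C * (1 + norm q) powr (- (s + real N))"
      using C(2)[OF \<nu>, of q] by (simp add: hermite_sum_0)
    also note 1
    finally have "norm (expint (\<nu> / 2) (pi * (norm (w k /\<^sub>R r))\<^sup>2)) \<le> C' * (1 + norm (w k)) powr (- (s + real N))"
      by (simp add: expint_family_def q_def)
    hence "norm (real_term y \<nu> k) \<le> (1 + norm (w k)) ^ N * (C' * (1 + norm (w k)) powr (- (s + real N)))"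
      unfolding real_term_def norm_mult N_def by (intro mult_mono norm_phase_le) auto
    also have "\<dots> = C' * ((1 + norm (w k)) ^ N * (1 + norm (w k)) powr (- (s + real N)))" by (simp only: mult_ac)
    also have "\<dots> = C' * (1 + norm (w k)) powr (- s)" by (subst powr_power_le) auto
    finally show "norm (real_term y \<nu> k) \<le> C' * (1 + norm (w k)) powr (- s)" .
  qed
qed

text \<open>Formulated for a set of indices and a set of \<open>y\<close> with a common gap, so that
  it applies both to a single \<open>y\<close> off the dual lattice and to a ball around 0 with the
  index 0 removed. The half-plane is a right one because \<open>\<nu>\<close> enters through
  \<open>d - \<nu>\<close>.\<close>

lemma dual_term_bound:
  assumes \<delta>: "\<delta> > 0" "\<And>k y. k \<in> K \<Longrightarrow> y \<in> Y \<Longrightarrow> \<delta> \<le> norm (p k + y)"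
    and R: "\<And>y. y \<in> Y \<Longrightarrow> norm y \<le> R"
  obtains M where "M summable_on K"
    "\<And>y \<nu> k. k \<in> K \<Longrightarrow> y \<in> Y \<Longrightarrow> - \<sigma> \<le> Re \<nu> \<Longrightarrow> norm (dual_term y \<nu> k) \<le> M k"
    "\<And>y \<nu> k. k \<in> K \<Longrightarrow> y \<in> Y \<Longrightarrow> - \<sigma> \<le> Re \<nu> \<Longrightarrow> (1 + norm (r *\<^sub>R (p k + y))) ^ mi_size \<alpha> *
      (\<Sum>m\<le>mi_size \<alpha>. norm (expint_family (of_nat CARD('n) - \<nu>) m (r *\<^sub>R (p k + y)))) \<le> M k"
proof -
  define s where "s = real CARD('n) + 1"
  obtain C where C: "C \<ge> 0" "\<And>\<nu> (q :: real ^ 'n). Re \<nu> \<le> real CARD('n) + \<sigma> \<Longrightarrow> norm q \<ge> r * \<delta> \<Longrightarrow>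
      (1 + norm q) ^ mi_size \<alpha> * (\<Sum>m\<le>mi_size \<alpha>. norm (expint_family \<nu> m q)) \<le> C * (1 + norm q) powr (- s)"
    "\<And>\<nu> (q :: real ^ 'n). Re \<nu> \<le> real CARD('n) + \<sigma> \<Longrightarrow> norm q \<ge> r * \<delta> \<Longrightarrow>
      norm (hermite_sum \<alpha> (expint_family \<nu>) q) \<le> C * (1 + norm q) powr (- s)"
    using expint_family_decay[where \<delta> = "r * \<delta>" and \<alpha> = \<alpha> and s = s and \<sigma> = "real CARD('n) + \<sigma>"] \<delta>(1) r by (metis mult_pos_pos)
  define L where "L = (1 + \<bar>R\<bar>) * max 1 (1 / r)"
  have L: "L > 0" by (simp add: L_def)
  define C' where "C' = C * L powr s"
  have est: "C * (1 + norm (r *\<^sub>R (p k + y))) powr (- s) \<le> C' * (1 + norm (p k)) powr (- s)" if y: "y \<in> Y" for k y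
  proof -
    define q where "q = r *\<^sub>R (p k + y)"
    have "1 + norm (p k) \<le> (1 + \<bar>R\<bar>) * (1 + norm (p k + y))"
    proof -
      have "norm (p k) \<le> norm (p k + y) + norm y" using norm_triangle_ineq4[of "p k + y" y] by simp
      moreover have "norm y \<le> \<bar>R\<bar>" using R[OF y] by linarith
      moreover have "0 \<le> \<bar>R\<bar> * norm (p k + y)" by simp
      moreover have "(1 + \<bar>R\<bar>) * (1 + norm (p k + y)) = 1 + \<bar>R\<bar> + norm (p k + y) + \<bar>R\<bar> * norm (p k + y)"
        by (simp add: algebra_simps)
      ultimately show ?thesis by linarith
    qed
    also have "1 + norm (p k + y) \<le> max 1 (1 / r) * (1 + norm q)"
    proof -
      have "norm (p k + y) = (1 / r) * norm q" using r by (simp add: q_def)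
      also have "\<dots> \<le> max 1 (1 / r) * norm q" by (intro mult_right_mono) auto
      finally show ?thesis by (simp add: distrib_left add_mono)
    qed
    hence "(1 + \<bar>R\<bar>) * (1 + norm (p k + y)) \<le> L * (1 + norm q)"
      unfolding L_def mult.assoc by (rule mult_left_mono) simp
    finally have "1 + norm (p k) \<le> L * (1 + norm q)" .
    hence "(1 + norm q) powr (- s) \<le> L powr s * (1 + norm (p k)) powr (- s)"
      using L by (intro powr_neg_le_of_le_mult) (auto simp: s_def)
    thus ?thesis unfolding C'_def mult.assoc q_def by (rule mult_left_mono) (rule C)
  qed
  show thesis
  proof (rule that[of "\<lambda>k. C' * (1 + norm (p k)) powr (- s)"])
    have "(\<lambda>k. (1 + norm (p k)) powr (- s)) summable_on UNIV"
      using summable_affine_lattice[OF invB, of s 0] by (simp add: p_def s_def)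
    thus "(\<lambda>k. C' * (1 + norm (p k)) powr (- s)) summable_on K"
      by (intro summable_on_cmult_right) (rule summable_on_subset_banach, auto)
    fix y \<nu> k assume k: "k \<in> K" and y: "y \<in> Y" and \<nu>: "- \<sigma> \<le> Re \<nu>"
    have q: "norm (r *\<^sub>R (p k + y)) \<ge> r * \<delta>" using \<delta>(2)[OF k y] r by simp
    have \<nu>': "Re (of_nat CARD('n) - \<nu>) \<le> real CARD('n) + \<sigma>" using \<nu> by simp
    show "norm (dual_term y \<nu> k) \<le> C' * (1 + norm (p k)) powr (- s)"
      using order_trans[OF C(3)[OF \<nu>' q] est[OF y, of k]] by (simp only: dual_term_def norm_mult norm_fourier_kernel mult_1_right)
    show "(1 + norm (r *\<^sub>R (p k + y))) ^ mi_size \<alpha> *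
      (\<Sum>m\<le>mi_size \<alpha>. norm (expint_family (of_nat CARD('n) - \<nu>) m (r *\<^sub>R (p k + y)))) \<le> C' * (1 + norm (p k)) powr (- s)"
      by (rule order_trans[OF C(2)[OF \<nu>' q] est[OF y]])
  qed
qed

lemma dual_gap:
  assumes "y \<notin> dual_lattice A"
  obtains \<delta> where "\<delta> > 0" "\<And>k. \<delta> \<le> norm (p k + y)"
  using lattice_gap[OF invB, of y] p_add_nonzero[OF assms] unfolding p_def by metis

lemma dual_term_bound_single:
  assumes y: "y \<notin> dual_lattice A"
  obtains M where "M summable_on UNIV"
    "\<And>\<nu> k. - \<sigma> \<le> Re \<nu> \<Longrightarrow> norm (dual_term y \<nu> k) \<le> M k"
    "\<And>\<nu> k. - \<sigma> \<le> Re \<nu> \<Longrightarrow> (1 + norm (r *\<^sub>R (p k + y))) ^ mi_size \<alpha> *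
      (\<Sum>m\<le>mi_size \<alpha>. norm (expint_family (of_nat CARD('n) - \<nu>) m (r *\<^sub>R (p k + y)))) \<le> M k"
proof -
  obtain \<delta> where \<delta>: "\<delta> > 0" "\<And>k. \<delta> \<le> norm (p k + y)" using dual_gap[OF y] by blast
  obtain M where "M summable_on UNIV"
    "\<And>z \<nu> k. k \<in> UNIV \<Longrightarrow> z \<in> {y} \<Longrightarrow> - \<sigma> \<le> Re \<nu> \<Longrightarrow> norm (dual_term z \<nu> k) \<le> M k"
    "\<And>z \<nu> k. k \<in> UNIV \<Longrightarrow> z \<in> {y} \<Longrightarrow> - \<sigma> \<le> Re \<nu> \<Longrightarrow> (1 + norm (r *\<^sub>R (p k + z))) ^ mi_size \<alpha> *
      (\<Sum>m\<le>mi_size \<alpha>. norm (expint_family (of_nat CARD('n) - \<nu>) m (r *\<^sub>R (p k + z)))) \<le> M k"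
    by (rule dual_term_bound[of \<delta> UNIV "{y}" "norm y" \<sigma>]) (use \<delta> in auto)
  with that[of M] show thesis by simp
qed

lemma expint_half_holomorphic:
  assumes "u > 0"
  shows "(\<lambda>\<nu>. expint ((a + b * \<nu>) / 2 + c) u) holomorphic_on UNIV"
proof -
  have "(\<lambda>s. expint s u) \<circ> (\<lambda>\<nu>. (a + b * \<nu>) / 2 + c) holomorphic_on UNIV"
    by (intro holomorphic_on_compose holomorphic_on_subset[OF expint_holomorphic[OF assms]] holomorphic_intros) auto
  thus ?thesis by (simp add: o_def)
qed

lemma real_sum_holomorphic: "(\<lambda>\<nu>. \<Sum>\<^sub>\<infinity>k\<in>off_lattice. real_term y \<nu> k) holomorphic_on UNIV"
proof (rule holomorphic_infsum)
  fix k assume "k \<in> off_lattice"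
  hence "pi * (norm (w k /\<^sub>R r))\<^sup>2 > 0" using r by (simp add: off_lattice_def)
  from expint_half_holomorphic[OF this, of 0 1 0]
  show "(\<lambda>\<nu>. real_term y \<nu> k) holomorphic_on UNIV"
    unfolding real_term_def by (intro holomorphic_intros) simp
next
  fix R
  obtain M where M: "M summable_on off_lattice"
    "\<And>y \<nu> k. k \<in> off_lattice \<Longrightarrow> Re \<nu> \<le> R \<Longrightarrow> norm (real_term y \<nu> k) \<le> M k" by (rule real_term_bound[where \<sigma> = R]) blast
  have "Re \<nu> \<le> R" if "norm \<nu> \<le> R" for \<nu> using complex_Re_le_cmod[of \<nu>] that by linarith
  with M show "\<exists>M. M summable_on off_lattice \<and> (\<forall>k\<in>off_lattice. \<forall>\<nu>. norm \<nu> \<le> R \<longrightarrow> norm (real_term y \<nu> k) \<le> M k)"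
    by blast
qed

lemma dual_sum_holomorphic:
  assumes y: "y \<notin> dual_lattice A"
  shows "(\<lambda>\<nu>. \<Sum>\<^sub>\<infinity>k. dual_term y \<nu> k) holomorphic_on UNIV"
proof (rule holomorphic_infsum)
  fix k
  have u: "pi * (norm (r *\<^sub>R (p k + y)))\<^sup>2 > 0" using r p_add_nonzero[OF y] by simp
  have "(\<lambda>\<nu>. expint_family (of_nat CARD('n) - \<nu>) m (r *\<^sub>R (p k + y))) holomorphic_on UNIV" for m
    using expint_half_holomorphic[OF u, of "of_nat CARD('n)" "-1" "of_nat m"] by (simp add: expint_family_def)
  thus "(\<lambda>\<nu>. dual_term y \<nu> k) holomorphic_on UNIV"
    unfolding dual_term_def hermite_sum_def by (intro holomorphic_intros)
next
  fix R
  obtain M where M: "M summable_on UNIV" "\<And>\<nu> k. - R \<le> Re \<nu> \<Longrightarrow> norm (dual_term y \<nu> k) \<le> M k"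
    by (rule dual_term_bound_single[OF y, where \<sigma> = R]) blast
  have "- R \<le> Re \<nu>" if "norm \<nu> \<le> R" for \<nu> using abs_Re_le_cmod[of \<nu>] that by linarith
  with M show "\<exists>M. M summable_on UNIV \<and> (\<forall>k\<in>UNIV. \<forall>\<nu>. norm \<nu> \<le> R \<longrightarrow> norm (dual_term y \<nu> k) \<le> M k)"
    by blast
qed

lemma summable_theta_terms:
  assumes "t > 0"
  shows "(\<lambda>k. theta_term \<alpha> t y (w k)) summable_on UNIV"
    "(\<lambda>k. hermite_sum \<alpha> (gauss_family (1 / t)) (p k + y) * fourier_kernel (x \<bullet> p k)) summable_on UNIV"
proof -
  define s where "s = real CARD('n) + 1"
  obtain C where C: "C \<ge> 0" "\<And>y w. norm (theta_term \<alpha> t y w) \<le> C * (1 + norm w) powr (- s)"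
    using theta_term_decay[OF assms] by blast
  show "(\<lambda>k. theta_term \<alpha> t y (w k)) summable_on UNIV"
  proof (rule abs_summable_summable, rule Infinite_Sum.abs_summable_on_comparison_test')
    show "(\<lambda>k. C * (1 + norm (w k)) powr (- s)) summable_on UNIV"
      by (intro summable_on_cmult_right summable_w) (simp add: s_def)
  qed (rule C)
  obtain C where C: "C \<ge> 0" "\<And>q :: real ^ 'n. norm (hermite_sum \<alpha> (gauss_family (1 / t)) q) \<le> C * (1 + norm q) powr (- s)"
    using hermite_gauss_decay[of "1 / t"] assms by (metis zero_less_divide_1_iff)
  show "(\<lambda>k. hermite_sum \<alpha> (gauss_family (1 / t)) (p k + y) * fourier_kernel (x \<bullet> p k)) summable_on UNIV"
  proof (rule abs_summable_summable, rule Infinite_Sum.abs_summable_on_comparison_test')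
    show "(\<lambda>k. C * (1 + norm (p k + y)) powr (- s)) summable_on UNIV"
      unfolding p_def by (intro summable_on_cmult_right summable_affine_lattice invB) (simp add: s_def)
    show "norm (hermite_sum \<alpha> (gauss_family (1 / t)) (p k + y) * fourier_kernel (x \<bullet> p k)) \<le> C * (1 + norm (p k + y)) powr (- s)" for k
      using C(2)[of "p k + y"] by (simp only: norm_mult norm_fourier_kernel mult_1_right)
  qed
qed

text \<open>By the gap, \<open>norm (w k)\<close> is comparable with \<open>1 + norm (w k)\<close>;
  the polynomial factor costs \<open>mi_size \<alpha>\<close> in the exponent, which accounts for
  the half-plane.\<close>

lemma summable_norm_powr_w:
  assumes "Re \<nu> > real CARD('n) + real (mi_size \<alpha>)"
  shows "(\<lambda>k. norm (phase y k) * norm (w k) powr (- Re \<nu>)) summable_on off_lattice"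
proof -
  obtain \<delta> where \<delta>: "\<delta> > 0" "\<And>k. k \<in> off_lattice \<Longrightarrow> \<delta> \<le> norm (w k)" by (rule w_gap) blast
  define s where "s = Re \<nu> - real (mi_size \<alpha>)"
  define L where "L = 1 + 1 / \<delta>"
  have L: "L > 0" using \<delta>(1) by (simp add: L_def add_pos_pos)
  show ?thesis
  proof (rule summable_on_comparison_test)
    show "(\<lambda>k. L powr Re \<nu> * (1 + norm (w k)) powr (- s)) summable_on off_lattice"
      by (intro summable_on_cmult_right summable_w) (use assms in \<open>simp add: s_def\<close>)
    fix k assume k: "k \<in> off_lattice"
    define \<rho> where "\<rho> = norm (w k)"
    have \<rho>: "\<rho> \<ge> \<delta>" "\<rho> > 0" using \<delta>(1) \<delta>(2)[OF k] by (auto simp: \<rho>_def)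
    have "1 \<le> (1 / \<delta>) * \<rho>" using \<rho> \<delta>(1) by (simp add: field_simps)
    hence "1 + \<rho> \<le> L * (1 + (\<rho> - 1))" by (simp add: L_def algebra_simps)
    have Re: "Re \<nu> \<ge> 0" using assms by linarith
    have "(1 + \<rho>) powr Re \<nu> \<le> (L * \<rho>) powr Re \<nu>"
      using \<open>1 + \<rho> \<le> L * (1 + (\<rho> - 1))\<close> \<rho> Re by (intro powr_mono2) auto
    also have "\<dots> = L powr Re \<nu> * \<rho> powr Re \<nu>" by (rule powr_mult)
    finally have "\<rho> powr (- Re \<nu>) \<le> L powr Re \<nu> * (1 + \<rho>) powr (- Re \<nu>)"
      using \<rho> L by (simp add: powr_minus_divide field_simps)
    hence "norm (phase y k) * \<rho> powr (- Re \<nu>) \<le> (1 + \<rho>) ^ mi_size \<alpha> * (L powr Re \<nu> * (1 + \<rho>) powr (- Re \<nu>))"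
      unfolding \<rho>_def by (intro mult_mono norm_phase_le) auto
    also have "\<dots> = L powr Re \<nu> * ((1 + \<rho>) ^ mi_size \<alpha> * (1 + \<rho>) powr (- (s + real (mi_size \<alpha>))))"
      by (simp add: s_def)
    also have "\<dots> = L powr Re \<nu> * (1 + \<rho>) powr (- s)"
      using \<rho> by (subst powr_power_le) auto
    finally show "norm (phase y k) * norm (w k) powr (- Re \<nu>) \<le> L powr Re \<nu> * (1 + norm (w k)) powr (- s)"
      by (simp add: \<rho>_def)
  qed auto
qed

lemma mellin_exp_Ioc_integrable:
  assumes "Re s > 0" "u \<ge> 0"
  shows "mellin_exp s u absolutely_integrable_on {0<..1}"
proof (cases "u = 0")
  case True
  thus ?thesis using powr_integrable_Ioc(1)[OF assms(1)] by (simp add: mellin_exp_def[abs_def])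
next
  case False
  moreover have "{0<..1} \<subseteq> {0 :: real <..}" by (rule subsetI) simp
  ultimately show ?thesis using assms by (intro set_integrable_subset[OF mellin_exp_integrable_Ioi]) auto
qed

lemma theta_integrand_left:
  assumes "t > 0"
  shows "of_real t powr (s - 1) * theta_term \<alpha> (t / r\<^sup>2) y (w k) = phase y k * mellin_exp s (pi * (norm (w k /\<^sub>R r))\<^sup>2) t"
proof -
  have "pi * (t / r\<^sup>2) * (norm (w k))\<^sup>2 = pi * (norm (w k /\<^sub>R r))\<^sup>2 * t"
    using r by (simp add: power_mult_distrib power_divide divide_inverse power_inverse)
  thus ?thesis by (simp add: theta_term_def phase_def mellin_exp_def)
qed

lemma theta_integrand_right:
  fixes \<nu> :: complex and y :: "real ^ 'n"
  assumes t: "t > 0"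
  defines "g \<equiv> \<lambda>k. hermite_sum \<alpha> (\<lambda>m z. inv_mellin ((of_nat CARD('n) - \<nu>) / 2 + of_nat m) (pi * (norm z)\<^sup>2) t) (r *\<^sub>R (p k + y)) * fourier_kernel (x \<bullet> p k)"
  shows "of_real t powr (\<nu> / 2 - 1) * ((\<i> / (2 * of_real pi)) ^ mi_size \<alpha> * of_real ((t / r\<^sup>2) powr (- (real CARD('n) / 2))) / of_real \<bar>det A\<bar>
      * (hermite_sum \<alpha> (gauss_family (1 / (t / r\<^sup>2))) (p k + y) * fourier_kernel (x \<bullet> p k))) = dual_factor * g k"
proof -
  define d where "d = CARD('n)"
  have "(t / r\<^sup>2) powr (- (real d / 2)) = t powr (- (real d / 2)) * (r\<^sup>2) powr (real d / 2)"
    using t r by (simp add: powr_divide powr_minus_divide)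
  also have "(r\<^sup>2) powr (real d / 2) = r ^ d"
    using r by (simp add: powr_powr powr_realpow flip: powr_numeral)
  finally have 1: "complex_of_real ((t / r\<^sup>2) powr (- (real d / 2))) = of_real (t powr (- (real d / 2))) * of_real (r ^ d)"
    by (simp only: of_real_mult)
  have 2: "of_real t powr (\<nu> / 2 - 1) * of_real (t powr (- (real d / 2))) * hermite_sum \<alpha> (gauss_family (1 / t)) z =
    hermite_sum \<alpha> (\<lambda>m z. inv_mellin ((of_nat d - \<nu>) / 2 + of_nat m) (pi * (norm z)\<^sup>2) t) z" for z :: "real ^ 'n"
    unfolding hermite_sum_def sum_distrib_left inv_mellin_gauss[OF t, symmetric] by (intro sum.cong) (auto simp only: mult_ac)
  have "dual_factor * g k = (\<i> / (2 * of_real pi)) ^ mi_size \<alpha> * of_real (r ^ d * r ^ mi_size \<alpha>) / of_real \<bar>det A\<bar> *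
     (of_real t powr (\<nu> / 2 - 1) * of_real (t powr (- (real d / 2))) * hermite_sum \<alpha> (gauss_family (1 / t)) (r *\<^sub>R (p k + y)) * fourier_kernel (x \<bullet> p k))"
    unfolding 2 by (simp add: g_def dual_factor_def d_def)
  moreover have "hermite_sum \<alpha> (gauss_family (1 / (t / r\<^sup>2))) (p k + y) = of_real (r ^ mi_size \<alpha>) * hermite_sum \<alpha> (gauss_family (1 / t)) (r *\<^sub>R (p k + y))"
    unfolding gauss_family_scale[OF t] hermite_sum_scale ..
  moreover have "T * (c * (a * b) / D * (e * H * F)) = c * (b * e) / D * (T * a * H * F)" for T c a b D e H F :: complex
    by simp
  ultimately show ?thesis unfolding d_def[symmetric] 1 of_real_mult by (simp only:)
qed

text \<open>The theta identity at t / r^2 is integrated against t^(\<nu>/2 - 1) over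
  \<open>{0<..1}\<close>. All indices occur on the left, including the one with
  \<open>w k = 0\<close> when \<open>x\<close> is a lattice point; that contribution is removed
  later.\<close>

theorem mellin_theta:
  assumes y: "y \<notin> dual_lattice A" and \<nu>: "Re \<nu> > real CARD('n) + real (mi_size \<alpha>)"
  shows "((\<lambda>k. phase y k * integral {0<..1} (mellin_exp (\<nu> / 2) (pi * (norm (w k /\<^sub>R r))\<^sup>2)))
    has_sum dual_factor * (\<Sum>\<^sub>\<infinity>k. dual_term y \<nu> k)) UNIV"
proof -
  define s where "s = \<nu> / 2"
  have s: "Re s > 0" using \<nu> by (simp add: s_def)
  define u where "u k = pi * (norm (w k /\<^sub>R r))\<^sup>2" for k
  define f where "f k t = phase y k * mellin_exp s (u k) t" for k t
  define h where "h k t = hermite_sum \<alpha> (\<lambda>m z. inv_mellin ((of_nat CARD('n) - \<nu>) / 2 + of_nat m) (pi * (norm z)\<^sup>2) t) (r *\<^sub>R (p k + y))" for k t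
  define g where "g k t = h k t * fourier_kernel (x \<bullet> p k)" for k t
  have pt: "(\<Sum>\<^sub>\<infinity>k. f k t) = dual_factor * (\<Sum>\<^sub>\<infinity>k. g k t)" "(\<lambda>k. f k t) summable_on UNIV" "(\<lambda>k. dual_factor * g k t) summable_on UNIV"
    if "t \<in> {0<..1}" for t
  proof -
    have t: "t > 0" "t / r\<^sup>2 > 0" using that r by auto
    define c where "c = (\<i> / (2 * of_real pi)) ^ mi_size \<alpha> * of_real ((t / r\<^sup>2) powr (- (real CARD('n) / 2))) / complex_of_real \<bar>det A\<bar>"
    have fe: "f k t = of_real t powr (s - 1) * theta_term \<alpha> (t / r\<^sup>2) y (w k)" for k
      using theta_integrand_left[OF t(1), of s y k] by (simp add: f_def u_def)
    have ge: "dual_factor * g k t = of_real t powr (s - 1) * (c * (hermite_sum \<alpha> (gauss_family (1 / (t / r\<^sup>2))) (p k + y) * fourier_kernel (x \<bullet> p k)))" for k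
      using theta_integrand_right[OF t(1), of \<nu> k y] unfolding c_def g_def h_def s_def by (simp only:)
    show "(\<lambda>k. f k t) summable_on UNIV"
      unfolding fe by (intro summable_on_cmult_right summable_theta_terms t)
    show "(\<lambda>k. dual_factor * g k t) summable_on UNIV"
      unfolding ge by (intro summable_on_cmult_right summable_theta_terms t)
    have "(\<Sum>\<^sub>\<infinity>k. f k t) = of_real t powr (s - 1) * (\<Sum>\<^sub>\<infinity>k. theta_term \<alpha> (t / r\<^sup>2) y (w k))"
      unfolding fe by (rule infsum_cmult_right')
    also have "\<dots> = of_real t powr (s - 1) * (c * (\<Sum>\<^sub>\<infinity>k. hermite_sum \<alpha> (gauss_family (1 / (t / r\<^sup>2))) (p k + y) * fourier_kernel (x \<bullet> p k)))"
      using theta_identity[OF invA t(2), of \<alpha> y x] unfolding w_def p_def c_def by (simp only:)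
    also have "\<dots> = (\<Sum>\<^sub>\<infinity>k. dual_factor * g k t)"
      unfolding ge by (simp only: infsum_cmult_right')
    finally show "(\<Sum>\<^sub>\<infinity>k. f k t) = dual_factor * (\<Sum>\<^sub>\<infinity>k. g k t)"
      by (simp only: infsum_cmult_right')
  qed
  have u: "u k \<ge> 0" for k by (simp add: u_def)
  have fint: "f k absolutely_integrable_on {0<..1}" for k
    unfolding f_def[abs_def] by (intro set_integrable_mult_right mellin_exp_Ioc_integrable s u)
  \<comment> \<open>The integrals of the norms are dominated by the terms of the absolutely
    convergent Dirichlet series; only finitely many indices lie outside
    \<open>off_lattice\<close>.\<close>
  have left: "((\<lambda>k. integral {0<..1} (f k)) has_sum integral {0<..1} (\<lambda>t. \<Sum>\<^sub>\<infinity>k. f k t)) UNIV"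
  proof (rule has_sum_integral_swap(2)[OF countable_int_vec])
    have "(\<lambda>k. integral {0<..1} (\<lambda>t. norm (f k t))) summable_on off_lattice"
    proof (rule summable_on_comparison_test)
      define c where "c = norm (Gamma (of_real (Re s) :: complex)) * (pi / r\<^sup>2) powr (- Re s)"
      show "(\<lambda>k. c * (norm (phase y k) * norm (w k) powr (- Re \<nu>))) summable_on off_lattice"
        by (intro summable_on_cmult_right summable_norm_powr_w \<nu>)
      fix k assume "k \<in> off_lattice"
      hence uk: "u k > 0" "norm (w k) > 0" using r by (auto simp: off_lattice_def u_def)
      have "integral {0<..1} (\<lambda>t. norm (f k t)) = norm (phase y k) * integral {0<..1} (\<lambda>t. norm (mellin_exp s (u k) t))"
        by (simp add: f_def norm_mult)
      also have "\<dots> \<le> norm (phase y k) * (norm (Gamma (of_real (Re s) :: complex)) * u k powr (- Re s))"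
        by (intro mult_left_mono integral_norm_mellin_Ioc_le uk s) auto
      also have "u k = pi / r\<^sup>2 * (norm (w k))\<^sup>2"
        using r by (simp add: u_def power_mult_distrib power_divide divide_inverse power_inverse)
      also have "\<dots> powr (- Re s) = (pi / r\<^sup>2) powr (- Re s) * ((norm (w k))\<^sup>2) powr (- Re s)"
        by (rule powr_mult)
      also have "((norm (w k))\<^sup>2) powr (- Re s) = norm (w k) powr (- Re \<nu>)"
        using uk by (simp add: powr_powr s_def flip: powr_numeral)
      finally show "integral {0<..1} (\<lambda>t. norm (f k t)) \<le> c * (norm (phase y k) * norm (w k) powr (- Re \<nu>))"
        by (simp only: c_def mult_ac)
    qed (auto intro!: integral_nonneg simp: absolutely_integrable_on_def fint[unfolded absolutely_integrable_on_def])
    moreover have "(\<lambda>k. integral {0<..1} (\<lambda>t. norm (f k t))) summable_on - off_lattice"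
      by (rule summable_on_finite[OF finite_on_lattice])
    ultimately have "(\<lambda>k. integral {0<..1} (\<lambda>t. norm (f k t))) summable_on (off_lattice \<union> - off_lattice)"
      by (rule summable_on_Un_disjoint) auto
    thus "(\<lambda>k. integral {0<..1} (\<lambda>t. norm (f k t))) summable_on UNIV" by simp
  qed (use fint pt in auto)
  have z: "r *\<^sub>R (p k + y) \<noteq> 0" for k using p_add_nonzero[OF y] r by simp
  have hint: "h k absolutely_integrable_on {0<..1}" for k
    unfolding h_def[abs_def] by (rule hermite_inv_mellin_integral(1)[OF z])
  have gint: "(\<lambda>t. dual_factor * g k t) absolutely_integrable_on {0<..1}" for k
    unfolding g_def[abs_def] by (intro set_integrable_mult_right set_integrable_mult_left hint)
  have gI: "integral {0<..1} (\<lambda>t. dual_factor * g k t) = dual_factor * dual_term y \<nu> k" for k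
  proof -
    have "integral {0<..1} (h k) = hermite_sum \<alpha> (expint_family (of_nat CARD('n) - \<nu>)) (r *\<^sub>R (p k + y))"
      unfolding h_def[abs_def] by (rule hermite_inv_mellin_integral(2)[OF z])
    thus ?thesis by (simp add: g_def dual_term_def)
  qed
  \<comment> \<open>On the dual side every argument \<open>p k + y\<close> is nonzero, and the
    integrals of the norms are dominated through the uniform constant \<open>K\<close> and the
    majorant \<open>M\<close> at the real part of \<open>\<nu>\<close>.\<close>
  have right: "((\<lambda>k. integral {0<..1} (\<lambda>t. dual_factor * g k t)) has_sum integral {0<..1} (\<lambda>t. \<Sum>\<^sub>\<infinity>k. dual_factor * g k t)) UNIV"
  proof (rule has_sum_integral_swap(2)[OF countable_int_vec gint])
    obtain K where K: "K \<ge> 0"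
      "\<And>\<Phi> q. norm (hermite_sum \<alpha> \<Phi> q) \<le> K * (1 + norm q) ^ mi_size \<alpha> * (\<Sum>m\<le>mi_size \<alpha>. norm (\<Phi> m q))"
      using hermite_sum_bound[of \<alpha>] by blast
    obtain M where M: "M summable_on UNIV"
      "\<And>\<nu>' k. - \<bar>Re \<nu>\<bar> \<le> Re \<nu>' \<Longrightarrow> norm (dual_term y \<nu>' k) \<le> M k"
      "\<And>\<nu>' k. - \<bar>Re \<nu>\<bar> \<le> Re \<nu>' \<Longrightarrow> (1 + norm (r *\<^sub>R (p k + y))) ^ mi_size \<alpha> *
        (\<Sum>m\<le>mi_size \<alpha>. norm (expint_family (of_nat CARD('n) - \<nu>') m (r *\<^sub>R (p k + y)))) \<le> M k"
      by (rule dual_term_bound_single[OF y, where \<sigma> = "\<bar>Re \<nu>\<bar>"]) blast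
    show "(\<lambda>k. integral {0<..1} (\<lambda>t. norm (dual_factor * g k t))) summable_on UNIV"
    proof (rule summable_on_comparison_test)
      show "(\<lambda>k. norm dual_factor * (K * M k)) summable_on UNIV"
        by (intro summable_on_cmult_right M)
      fix k
      have "integral {0<..1} (\<lambda>t. norm (dual_factor * g k t)) = norm dual_factor * integral {0<..1} (\<lambda>t. norm (h k t))"
        by (simp only: g_def norm_mult norm_fourier_kernel mult_1_right integral_mult_right)
      also have "\<dots> \<le> norm dual_factor * (K * ((1 + norm (r *\<^sub>R (p k + y))) ^ mi_size \<alpha> *
        (\<Sum>m\<le>mi_size \<alpha>. norm (expint_family (of_real (Re (of_nat CARD('n) - \<nu>))) m (r *\<^sub>R (p k + y))))))"
        unfolding h_def[abs_def] by (intro mult_left_mono hermite_inv_mellin_integral(3)[OF z] K) auto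
      also have "of_real (Re (of_nat CARD('n) - \<nu>)) = (of_nat CARD('n) - of_real (Re \<nu>) :: complex)" by simp
      also have "norm dual_factor * (K * ((1 + norm (r *\<^sub>R (p k + y))) ^ mi_size \<alpha> *
        (\<Sum>m\<le>mi_size \<alpha>. norm (expint_family (of_nat CARD('n) - of_real (Re \<nu>)) m (r *\<^sub>R (p k + y)))))) \<le> norm dual_factor * (K * M k)"
        by (intro mult_left_mono M(3) K) auto
      finally show "integral {0<..1} (\<lambda>t. norm (dual_factor * g k t)) \<le> norm dual_factor * (K * M k)" .
    next
      fix k
      show "0 \<le> integral {0<..1} (\<lambda>t. norm (dual_factor * g k t))"
        using gint[of k] by (intro integral_nonneg) (auto simp: absolutely_integrable_on_def)
    qed
  qed (use pt in auto)
  have "integral {0<..1} (\<lambda>t. \<Sum>\<^sub>\<infinity>k. f k t) = integral {0<..1} (\<lambda>t. \<Sum>\<^sub>\<infinity>k. dual_factor * g k t)"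
    by (rule integral_cong) (simp add: pt(1) infsum_cmult_right')
  also have "\<dots> = (\<Sum>\<^sub>\<infinity>k. dual_factor * dual_term y \<nu> k)"
    using infsumI[OF right] unfolding gI ..
  also have "\<dots> = dual_factor * (\<Sum>\<^sub>\<infinity>k. dual_term y \<nu> k)" by (rule infsum_cmult_right')
  finally have "integral {0<..1} (\<lambda>t. \<Sum>\<^sub>\<infinity>k. f k t) = dual_factor * (\<Sum>\<^sub>\<infinity>k. dual_term y \<nu> k)" .
  moreover have "integral {0<..1} (f k) = phase y k * integral {0<..1} (mellin_exp (\<nu> / 2) (pi * (norm (w k /\<^sub>R r))\<^sup>2))" for k
    unfolding f_def[abs_def] s_def u_def by (rule integral_mult_right)
  ultimately show ?thesis using left by simp
qed

end

section \<open>The singular part and the continued zeta function\<close>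

lemma s_hat_eq_Gamma_s_hat:
  fixes y :: "real ^ 'n"
  shows "s_hat \<nu> y = rGamma (\<nu> / 2) * Gamma_s_hat (of_nat CARD('n) - \<nu>) y"
proof (cases "\<exists>l::nat. \<nu> = - 2 * of_nat l")
  case True
  then obtain l :: nat where l: "\<nu> = - 2 * of_nat l" by blast
  \<comment> \<open>At these points both sides vanish: \<open>s_hat\<close> contains the factor
    \<open>rGamma (\<nu> / 2)\<close>, since \<open>\<nu>\<close> is outside its logarithmic
    branch.\<close>
  have rG: "rGamma (\<nu> / 2) = 0"
    unfolding l rGamma_eq_zero_iff by simp
  have "\<nu> \<noteq> of_nat CARD('n) + 2 * of_nat l'" for l' :: nat
  proof
    assume "\<nu> = of_nat CARD('n) + 2 * of_nat l'"
    hence h: "of_nat CARD('n) + 2 * of_nat l' = (- 2 * of_nat l :: complex)" using l by simp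
    have "complex_of_nat (CARD('n) + 2 * l' + 2 * l) = (of_nat CARD('n) + 2 * of_nat l') + 2 * of_nat l" by simp
    also have "\<dots> = of_nat 0" unfolding h by simp
    finally have "complex_of_nat (CARD('n) + 2 * l' + 2 * l) = of_nat 0" .
    hence "CARD('n) + 2 * l' + 2 * l = 0" by (simp only: of_nat_eq_iff)
    thus False using zero_less_card_finite[where 'a = 'n] by simp
  qed
  thus ?thesis using rG by (simp add: s_hat_def)
next
  case False
  hence "\<not> (\<exists>l::nat. of_nat CARD('n) - \<nu> = of_nat CARD('n) + 2 * of_nat l)"
    by (metis add_diff_cancel_left' diff_add_cancel diff_minus_eq_add minus_diff_eq mult_minus_left)
  hence "Gamma_s_hat (of_nat CARD('n) - \<nu>) y = Gamma (\<nu> / 2) * s_hat \<nu> y"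
    unfolding Gamma_s_hat_def Let_def by (simp only: if_False diff_diff_eq2 add_diff_cancel_left')
  moreover have "\<nu> / 2 \<notin> \<int>\<^sub>\<le>\<^sub>0"
  proof
    assume "\<nu> / 2 \<in> \<int>\<^sub>\<le>\<^sub>0"
    then obtain n where "\<nu> / 2 = - of_nat n" by (elim nonpos_Ints_cases')
    hence "\<nu> = - 2 * of_nat n" by (simp add: field_simps)
    with False show False by blast
  qed
  ultimately show ?thesis by (simp add: rGamma_inverse_Gamma Gamma_eq_zero_iff)
qed

text \<open>\<open>s_hat_eq_Gamma_s_hat\<close> and \<open>crandall_G_sub_Gamma_s_hat\<close>
  exhibit \<open>s_hat\<close> off 0 as a multiple of a Crandall function minus its power series
  part, both members of scaled families. This later trades the singular dual summand for a regular
  one.\<close>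

lemma nabla_s_hat:
  fixes y :: "real ^ 'n"
  assumes r: "r > 0" and y: "y \<noteq> 0"
  shows "nabla \<alpha> (s_hat \<nu>) y = crandall_factor r \<nu> * of_real (r ^ CARD('n) * r ^ mi_size \<alpha>) *
    (hermite_sum \<alpha> (expint_family (of_nat CARD('n) - \<nu>)) (r *\<^sub>R y)
      - hermite_sum \<alpha> (pser_family (regG_coeff (of_nat CARD('n) - \<nu>) r)) (r *\<^sub>R y))"
proof -
  define d where "d = (of_nat CARD('n) :: complex)"
  define c where "c = crandall_factor r \<nu> * of_real (r ^ CARD('n))"
  define \<Phi> :: "nat \<Rightarrow> real ^ 'n \<Rightarrow> complex" where "\<Phi> = scale_family r (expint_family (d - \<nu>))"
  define \<Psi> :: "nat \<Rightarrow> real ^ 'n \<Rightarrow> complex" where "\<Psi> = scale_family r (pser_family (regG_coeff (d - \<nu>) r))"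
  define \<Theta> where "\<Theta> m q = c * \<Phi> m q + (- c) * \<Psi> m q" for m and q :: "real ^ 'n"
  \<comment> \<open>All powers of \<open>r\<close> and \<open>pi\<close> cancel: (pi/r^2)^(\<nu>/2)
    r^d times r^(-(d-\<nu>)) pi^(-\<nu>/2) is 1.\<close>
  have c: "c * (of_real r powr (- (d - \<nu>)) * of_real pi powr (- (d - (d - \<nu>)) / 2)) = rGamma (\<nu> / 2)"
  proof -
    have 1: "complex_of_real (pi / r\<^sup>2) powr (\<nu> / 2) = exp (\<nu> / 2 * of_real (ln pi - 2 * ln r))"
      using r by (simp add: powr_def Ln_of_real ln_div ln_realpow del: of_real_divide)
    have 2: "complex_of_real (r ^ CARD('n)) = exp (d * of_real (ln r))"
      using r by (simp add: d_def exp_of_nat_mult exp_of_real)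
    have 3: "complex_of_real r powr (- (d - \<nu>)) = exp (- (d - \<nu>) * of_real (ln r))"
      "complex_of_real pi powr (- (d - (d - \<nu>)) / 2) = exp (- (d - (d - \<nu>)) / 2 * of_real (ln pi))"
      using r by (simp_all add: powr_def Ln_of_real)
    have "exp (\<nu> / 2 * of_real (ln pi - 2 * ln r)) * exp (d * of_real (ln r)) *
       (exp (- (d - \<nu>) * of_real (ln r)) * exp (- (d - (d - \<nu>)) / 2 * of_real (ln pi))) = 1"
      by (simp add: exp_add[symmetric] algebra_simps)
    hence "rGamma (\<nu> / 2) * (exp (\<nu> / 2 * of_real (ln pi - 2 * ln r)) * exp (d * of_real (ln r)) *
       (exp (- (d - \<nu>) * of_real (ln r)) * exp (- (d - (d - \<nu>)) / 2 * of_real (ln pi)))) = rGamma (\<nu> / 2)"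
      by (simp only: mult_1_right)
    thus ?thesis unfolding c_def crandall_factor_def 1 2 3 by (simp only: mult_ac)
  qed
  have "nabla \<alpha> (s_hat \<nu>) y = hermite_sum \<alpha> \<Theta> y"
  proof (rule nabla_deriv_family[of "- {0}"])
    show "deriv_family \<Theta> q" if "q \<in> - {0}" for q
      unfolding \<Theta>_def[abs_def] \<Phi>_def \<Psi>_def
      by (intro deriv_family_linear deriv_family_scale deriv_family_expint deriv_family_pser bounded_regG_coeff)
        (use that r in auto)
    show "s_hat \<nu> q = \<Theta> 0 q" if "q \<in> - {0}" for q :: "real ^ 'n"
    proof -
      have q: "q \<noteq> 0" "r *\<^sub>R q \<noteq> 0" using that r by auto
      have "\<Theta> 0 q = c * (crandall_G (d - \<nu>) (r *\<^sub>R q) - pser_family (regG_coeff (d - \<nu>) r) 0 (r *\<^sub>R q))"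
        by (simp add: \<Theta>_def \<Phi>_def \<Psi>_def scale_family_def crandall_G_eq[OF q(2)] algebra_simps)
      also have "\<dots> = c * (of_real r powr (- (d - \<nu>)) * of_real pi powr (- (d - (d - \<nu>)) / 2) * Gamma_s_hat (d - \<nu>) q)"
        unfolding crandall_G_sub_Gamma_s_hat[OF r q(1), symmetric, folded d_def] by simp
      also have "\<dots> = rGamma (\<nu> / 2) * Gamma_s_hat (d - \<nu>) q"
        unfolding c[symmetric] by (simp only: mult_ac)
      finally show ?thesis by (simp add: s_hat_eq_Gamma_s_hat d_def)
    qed
  qed (use y in auto)
  also have "\<dots> = c * hermite_sum \<alpha> \<Phi> y + (- c) * hermite_sum \<alpha> \<Psi> y"
    unfolding \<Theta>_def[abs_def] by (rule hermite_sum_linear)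
  finally show ?thesis
    unfolding \<Phi>_def \<Psi>_def hermite_sum_scale by (simp add: c_def d_def algebra_simps)
qed

lemma isCont_hermite_sum:
  fixes \<Phi> :: "nat \<Rightarrow> real ^ 'n \<Rightarrow> complex"
  assumes "deriv_family \<Phi> q"
  shows "isCont (hermite_sum \<alpha> \<Phi>) q"
proof -
  obtain D where "(hermite_sum \<alpha> \<Phi> has_derivative D) (at q)"
    using hermite_sum_has_derivative[of \<Phi> q \<alpha>] assms unfolding deriv_family_def by blast
  thus ?thesis by (rule has_derivative_continuous)
qed

lemma powr_rGamma_holomorphic:
  assumes "c > 0"
  shows "(\<lambda>\<nu>. of_real c powr (\<nu> / 2) * rGamma (\<nu> / 2 + a)) holomorphic_on UNIV"
proof -
  have "(\<lambda>\<nu>. exp (\<nu> / 2 * Ln (of_real c))) holomorphic_on UNIV"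
    by (intro holomorphic_intros) auto
  hence "(\<lambda>\<nu>. of_real c powr (\<nu> / 2)) holomorphic_on UNIV"
    using assms by (simp add: powr_def)
  moreover have "rGamma \<circ> (\<lambda>\<nu>. \<nu> / 2 + a) holomorphic_on UNIV"
    by (intro holomorphic_on_compose holomorphic_rGamma holomorphic_intros) auto
  ultimately show ?thesis by (intro holomorphic_on_mult) (simp_all add: o_def)
qed

lemma crandall_factor_holomorphic:
  assumes "r > 0"
  shows "crandall_factor r holomorphic_on UNIV"
  unfolding crandall_factor_def[abs_def] using powr_rGamma_holomorphic[of "pi / r\<^sup>2" 0] assms by simp

context epstein
begin

text \<open>
  If \<open>x\<close> is a lattice point, the summand \<open>z = x\<close> is missing from the zeta sum but present in the
  theta series, where it contributes \<open>\<integral>\<^sub>0\<^sup>1 t\<^sup>s\<^sup>-\<^sup>1 dt = 1/s\<close> for \<open>s = \<nu>/2\<close>; here \<open>rGamma s / s = rGamma (s + 1)\<close>.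
\<close>

definition zero_correction :: "complex \<Rightarrow> complex" where
  "zero_correction \<nu> = (if x \<in> lattice A then of_real (mi_power (0 :: real ^ 'n) \<alpha>) else 0) *
    (of_real (pi / r\<^sup>2) powr (\<nu> / 2) * rGamma (\<nu> / 2 + 1))"

lemma off_lattice_alt: "off_lattice = (if x \<in> lattice A then - {THE k. w k = 0} else UNIV)"
  and w_The: "x \<in> lattice A \<Longrightarrow> w (THE k. w k = 0) = 0"
proof -
  have *: "\<exists>!k. w k = 0" if "x \<in> lattice A"
  proof -
    from that obtain k where k: "x = A *v ivec k" unfolding lattice_eq_range by blast
    have "l = k" if "w l = 0" for l
    proof -
      have "A *v ivec l = x" using that by (simp only: w_def right_minus_eq)
      hence "A *v ivec l = A *v ivec k" using k by (rule trans)
      thus ?thesis using inj_lattice[OF invA] by (simp add: inj_def)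
    qed
    moreover have "w k = 0" unfolding w_def k[symmetric] by simp
    ultimately show ?thesis by blast
  qed
  show The: "w (THE k. w k = 0) = 0" if "x \<in> lattice A" using theI'[OF *[OF that]] .
  show "off_lattice = (if x \<in> lattice A then - {THE k. w k = 0} else UNIV)"
  proof (cases "x \<in> lattice A")
    case True
    have "w k = 0 \<longleftrightarrow> k = (THE k. w k = 0)" for k using *[OF True] The[OF True] by blast
    hence "off_lattice = - {THE k. w k = 0}" unfolding off_lattice_def by blast
    thus ?thesis using True by (simp only: if_True)
  next
    case False
    thus ?thesis unfolding lattice_eq_range off_lattice_def w_def by auto
  qed
qed

lemma has_sum_on_lattice:
  assumes "\<And>k. w k = 0 \<Longrightarrow> f k = c"
  shows "(f has_sum (if x \<in> lattice A then c else 0)) (- off_lattice)"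
proof (cases "x \<in> lattice A")
  case True
  thus ?thesis using assms[OF w_The] has_sum_finite[of "{THE k. w k = 0}" f] by (simp add: off_lattice_alt)
next
  case False
  thus ?thesis by (simp add: off_lattice_alt)
qed

lemma phase_on_lattice: "w k = 0 \<Longrightarrow> phase y k = of_real (mi_power (0 :: real ^ 'n) \<alpha>)"
  by (simp add: phase_def)

lemma real_term_has_sum: "((\<lambda>k. real_term y \<nu> k) has_sum (\<Sum>\<^sub>\<infinity>k\<in>off_lattice. real_term y \<nu> k)) off_lattice"
proof -
  obtain M where M: "M summable_on off_lattice"
    "\<And>y \<nu>' k. k \<in> off_lattice \<Longrightarrow> Re \<nu>' \<le> Re \<nu> \<Longrightarrow> norm (real_term y \<nu>' k) \<le> M k" by (rule real_term_bound[where \<sigma> = "Re \<nu>"]) blast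
  have "(\<lambda>k. real_term y \<nu> k) summable_on off_lattice"
    by (rule abs_summable_summable, rule Infinite_Sum.abs_summable_on_comparison_test'[OF M(1)]) (use M(2) in auto)
  thus ?thesis by (rule has_sum_infsum)
qed

text \<open>For each index in \<open>off_lattice\<close>, \<open>Gamma_split\<close> writes the
  Euler integral as a part over \<open>{0<..1}\<close> plus an \<open>expint\<close>;
  \<open>mellin_theta\<close> sums the former, and the latter form the real-space sum.
  \<open>crandall_factor\<close> then cancels Gamma(\<nu>/2) and the powers of pi and
  \<open>r\<close>.\<close>

lemma dirichlet_series_eq:
  assumes y: "y \<notin> dual_lattice A" and \<nu>: "Re \<nu> > real CARD('n) + real (mi_size \<alpha>)"
  shows "(\<Sum>\<^sub>\<infinity>k\<in>off_lattice. phase y k * of_real (norm (w k)) powr (- \<nu>)) =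
    crandall_factor r \<nu> * ((\<Sum>\<^sub>\<infinity>k\<in>off_lattice. real_term y \<nu> k) + dual_factor * (\<Sum>\<^sub>\<infinity>k. dual_term y \<nu> k)) - zero_correction \<nu>"
proof -
  define s where "s = \<nu> / 2"
  have s: "Re s > 0" using \<nu> by (simp add: s_def)
  have s0: "s \<noteq> 0" using s by auto
  define u where "u k = pi * (norm (w k /\<^sub>R r))\<^sup>2" for k
  define I where "I k = integral {0<..1} (mellin_exp s (u k))" for k
  define R where "R = (\<Sum>\<^sub>\<infinity>k\<in>off_lattice. real_term y \<nu> k)"
  define D where "D = dual_factor * (\<Sum>\<^sub>\<infinity>k. dual_term y \<nu> k)"
  define m0 where "m0 = complex_of_real (mi_power (0 :: real ^ 'n) \<alpha>)"
  \<comment> \<open>\<open>mellin_theta\<close> also counts the lattice point \<open>x\<close>,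
    where the integrand is t^(s-1) alone up to the phase; this contribution is subtracted.\<close>
  define Z where "Z = (if x \<in> lattice A then m0 * (1 / s) else 0)"
  have "((\<lambda>k. phase y k * I k) has_sum D) UNIV"
    using mellin_theta[OF y \<nu>] by (simp only: I_def u_def s_def D_def)
  moreover have "((\<lambda>k. phase y k * I k) has_sum Z) (- off_lattice)"
    unfolding Z_def
  proof (rule has_sum_on_lattice)
    fix k assume "w k = 0"
    thus "phase y k * I k = m0 * (1 / s)"
      using integral_unique[OF integral_powr_Ioc[OF s]]
      by (simp add: phase_on_lattice m0_def I_def u_def mellin_exp_def[abs_def])
  qed
  ultimately have "((\<lambda>k. phase y k * I k) has_sum (D - Z)) (UNIV - (- off_lattice))"
    by (rule has_sum_Diff) auto
  hence "((\<lambda>k. phase y k * I k) has_sum (D - Z)) off_lattice" by (simp add: Diff_eq)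
  from has_sum_add[OF this real_term_has_sum[of y \<nu>]]
  have "((\<lambda>k. crandall_factor r \<nu> * (phase y k * I k + real_term y \<nu> k)) has_sum (crandall_factor r \<nu> * (D - Z + R))) off_lattice"
    unfolding R_def by (rule has_sum_cmult_right)
  moreover have "crandall_factor r \<nu> * (phase y k * I k + real_term y \<nu> k) = phase y k * of_real (norm (w k)) powr (- \<nu>)"
    if k: "k \<in> off_lattice" for k
  proof -
    have wk: "norm (w k) > 0" and uk: "u k > 0" using k r by (auto simp: off_lattice_def u_def)
    have "phase y k * I k + real_term y \<nu> k = phase y k * (I k + expint s (u k))"
      by (simp add: real_term_def s_def u_def distrib_left)
    also have "I k + expint s (u k) = Gamma s / of_real (u k) powr s"
      unfolding I_def by (rule Gamma_split[OF uk s, symmetric])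
    finally have 1: "phase y k * I k + real_term y \<nu> k = phase y k * (Gamma s / of_real (u k) powr s)" .
    have 2: "of_real (u k) powr s = of_real (pi / r\<^sup>2) powr s * (of_real (norm (w k)) powr \<nu> :: complex)"
    proof -
      have "u k = pi / r\<^sup>2 * (norm (w k))\<^sup>2"
        using r by (simp add: u_def power_mult_distrib power_divide divide_inverse power_inverse)
      hence "ln (u k) = ln (pi / r\<^sup>2) + ln ((norm (w k))\<^sup>2)"
        using r wk by (simp only:) (rule ln_mult_pos, auto)
      hence "ln (u k) = ln (pi / r\<^sup>2) + 2 * ln (norm (w k))"
        using wk by (simp add: ln_realpow)
      hence "s * of_real (ln (u k)) = s * of_real (ln (pi / r\<^sup>2)) + \<nu> * of_real (ln (norm (w k)))"
        by (simp add: s_def algebra_simps)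
      moreover have "of_real a powr z = exp (z * complex_of_real (ln a))" if "a > 0" for a z
        using that by (simp add: powr_def Ln_of_real)
      moreover have "pi / r\<^sup>2 > 0" using r by simp
      ultimately show ?thesis using uk wk by (simp only: exp_add)
    qed
    have 3: "rGamma s * Gamma s = 1"
    proof -
      have "s \<notin> \<int>\<^sub>\<le>\<^sub>0" using s by (auto elim!: nonpos_Ints_cases')
      thus ?thesis by (simp add: rGamma_inverse_Gamma Gamma_eq_zero_iff)
    qed
    have 4: "of_real (pi / r\<^sup>2) powr s \<noteq> (0 :: complex)" using r by simp
    have "crandall_factor r \<nu> * (phase y k * (Gamma s / of_real (u k) powr s)) =
        phase y k * (rGamma s * Gamma s) * (of_real (pi / r\<^sup>2) powr s / of_real (pi / r\<^sup>2) powr s) / of_real (norm (w k)) powr \<nu>"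
      unfolding crandall_factor_def 2 s_def[symmetric] by (simp only: times_divide_eq_left times_divide_eq_right divide_divide_eq_left mult_ac)
    also have "\<dots> = phase y k / of_real (norm (w k)) powr \<nu>" using 3 4 by simp
    finally show ?thesis unfolding 1 by (simp add: powr_minus_divide)
  qed
  ultimately have "((\<lambda>k. phase y k * of_real (norm (w k)) powr (- \<nu>)) has_sum (crandall_factor r \<nu> * (D - Z + R))) off_lattice"
    by (subst has_sum_cong[symmetric]) auto
  moreover have "crandall_factor r \<nu> * Z = zero_correction \<nu>"
    using rGamma_plus1[of s] s0
    by (simp add: Z_def zero_correction_def crandall_factor_def m0_def s_def[symmetric] field_simps)
  hence "crandall_factor r \<nu> * (D - Z + R) = crandall_factor r \<nu> * (R + D) - zero_correction \<nu>"
    by (simp add: algebra_simps)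
  ultimately show ?thesis unfolding R_def D_def by (simp add: infsumI)
qed

text \<open>The right-hand side is entire and agrees with the defining series in the half-plane by
  \<open>dirichlet_series_eq\<close>; writing the lattice point as \<open>w k + x\<close> produces
  the overall phase.\<close>

lemma epstein_zeta_eq:
  assumes y: "y \<notin> dual_lattice A"
  shows "epstein_zeta A \<nu> \<alpha> x y = fourier_kernel (x \<bullet> y) *
    (crandall_factor r \<nu> * ((\<Sum>\<^sub>\<infinity>k\<in>off_lattice. real_term y \<nu> k) + dual_factor * (\<Sum>\<^sub>\<infinity>k. dual_term y \<nu> k)) - zero_correction \<nu>)"
proof -
  define E where "E \<nu> = fourier_kernel (x \<bullet> y) *
    (crandall_factor r \<nu> * ((\<Sum>\<^sub>\<infinity>k\<in>off_lattice. real_term y \<nu> k) + dual_factor * (\<Sum>\<^sub>\<infinity>k. dual_term y \<nu> k)) - zero_correction \<nu>)" for \<nu>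
  define f where "f = (\<lambda>\<nu>. \<Sum>\<^sub>\<infinity>z\<in>lattice A - {x}.
          exp (- 2 * of_real pi * \<i> * of_real (y \<bullet> z)) * of_real (mi_power (z - x) \<alpha>)
            * of_real (norm (z - x)) powr (- \<nu>))"
  have "(\<lambda>\<nu>. of_real (pi / r\<^sup>2) powr (\<nu> / 2) * rGamma (\<nu> / 2 + 1)) holomorphic_on UNIV"
    using r by (intro powr_rGamma_holomorphic) auto
  hence "zero_correction holomorphic_on UNIV"
    unfolding zero_correction_def[abs_def] by (rule holomorphic_on_mult[OF holomorphic_on_const])
  hence "E holomorphic_on UNIV"
    unfolding E_def[abs_def]
    by (intro holomorphic_on_mult holomorphic_on_diff holomorphic_on_add holomorphic_on_const
        crandall_factor_holomorphic real_sum_holomorphic dual_sum_holomorphic y r)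
  hence "E nicely_meromorphic_on UNIV"
    by (intro analytic_on_imp_nicely_meromorphic_on) (simp add: analytic_on_open)
  moreover have "E \<nu> = f \<nu>" if \<nu>: "Re \<nu> > real CARD('n) + real (mi_size \<alpha>)" for \<nu>
  proof -
    have im: "lattice A - {x} = (\<lambda>k. A *v ivec k) ` off_lattice"
      unfolding lattice_eq_range off_lattice_def w_def by auto
    have "f \<nu> = (\<Sum>\<^sub>\<infinity>k\<in>off_lattice. fourier_kernel (y \<bullet> (A *v ivec k)) * of_real (mi_power (w k) \<alpha>) * of_real (norm (w k)) powr (- \<nu>))"
      unfolding f_def im by (subst infsum_reindex) (auto simp: o_def w_def intro: inj_on_subset[OF inj_lattice[OF invA]])
    also have "\<dots> = (\<Sum>\<^sub>\<infinity>k\<in>off_lattice. fourier_kernel (x \<bullet> y) * (phase y k * of_real (norm (w k)) powr (- \<nu>)))"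
    proof (rule infsum_cong)
      fix k
      have "y \<bullet> (A *v ivec k) = x \<bullet> y + y \<bullet> w k" by (simp add: w_def inner_diff_right inner_commute)
      hence "fourier_kernel (y \<bullet> (A *v ivec k)) = fourier_kernel (x \<bullet> y) * fourier_kernel (y \<bullet> w k)"
        by (simp only: fourier_kernel_add)
      thus "fourier_kernel (y \<bullet> (A *v ivec k)) * of_real (mi_power (w k) \<alpha>) * of_real (norm (w k)) powr (- \<nu>) =
        fourier_kernel (x \<bullet> y) * (phase y k * of_real (norm (w k)) powr (- \<nu>))"
        unfolding phase_def by (simp only: mult_ac)
    qed
    also have "\<dots> = E \<nu>"
      unfolding infsum_cmult_right' dirichlet_series_eq[OF y \<nu>] E_def ..
    finally show ?thesis ..
  qed
  ultimately have "meromorphic_continuation (real CARD('n) + real (mi_size \<alpha>)) f = E"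
    by (rule meromorphic_continuation_eqI)
  thus ?thesis unfolding epstein_zeta_def f_def E_def[symmetric] by simp
qed

end

section \<open>Regularization and the limit at the origin\<close>

context epstein
begin

text \<open>The continued formula, freed of its phase, with the dual term of index 0 replaced by its
  power series part; in this form every ingredient is continuous at \<open>y = 0\<close>.\<close>

definition reg_value :: "complex \<Rightarrow> real ^ 'n \<Rightarrow> complex" where
  "reg_value \<nu> y = crandall_factor r \<nu> * ((\<Sum>\<^sub>\<infinity>k\<in>off_lattice. real_term y \<nu> k) + dual_factor *
    (hermite_sum \<alpha> (pser_family (regG_coeff (of_nat CARD('n) - \<nu>) r)) (r *\<^sub>R y) + (\<Sum>\<^sub>\<infinity>k\<in>- {0}. dual_term y \<nu> k)))
    - zero_correction \<nu>"

lemma zero_in_dual_lattice: "0 \<in> dual_lattice A"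
  using range_p p_eq_0_iff[of 0] by (metis rangeI)

lemma dual_term_summable:
  assumes "y \<notin> dual_lattice A"
  shows "(\<lambda>k. dual_term y \<nu> k) summable_on UNIV"
proof -
  obtain M where M: "M summable_on UNIV" "\<And>\<nu>' k. - \<bar>Re \<nu>\<bar> \<le> Re \<nu>' \<Longrightarrow> norm (dual_term y \<nu>' k) \<le> M k"
    by (rule dual_term_bound_single[OF assms, where \<sigma> = "\<bar>Re \<nu>\<bar>"]) blast
  show ?thesis
    by (rule abs_summable_summable, rule Infinite_Sum.abs_summable_on_comparison_test'[OF M(1)]) (rule M(2), simp)
qed

lemma dual_sum_split:
  assumes y: "y \<notin> dual_lattice A"
  shows "(\<Sum>\<^sub>\<infinity>k. dual_term y \<nu> k) = hermite_sum \<alpha> (expint_family (of_nat CARD('n) - \<nu>)) (r *\<^sub>R y) + (\<Sum>\<^sub>\<infinity>k\<in>- {0}. dual_term y \<nu> k)"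
proof -
  have "(\<lambda>k. dual_term y \<nu> k) summable_on - {0}"
    using dual_term_summable[OF y] by (rule summable_on_subset_banach) auto
  hence "infsum (dual_term y \<nu>) (insert 0 (- {0})) = dual_term y \<nu> 0 + (\<Sum>\<^sub>\<infinity>k\<in>- {0}. dual_term y \<nu> k)"
    by (intro infsum_insert) auto
  moreover have "insert 0 (- {0}) = (UNIV :: (int ^ 'n) set)" by auto
  moreover have "dual_term y \<nu> 0 = hermite_sum \<alpha> (expint_family (of_nat CARD('n) - \<nu>)) (r *\<^sub>R y)"
    using p_eq_0_iff[of 0] by (simp add: dual_term_def)
  ultimately show ?thesis by simp
qed

text \<open>By \<open>nabla_s_hat\<close>, subtracting the derivative of \<open>s_hat\<close>
  replaces the singular dual term \<open>X\<close> by the power series part \<open>H\<close>; the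
  constants fit because \<open>\<i> / (2 * pi)\<close> inverts -2 pi i.\<close>

lemma epstein_zeta_reg_punctured_eq:
  assumes y: "y \<notin> dual_lattice A"
  shows "epstein_zeta_reg_punctured A \<nu> \<alpha> x y = reg_value \<nu> y"
proof -
  define H where "H = hermite_sum \<alpha> (pser_family (regG_coeff (of_nat CARD('n) - \<nu>) r)) (r *\<^sub>R y)"
  define X where "X = hermite_sum \<alpha> (expint_family (of_nat CARD('n) - \<nu>)) (r *\<^sub>R y)"
  define R where "R = (\<Sum>\<^sub>\<infinity>k\<in>off_lattice. real_term y \<nu> k)"
  define D where "D = (\<Sum>\<^sub>\<infinity>k\<in>- {0}. dual_term y \<nu> k)"
  define c where "c = crandall_factor r \<nu>"
  define e where "e = (- 2 * of_real pi * \<i>) ^ mi_size \<alpha>"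
  define f where "f = complex_of_real (r ^ CARD('n) * r ^ mi_size \<alpha>)"
  define v where "v = complex_of_real (covolume A)"
  have y0: "y \<noteq> 0" using y zero_in_dual_lattice by auto
  have 1: "exp (2 * of_real pi * \<i> * of_real (x \<bullet> y)) * fourier_kernel (x \<bullet> y) = 1"
    by (simp add: exp_add[symmetric])
  have "e * (\<i> / (2 * of_real pi)) ^ mi_size \<alpha> = 1"
    unfolding e_def power_mult_distrib[symmetric] by simp
  hence "(\<i> / (2 * of_real pi)) ^ mi_size \<alpha> = 1 / e"
    by (metis mult_zero_left nonzero_eq_divide_eq mult.commute zero_neq_one)
  hence DF: "dual_factor = f / (e * v)"
    by (simp add: dual_factor_def f_def v_def covolume_def)
  have ns: "nabla \<alpha> (s_hat \<nu>) y = c * f * (X - H)"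
    unfolding c_def f_def X_def H_def by (rule nabla_s_hat[OF r y0])
  have "exp (2 * of_real pi * \<i> * of_real (x \<bullet> y)) * epstein_zeta A \<nu> \<alpha> x y =
      c * (R + dual_factor * (X + D)) - zero_correction \<nu>"
    unfolding epstein_zeta_eq[OF y] dual_sum_split[OF y] c_def R_def X_def D_def
    by (simp only: mult.assoc[symmetric] 1 mult_1_left)
  moreover have "nabla \<alpha> (s_hat \<nu>) y / (e * v) = c * dual_factor * (X - H)"
    unfolding ns DF by simp
  ultimately have "epstein_zeta_reg_punctured A \<nu> \<alpha> x y =
      c * (R + dual_factor * (X + D)) - zero_correction \<nu> - c * dual_factor * (X - H)"
    unfolding epstein_zeta_reg_punctured_def e_def v_def by simp
  also have "\<dots> = reg_value \<nu> y"
    unfolding reg_value_def c_def[symmetric] H_def[symmetric] R_def[symmetric] D_def[symmetric]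
    by (simp add: algebra_simps)
  finally show ?thesis .
qed

lemma isCont_expint_family_sum:
  assumes "r *\<^sub>R (a + y) \<noteq> 0"
  shows "isCont (\<lambda>y. hermite_sum \<alpha> (expint_family \<mu>) (r *\<^sub>R (a + y))) y"
  by (rule isCont_o2[where g = "hermite_sum \<alpha> (expint_family \<mu>)"])
    (intro continuous_intros isCont_hermite_sum deriv_family_expint assms)+

lemma reg_value_tendsto: "(reg_value \<nu> \<longlongrightarrow> reg_value \<nu> 0) (at 0)"
proof -
  obtain M where M: "M summable_on off_lattice"
    "\<And>y \<nu>' k. k \<in> off_lattice \<Longrightarrow> Re \<nu>' \<le> Re \<nu> \<Longrightarrow> norm (real_term y \<nu>' k) \<le> M k" by (rule real_term_bound[where \<sigma> = "Re \<nu>"]) blast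
  have "continuous_on UNIV (\<lambda>y. \<Sum>\<^sub>\<infinity>k\<in>off_lattice. real_term y \<nu> k)"
  proof (rule continuous_on_infsum[OF _ _ M(1)])
    show "continuous_on UNIV (\<lambda>y. real_term y \<nu> k)" for k
      unfolding real_term_def phase_def by (intro continuous_intros)
  qed (use M(2) in auto)
  hence c1: "isCont (\<lambda>y. \<Sum>\<^sub>\<infinity>k\<in>off_lattice. real_term y \<nu> k) 0"
    by (simp add: continuous_on_eq_continuous_at)
  have c2: "isCont (\<lambda>y. hermite_sum \<alpha> (pser_family (regG_coeff (of_nat CARD('n) - \<nu>) r)) (r *\<^sub>R y)) 0"
    by (rule isCont_o2[where g = "hermite_sum \<alpha> (pser_family (regG_coeff (of_nat CARD('n) - \<nu>) r))"])
      (intro continuous_intros isCont_hermite_sum deriv_family_pser bounded_regG_coeff)+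
  obtain \<delta> where \<delta>: "\<delta> > 0" "\<And>k. k \<noteq> 0 \<Longrightarrow> \<delta> \<le> norm (p k)" by (rule p_gap) blast
  \<comment> \<open>For \<open>k \<noteq> 0\<close> and \<open>y\<close> within half the gap of the
    dual lattice, \<open>p k + y\<close> keeps distance \<open>\<delta> / 2\<close> from 0, so one
    majorant serves the whole ball.\<close>
  have gap: "\<delta> / 2 \<le> norm (p k + y)" if "k \<in> - {0}" "y \<in> ball 0 (\<delta> / 2)" for k y
    using \<delta>(2)[of k] that norm_triangle_ineq4[of "p k + y" y] by simp
  obtain M' where M': "M' summable_on - {0}"
    "\<And>y \<nu>' k. k \<in> - {0} \<Longrightarrow> y \<in> ball 0 (\<delta> / 2) \<Longrightarrow> - \<bar>Re \<nu>\<bar> \<le> Re \<nu>' \<Longrightarrow> norm (dual_term y \<nu>' k) \<le> M' k"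
    by (rule dual_term_bound[of "\<delta> / 2" "- {0}" "ball 0 (\<delta> / 2)" "\<delta> / 2" "\<bar>Re \<nu>\<bar>"]) (use \<delta>(1) gap in auto)
  have "continuous_on (ball 0 (\<delta> / 2)) (\<lambda>y. \<Sum>\<^sub>\<infinity>k\<in>- {0}. dual_term y \<nu> k)"
  proof (rule continuous_on_infsum[OF _ _ M'(1)])
    fix k :: "int ^ 'n" assume k: "k \<in> - {0}"
    have "isCont (\<lambda>y. dual_term y \<nu> k) y" if "y \<in> ball 0 (\<delta> / 2)" for y
    proof -
      have "r *\<^sub>R (p k + y) \<noteq> 0" using gap[OF k that] \<delta>(1) r by auto
      thus ?thesis unfolding dual_term_def by (intro isCont_mult isCont_expint_family_sum continuous_const)
    qed
    thus "continuous_on (ball 0 (\<delta> / 2)) (\<lambda>y. dual_term y \<nu> k)"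
      by (simp add: continuous_at_imp_continuous_on)
  qed (use M'(2) in auto)
  hence c3: "isCont (\<lambda>y. \<Sum>\<^sub>\<infinity>k\<in>- {0}. dual_term y \<nu> k) 0"
    by (rule continuous_on_interior) (use \<delta>(1) in \<open>simp add: interior_open\<close>)
  have "isCont (reg_value \<nu>) 0"
    unfolding reg_value_def[abs_def] by (intro continuous_intros c1 c2 c3)
  thus ?thesis by (simp add: isCont_def)
qed

text \<open>At \<open>y = 0\<close> the value is a limit; a small punctured ball around 0 avoids the
  dual lattice, so the punctured function equals \<open>reg_value\<close> there and the limit
  follows from continuity.\<close>

lemma epstein_zeta_reg_eq:
  assumes "y \<notin> dual_lattice A \<or> y = 0"
  shows "epstein_zeta_reg A \<nu> \<alpha> x y = reg_value \<nu> y"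
proof (cases "y = 0")
  case False
  thus ?thesis using assms epstein_zeta_reg_punctured_eq by (simp add: epstein_zeta_reg_def)
next
  case True
  obtain \<delta> where \<delta>: "\<delta> > 0" "\<And>k. k \<noteq> 0 \<Longrightarrow> \<delta> \<le> norm (p k)" by (rule p_gap) blast
  have "\<forall>\<^sub>F z in at 0. z \<in> ball 0 \<delta> - {0}"
    using \<delta>(1) by (intro eventually_at_in_open) auto
  hence "\<forall>\<^sub>F z in at 0. reg_value \<nu> z = epstein_zeta_reg_punctured A \<nu> \<alpha> x z"
  proof eventually_elim
    case (elim z)
    have "z \<noteq> p k" for k using elim \<delta>(2)[of k] p_eq_0_iff[of k] by (cases "k = 0") auto
    hence "z \<notin> dual_lattice A" unfolding range_p[symmetric] by blast
    thus ?case by (simp add: epstein_zeta_reg_punctured_eq)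
  qed
  hence "(epstein_zeta_reg_punctured A \<nu> \<alpha> x \<longlongrightarrow> reg_value \<nu> 0) (at 0)"
    by (rule Lim_transform_eventually[OF reg_value_tendsto])
  hence "Lim (at 0) (epstein_zeta_reg_punctured A \<nu> \<alpha> x) = reg_value \<nu> 0"
    by (intro tendsto_Lim) auto
  thus ?thesis using True by (simp add: epstein_zeta_reg_def)
qed

section \<open>Assembling the sums over the lattice and its dual\<close>

definition zero_summand :: "complex \<Rightarrow> complex" where
  "zero_summand \<nu> = (if x \<in> lattice A then of_real (mi_power (0 :: real ^ 'n) \<alpha>) * crandall_G \<nu> (0 :: real ^ 'n) else 0)"

text \<open>With \<open>rGamma (\<nu> / 2) = (\<nu> / 2) * rGamma (\<nu> / 2 + 1)\<close>, the value
  \<open>- 2 / \<nu>\<close> of the Crandall function at 0 reproduces the correction for the term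
  missing from the zeta sum.\<close>

lemma crandall_factor_zero_summand:
  assumes "\<nu> \<noteq> 0"
  shows "crandall_factor r \<nu> * zero_summand \<nu> = - zero_correction \<nu>"
  using rGamma_plus1[of "\<nu> / 2"] assms
  by (simp add: zero_summand_def crandall_G_def crandall_factor_def zero_correction_def field_simps)

text \<open>At \<open>\<nu> = 0\<close> with \<open>x\<close> in the lattice,
  \<open>crandall_factor\<close> vanishes, so the product contributes nothing and
  \<open>zero_term_limit\<close> supplies the value, by continuity of the entire function
  \<open>zero_correction\<close>. In all other cases the extra limit is zero by definition.\<close>

lemma zero_correction_eq:
  "crandall_factor r \<nu> * zero_summand \<nu> + zero_term_limit r \<nu> \<alpha> A x = - zero_correction \<nu>"
proof (cases "\<nu> = 0 \<and> x \<in> lattice A")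
  case True
  have "isCont (\<lambda>\<mu>. - zero_correction \<mu>) 0"
  proof -
    have "(\<lambda>\<mu>. of_real (pi / r\<^sup>2) powr (\<mu> / 2) * rGamma (\<mu> / 2 + 1)) holomorphic_on UNIV"
      using r by (intro powr_rGamma_holomorphic) auto
    hence "isCont (\<lambda>\<mu>. of_real (pi / r\<^sup>2) powr (\<mu> / 2) * rGamma (\<mu> / 2 + 1)) (0 :: complex)"
      by (intro continuous_on_interior[OF holomorphic_on_imp_continuous_on]) auto
    thus ?thesis unfolding zero_correction_def by (intro isCont_minus isCont_mult[OF continuous_const])
  qed
  hence "((\<lambda>\<mu>. - zero_correction \<mu>) \<longlongrightarrow> - zero_correction 0) (at 0)" by (simp only: isCont_def)
  moreover have "\<forall>\<^sub>F \<mu> in at 0. - zero_correction \<mu> = crandall_factor r \<mu> * of_real (mi_power (0 :: real ^ 'n) \<alpha>) * crandall_G \<mu> (0 :: real ^ 'n)"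
    unfolding eventually_at_filter
    by (rule always_eventually) (use crandall_factor_zero_summand True in \<open>auto simp: zero_summand_def mult.assoc\<close>)
  ultimately have "((\<lambda>\<mu>. crandall_factor r \<mu> * of_real (mi_power (0 :: real ^ 'n) \<alpha>) * crandall_G \<mu> (0 :: real ^ 'n)) \<longlongrightarrow> - zero_correction 0) (at 0)"
    by (rule Lim_transform_eventually)
  hence "zero_term_limit r \<nu> \<alpha> A x = - zero_correction \<nu>"
    using True by (simp add: zero_term_limit_def tendsto_Lim)
  moreover have "crandall_factor r \<nu> = 0" using True by (simp add: crandall_factor_def)
  ultimately show ?thesis by simp
next
  case False
  show ?thesis
  proof (cases "\<nu> = 0")
    case True
    thus ?thesis using False by (auto simp: zero_summand_def zero_correction_def zero_term_limit_def)
  next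
    case False
    thus ?thesis using crandall_factor_zero_summand by (simp add: zero_term_limit_def)
  qed
qed

lemma translated_lattice: "(\<lambda>z. z - x) ` lattice A = range w" and inj_w: "inj w"
  using inj_lattice[OF invA] by (auto simp: lattice_eq_range w_def inj_def)

lemma real_sum_has_sum:
  "((\<lambda>z. of_real (mi_power z \<alpha>) * crandall_G \<nu> (z /\<^sub>R r) * fourier_kernel (y \<bullet> z))
     has_sum ((\<Sum>\<^sub>\<infinity>k\<in>off_lattice. real_term y \<nu> k) + zero_summand \<nu>)) ((\<lambda>z. z - x) ` lattice A)"
proof -
  define g where "g k = of_real (mi_power (w k) \<alpha>) * crandall_G \<nu> (w k /\<^sub>R r) * fourier_kernel (y \<bullet> w k)" for k
  have "g k = real_term y \<nu> k" if "k \<in> off_lattice" for k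
    using that r by (simp add: g_def off_lattice_def real_term_def phase_def crandall_G_eq expint_family_def)
  hence "(g has_sum (\<Sum>\<^sub>\<infinity>k\<in>off_lattice. real_term y \<nu> k)) off_lattice"
    using has_sum_cong[of off_lattice g "real_term y \<nu>"] real_term_has_sum by blast
  moreover have "(g has_sum zero_summand \<nu>) (- off_lattice)"
    unfolding zero_summand_def by (rule has_sum_on_lattice) (simp add: g_def)
  ultimately have "(g has_sum ((\<Sum>\<^sub>\<infinity>k\<in>off_lattice. real_term y \<nu> k) + zero_summand \<nu>)) (off_lattice \<union> - off_lattice)"
    by (rule has_sum_Un_disjoint) auto
  hence "(g has_sum ((\<Sum>\<^sub>\<infinity>k\<in>off_lattice. real_term y \<nu> k) + zero_summand \<nu>)) UNIV" by simp
  thus ?thesis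
    unfolding translated_lattice has_sum_reindex[OF inj_w] by (simp only: o_def g_def[abs_def])
qed

lemma p_image: "dual_lattice A - {0} = p ` (- {0})"
  using range_p p_eq_0_iff by auto

text \<open>The index 0 is excluded, so \<open>p k + y\<close> is nonzero even for
  \<open>y = 0\<close>, and \<open>nabla_crandall_G\<close> evaluates each summand.\<close>

lemma dual_sum_has_sum:
  assumes "y \<notin> dual_lattice A \<or> y = 0"
  shows "((\<lambda>q. nabla \<alpha> (crandall_G (of_nat CARD('n) - \<nu>)) (r *\<^sub>R (q + y)) * fourier_kernel (x \<bullet> q))
     has_sum (\<Sum>\<^sub>\<infinity>k\<in>- {0}. dual_term y \<nu> k)) (dual_lattice A - {0})"
proof -
  have nz: "p k + y \<noteq> 0" if "k \<in> - {0}" for k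
    using assms p_add_nonzero[of y k] p_eq_0_iff[of k] that by auto
  have "(\<lambda>k. dual_term y \<nu> k) summable_on - {0}"
  proof -
    obtain \<delta> where \<delta>: "\<delta> > 0" "\<And>k. p k + y \<noteq> 0 \<Longrightarrow> \<delta> \<le> norm (p k + y)"
      using lattice_gap[OF invB, of y] unfolding p_def by blast
    obtain M where M: "M summable_on - {0}"
      "\<And>z \<nu>' k. k \<in> - {0} \<Longrightarrow> z \<in> {y} \<Longrightarrow> - \<bar>Re \<nu>\<bar> \<le> Re \<nu>' \<Longrightarrow> norm (dual_term z \<nu>' k) \<le> M k"
      by (rule dual_term_bound[of \<delta> "- {0}" "{y}" "norm y" "\<bar>Re \<nu>\<bar>"]) (use \<delta> nz in auto)
    show ?thesis
      by (rule abs_summable_summable, rule Infinite_Sum.abs_summable_on_comparison_test'[OF M(1)]) (use M(2) in auto)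
  qed
  hence "((\<lambda>k. dual_term y \<nu> k) has_sum (\<Sum>\<^sub>\<infinity>k\<in>- {0}. dual_term y \<nu> k)) (- {0})" by (rule has_sum_infsum)
  moreover have "nabla \<alpha> (crandall_G (of_nat CARD('n) - \<nu>)) (r *\<^sub>R (p k + y)) * fourier_kernel (x \<bullet> p k) = dual_term y \<nu> k"
    if "k \<in> - {0}" for k
    using nz[OF that] r by (simp add: dual_term_def nabla_crandall_G)
  ultimately have "((\<lambda>k. nabla \<alpha> (crandall_G (of_nat CARD('n) - \<nu>)) (r *\<^sub>R (p k + y)) * fourier_kernel (x \<bullet> p k))
      has_sum (\<Sum>\<^sub>\<infinity>k\<in>- {0}. dual_term y \<nu> k)) (- {0})"
    by (subst has_sum_cong) auto
  thus ?thesis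
    unfolding p_image by (subst has_sum_reindex[OF inj_on_subset[OF inj_p]]) (auto simp: o_def)
qed

lemma dual_factor_eq:
  "dual_factor = inverse ((- 2 * of_real pi * \<i>) ^ mi_size \<alpha>) * (of_real (r ^ CARD('n)) / of_real (covolume A)) * of_real (r ^ mi_size \<alpha>)"
proof -
  have "inverse (- 2 * of_real pi * \<i>) = \<i> / (2 * of_real pi)"
    by (simp add: field_simps)
  hence "inverse ((- 2 * of_real pi * \<i>) ^ mi_size \<alpha>) = (\<i> / (2 * of_real pi)) ^ mi_size \<alpha>"
    by (simp only: power_inverse[symmetric])
  thus ?thesis by (simp add: dual_factor_def covolume_def)
qed

end

theorem theorem2p18:
  fixes A :: "real ^ 'n ^ 'n" and x y :: "real ^ 'n" and \<nu> :: complex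
    and \<alpha> :: "nat ^ 'n" and r :: real
  assumes "invertible A"
    and "y \<notin> dual_lattice A \<or> y = 0"
    and "r > 0"
  shows
    "(\<lambda>z. of_real (mi_power z \<alpha>) * crandall_G \<nu> (z /\<^sub>R r)
            * exp (- 2 * of_real pi * \<i> * of_real (y \<bullet> z)))
       summable_on ((\<lambda>z. z - x) ` lattice A)
     \<and> (\<lambda>p. nabla \<alpha> (crandall_G (of_nat (CARD('n)) - \<nu>)) (r *\<^sub>R (p + y))
            * exp (- 2 * of_real pi * \<i> * of_real (x \<bullet> p)))
       summable_on (dual_lattice A - {0})
     \<and> epstein_zeta_reg A \<nu> \<alpha> x y =
         crandall_factor r \<nu> *
           ((\<Sum>\<^sub>\<infinity>z\<in>(\<lambda>z. z - x) ` lattice A.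
               of_real (mi_power z \<alpha>) * crandall_G \<nu> (z /\<^sub>R r)
                 * exp (- 2 * of_real pi * \<i> * of_real (y \<bullet> z)))
            + inverse ((- 2 * of_real pi * \<i>) ^ mi_size \<alpha>)
                * (of_real (r ^ CARD('n)) / of_real (covolume A))
                * (nabla \<alpha> (crandall_G_reg (of_nat (CARD('n)) - \<nu>) r) y
                   + of_real (r ^ mi_size \<alpha>)
                     * (\<Sum>\<^sub>\<infinity>p\<in>dual_lattice A - {0}.
                          nabla \<alpha> (crandall_G (of_nat (CARD('n)) - \<nu>)) (r *\<^sub>R (p + y))
                            * exp (- 2 * of_real pi * \<i> * of_real (x \<bullet> p)))))
         + zero_term_limit r \<nu> \<alpha> A x
     \<and> (((\<forall>l::nat. \<nu> \<noteq> - 2 * of_nat l) \<or>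
          (\<exists>l::nat. \<nu> = - 2 * of_nat l \<and> l < (\<Sum>j\<in>UNIV. nat \<lceil>real (\<alpha> $ j) / 2\<rceil>)))
         \<longrightarrow> nabla \<alpha> (crandall_G_reg \<nu> r) y
               = - of_real (r ^ mi_size \<alpha>) * crandall_g_deriv \<nu> \<alpha> (r *\<^sub>R y))
     \<and> (\<forall>l::nat.
          summable (\<lambda>j. if j = l then 0 else
            of_real ((- pi * r\<^sup>2) ^ j / (real j - real l)) * nabla \<alpha> (Y_poly j) y)
          \<and> nabla \<alpha> (crandall_G_reg (- 2 * of_nat l) r) y =
              of_real ((- pi * r\<^sup>2) ^ l * (harm l - euler_mascheroni - 2 * ln r))
                * nabla \<alpha> (Y_poly l) y
              - (\<Sum>j. if j = l then 0 else
                  of_real ((- pi * r\<^sup>2) ^ j / (real j - real l)) * nabla \<alpha> (Y_poly j) y))"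
proof -
  interpret epstein A x \<alpha> r by unfold_locales fact+
  note y = assms(2)
  define R where "R = (\<Sum>\<^sub>\<infinity>k\<in>off_lattice. real_term y \<nu> k)"
  define D where "D = (\<Sum>\<^sub>\<infinity>k\<in>- {0}. dual_term y \<nu> k)"
  define H where "H = hermite_sum \<alpha> (pser_family (regG_coeff (of_nat CARD('n) - \<nu>) r)) (r *\<^sub>R y)"
  define c where "c = inverse ((- 2 * of_real pi * \<i>) ^ mi_size \<alpha>) * (of_real (r ^ CARD('n)) / of_real (covolume A))"
  have "epstein_zeta_reg A \<nu> \<alpha> x y = crandall_factor r \<nu> * (R + dual_factor * (H + D)) + (- zero_correction \<nu>)"
    unfolding epstein_zeta_reg_eq[OF y] reg_value_def R_def D_def H_def by simp
  \<comment> \<open>\<open>zero_correction_eq\<close> splits the correction into the summand at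
    \<open>z = 0\<close>, which joins the real-space sum, and the separate limit;
    \<open>r ^ mi_size \<alpha>\<close> is taken out of \<open>dual_factor\<close> to turn
    \<open>H\<close> into the derivative of \<open>crandall_G_reg\<close>.\<close>
  also have "\<dots> = crandall_factor r \<nu> * ((R + zero_summand \<nu>) + c * (of_real (r ^ mi_size \<alpha>) * H + of_real (r ^ mi_size \<alpha>) * D)) + zero_term_limit r \<nu> \<alpha> A x"
    unfolding zero_correction_eq[symmetric] dual_factor_eq c_def[symmetric] by (simp only: algebra_simps)
  finally have main: "epstein_zeta_reg A \<nu> \<alpha> x y = crandall_factor r \<nu> * ((R + zero_summand \<nu>)
      + c * (nabla \<alpha> (crandall_G_reg (of_nat CARD('n) - \<nu>) r) y + of_real (r ^ mi_size \<alpha>) * D)) + zero_term_limit r \<nu> \<alpha> A x"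
    unfolding nabla_crandall_G_reg[OF r] H_def .
  show ?thesis
    using has_sum_imp_summable[OF real_sum_has_sum[of \<nu> y]] has_sum_imp_summable[OF dual_sum_has_sum[OF y, of \<nu>]]
      main[unfolded R_def infsumI[OF real_sum_has_sum[of \<nu> y], symmetric] D_def infsumI[OF dual_sum_has_sum[OF y, of \<nu>], symmetric] c_def]
      nabla_crandall_G_reg_eq_g[OF r, of \<nu> \<alpha> y] nabla_crandall_G_reg_series[OF r]
    by blast
qed

end
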